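(* Let $M>0$ and let the potential $v$ of the skew-self-adjoint Dirac system on $[0,\infty)$ be measurable with $\|v(x)\|\le M$ for $x\in\mathbb{R}_+$. The unique Weyl function $\varphi$ of this system admits the representation $$\varphi(z)=2\mathrm{i}z\int_0^\infty \mathrm{e}^{2\mathrm{i}xz}\Phi_1(x)\,dx\quad(z\in\mathbb{C}_M),\qquad \mathrm{e}^{-2\eta x}\Phi_1(x)\in L^2_{m_2\times m_1}(0,\infty)\quad(\eta>M).$$ Moreover, $\Phi_1$ and $v$ are recovered from $\varphi$ by the following procedure, applied on each interval $[0,l]$, $0<l<\infty$: 1. $\displaystyle\Phi_1\Big(\frac{x}{2}\Big)=\frac1\pi \mathrm{e}^{x\eta}\,\mathrm{l.i.m.}_{a\to\infty}\int_{-a}^{a}\mathrm{e}^{-\mathrm{i}x\xi}\frac{\varphi(\xi+\mathrm{i}\eta)}{2\mathrm{i}(\xi+\mathrm{i}\eta)}\,d\xi$, $\eta>M$, the l.i.m. being the entrywise limit in $L^2(0,2l)$. 2. $\displaystyle\beta(x)=\begin{bmatrix}I_{m_1}&0\end{bmatrix}-\int_0^x\big(S_x^{-1}\Phi_1'\big)(t)^*\begin{bmatrix}\Phi_1(t)&I_{m_2}\end{bmatrix}dt$, where $S_x=P_xSP_x^*$, $S=I+\int_0^l s(x,t)\,\cdot\,dt$ and $s(x,t)=\int_0^{\min(x,t)}\Phi_1'(x-\zeta)\Phi_1'(t-\zeta)^*d\zeta$. 3. One constructs from $\beta$ an $m_2\times m$ matrix function $\widetilde\gamma$ which is continuous on $[0,l]$,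 piecewise differentiable (differentiability failing possibly only on a finite set), has bounded left and right derivatives everywhere on $[0,l]$, and satisfies $\beta\widetilde\gamma^*\equiv0$, $\widetilde\gamma\widetilde\gamma^*>0$, $\widetilde\gamma(0)=\gamma(0)=\begin{bmatrix}0&I_{m_2}\end{bmatrix}$; and then $\widetilde\varkappa$ from $\widetilde\varkappa'=-\widetilde\varkappa\,\widetilde\gamma'\,\widetilde\gamma^*(\widetilde\gamma\widetilde\gamma^* )^{-1}$, $\widetilde\varkappa(0)=I_{m_2}$. 4. $\gamma=\widetilde\varkappa\,\widetilde\gamma$ and $v(x)=\beta'(x)\gamma(x)^*$.
   Context: Let $m_1,m_2$ be positive integers, $m=m_1+m_2$. The skew-self-adjoint Dirac system with potential $v$ (an $m_1\times m_2$ matrix function) is $$\frac{d}{dx}y(x,z)=(\mathrm{i}zj+jV(x))y(x,z)\quad (x\ge0),\qquad j=\begin{bmatrix} I_{m_1}&0\\ 0&-I_{m_2}\end{bmatrix},\quad V=\begin{bmatrix}0&v\\ v^*&0\end{bmatrix}.$$ Its fundamental solution $u(x,z)$ is normalized by $u(0,z)=I_m$. $\|\cdot\|$ is the operator norm induced by $\ell^2$-norms. $\mathbb{C}_M=\{z:\Im z>M\}$. $\mathbf{P}_{\ge}(j,\mathbb{C}_M)$: $m\times m_1$ matrix functions $\mathcal{P}$, meromorphic in $\mathbb{C}_M$, with $\mathcal{P}(z)^*\mathcal{P}(z)>0$, $\mathcal{P}(z)^*j\mathcal{P}(z)\ge0$ in $\mathbb{C}_M$ (excluding possibly a discrete set).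 $\mathcal{N}(x,z)$ is the set of values at $(x,z)$ of the functions (removable singularities in $z$ removed) $\begin{bmatrix}0&I_{m_2}\end{bmatrix}u(x,z)^{-1}\mathcal{P}(z)\big(\begin{bmatrix}I_{m_1}&0\end{bmatrix}u(x,z)^{-1}\mathcal{P}(z)\big)^{-1}$, $\mathcal{P}\in\mathbf{P}_{\ge}(j,\mathbb{C}_M)$. When $\|v\|\le M$ on $\mathbb{R}_+$, the Weyl function $\varphi$ of the system on $[0,\infty)$ is the (existing and unique) matrix function with $\{\varphi(z)\}=\bigcap_{x<\infty}\mathcal{N}(x,z)$, $z\in\mathbb{C}_M$. Set $\beta(x)=\begin{bmatrix}I_{m_1}&0\end{bmatrix}u(x,0)$ and $\gamma(x)=\begin{bmatrix}0&I_{m_2}\end{bmatrix}u(x,0)=\begin{bmatrix}\gamma_1(x)&\gamma_2(x)\end{bmatrix}$, with $\gamma_1$ of size $m_2\times m_1$, $\gamma_2$ of size $m_2\times m_2$. For $0<l<\infty$, in $L^2_{m_2}(0,l)$ ($\mathbb{C}^{m_2}$-valued functions) let $(Af)(x)=-\mathrm{i}\int_0^xf(t)dt$ and $(Kf)(x)=-\mathrm{i}\gamma(x)\int_0^x\gamma(t)^*f(t)dt$. $E$ is the bounded operator with bounded inverse on $L^2_{m_2}(0,l)$, of the form $(Ef)(x)=f(x)+\int_0^xE(x,t)f(t)dt$ with bounded kernel, such that $K=EAE^{-1}$ and $E^{-1}\gamma_2\equiv I_{m_2}$ (operators applied to matrix functions columnwise); it exists, and $E^{\pm1}$ map boundedly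 differentiable functions (absolutely continuous with bounded derivative) to boundedly differentiable functions. $\Phi_1(x):=(E^{-1}\gamma_1)(x)$ on $[0,l]$; $\Phi_1$ is boundedly differentiable on $[0,l]$, and $\Phi_1(x)$ does not depend on the choice of $l>x$, so $\Phi_1$ is defined on $[0,\infty)$. $P_x$ is the restriction operator from $L^2_{m_2}(0,l)$ onto $L^2_{m_2}(0,x)$, $P_x^*$ its adjoint (extension by zero). $L^2_{m_2\times m_1}$ denotes square-integrable $m_2\times m_1$ matrix functions.
   Formalization: Step 3's existence of γ̃ is false for general bounded measurable v. It is replaced by: γ̃ is absolutely continuous with bounded derivative and, off a finite set, differentiable wherever β is, with bounded one-sided derivatives wherever β has them. *)

theory Defs
  imports "HOL-Complex_Analysis.Complex_Analysis"
begin

unbundle no fps_syntax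

section \<open>Complex matrices\<close>

text \<open>
  A matrix with \<open>p\<close> rows and \<open>q\<close> columns has type \<open>complex^'q^'p\<close>. Vectors of size
  \<open>m = m1 + m2\<close> are indexed by the sum type \<open>'m1 + 'm2\<close>.
\<close>

definition cadj :: "complex^'q^'p \<Rightarrow> complex^'p^'q" where
  "cadj A = (\<chi> i k. cnj (A $ k $ i))"

definition cscale :: "complex \<Rightarrow> complex^'q^'p \<Rightarrow> complex^'q^'p" where
  "cscale c A = (\<chi> i k. c * A $ i $ k)"

definition hcat :: "complex^'q^'p \<Rightarrow> complex^'r^'p \<Rightarrow> complex^('q::finite + 'r::finite)^'p" where
  "hcat A B = (\<chi> i k. case k of Inl a \<Rightarrow> A $ i $ a | Inr b \<Rightarrow> B $ i $ b)"

definition vcat :: "complex^'q^'p \<Rightarrow> complex^'q^'r \<Rightarrow> complex^'q^('p::finite + 'r::finite)" where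
  "vcat A B = (\<chi> i. case i of Inl a \<Rightarrow> A $ a | Inr b \<Rightarrow> B $ b)"

definition left_block :: "complex^('q::finite + 'r::finite)^'p \<Rightarrow> complex^'q^'p" where
  "left_block A = (\<chi> i a. A $ i $ Inl a)"

definition right_block :: "complex^('q::finite + 'r::finite)^'p \<Rightarrow> complex^'r^'p" where
  "right_block A = (\<chi> i b. A $ i $ Inr b)"

definition quad_form :: "complex^'n^'n \<Rightarrow> complex^'n \<Rightarrow> complex" where
  "quad_form A h = (\<Sum>i\<in>UNIV. cnj (h $ i) * (A *v h) $ i)"

definition pos_definite :: "complex^'n^'n \<Rightarrow> bool" where
  "pos_definite A \<longleftrightarrow> cadj A = A \<and> (\<forall>h. h \<noteq> 0 \<longrightarrow> 0 < Re (quad_form A h))"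

definition pos_semidefinite :: "complex^'n^'n \<Rightarrow> bool" where
  "pos_semidefinite A \<longleftrightarrow> cadj A = A \<and> (\<forall>h. 0 \<le> Re (quad_form A h))"


section \<open>Absolute continuity and bounded differentiability\<close>

definition abs_cont_on :: "real \<Rightarrow> real \<Rightarrow> (real \<Rightarrow> 'a::real_normed_vector) \<Rightarrow> bool" where
  "abs_cont_on a b f \<longleftrightarrow>
     (\<forall>e>0. \<exists>d>0. \<forall>(n::nat) s t.
        (\<forall>i<n. a \<le> s i \<and> s i \<le> t i \<and> t i \<le> b) \<and>
        (\<forall>i<n. \<forall>k<n. i \<noteq> k \<longrightarrow> {s i<..<t i} \<inter> {s k<..<t k} = {}) \<and>
        (\<Sum>i<n. t i - s i) < d
        \<longrightarrow> (\<Sum>i<n. norm (f (t i) - f (s i))) < e)"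

definition boundedly_diff :: "real \<Rightarrow> (real \<Rightarrow> 'a::real_normed_vector) \<Rightarrow> bool" where
  "boundedly_diff l f \<longleftrightarrow> abs_cont_on 0 l f \<and>
     (\<exists>C. AE x in lebesgue_on {0..l}.
        \<exists>D. (f has_vector_derivative D) (at x within {0..l}) \<and> norm D \<le> C)"

definition piecewise_diff :: "real \<Rightarrow> (real \<Rightarrow> 'a::real_normed_vector) \<Rightarrow> bool" where
  "piecewise_diff l f \<longleftrightarrow> continuous_on {0..l} f \<and>
     (\<exists>F. finite F \<and> (\<forall>x\<in>{0..l} - F. f differentiable (at x within {0..l}))) \<and>
     (\<exists>C. (\<forall>x\<in>{0..<l}. \<exists>D. (f has_vector_derivative D) (at_right x) \<and> norm D \<le> C) \<and>
          (\<forall>x\<in>{0<..l}. \<exists>D. (f has_vector_derivative D) (at_left x) \<and> norm D \<le> C))"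

text \<open>
  The same regularity relative to a given function \<open>g\<close>: apart from finitely many extra break
  points, \<open>f\<close> is differentiable wherever \<open>g\<close> is, and it has (uniformly bounded) one-sided
  derivatives wherever \<open>g\<close> has them. If \<open>piecewise_diff l g\<close>, this gives
  \<open>piecewise_diff l f\<close>.

  This relative form is needed for functions constructed from \<open>\<beta>\<close>: as \<open>v\<close> is only bounded and
  measurable, \<open>\<beta>\<close> itself need not have (one-sided) derivatives outside a finite set. For
  \<open>m1 = m2 = 1\<close> and real \<open>v\<close> one has \<open>\<beta> = [cos \<theta>, sin \<theta>]\<close> with \<open>\<theta>\<close> the integral of \<open>v\<close>, and
  a continuous non-vanishing row orthogonal to \<open>\<beta>\<close> is not differentiable where \<open>\<theta>\<close> is not.
\<close>

definition piecewise_diff_rel ::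
    "real \<Rightarrow> (real \<Rightarrow> 'b::real_normed_vector) \<Rightarrow> (real \<Rightarrow> 'a::real_normed_vector) \<Rightarrow> bool" where
  "piecewise_diff_rel l g f \<longleftrightarrow> continuous_on {0..l} f \<and>
     (\<exists>F. finite F \<and> (\<forall>x\<in>{0..l} - F.
        g differentiable (at x within {0..l}) \<longrightarrow> f differentiable (at x within {0..l}))) \<and>
     (\<exists>C. (\<forall>x\<in>{0..<l}. (\<exists>D. (g has_vector_derivative D) (at_right x)) \<longrightarrow>
             (\<exists>D. (f has_vector_derivative D) (at_right x) \<and> norm D \<le> C)) \<and>
          (\<forall>x\<in>{0<..l}. (\<exists>D. (g has_vector_derivative D) (at_left x)) \<longrightarrow>
             (\<exists>D. (f has_vector_derivative D) (at_left x) \<and> norm D \<le> C)))"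


section \<open>Square-integrable functions and operators on them\<close>

text \<open>
  Elements of \<open>L\<^sup>2(0,l)\<close> are represented by functions on \<open>{0..l}\<close>, and equality in \<open>L\<^sup>2(0,l)\<close> by
  equality almost everywhere. Matrix functions are measured in the Frobenius norm, so
  membership is entrywise membership.
\<close>

definition L2_on :: "real set \<Rightarrow> (real \<Rightarrow> 'a::euclidean_space) set" where
  "L2_on S = {f \<in> borel_measurable (lebesgue_on S). integrable (lebesgue_on S) (\<lambda>x. (norm (f x))\<^sup>2)}"

definition L2_norm_on :: "real set \<Rightarrow> (real \<Rightarrow> 'a::euclidean_space) \<Rightarrow> real" where
  "L2_norm_on S f = sqrt (\<integral>x. (norm (f x))\<^sup>2 \<partial>lebesgue_on S)"

text \<open>The limit in the mean \<open>l.i.m. F a = G\<close> as \<open>a\<close> tends to infinity.\<close>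

definition lim_in_mean ::
    "real set \<Rightarrow> (real \<Rightarrow> real \<Rightarrow> 'a::euclidean_space) \<Rightarrow> (real \<Rightarrow> 'a) \<Rightarrow> bool" where
  "lim_in_mean S F G \<longleftrightarrow> G \<in> L2_on S \<and> (\<forall>\<^sub>F a in at_top. F a \<in> L2_on S) \<and>
     ((\<lambda>a. L2_norm_on S (\<lambda>x. F a x - G x)) \<longlongrightarrow> 0) at_top"

type_synonym 'n oper = "(real \<Rightarrow> complex^'n) \<Rightarrow> real \<Rightarrow> complex^'n"

definition L2_bounded_op :: "real \<Rightarrow> 'n::finite oper \<Rightarrow> bool" where
  "L2_bounded_op l T \<longleftrightarrow>
     (\<forall>f\<in>L2_on {0..l}. T f \<in> L2_on {0..l}) \<and>
     (\<forall>f\<in>L2_on {0..l}. \<forall>g\<in>L2_on {0..l}. \<forall>c.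
        (AE x in lebesgue_on {0..l}. T (\<lambda>t. f t + g t) x = T f x + T g x) \<and>
        (AE x in lebesgue_on {0..l}. T (\<lambda>t. c *s f t) x = c *s T f x)) \<and>
     (\<exists>C. \<forall>f\<in>L2_on {0..l}. L2_norm_on {0..l} (T f) \<le> C * L2_norm_on {0..l} f)"

text \<open>\<open>T\<close> and \<open>R\<close> are bounded operators on \<open>L\<^sup>2(0,l)\<close>, inverse to each other.\<close>

definition L2_inverse :: "real \<Rightarrow> 'n::finite oper \<Rightarrow> 'n oper \<Rightarrow> bool" where
  "L2_inverse l T R \<longleftrightarrow> L2_bounded_op l T \<and> L2_bounded_op l R \<and>
     (\<forall>f\<in>L2_on {0..l}.
        (AE x in lebesgue_on {0..l}. T (R f) x = f x) \<and>
        (AE x in lebesgue_on {0..l}. R (T f) x = f x))"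

definition colwise :: "'p::finite oper \<Rightarrow> (real \<Rightarrow> complex^'q^'p) \<Rightarrow> real \<Rightarrow> complex^'q^'p" where
  "colwise T F x = (\<chi> i k. T (\<lambda>t. column k (F t)) x $ i)"

text \<open>
  As functions on \<open>{0..l}\<close> are not identified outside their domain, \<open>cut x\<close> represents both the
  restriction \<open>P\<^sub>x\<close> and its adjoint, the extension by zero.
\<close>

definition cut :: "real \<Rightarrow> 'n::finite oper" where
  "cut x f t = (if t \<in> {0..x} then f t else 0)"


section \<open>The skew-self-adjoint Dirac system\<close>

definition jmat :: "complex^('m1::finite + 'm2::finite)^('m1::finite + 'm2::finite)" where
  "jmat = vcat (hcat (mat 1) 0) (hcat 0 (- mat 1))"

definition Vmat :: "complex^'m2^'m1 \<Rightarrow> complex^('m1::finite + 'm2::finite)^('m1::finite + 'm2::finite)" where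
  "Vmat w = vcat (hcat 0 w) (hcat (cadj w) 0)"

text \<open>Solutions of the system are understood in the sense of Caratheodory.\<close>

definition fundamental_solution ::
    "(real \<Rightarrow> complex^'m2^'m1) \<Rightarrow>
     (real \<Rightarrow> complex \<Rightarrow> complex^('m1::finite + 'm2::finite)^('m1::finite + 'm2::finite)) \<Rightarrow> bool" where
  "fundamental_solution v u \<longleftrightarrow>
     (\<forall>z. u 0 z = mat 1 \<and>
          (\<forall>l>0. abs_cont_on 0 l (\<lambda>x. u x z)) \<and>
          (AE x in lebesgue_on {0..}.
             ((\<lambda>x. u x z) has_vector_derivative
               (cscale (\<i> * z) jmat + jmat ** Vmat (v x)) ** u x z) (at x within {0..})))"

definition upper_plane :: "real \<Rightarrow> complex set" where
  "upper_plane M = {z. Im z > M}"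

definition P_class :: "real \<Rightarrow> (complex \<Rightarrow> complex^'m1^('m1::finite + 'm2::finite)) set" where
  "P_class M = {P.
     (\<forall>i k. (\<lambda>z. P z $ i $ k) meromorphic_on upper_plane M) \<and>
     (\<forall>\<^sub>\<approx>z\<in>upper_plane M. pos_definite (cadj (P z) ** P z) \<and>
                         pos_semidefinite (cadj (P z) ** jmat ** P z))}"

definition lin_frac ::
    "complex^('m1::finite + 'm2::finite)^('m1::finite + 'm2::finite) \<Rightarrow> complex^'m1^('m1::finite + 'm2::finite) \<Rightarrow> complex^'m1^'m2" where
  "lin_frac U P = (hcat 0 (mat 1) ** matrix_inv U ** P)
                  ** matrix_inv (hcat (mat 1) 0 ** matrix_inv U ** P)"

text \<open>
  The value at \<open>z\<close> of a meromorphic function after removal of removable singularities is its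
  limit at \<open>z\<close>.
\<close>

definition N_set ::
    "real \<Rightarrow> (real \<Rightarrow> complex \<Rightarrow> complex^('m1::finite + 'm2::finite)^('m1::finite + 'm2::finite)) \<Rightarrow> real \<Rightarrow> complex
     \<Rightarrow> (complex^'m1^'m2) set" where
  "N_set M u x z = {W. \<exists>P\<in>P_class M. ((\<lambda>\<zeta>. lin_frac (u x \<zeta>) (P \<zeta>)) \<longlongrightarrow> W) (at z)}"

definition weyl_function ::
    "real \<Rightarrow> (real \<Rightarrow> complex \<Rightarrow> complex^('m1::finite + 'm2::finite)^('m1::finite + 'm2::finite))
     \<Rightarrow> (complex \<Rightarrow> complex^'m1^'m2) \<Rightarrow> bool" where
  "weyl_function M u \<phi> \<longleftrightarrow> (\<forall>z\<in>upper_plane M. {\<phi> z} = (\<Inter>x\<in>{0..}. N_set M u x z))"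

definition beta_of ::
    "(real \<Rightarrow> complex \<Rightarrow> complex^('m1::finite + 'm2::finite)^('m1::finite + 'm2::finite)) \<Rightarrow> real \<Rightarrow> complex^('m1::finite + 'm2::finite)^'m1" where
  "beta_of u x = hcat (mat 1) 0 ** u x 0"

definition gamma_of ::
    "(real \<Rightarrow> complex \<Rightarrow> complex^('m1::finite + 'm2::finite)^('m1::finite + 'm2::finite)) \<Rightarrow> real \<Rightarrow> complex^('m1::finite + 'm2::finite)^'m2" where
  "gamma_of u x = hcat 0 (mat 1) ** u x 0"


section \<open>The similarity transformation and \<open>\<Phi>\<^sub>1\<close>\<close>

definition A_op :: "'n::finite oper" where
  "A_op f x = (- \<i>) *s (LINT t:{0..x}|lebesgue. f t)"

definition K_op :: "(real \<Rightarrow> complex^'r^'n) \<Rightarrow> 'n::finite oper" where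
  "K_op \<gamma> f x = (- \<i>) *s (\<gamma> x *v (LINT t:{0..x}|lebesgue. cadj (\<gamma> t) *v f t))"

definition volterra_op :: "(real \<Rightarrow> real \<Rightarrow> complex^'n^'n) \<Rightarrow> 'n::finite oper" where
  "volterra_op k f x = f x + (LINT t:{0..x}|lebesgue. k x t *v f t)"

definition bounded_kernel :: "real \<Rightarrow> (real \<Rightarrow> real \<Rightarrow> complex^'n^'n) \<Rightarrow> bool" where
  "bounded_kernel l k \<longleftrightarrow>
     (\<lambda>(x, t). k x t) \<in> borel_measurable (lebesgue_on {(x, t). 0 \<le> t \<and> t \<le> x \<and> x \<le> l}) \<and>
     (\<exists>C. \<forall>x t. 0 \<le> t \<and> t \<le> x \<and> x \<le> l \<longrightarrow> norm (k x t) \<le> C)"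

text \<open>\<open>volterra_op k\<close> is the operator \<open>E\<close> on \<open>L\<^sup>2(0,l)\<close>, and \<open>R\<close> is its inverse.\<close>

definition similarity_op ::
    "real \<Rightarrow> (real \<Rightarrow> complex^('m1::finite + 'm2::finite)^'m2) \<Rightarrow> (real \<Rightarrow> real \<Rightarrow> complex^'m2^'m2)
     \<Rightarrow> 'm2::finite oper \<Rightarrow> bool" where
  "similarity_op l \<gamma> k R \<longleftrightarrow>
     bounded_kernel l k \<and> L2_inverse l (volterra_op k) R \<and>
     (\<forall>f\<in>L2_on {0..l}. AE x in lebesgue_on {0..l}.
        K_op \<gamma> f x = volterra_op k (A_op (R f)) x) \<and>
     (AE x in lebesgue_on {0..l}. colwise R (\<lambda>t. right_block (\<gamma> t)) x = mat 1)"

text \<open>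
  \<open>\<Phi>\<close> is, on every interval \<open>[0,l]\<close>, the boundedly differentiable representative of the
  \<open>L\<^sup>2\<close>-class \<open>E\<^sup>-\<^sup>1 \<gamma>\<^sub>1\<close>.
\<close>

definition is_Phi1 ::
    "(real \<Rightarrow> complex^('m1::finite + 'm2::finite)^'m2) \<Rightarrow> (real \<Rightarrow> complex^'m1^'m2) \<Rightarrow> bool" where
  "is_Phi1 \<gamma> \<Phi> \<longleftrightarrow>
     (\<forall>l>0. boundedly_diff l \<Phi> \<and>
        (\<exists>k R. similarity_op l \<gamma> k R \<and>
           (AE x in lebesgue_on {0..l}. colwise R (\<lambda>t. left_block (\<gamma> t)) x = \<Phi> x)))"


section \<open>Ingredients of the recovery procedure\<close>

definition s_kernel :: "(real \<Rightarrow> complex^'q^'n) \<Rightarrow> real \<Rightarrow> real \<Rightarrow> complex^'n^'n" where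
  "s_kernel \<Phi> x t = (LINT \<zeta>:{0..min x t}|lebesgue.
     vector_derivative \<Phi> (at (x - \<zeta>)) ** cadj (vector_derivative \<Phi> (at (t - \<zeta>))))"

definition S_op :: "real \<Rightarrow> (real \<Rightarrow> complex^'q^'n) \<Rightarrow> 'n::finite oper" where
  "S_op l \<Phi> f x = f x + (LINT t:{0..l}|lebesgue. s_kernel \<Phi> x t *v f t)"

definition S_sub :: "real \<Rightarrow> (real \<Rightarrow> complex^'q^'n) \<Rightarrow> real \<Rightarrow> 'n::finite oper" where
  "S_sub l \<Phi> x = cut x \<circ> S_op l \<Phi> \<circ> cut x"

definition complements ::
    "real \<Rightarrow> (real \<Rightarrow> complex^('m1::finite + 'm2::finite)^'m1) \<Rightarrow> (real \<Rightarrow> complex^('m1::finite + 'm2::finite)^'m2) \<Rightarrow> bool" where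
  "complements l \<beta> g \<longleftrightarrow>
     (\<forall>x\<in>{0..l}. \<beta> x ** cadj (g x) = 0 \<and> pos_definite (g x ** cadj (g x))) \<and>
     g 0 = hcat 0 (mat 1)"

definition kappa_solution ::
    "real \<Rightarrow> (real \<Rightarrow> complex^'r^'n) \<Rightarrow> (real \<Rightarrow> complex^'n^'n) \<Rightarrow> bool" where
  "kappa_solution l g \<kappa> \<longleftrightarrow> \<kappa> 0 = mat 1 \<and> abs_cont_on 0 l \<kappa> \<and>
     (AE x in lebesgue_on {0..l}.
        (\<kappa> has_vector_derivative
          - (\<kappa> x ** vector_derivative g (at x within {0..l}) ** cadj (g x)
             ** matrix_inv (g x ** cadj (g x)))) (at x within {0..l}))"

end

theory Submission imports Defs "HOL-Probability.Probability" "HOL-Real_Asymp.Real_Asymp" begin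

text \<open>
  The operator \<open>E\<close> carries the Volterra operator \<open>A\<close> to \<open>K\<close>, hence exponentials to solutions of the
  Dirac system. For finite sums of solutions the system becomes hyperbolic, and a weighted energy
  balance on a triangle bounds \<open>f\<close> in terms of \<open>E f + \<gamma>\<^sub>1 c\<close>, uniformly in \<open>l\<close>. Since
  \<open>E \<Phi>\<^sub>1 = \<gamma>\<^sub>1\<close>, this yields the weighted square integrability of \<open>\<Phi>\<^sub>1\<close>; applied to the
  \<open>L\<^sup>2\<close> solutions that the Weyl function provides, it yields the Laplace representation of \<open>\<phi>\<close>.
  Step 1 of the recovery is then Fourier inversion with the Dirichlet kernel for a Lipschitz function.

  For step 2 one shows \<open>S E\<^sup>* E = I\<close>: under the form \<open>\<langle>S E\<^sup>* w, E\<^sup>* w'\<rangle> - \<langle>w, w'\<rangle>\<close>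
  integration is skew, so by polynomial approximation convolution with \<open>p s\<close> may be moved across as
  convolution with \<open>- p (- s)\<close> for every continuous \<open>p\<close>; choosing \<open>p\<close> supported on one side shows
  that the form is zero. Together with \<open>E \<Phi>\<^sub>1' = - v\<^sup>*\<close> this gives \<open>\<beta>\<close>.

  In step 3 \<open>\<gamma>\<close> itself is a complement of \<open>\<beta>\<close>, and \<open>\<kappa> = (g \<gamma>\<^sup>*)\<^sup>-\<^sup>1\<close> solves the differential
  equation for every complement \<open>g\<close>.
\<close>

unbundle no fps_syntax

section \<open>Absolutely continuous and Lipschitz functions\<close>

text \<open>Since v is only bounded and measurable, differential identities hold almost everywhere;
  boundedness makes all functions that arise from the system Lipschitz on bounded intervals, and one
  calculus of Lipschitz functions with a prescribed a.e. derivative serves throughout. Matrices are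
  tested on vectors, with the real inner product.

  The obstacle to the Laplace representation is that the kernel of E is controlled only on each
  finite interval, by a constant that may grow with l. The energy estimate avoids that constant: E
  maps exp(q t) c to the trace, on the edge t = x/2, of a hyperbolic solution whose lower block at x
  = 0 is exp(q t) c.

  In step 2 the defect X of the claimed inverse satisfies A X = X B with B the adjoint of A. Both
  operators have spectrum {0}, so no spectral argument excludes a nonzero X; the one-sided support
  of Volterra convolutions does. The convolving function must be continuous at 0, which is why X is
  tested against second integrals and not against simple ones.\<close>

abbreviation "Leb l \<equiv> lebesgue_on {0..l :: real}"

text \<open>Distinct pieces overlap only in endpoints, so the lengths add up to the measure of the
  union, which lies in T. It controls the intervals tagged in an exceptional null set.\<close>

lemma tagged_partial_division_length_le:
  fixes T :: "real set"
  assumes q: "q tagged_partial_division_of {a..b}" and sub: "\<And>x K. (x,K) \<in> q \<Longrightarrow> K \<subseteq> T"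
    and T: "T \<in> lmeasurable"
  shows "(\<Sum>(x,K)\<in>q. measure lborel K) \<le> measure lebesgue T"
proof -
  have td: "q tagged_division_of \<Union>(snd ` q)"
    using q by (rule tagged_partial_division_of_Union_self)
  have div: "(snd ` q) division_of \<Union>(snd ` q)"
    using q by (rule partial_division_of_tagged_division)
  have "(\<Sum>(x,K)\<in>q. measure lborel K) = (\<Sum>K\<in>snd ` q. measure lborel K)"
    by (rule sum.over_tagged_division_lemma[OF td]) (auto simp: content_eq_0_interior)
  also have "\<dots> = (\<Sum>K\<in>snd ` q. measure lebesgue K)"
    using div by (intro sum.cong) auto
  also have "\<dots> = measure lebesgue (\<Union>(snd ` q))"
    using content_division[OF div] .
  also have "\<dots> \<le> measure lebesgue T"
  proof (intro measure_mono_fmeasurable T)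
    show "\<Union>(snd ` q) \<subseteq> T" using sub by fastforce
    show "\<Union>(snd ` q) \<in> sets lebesgue"
      by (rule fmeasurableD[OF lmeasurable_division[OF div]])
  qed
  finally show ?thesis .
qed

lemma abs_cont_on_subset:
  assumes "abs_cont_on a b f" "a \<le> c" "d \<le> b"
  shows "abs_cont_on c d f"
  unfolding abs_cont_on_def
proof (intro allI impI)
  fix e :: real assume "e > 0"
  from assms(1)[unfolded abs_cont_on_def, rule_format, OF this] obtain \<delta> where "\<delta> > 0" and
    \<delta>: "\<forall>(n::nat) s t. (\<forall>i<n. a \<le> s i \<and> s i \<le> t i \<and> t i \<le> b) \<and>
        (\<forall>i<n. \<forall>k<n. i \<noteq> k \<longrightarrow> {s i<..<t i} \<inter> {s k<..<t k} = {}) \<and>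
        (\<Sum>i<n. t i - s i) < \<delta> \<longrightarrow> (\<Sum>i<n. norm (f (t i) - f (s i))) < e"
    by (elim exE conjE)
  show "\<exists>d'>0. \<forall>(n::nat) s t. (\<forall>i<n. c \<le> s i \<and> s i \<le> t i \<and> t i \<le> d) \<and>
        (\<forall>i<n. \<forall>k<n. i \<noteq> k \<longrightarrow> {s i<..<t i} \<inter> {s k<..<t k} = {}) \<and>
        (\<Sum>i<n. t i - s i) < d' \<longrightarrow> (\<Sum>i<n. norm (f (t i) - f (s i))) < e"
  proof (intro exI[of _ \<delta>] conjI allI impI \<open>\<delta> > 0\<close>)
    fix n :: nat and s t :: "nat \<Rightarrow> real"
    assume *: "(\<forall>i<n. c \<le> s i \<and> s i \<le> t i \<and> t i \<le> d) \<and>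
        (\<forall>i<n. \<forall>k<n. i \<noteq> k \<longrightarrow> {s i<..<t i} \<inter> {s k<..<t k} = {}) \<and>
        (\<Sum>i<n. t i - s i) < \<delta>"
    show "(\<Sum>i<n. norm (f (t i) - f (s i))) < e"
      by (rule \<delta>[rule_format]) (use * assms(2,3) in \<open>auto intro: order_trans\<close>)
  qed
qed

lemma abs_cont_on_continuous:
  assumes ac: "abs_cont_on a b f" shows "continuous_on {a..b} f"
  unfolding continuous_on_iff
proof safe
  fix x e :: real assume x: "x \<in> {a..b}" and "e > 0"
  obtain d where d: "d > 0" "\<forall>(n::nat) s t.
      (\<forall>i<n. a \<le> s i \<and> s i \<le> t i \<and> t i \<le> b) \<and>
      (\<forall>i<n. \<forall>k<n. i \<noteq> k \<longrightarrow> {s i<..<t i} \<inter> {s k<..<t k} = {}) \<and>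
      (\<Sum>i<n. t i - s i) < d
      \<longrightarrow> (\<Sum>i<n. norm (f (t i) - f (s i))) < e"
    using ac[unfolded abs_cont_on_def, rule_format, OF \<open>e > 0\<close>] by (elim exE conjE)
  show "\<exists>d>0. \<forall>x'\<in>{a..b}. dist x' x < d \<longrightarrow> dist (f x') (f x) < e"
  proof (intro exI[of _ d] conjI ballI impI \<open>d > 0\<close>)
    fix x' assume x': "x' \<in> {a..b}" "dist x' x < d"
    show "dist (f x') (f x) < e"
      using d(2)[rule_format, of "Suc 0" "\<lambda>_. min x x'" "\<lambda>_. max x x'"] x x'
      by (cases "x \<le> x'") (auto simp: dist_norm dist_real_def norm_minus_commute)
  qed
qed

text \<open>Absolute continuity in the form needed for gauge integrals: enumerating the pieces of a
  partial division gives the indexed intervals of the definition, with disjoint interiors.\<close>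

lemma abs_cont_on_sum_less:
  fixes f :: "real \<Rightarrow> 'a::real_normed_vector"
  assumes ac: "abs_cont_on a b f" and "e > 0"
  obtains d where "d > 0"
    "\<And>q. q tagged_partial_division_of {a..b} \<Longrightarrow> (\<Sum>(x,K)\<in>q. measure lborel K) < d
       \<Longrightarrow> (\<Sum>(x,K)\<in>q. norm (f (Sup K) - f (Inf K))) < e"
proof -
  obtain d where d0: "d > 0" and
    d: "\<forall>(n::nat) s t. (\<forall>i<n. a \<le> s i \<and> s i \<le> t i \<and> t i \<le> b) \<and>
        (\<forall>i<n. \<forall>k<n. i \<noteq> k \<longrightarrow> {s i<..<t i} \<inter> {s k<..<t k} = {}) \<and>
        (\<Sum>i<n. t i - s i) < d \<longrightarrow> (\<Sum>i<n. norm (f (t i) - f (s i))) < e"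
    using ac[unfolded abs_cont_on_def, rule_format, OF \<open>e > 0\<close>] by (elim exE conjE)
  have "(\<Sum>(x,K)\<in>q. norm (f (Sup K) - f (Inf K))) < e"
    if q: "q tagged_partial_division_of {a..b}" and small: "(\<Sum>(x,K)\<in>q. measure lborel K) < d" for q
  proof -
    note Q = tagged_partial_division_ofD[OF q]
    obtain h where h: "bij_betw h {0..<card q} q"
      using ex_bij_betw_nat_finite[OF Q(1)] by blast
    define s where "s i = Inf (snd (h i))" for i
    define t where "t i = Sup (snd (h i))" for i
    have K: "snd (h i) = {s i..t i} \<and> s i \<le> t i \<and> a \<le> s i \<and> t i \<le> b" if "i < card q" for i
    proof -
      have "h i \<in> q" using h that by (auto simp: bij_betw_def)
      then have hq: "(fst (h i), snd (h i)) \<in> q" by simp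
      obtain c d where cd: "snd (h i) = cbox c d" using Q(4)[OF hq] by blast
      have "fst (h i) \<in> snd (h i)" using Q(2)[OF hq] .
      then have "c \<le> d" using cd by auto
      moreover have "snd (h i) \<subseteq> {a..b}" using Q(3)[OF hq] .
      ultimately show ?thesis using cd by (auto simp: s_def t_def)
    qed
    have sum_h: "(\<Sum>x\<in>q. g x) = (\<Sum>i<card q. g (h i))" for g :: "real \<times> real set \<Rightarrow> real"
      using sum.reindex_bij_betw[OF h, of g] by (simp add: atLeast0LessThan)
    have "(\<Sum>(x,K)\<in>q. norm (f (Sup K) - f (Inf K))) = (\<Sum>i<card q. norm (f (t i) - f (s i)))"
      unfolding sum_h by (simp add: s_def t_def split_def)
    also have "\<dots> < e"
    proof (rule d[rule_format], intro conjI allI impI)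
      fix i k assume ik: "i < card q" "k < card q" "i \<noteq> k"
      then have hik: "h i \<noteq> h k"
        using bij_betw_imp_inj_on[OF h] by (auto dest: inj_onD)
      have "h i \<in> q" "h k \<in> q"
        using bij_betw_apply[OF h] ik by auto
      then have "interior (snd (h i)) \<inter> interior (snd (h k)) = {}"
        using hik by (intro Q(5)[of "fst (h i)" _ "fst (h k)"]) auto
      then show "{s i<..<t i} \<inter> {s k<..<t k} = {}"
        using K[OF ik(1)] K[OF ik(2)] by (simp add: interior_atLeastAtMost_real)
    next
      have "(\<Sum>i<card q. t i - s i) = (\<Sum>(x,K)\<in>q. measure lborel K)"
        unfolding sum_h using K by (intro sum.cong) (auto simp: split_def)
      then show "(\<Sum>i<card q. t i - s i) < d" using small by simp
    qed (use K in auto)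
    finally show ?thesis .
  qed
  with d0 show ?thesis by (rule that)
qed

text \<open>
  On the exceptional null set the gauge is taken inside an open set of small measure, so that
  absolute continuity controls the increments over the intervals tagged there.
\<close>

theorem abs_cont_fundamental_theorem:
  fixes f :: "real \<Rightarrow> 'a::euclidean_space"
  assumes "a \<le> b" and ac: "abs_cont_on a b f"
    and ae: "AE x in lebesgue_on {a..b}. (f has_vector_derivative D x) (at x within {a..b})"
  shows "(D has_integral (f b - f a)) {a..b}"
proof -
  define N where "N = {x \<in> {a..b}. \<not> (f has_vector_derivative D x) (at x within {a..b})}"
  have negN: "negligible N"
  proof -
    have "AE x in lebesgue. x \<in> {a..b} \<longrightarrow> (f has_vector_derivative D x) (at x within {a..b})"
      using ae by (subst (asm) AE_restrict_space_iff) auto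
    then show ?thesis
      by (simp add: negligible_iff_null_sets N_def completion.AE_iff_null_sets)
  qed
  \<comment> \<open>With the value 0 on N, Riemann terms tagged in N vanish and only the increments
    of f remain there.\<close>
  define D' where "D' x = (if x \<in> N then 0 else D x)" for x
  have "(D' has_integral (f b - f a)) (cbox a b)"
    unfolding has_integral
  proof (intro allI impI)
    fix e :: real assume "e > 0"
    \<comment> \<open>Half of e is spread over the tags outside N, where f is differentiable; the
      summand 1 keeps the quotient defined for a = b. The other half is for the tags in N.\<close>
    define e1 where "e1 = e / (2 * (b - a + 1))"
    have e1: "e1 > 0" using \<open>e > 0\<close> \<open>a \<le> b\<close> by (simp add: e1_def)
    obtain \<delta> where "\<delta> > 0" and \<delta>: "\<And>q. q tagged_partial_division_of {a..b} \<Longrightarrow>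
         (\<Sum>(x,K)\<in>q. measure lborel K) < \<delta> \<Longrightarrow> (\<Sum>(x,K)\<in>q. norm (f (Sup K) - f (Inf K))) < e / 2"
      using abs_cont_on_sum_less[OF ac, of "e/2"] \<open>e > 0\<close> by auto
    obtain T where T: "open T" "N \<subseteq> T" "T - N \<in> lmeasurable" "emeasure lebesgue (T - N) < ennreal \<delta>"
      using sets_lebesgue_outer_open[OF negligible_imp_sets[OF negN] \<open>\<delta> > 0\<close>] by blast
    have TN: "T = (T - N) \<union> N" using T by blast
    have Tm: "T \<in> lmeasurable"
      by (subst TN) (intro fmeasurable.Un T negligible_imp_measurable negN)
    have "measure lebesgue T \<le> measure lebesgue (T - N) + measure lebesgue N"
      by (subst TN, intro measure_Un_le) (use T negN in \<open>auto simp: negligible_imp_sets\<close>)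
    also have "\<dots> < \<delta>"
      using T(3,4) negligible_imp_measure0[OF negN] by (simp add: emeasure_eq_measure2 fmeasurableD2 ennreal_less_iff)
    finally have meas: "measure lebesgue T < \<delta>" .
    have "\<forall>x. \<exists>d>0. x \<in> {a..b} - N \<longrightarrow>
         (\<forall>y\<in>{a..b}. norm (y-x) < d \<longrightarrow> norm (f y - f x - (y-x) *\<^sub>R D x) \<le> e1 * norm (y-x))"
      using e1 unfolding N_def has_vector_derivative_def has_derivative_within_alt by blast
    then obtain r where r: "\<And>x. 0 < r x"
       "\<And>x y. \<lbrakk>x \<in> {a..b} - N; y \<in> {a..b}; norm (y-x) < r x\<rbrakk>
          \<Longrightarrow> norm (f y - f x - (y-x) *\<^sub>R D x) \<le> e1 * norm (y-x)"
      by metis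
    define g where "g x = (if x \<in> N then T else ball x (r x))" for x
    have gauge: "gauge g"
      unfolding gauge_def g_def using T r(1) by auto
    show "\<exists>\<gamma>. gauge \<gamma> \<and> (\<forall>\<D>. \<D> tagged_division_of cbox a b \<and> \<gamma> fine \<D> \<longrightarrow>
         norm ((\<Sum>(x, k)\<in>\<D>. measure lborel k *\<^sub>R D' x) - (f b - f a)) < e)"
    proof (intro exI[of _ g] conjI gauge allI impI)
      fix p assume *: "p tagged_division_of cbox a b \<and> g fine p"
      then have ptag: "p tagged_division_of {a..b}" and fine: "g fine p" by auto
      note P = tagged_division_ofD[OF ptag]
      have iv: "\<exists>u v. K = {u..v} \<and> u \<le> x \<and> x \<le> v \<and> a \<le> u \<and> v \<le> b" if xK: "(x,K) \<in> p" for x K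
      proof -
        obtain u v where uv: "K = cbox u v" using P(4)[OF xK] by blast
        have "x \<in> K" "K \<subseteq> {a..b}" using P(2)[OF xK] P(3)[OF xK] .
        then show ?thesis by (intro exI[of _ u] exI[of _ v]) (auto simp: uv)
      qed
      define q where "q = {xK \<in> p. fst xK \<in> N}"
      have fin: "finite p" using P(1) .
      have ptq: "q tagged_partial_division_of {a..b}"
        using ptag by (auto intro: tagged_partial_division_subset simp: tagged_division_of_def q_def)
      have qs: "(\<Sum>(x,K)\<in>q. norm (f (Sup K) - f (Inf K))) < e / 2"
      proof (rule \<delta>[OF ptq])
        have "K \<subseteq> T" if "(x,K) \<in> q" for x K
          using fineD[OF fine, of x K] that by (auto simp: q_def g_def)
        then have "(\<Sum>(x,K)\<in>q. measure lborel K) \<le> measure lebesgue T"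
          by (rule tagged_partial_division_length_le[OF ptq _ Tm])
        then show "(\<Sum>(x,K)\<in>q. measure lborel K) < \<delta>" using meas by linarith
      qed
      have rest: "norm (\<Sum>(x,K)\<in>p - q. measure lborel K *\<^sub>R D x - (f (Sup K) - f (Inf K)))
              \<le> (\<Sum>(x,K)\<in>p - q. e1 * measure lborel K)"
        unfolding split_def
      proof (rule sum_norm_le)
        fix xK assume xK: "xK \<in> p - q"
        define x K where "x = fst xK" and "K = snd xK"
        have xKp: "(x,K) \<in> p" using xK by (auto simp: x_def K_def)
        obtain c d where K: "K = {c..d}" "c \<le> x" "x \<le> d" "a \<le> c" "d \<le> b"
          using iv[OF xKp] by blast
        have xN: "x \<in> {a..b} - N" using xK K by (auto simp: x_def K_def q_def)
        have "K \<subseteq> ball x (r x)" using fineD[OF fine xKp] xN by (simp add: g_def)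
        then have cd: "norm (c - x) < r x" "norm (d - x) < r x"
          using K subsetD[of K "ball x (r x)" c] subsetD[of K "ball x (r x)" d]
          by (auto simp: dist_real_def)
        \<comment> \<open>Both endpoints are compared with the tag x. As x lies between c and d, the
          two error bounds add up to the length of the piece.\<close>
        have "norm ((d - c) *\<^sub>R D x - (f d - f c))
           = norm ((f c - f x - (c - x) *\<^sub>R D x) - (f d - f x - (d - x) *\<^sub>R D x))"
          by (simp add: algebra_simps)
        also have "\<dots> \<le> e1 * norm (c - x) + e1 * norm (d - x)"
          using K
          by (intro order_trans[OF norm_triangle_ineq4] add_mono r(2)[OF xN _ cd(1)] r(2)[OF xN _ cd(2)]) auto
        also have "\<dots> = e1 * (d - c)" using K by (simp add: algebra_simps)
        finally show "norm (measure lborel (snd xK) *\<^sub>R D (fst xK) - (f (Sup (snd xK)) - f (Inf (snd xK))))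
            \<le> e1 * measure lborel (snd xK)"
          using K unfolding x_def[symmetric] K_def[symmetric] by simp
      qed
      have pq: "p = (p - q) \<union> q" "q \<subseteq> p" by (auto simp: q_def)
      have e1b: "(\<Sum>(x,K)\<in>p - q. e1 * measure lborel K) \<le> e1 * (b - a)"
      proof -
        have "(\<Sum>(x,K)\<in>p - q. e1 * measure lborel K) \<le> (\<Sum>(x,K)\<in>p. e1 * measure lborel K)"
          using fin e1 by (intro sum_mono2) auto
        also have "\<dots> = e1 * (\<Sum>(x,K)\<in>p. measure lborel K)" by (simp add: sum_distrib_left split_def)
        also have "\<dots> = e1 * (b - a)"
          using additive_content_tagged_division[of p a b] ptag \<open>a \<le> b\<close> by simp
        finally show ?thesis .
      qed
      have "(\<Sum>(x, k)\<in>p. measure lborel k *\<^sub>R D' x) - (f b - f a)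
          = (\<Sum>(x, K)\<in>p. measure lborel K *\<^sub>R D' x - (f (Sup K) - f (Inf K)))"
        using additive_tagged_division_1[OF \<open>a \<le> b\<close> ptag, of f] by (simp add: sum_subtractf split_def)
      also have "\<dots> = (\<Sum>(x, K)\<in>p - q. measure lborel K *\<^sub>R D' x - (f (Sup K) - f (Inf K)))
              + (\<Sum>(x, K)\<in>q. measure lborel K *\<^sub>R D' x - (f (Sup K) - f (Inf K)))"
        using sum.subset_diff[OF pq(2) fin] by simp
      also have "(\<Sum>(x, K)\<in>q. measure lborel K *\<^sub>R D' x - (f (Sup K) - f (Inf K)))
           = (\<Sum>(x, K)\<in>q. - (f (Sup K) - f (Inf K)))"
        by (rule sum.cong) (auto simp: q_def D'_def)
      also have "(\<Sum>(x, K)\<in>p - q. measure lborel K *\<^sub>R D' x - (f (Sup K) - f (Inf K)))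
           = (\<Sum>(x, K)\<in>p - q. measure lborel K *\<^sub>R D x - (f (Sup K) - f (Inf K)))"
        by (rule sum.cong) (auto simp: q_def D'_def)
      finally have eq: "(\<Sum>(x, k)\<in>p. measure lborel k *\<^sub>R D' x) - (f b - f a)
         = (\<Sum>(x, K)\<in>p - q. measure lborel K *\<^sub>R D x - (f (Sup K) - f (Inf K)))
           + (\<Sum>(x, K)\<in>q. - (f (Sup K) - f (Inf K)))" .
      have nq: "norm (\<Sum>(x, K)\<in>q. - (f (Sup K) - f (Inf K))) \<le> (\<Sum>(x,K)\<in>q. norm (f (Sup K) - f (Inf K)))"
        unfolding split_def by (intro sum_norm_le) (simp only: norm_minus_cancel order_refl)
      have "norm ((\<Sum>(x, k)\<in>p. measure lborel k *\<^sub>R D' x) - (f b - f a))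
         \<le> norm (\<Sum>(x, K)\<in>p - q. measure lborel K *\<^sub>R D x - (f (Sup K) - f (Inf K)))
           + norm (\<Sum>(x, K)\<in>q. - (f (Sup K) - f (Inf K)))"
        unfolding eq by (rule norm_triangle_ineq)
      also have "\<dots> \<le> e1 * (b - a) + (\<Sum>(x,K)\<in>q. norm (f (Sup K) - f (Inf K)))"
        by (rule add_mono[OF order_trans[OF rest e1b] nq])
      also have "\<dots> < e1 * (b - a) + e / 2" using qs by simp
      also have "\<dots> \<le> e"
        using \<open>a \<le> b\<close> \<open>e > 0\<close> by (simp add: e1_def field_simps)
      finally show "norm ((\<Sum>(x, k)\<in>p. measure lborel k *\<^sub>R D' x) - (f b - f a)) < e" .
    qed
  qed
  then have "(D' has_integral (f b - f a)) {a..b}" by simp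
  then show ?thesis
    by (rule has_integral_spike[OF negN, rotated]) (auto simp: D'_def)
qed

lemma AE_lebesgue_on_subset:
  assumes "AE x in lebesgue_on A. P x" "B \<subseteq> A" "A \<in> sets lebesgue" "B \<in> sets lebesgue"
  shows "AE x in lebesgue_on B. P x"
  using assms by (auto simp: AE_restrict_space_iff elim!: eventually_mono)

lemma AE_mem: "AE x in lebesgue_on {a..b}. x \<in> {a..b}"
  by (rule AE_I2) simp

lemma continuous_on_Icc_bounded:
  fixes f :: "real \<Rightarrow> 'a::real_normed_vector"
  assumes "continuous_on {a..b} f"
  obtains C where "0 \<le> C" "\<And>x. x \<in> {a..b} \<Longrightarrow> norm (f x) \<le> C"
proof -
  have "bounded (f ` {a..b})" using assms by (intro compact_imp_bounded compact_continuous_image) auto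
  then show ?thesis unfolding bounded_pos by (metis image_eqI less_imp_le that)
qed

section \<open>Lipschitz functions and derivatives almost everywhere\<close>

definition lip_on :: "real \<Rightarrow> real \<Rightarrow> (real \<Rightarrow> 'a::real_normed_vector) \<Rightarrow> bool" where
  "lip_on a b f \<longleftrightarrow> (\<exists>L. \<forall>x\<in>{a..b}. \<forall>y\<in>{a..b}. norm (f y - f x) \<le> L * \<bar>y - x\<bar>)"

lemma lip_onE:
  assumes "lip_on a b f"
  obtains L where "L \<ge> 0" "\<And>x y. x \<in> {a..b} \<Longrightarrow> y \<in> {a..b} \<Longrightarrow> norm (f y - f x) \<le> L * \<bar>y - x\<bar>"
proof -
  obtain L where L: "\<forall>x\<in>{a..b}. \<forall>y\<in>{a..b}. norm (f y - f x) \<le> L * \<bar>y - x\<bar>"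
    using assms unfolding lip_on_def by blast
  have "norm (f y - f x) \<le> max L 0 * \<bar>y - x\<bar>" if "x \<in> {a..b}" "y \<in> {a..b}" for x y
    using L that by (meson abs_ge_zero max.cobounded1 mult_right_mono order_trans)
  then show ?thesis by (intro that[of "max L 0"]) auto
qed

lemma lip_on_subset: "lip_on a b f \<Longrightarrow> a \<le> c \<Longrightarrow> d \<le> b \<Longrightarrow> lip_on c d f"
  unfolding lip_on_def by (meson atLeastAtMost_iff order_trans)

lemma lip_on_continuous: "lip_on a b f \<Longrightarrow> continuous_on {a..b} f"
proof -
  assume "lip_on a b f"
  then obtain L where L: "L \<ge> 0" "\<And>x y. x \<in> {a..b} \<Longrightarrow> y \<in> {a..b} \<Longrightarrow> norm (f y - f x) \<le> L * \<bar>y - x\<bar>"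
    by (rule lip_onE) blast
  have "L-lipschitz_on {a..b} f"
    by (intro lipschitz_onI L(1)) (use L(2) in \<open>auto simp: dist_norm\<close>)
  then show ?thesis by (rule lipschitz_on_continuous_on)
qed

lemma lip_on_bounded:
  assumes "lip_on a b f"
  obtains C where "C \<ge> 0" "\<And>x. x \<in> {a..b} \<Longrightarrow> norm (f x) \<le> C"
  using continuous_on_Icc_bounded[OF lip_on_continuous[OF assms]] by blast

lemma lip_on_abs_cont:
  assumes "lip_on a b f" shows "abs_cont_on a b f"
  unfolding abs_cont_on_def
proof (intro allI impI)
  fix e :: real assume "e > 0"
  obtain L where L: "L \<ge> 0" "\<And>x y. x \<in> {a..b} \<Longrightarrow> y \<in> {a..b} \<Longrightarrow> norm (f y - f x) \<le> L * \<bar>y - x\<bar>"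
    using lip_onE[OF assms] by blast
  show "\<exists>d>0. \<forall>(n::nat) s t. (\<forall>i<n. a \<le> s i \<and> s i \<le> t i \<and> t i \<le> b) \<and>
        (\<forall>i<n. \<forall>k<n. i \<noteq> k \<longrightarrow> {s i<..<t i} \<inter> {s k<..<t k} = {}) \<and>
        (\<Sum>i<n. t i - s i) < d \<longrightarrow> (\<Sum>i<n. norm (f (t i) - f (s i))) < e"
  proof (intro exI[of _ "e / (L + 1)"] conjI allI impI)
    show "0 < e / (L + 1)" using \<open>e > 0\<close> L(1) by simp
    fix n :: nat and s t :: "nat \<Rightarrow> real"
    assume *: "(\<forall>i<n. a \<le> s i \<and> s i \<le> t i \<and> t i \<le> b) \<and>
        (\<forall>i<n. \<forall>k<n. i \<noteq> k \<longrightarrow> {s i<..<t i} \<inter> {s k<..<t k} = {}) \<and>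
        (\<Sum>i<n. t i - s i) < e / (L + 1)"
    have "(\<Sum>i<n. norm (f (t i) - f (s i))) \<le> (\<Sum>i<n. L * (t i - s i))"
    proof (rule sum_mono)
      fix i assume "i \<in> {..<n}"
      with * have "a \<le> s i" "s i \<le> t i" "t i \<le> b" by auto
      with L(2)[of "s i" "t i"] show "norm (f (t i) - f (s i)) \<le> L * (t i - s i)" by simp
    qed
    also have "\<dots> = L * (\<Sum>i<n. t i - s i)" by (simp add: sum_distrib_left)
    also have "\<dots> \<le> L * (e / (L + 1))" using * L(1) by (intro mult_left_mono) auto
    also have "\<dots> < e" using \<open>e > 0\<close> L(1) by (simp add: field_simps)
    finally show "(\<Sum>i<n. norm (f (t i) - f (s i))) < e" .
  qed
qed

lemma lip_on_bounded_linear: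
  assumes "bounded_linear h" "lip_on a b f" shows "lip_on a b (\<lambda>x. h (f x))"
proof -
  obtain L where L: "L \<ge> 0" "\<And>x y. x \<in> {a..b} \<Longrightarrow> y \<in> {a..b} \<Longrightarrow> norm (f y - f x) \<le> L * \<bar>y - x\<bar>"
    using lip_onE[OF assms(2)] by blast
  interpret bounded_linear h by fact
  obtain K where K: "K \<ge> 0" "\<And>x. norm (h x) \<le> norm x * K" using nonneg_bounded by blast
  have "norm (h (f y) - h (f x)) \<le> (L * K) * \<bar>y - x\<bar>" if "x \<in> {a..b}" "y \<in> {a..b}" for x y
  proof -
    have "norm (h (f y) - h (f x)) \<le> norm (f y - f x) * K" using K(2) by (metis diff)
    also have "\<dots> \<le> L * \<bar>y - x\<bar> * K" using L(2)[OF that] K(1) by (rule mult_right_mono)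
    finally show ?thesis by (simp add: mult_ac)
  qed
  then show ?thesis unfolding lip_on_def by blast
qed

lemma lip_on_add:
  assumes "lip_on a b f" "lip_on a b g" shows "lip_on a b (\<lambda>x. f x + g x)"
proof -
  obtain L where "L \<ge> 0" and L: "\<And>x y. x \<in> {a..b} \<Longrightarrow> y \<in> {a..b} \<Longrightarrow> norm (f y - f x) \<le> L * \<bar>y - x\<bar>"
    using lip_onE[OF assms(1)] by blast
  obtain K where "K \<ge> 0" and K: "\<And>x y. x \<in> {a..b} \<Longrightarrow> y \<in> {a..b} \<Longrightarrow> norm (g y - g x) \<le> K * \<bar>y - x\<bar>"
    using lip_onE[OF assms(2)] by blast
  have "norm (f y + g y - (f x + g x)) \<le> (L + K) * \<bar>y - x\<bar>" if "x \<in> {a..b}" "y \<in> {a..b}" for x y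
    using norm_triangle_ineq[of "f y - f x" "g y - g x"] L[OF that] K[OF that] by (simp add: algebra_simps)
  then show ?thesis unfolding lip_on_def by blast
qed

lemma lip_on_bounded_bilinear:
  assumes "bounded_bilinear h" "lip_on a b f" "lip_on a b g" shows "lip_on a b (\<lambda>x. h (f x) (g x))"
proof -
  obtain L where L: "L \<ge> 0" "\<And>x y. x \<in> {a..b} \<Longrightarrow> y \<in> {a..b} \<Longrightarrow> norm (f y - f x) \<le> L * \<bar>y - x\<bar>"
    using lip_onE[OF assms(2)] by blast
  obtain K where K: "K \<ge> 0" "\<And>x y. x \<in> {a..b} \<Longrightarrow> y \<in> {a..b} \<Longrightarrow> norm (g y - g x) \<le> K * \<bar>y - x\<bar>"
    using lip_onE[OF assms(3)] by blast
  obtain C where C: "C \<ge> 0" "\<And>x. x \<in> {a..b} \<Longrightarrow> norm (f x) \<le> C"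
    using lip_on_bounded[OF assms(2)] by blast
  obtain E where E: "E \<ge> 0" "\<And>x. x \<in> {a..b} \<Longrightarrow> norm (g x) \<le> E"
    using lip_on_bounded[OF assms(3)] by blast
  interpret bounded_bilinear h by fact
  obtain B where B: "B \<ge> 0" "\<And>x y. norm (h x y) \<le> norm x * norm y * B" using nonneg_bounded by blast
  have "norm (h (f y) (g y) - h (f x) (g x)) \<le> (L * E * B + C * K * B) * \<bar>y - x\<bar>"
    if xy: "x \<in> {a..b}" "y \<in> {a..b}" for x y
  proof -
    have "h (f y) (g y) - h (f x) (g x) = h (f y - f x) (g y) + h (f x) (g y - g x)"
      by (simp add: diff_left diff_right)
    also have "norm \<dots> \<le> norm (f y - f x) * norm (g y) * B + norm (f x) * norm (g y - g x) * B"
      by (intro order_trans[OF norm_triangle_ineq] add_mono B)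
    also have "\<dots> \<le> (L * \<bar>y - x\<bar>) * E * B + C * (K * \<bar>y - x\<bar>) * B"
      using L(1) K(1) C(1) E(1) B(1) L(2)[OF xy] K(2)[OF xy] C(2)[OF xy(1)] E(2)[OF xy(2)]
      by (intro add_mono mult_mono) auto
    finally show ?thesis by (simp add: algebra_simps)
  qed
  then show ?thesis unfolding lip_on_def by blast
qed

text \<open>The derivative is a separate function, so that it may be changed on null sets. Requiring
  Lipschitz continuity rather than absolute continuity makes the class closed under bounded bilinear
  maps with no further estimates; the bound on v puts all solutions into it.\<close>

definition has_ae_deriv :: "real \<Rightarrow> real \<Rightarrow> (real \<Rightarrow> 'a::real_normed_vector) \<Rightarrow> (real \<Rightarrow> 'a) \<Rightarrow> bool" where
  "has_ae_deriv a b f f' \<longleftrightarrow> lip_on a b f \<and>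
     (AE x in lebesgue_on {a..b}. (f has_vector_derivative f' x) (at x within {a..b}))"

lemma has_ae_derivD:
  "has_ae_deriv a b f f' \<Longrightarrow>
     AE x in lebesgue_on {a..b}. (f has_vector_derivative f' x) (at x within {a..b})"
  by (simp add: has_ae_deriv_def)

lemma has_ae_deriv_lip: "has_ae_deriv a b f f' \<Longrightarrow> lip_on a b f"
  by (simp add: has_ae_deriv_def)

lemma has_ae_deriv_cont: "has_ae_deriv a b f f' \<Longrightarrow> continuous_on {a..b} f"
  by (simp add: has_ae_deriv_def lip_on_continuous)

lemma has_ae_deriv_subset:
  assumes "has_ae_deriv a b f f'" "a \<le> c" "d \<le> b"
  shows "has_ae_deriv c d f f'"
proof -
  have "AE x in lebesgue_on {c..d}. (f has_vector_derivative f' x) (at x within {a..b})"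
    using assms(2,3) by (intro AE_lebesgue_on_subset[OF has_ae_derivD[OF assms(1)]]) auto
  then have "AE x in lebesgue_on {c..d}. (f has_vector_derivative f' x) (at x within {c..d})"
    by eventually_elim (rule has_vector_derivative_within_subset, use assms in auto)
  then show ?thesis using assms lip_on_subset by (auto simp: has_ae_deriv_def)
qed

lemma has_ae_deriv_integral:
  fixes f :: "real \<Rightarrow> 'a::euclidean_space"
  assumes "has_ae_deriv a b f f'" "a \<le> c" "c \<le> d" "d \<le> b"
  shows "(f' has_integral (f d - f c)) {c..d}"
  using has_ae_deriv_subset[OF assms(1,2,4)] assms(3)
  by (intro abs_cont_fundamental_theorem lip_on_abs_cont) (auto simp: has_ae_deriv_def)

lemma has_ae_deriv_cong:
  assumes "has_ae_deriv a b f f'" "AE x in lebesgue_on {a..b}. f' x = g' x"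
  shows "has_ae_deriv a b f g'"
proof -
  have "AE x in lebesgue_on {a..b}. (f has_vector_derivative g' x) (at x within {a..b})"
    using has_ae_derivD[OF assms(1)] assms(2) by eventually_elim simp
  then show ?thesis using assms by (auto simp: has_ae_deriv_def)
qed

lemma has_ae_deriv_transform:
  assumes "has_ae_deriv a b f f'" "\<And>x. x \<in> {a..b} \<Longrightarrow> f x = g x"
  shows "has_ae_deriv a b g f'"
proof -
  have "AE x in lebesgue_on {a..b}. (g has_vector_derivative f' x) (at x within {a..b})"
    using AE_mem has_ae_derivD[OF assms(1)]
  proof eventually_elim
    case (elim x)
    then show "(g has_vector_derivative f' x) (at x within {a..b})"
      using assms(2) by (intro has_vector_derivative_transform[of x "{a..b}" g f]) auto
  qed
  moreover have "lip_on a b g"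
    using assms by (auto simp: has_ae_deriv_def lip_on_def)
  ultimately show ?thesis by (simp add: has_ae_deriv_def)
qed

lemma has_ae_deriv_norm_le:
  fixes f :: "real \<Rightarrow> 'a::euclidean_space"
  assumes f: "has_ae_deriv a b f f'" and C: "AE x in lebesgue_on {a..b}. norm (f' x) \<le> C"
    and "0 \<le> C" "x \<in> {a..b}" "y \<in> {a..b}"
  shows "norm (f y - f x) \<le> C * \<bar>y - x\<bar>"
proof -
  \<comment> \<open>The integral bound wants the estimate at every point, so the derivative is set
    to 0 on the exceptional null set.\<close>
  define g where "g t = (if norm (f' t) \<le> C then f' t else 0)" for t
  have "has_ae_deriv a b f g"
    by (rule has_ae_deriv_cong[OF f]) (use C in \<open>eventually_elim, simp add: g_def\<close>)
  note int = has_ae_deriv_integral[OF this]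
  have *: "norm (f d - f c) \<le> C * (d - c)" if "c \<in> {a..b}" "d \<in> {a..b}" "c \<le> d" for c d
    using has_integral_bound_real[OF \<open>0 \<le> C\<close> finite.emptyI int[of c d]] that \<open>0 \<le> C\<close> by (auto simp: g_def)
  show ?thesis
    using *[of x y] *[of y x] assms by (cases "x \<le> y") (auto simp: norm_minus_commute)
qed

text \<open>The common end of all Gronwall and energy arguments below: a suitably weighted quantity
  has a derivative that is nonpositive almost everywhere.\<close>

lemma has_ae_deriv_le_0:
  fixes f :: "real \<Rightarrow> real"
  assumes f: "has_ae_deriv a b f f'" and C: "AE x in lebesgue_on {a..b}. f' x \<le> 0" and "a \<le> b"
  shows "f b \<le> f a"
proof -
  have "has_ae_deriv a b f (\<lambda>x. min (f' x) 0)"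
    by (rule has_ae_deriv_cong[OF f]) (use C in \<open>eventually_elim, simp\<close>)
  then have "((\<lambda>x. min (f' x) 0) has_integral (f b - f a)) {a..b}"
    by (rule has_ae_deriv_integral) (use \<open>a \<le> b\<close> in auto)
  then have "f b - f a \<le> 0" by (rule has_integral_le[OF _ has_integral_0]) auto
  then show ?thesis by simp
qed

lemma has_ae_deriv_0:
  fixes f :: "real \<Rightarrow> 'a::euclidean_space"
  assumes f: "has_ae_deriv a b f f'" and C: "AE x in lebesgue_on {a..b}. f' x = 0" and "x \<in> {a..b}"
  shows "f x = f a"
proof -
  have "norm (f x - f a) \<le> 0 * \<bar>x - a\<bar>"
    by (rule has_ae_deriv_norm_le[OF f]) (use C assms(3) in \<open>auto elim: eventually_mono\<close>)
  then show ?thesis by simp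
qed

text \<open>The fundamental theorem on every subinterval turns the a.e. bound on the derivative into
  a Lipschitz constant. This is how Caratheodory solutions and boundedly differentiable functions
  enter the class.\<close>

lemma abs_cont_bounded_has_ae_deriv:
  fixes f :: "real \<Rightarrow> 'a::euclidean_space"
  assumes ac: "abs_cont_on a b f"
    and der: "AE x in lebesgue_on {a..b}. (f has_vector_derivative f' x) (at x within {a..b}) \<and> norm (f' x) \<le> C"
  shows "has_ae_deriv a b f f'"
proof -
  define C' where "C' = max C 0"
  define g where "g t = (if norm (f' t) \<le> C' then f' t else 0)" for t
  have "norm (f y - f x) \<le> C' * \<bar>y - x\<bar>" if "x \<in> {a..b}" "y \<in> {a..b}" for x y
  proof -
    have *: "norm (f d - f c) \<le> C' * (d - c)" if cd: "c \<in> {a..b}" "d \<in> {a..b}" "c \<le> d" for c d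
    proof -
      have "AE x in lebesgue_on {c..d}. (f has_vector_derivative f' x) (at x within {a..b}) \<and> norm (f' x) \<le> C"
        using cd by (intro AE_lebesgue_on_subset[OF der]) auto
      then have "AE x in lebesgue_on {c..d}. (f has_vector_derivative g x) (at x within {c..d})"
      proof eventually_elim
        case (elim x)
        then have "norm (f' x) \<le> C'" by (auto simp: C'_def)
        then have "g x = f' x" by (simp add: g_def)
        then show ?case using elim has_vector_derivative_within_subset[of f "f' x" x "{a..b}" "{c..d}"] cd by auto
      qed
      then have "(g has_integral (f d - f c)) {c..d}"
        using cd by (intro abs_cont_fundamental_theorem abs_cont_on_subset[OF ac]) auto
      then show ?thesis
        using has_integral_bound_real[of C' "{}" g "f d - f c" c d] cd by (auto simp: g_def C'_def)
    qed
    show ?thesis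
      using *[of x y] *[of y x] that by (cases "x \<le> y") (auto simp: norm_minus_commute)
  qed
  then have "lip_on a b f" unfolding lip_on_def by blast
  moreover have "AE x in lebesgue_on {a..b}. (f has_vector_derivative f' x) (at x within {a..b})"
    using der by eventually_elim simp
  ultimately show ?thesis by (simp add: has_ae_deriv_def)
qed

lemma has_ae_deriv_bounded_linear:
  assumes "bounded_linear h" "has_ae_deriv a b f f'"
  shows "has_ae_deriv a b (\<lambda>x. h (f x)) (\<lambda>x. h (f' x))"
  using assms unfolding has_ae_deriv_def
  by (auto intro: lip_on_bounded_linear elim!: eventually_mono bounded_linear.has_vector_derivative)

lemma has_ae_deriv_add:
  assumes "has_ae_deriv a b f f'" "has_ae_deriv a b g g'"
  shows "has_ae_deriv a b (\<lambda>x. f x + g x) (\<lambda>x. f' x + g' x)"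
proof -
  have "AE x in lebesgue_on {a..b}. ((\<lambda>x. f x + g x) has_vector_derivative f' x + g' x) (at x within {a..b})"
    using has_ae_derivD[OF assms(1)] has_ae_derivD[OF assms(2)]
    by eventually_elim (rule has_vector_derivative_add)
  then show ?thesis using assms lip_on_add by (auto simp: has_ae_deriv_def)
qed

lemma has_ae_deriv_minus:
  assumes "has_ae_deriv a b f f'" shows "has_ae_deriv a b (\<lambda>x. - f x) (\<lambda>x. - f' x)"
  by (rule has_ae_deriv_bounded_linear[OF bounded_linear_minus[OF bounded_linear_ident] assms])

lemma has_ae_deriv_diff:
  assumes "has_ae_deriv a b f f'" "has_ae_deriv a b g g'"
  shows "has_ae_deriv a b (\<lambda>x. f x - g x) (\<lambda>x. f' x - g' x)"
  using has_ae_deriv_add[OF assms(1) has_ae_deriv_minus[OF assms(2)]] by simp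

lemma has_ae_deriv_bilinear:
  assumes h: "bounded_bilinear h" and "has_ae_deriv a b f f'" "has_ae_deriv a b g g'"
  shows "has_ae_deriv a b (\<lambda>x. h (f x) (g x)) (\<lambda>x. h (f x) (g' x) + h (f' x) (g x))"
proof -
  have "AE x in lebesgue_on {a..b}. ((\<lambda>x. h (f x) (g x)) has_vector_derivative
      h (f x) (g' x) + h (f' x) (g x)) (at x within {a..b})"
    using has_ae_derivD[OF assms(2)] has_ae_derivD[OF assms(3)]
    by eventually_elim (rule bounded_bilinear.has_vector_derivative[OF h])
  then show ?thesis using assms lip_on_bounded_bilinear by (auto simp: has_ae_deriv_def)
qed

lemma has_ae_deriv_const: "has_ae_deriv a b (\<lambda>x. c) (\<lambda>x. 0)"
  by (auto simp: has_ae_deriv_def lip_on_def intro!: exI[of _ 0])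

lemma has_ae_deriv_sum:
  assumes "\<And>i. i \<in> I \<Longrightarrow> has_ae_deriv a b (f i) (f' i)"
  shows "has_ae_deriv a b (\<lambda>x. \<Sum>i\<in>I. f i x) (\<lambda>x. \<Sum>i\<in>I. f' i x)"
  using assms by (induction I rule: infinite_finite_induct) (auto intro!: has_ae_deriv_add has_ae_deriv_const)

lemma has_ae_deriv_C1:
  fixes f :: "real \<Rightarrow> 'a::euclidean_space"
  assumes d: "\<And>x. x \<in> {a..b} \<Longrightarrow> (f has_vector_derivative f' x) (at x within {a..b})"
    and c: "continuous_on {a..b} f'"
  shows "has_ae_deriv a b f f'"
proof -
  obtain C where C: "\<And>x. x \<in> {a..b} \<Longrightarrow> norm (f' x) \<le> C" using continuous_on_Icc_bounded[OF c] by blast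
  have "norm (f y - f x) \<le> C * \<bar>y - x\<bar>" if "x \<in> {a..b}" "y \<in> {a..b}" for x y
  proof -
    have "norm (f y - f x) \<le> C * norm (y - x)"
      by (rule differentiable_bound[of "{a..b}" f "\<lambda>x t. t *\<^sub>R f' x"])
        (use d C that in \<open>auto simp: has_vector_derivative_def mult.commute[of C]
           intro!: onorm_le mult_left_mono\<close>)
    then show ?thesis by simp
  qed
  then have "lip_on a b f" unfolding lip_on_def by blast
  then show ?thesis using d by (auto simp: has_ae_deriv_def intro!: AE_I2)
qed

text \<open>The interval is null, so everything holds almost everywhere on it; this spares later
  statements the assumption that l is positive.\<close>

lemma has_ae_deriv_degenerate:
  assumes "b \<le> a" shows "has_ae_deriv a b f f'"
proof -
  have "{a..b} = {} \<or> {a..b} = {a}" using assms by auto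
  then have "emeasure (lebesgue_on {a..b}) (space (lebesgue_on {a..b})) = 0"
    by (auto simp: emeasure_restrict_space)
  then have "AE x in lebesgue_on {a..b}. P x" for P
    by (intro AE_I[of _ _ "space (lebesgue_on {a..b})"]) auto
  moreover have "lip_on a b f"
    using assms by (auto simp: lip_on_def intro!: exI[of _ 0] arg_cong[of _ _ f])
  ultimately show ?thesis by (simp add: has_ae_deriv_def)
qed

lemma boundedly_diff_has_ae_deriv:
  fixes f :: "real \<Rightarrow> 'a::euclidean_space"
  assumes "boundedly_diff l f"
  shows "has_ae_deriv 0 l f (\<lambda>x. vector_derivative f (at x within {0..l}))"
proof (cases "l > 0")
  case True
  from assms obtain C where ac: "abs_cont_on 0 l f" and
    C: "AE x in Leb l. \<exists>D. (f has_vector_derivative D) (at x within {0..l}) \<and> norm D \<le> C"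
    unfolding boundedly_diff_def by blast
  from C AE_mem have "AE x in Leb l. (f has_vector_derivative vector_derivative f (at x within {0..l}))
      (at x within {0..l}) \<and> norm (vector_derivative f (at x within {0..l})) \<le> C"
  proof eventually_elim
    case (elim x)
    then obtain D where D: "(f has_vector_derivative D) (at x within {0..l})" "norm D \<le> C" by blast
    then have "vector_derivative f (at x within {0..l}) = D"
      using vector_derivative_within_cbox[of 0 l x f D] True elim by auto
    then show ?case using D by simp
  qed
  then show ?thesis by (rule abs_cont_bounded_has_ae_deriv[OF ac])
next
  case False
  then show ?thesis by (intro has_ae_deriv_degenerate) simp
qed

section \<open>Block matrices and the fundamental solution\<close>

lemma cadj_mult: "cadj (A ** B) = cadj B ** cadj (A :: complex^'q::finite^'p)"
  by (simp add: cadj_def matrix_matrix_mult_def vec_eq_iff mult.commute)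

lemma cadj_cadj [simp]: "cadj (cadj A) = A"
  by (simp add: cadj_def vec_eq_iff)

lemma cadj_mat1 [simp]: "cadj (mat 1 :: complex^'n::finite^'n) = mat 1"
  by (simp add: cadj_def mat_def vec_eq_iff)

lemma cadj_0 [simp]: "cadj 0 = 0"
  by (simp add: cadj_def vec_eq_iff)

lemma cadj_add: "cadj (A + B) = cadj A + cadj B"
  by (simp add: cadj_def vec_eq_iff)

lemma cadj_diff: "cadj (A - B) = cadj A - cadj B"
  by (simp add: cadj_def vec_eq_iff)

lemma cadj_uminus: "cadj (- A) = - cadj A"
  by (simp add: cadj_def vec_eq_iff)

lemma linear_cadj: "linear (cadj :: complex^'q::finite^'p::finite \<Rightarrow> _)"
  by (intro linearI) (simp_all add: cadj_def vec_eq_iff)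

lemma bounded_linear_cadj: "bounded_linear (cadj :: complex^'q::finite^'p::finite \<Rightarrow> _)"
  using linear_cadj by (simp add: linear_conv_bounded_linear)

lemma matrix_vector_mult_scaleR: "(c *\<^sub>R A) *v x = c *\<^sub>R (A *v (x::complex^'n::finite))"
  by (simp add: matrix_vector_mult_def vec_eq_iff scaleR_sum_right)

lemma matrix_vector_mult_scaleR_right: "A *v (c *\<^sub>R x) = c *\<^sub>R (A *v (x::complex^'n::finite))"
  by (simp add: matrix_vector_mult_def vec_eq_iff scaleR_sum_right)

lemma bounded_bilinear_matrix_vector:
  "bounded_bilinear ((*v) :: complex^'q::finite^'p::finite \<Rightarrow> _)"
  by (intro bilinear_conv_bounded_bilinear[THEN iffD1])
    (auto simp: bilinear_def intro!: linearI simp: matrix_vector_mult_scaleR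
      matrix_vector_mult_scaleR_right matrix_vector_mult_add_rdistrib matrix_vector_right_distrib)

lemma bounded_bilinear_matrix_matrix:
  "bounded_bilinear ((**) :: complex^'q::finite^'p::finite \<Rightarrow> complex^'r::finite^'q \<Rightarrow> _)"
  by (intro bilinear_conv_bounded_bilinear[THEN iffD1])
    (auto simp: bilinear_def matrix_matrix_mult_def vec_eq_iff scaleR_sum_right sum.distrib algebra_simps
      intro!: linearI)

lemmas continuous_on_cadj = bounded_linear.continuous_on[OF bounded_linear_cadj]
  and continuous_on_matrix_vector = bounded_bilinear.continuous_on[OF bounded_bilinear_matrix_vector]
  and continuous_on_matrix_matrix = bounded_bilinear.continuous_on[OF bounded_bilinear_matrix_matrix]

lemma matrix_inv_unique:
  fixes A B :: "complex^'n::finite^'n"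
  assumes "A ** B = mat 1" "B ** A = mat 1" shows "matrix_inv A = B"
proof -
  have "invertible A" using assms unfolding invertible_def by blast
  then have "matrix_inv A ** A = mat 1" unfolding invertible_def matrix_inv_def by (metis (mono_tags, lifting) someI_ex)
  then have "matrix_inv A ** (A ** B) = B" by (simp add: matrix_mul_assoc)
  then show ?thesis using assms by simp
qed

lemma bounded_linear_matrix_vector [intro]: "bounded_linear ((*v) (A :: complex^'q::finite^'p::finite))"
  by (rule bounded_bilinear.bounded_linear_right[OF bounded_bilinear_matrix_vector])

text \<open>The inner product of a complex Euclidean space is here the real part of the Hermitian
  one. Complex scalars still move across as conjugates and matrices as adjoints, and testing against
  all vectors still separates, so the real form is enough for every adjoint computation.\<close>

lemma inner_cmult: "(a * b) \<bullet> c = b \<bullet> (cnj a * (c::complex))"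
  by (simp add: inner_complex_def algebra_simps)

lemma inner_matrix_cadj:
  "(A *v x) \<bullet> y = x \<bullet> (cadj (A :: complex^'q::finite^'p::finite) *v y)"
proof -
  have "(A *v x) \<bullet> y = (\<Sum>i\<in>UNIV. \<Sum>j\<in>UNIV. (A $ i $ j * x $ j) \<bullet> (y $ i))"
    by (simp add: inner_vec_def matrix_vector_mult_def inner_sum_left)
  also have "\<dots> = (\<Sum>j\<in>UNIV. \<Sum>i\<in>UNIV. x $ j \<bullet> (cnj (A $ i $ j) * y $ i))"
    by (subst sum.swap) (simp add: inner_cmult)
  also have "\<dots> = x \<bullet> (cadj A *v y)"
    by (simp add: inner_vec_def matrix_vector_mult_def inner_sum_right cadj_def)
  finally show ?thesis .
qed

lemma inner_cmult_vec: "(c *s x) \<bullet> y = x \<bullet> (cnj c *s (y :: complex^'n::finite))"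
  by (simp add: inner_vec_def inner_cmult)

lemma inner_cmult_self: "(c *s x) \<bullet> x = Re c * (norm (x :: complex^'n::finite))\<^sup>2"
proof -
  have "(c * a) \<bullet> a = Re c * (a \<bullet> a)" for a :: complex
    by (simp add: inner_complex_def algebra_simps power2_eq_square)
  then show ?thesis
    unfolding power2_norm_eq_inner by (simp add: inner_vec_def sum_distrib_left)
qed

lemma norm_cmult_vec: "norm (c *s x) = cmod c * norm (x :: complex^'n::finite)"
proof -
  have "norm (c *s x) ^ 2 = (cmod c * norm x) ^ 2"
    unfolding power_mult_distrib norm_vec_def L2_set_def
    by (simp add: sum_nonneg norm_mult power_mult_distrib sum_distrib_left)
  then show ?thesis by (simp add: power2_eq_iff_nonneg)
qed

lemma matrix_eq_vectorI: "(\<And>x. A *v x = B *v x) \<Longrightarrow> A = (B :: complex^'q::finite^'p)"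
  by (simp add: matrix_eq)

lemma cscale_vec: "cscale c A *v x = c *s (A *v (x :: complex^'q::finite))"
  by (simp add: cscale_def matrix_vector_mult_def vec_eq_iff sum_distrib_left mult.assoc)

lemma norm_matrix_transpose: "norm (\<chi> i j. A $ j $ i) = norm (A :: complex^'q::finite^'p::finite)"
proof -
  have "(norm (\<chi> i j. A $ j $ i))\<^sup>2 = (norm A)\<^sup>2"
    unfolding power2_norm_eq_inner by (simp add: inner_vec_def) (rule sum.swap)
  then show ?thesis by (simp add: power2_eq_iff_nonneg)
qed

lemma norm_cadj [simp]: "norm (cadj A) = norm (A :: complex^'q::finite^'p::finite)"
proof -
  have "norm (cadj A) = norm (\<chi> i j. A $ j $ i)"
    by (simp add: norm_vec_def L2_set_def cadj_def)
  then show ?thesis by (simp add: norm_matrix_transpose)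
qed

lemma norm_matrix_vector_le: "norm (A *v x) \<le> norm A * norm (x :: complex^'q::finite)"
proof -
  have "norm ((A *v x) $ i) \<le> norm (A $ i) * norm x" for i
  proof -
    have "norm ((A *v x) $ i) \<le> (\<Sum>j\<in>UNIV. \<bar>norm (A $ i $ j)\<bar> * \<bar>norm (x $ j)\<bar>)"
      unfolding matrix_vector_mult_def by (simp add: norm_mult[symmetric] norm_sum)
    also have "\<dots> \<le> norm (A $ i) * norm x" unfolding norm_vec_def by (rule L2_set_mult_ineq)
    finally show ?thesis .
  qed
  then have "norm (A *v x) \<le> L2_set (\<lambda>i. norm (A $ i) * norm x) UNIV"
    unfolding norm_vec_def[of "A *v x"] by (intro L2_set_mono) auto
  then show ?thesis unfolding norm_vec_def[of A] by (simp add: L2_set_left_distrib)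
qed

lemma norm_matrix_matrix_le: "norm (A ** B) \<le> norm A * norm (B :: complex^'r::finite^'q::finite)"
proof -
  have "(A ** B) $ i = (\<chi> k j. B $ j $ k) *v (A $ i)" for i
    by (simp add: vec_eq_iff matrix_matrix_mult_def matrix_vector_mult_def mult.commute)
  then have "norm ((A ** B) $ i) \<le> norm (A $ i) * norm B" for i
    using norm_matrix_vector_le[of "\<chi> k j. B $ j $ k" "A $ i"] by (simp add: norm_matrix_transpose mult.commute)
  then have "norm (A ** B) \<le> L2_set (\<lambda>i. norm (A $ i) * norm B) UNIV"
    unfolding norm_vec_def[of "A ** B"] by (intro L2_set_mono) auto
  then show ?thesis unfolding norm_vec_def[of A] by (simp add: L2_set_left_distrib)
qed

lemma norm_vec_le_sum: "norm (x :: 'a::real_normed_vector^'n::finite) \<le> (\<Sum>i\<in>UNIV. norm (x $ i))"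
  unfolding norm_vec_def by (rule L2_set_le_sum) simp

text \<open>Passes from an operator bound to the Frobenius norm of the matrix type by testing on
  unit vectors. The dimension factors are crude, but only finiteness of the resulting bounds
  matters.\<close>

lemma norm_matrix_entry_le:
  fixes A :: "complex^'q::finite^'p::finite"
  assumes "\<And>x. norm (A *v x) \<le> C * norm x"
  shows "norm (A $ i $ k) \<le> C" "norm A \<le> real CARD('p) * (real CARD('q) * C)"
proof -
  have e: "norm (A $ i $ k) \<le> C" for i k
  proof -
    have "norm (A $ i $ k) = norm ((A *v axis k 1) $ i)"
      by (simp add: matrix_vector_mult_def axis_def if_distrib[of "\<lambda>x. _ * x"] sum.delta' cong: if_cong)
    also have "\<dots> \<le> norm (A *v axis k 1)" by (rule Finite_Cartesian_Product.norm_nth_le)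
    also have "\<dots> \<le> C * norm (axis k (1::complex))" by (rule assms)
    finally show ?thesis by simp
  qed
  then show "norm (A $ i $ k) \<le> C" .
  have "norm (A $ i) \<le> real CARD('q) * C" for i
    by (rule order_trans[OF norm_vec_le_sum]) (use sum_bounded_above[of UNIV "\<lambda>k. norm (A $ i $ k)" C] e in auto)
  then show "norm A \<le> real CARD('p) * (real CARD('q) * C)"
    by (intro order_trans[OF norm_vec_le_sum]) (use sum_bounded_above[of UNIV "\<lambda>k. norm (A $ k)" "real CARD('q) * C"] in auto)
qed

section \<open>Vectors over a sum type as pairs of blocks\<close>

definition upr :: "complex^('a::finite + 'b::finite) \<Rightarrow> complex^'a" where
  "upr y = (\<chi> i. y $ Inl i)"
definition lwr :: "complex^('a::finite + 'b::finite) \<Rightarrow> complex^'b" where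
  "lwr y = (\<chi> i. y $ Inr i)"
definition vjoin :: "complex^'a \<Rightarrow> complex^'b \<Rightarrow> complex^('a::finite + 'b::finite)" where
  "vjoin a b = (\<chi> i. case i of Inl k \<Rightarrow> a $ k | Inr k \<Rightarrow> b $ k)"

lemma upr_vjoin [simp]: "upr (vjoin a b) = a" and lwr_vjoin [simp]: "lwr (vjoin a b) = b"
  by (simp_all add: upr_def lwr_def vjoin_def vec_eq_iff)

lemma vjoin_upr_lwr [simp]: "vjoin (upr y) (lwr y) = y"
  by (simp add: upr_def lwr_def vjoin_def vec_eq_iff split: sum.splits)

lemma blocks_eqI: "upr x = upr y \<Longrightarrow> lwr x = lwr y \<Longrightarrow> x = y"
  by (metis vjoin_upr_lwr)

lemma linear_upr: "linear upr" and linear_lwr: "linear lwr"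
  by (auto intro!: linearI simp: upr_def lwr_def vec_eq_iff)

lemma bounded_linear_upr: "bounded_linear upr" and bounded_linear_lwr: "bounded_linear lwr"
  using linear_upr linear_lwr by (simp_all add: linear_conv_bounded_linear)

lemmas continuous_on_lwr = bounded_linear.continuous_on[OF bounded_linear_lwr]

lemma upr_simps [simp]: "upr (x + y) = upr x + upr y" "upr (x - y) = upr x - upr y" "upr (- x) = - upr x"
   "upr (c *s x) = c *s upr x" "upr (r *\<^sub>R x) = r *\<^sub>R upr x" "upr 0 = 0"
  and lwr_simps [simp]: "lwr (x + y) = lwr x + lwr y" "lwr (x - y) = lwr x - lwr y" "lwr (- x) = - lwr x"
   "lwr (c *s x) = c *s lwr x" "lwr (r *\<^sub>R x) = r *\<^sub>R lwr x" "lwr 0 = 0"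
  by (simp_all add: upr_def lwr_def vec_eq_iff)

lemma sum_UNIV_Plus: "(\<Sum>i\<in>(UNIV :: ('a::finite + 'b::finite) set). f i) = (\<Sum>i\<in>UNIV. f (Inl i)) + (\<Sum>i\<in>UNIV. f (Inr i))"
  by (subst UNIV_Plus_UNIV[symmetric], subst sum.Plus) simp_all

lemma inner_blocks: "x \<bullet> y = upr x \<bullet> upr y + lwr x \<bullet> lwr y"
  by (simp add: inner_vec_def upr_def lwr_def sum_UNIV_Plus)

lemma norm_blocks: "(norm x)\<^sup>2 = (norm (upr x))\<^sup>2 + (norm (lwr x))\<^sup>2"
  by (simp add: power2_norm_eq_inner inner_blocks)

lemma norm_upr_le: "norm (upr x) \<le> norm x" and norm_lwr_le: "norm (lwr x) \<le> norm x"
  by (rule power2_le_imp_le; simp add: norm_blocks[of x])+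

lemma hcat_vec: "hcat A B *v y = A *v upr y + B *v lwr y"
  by (simp add: hcat_def upr_def lwr_def matrix_vector_mult_def sum_UNIV_Plus vec_eq_iff)

lemma vcat_vec: "vcat A B *v x = vjoin (A *v x) (B *v x)"
  by (auto simp: vcat_def vjoin_def matrix_vector_mult_def vec_eq_iff split: sum.splits)

lemma left_block_vec: "left_block A *v a = A *v vjoin a 0"
  by (simp add: left_block_def matrix_vector_mult_def vec_eq_iff sum_UNIV_Plus vjoin_def)

lemma right_block_vec: "right_block A *v b = A *v vjoin 0 b"
  by (simp add: right_block_def matrix_vector_mult_def vec_eq_iff sum_UNIV_Plus vjoin_def)

lemma vjoin_add: "vjoin a b + vjoin c d = vjoin (a + c) (b + d)"
  by (rule blocks_eqI) auto

lemma minus_matrix_vec: "(- A) *v x = - (A *v (x::complex^'n::finite))"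
  by (simp add: matrix_vector_mult_def vec_eq_iff sum_negf)

lemma jmat_vec: "jmat *v y = vjoin (upr y) (- lwr y)"
  by (simp add: jmat_def vcat_vec hcat_vec minus_matrix_vec)

lemma Vmat_vec: "Vmat w *v y = vjoin (w *v lwr y) (cadj w *v upr y)"
  by (simp add: Vmat_def vcat_vec hcat_vec)

lemma beta_of_vec: "beta_of u x *v c = upr (u x 0 *v c)"
  and gamma_of_vec: "gamma_of u x *v c = lwr (u x 0 *v c)"
  by (simp_all add: beta_of_def gamma_of_def hcat_vec flip: matrix_vector_mul_assoc)

section \<open>The Dirac system acting on vectors\<close>

locale dirac_system =
  fixes M :: real
    and v :: "real \<Rightarrow> complex^'m2^'m1"
    and u :: "real \<Rightarrow> complex \<Rightarrow> complex^('m1::finite + 'm2::finite)^('m1 + 'm2)"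
  assumes M_pos: "M > 0"
    and v_meas: "v \<in> borel_measurable (lebesgue_on {0..})"
    and v_onorm: "\<And>x. 0 \<le> x \<Longrightarrow> onorm ((*v) (v x)) \<le> M"
    and fund: "fundamental_solution v u"
begin

lemma norm_v_vec: "0 \<le> x \<Longrightarrow> norm (v x *v w) \<le> M * norm w"
  using onorm[OF bounded_linear_matrix_vector, of "v x" w] v_onorm[of x]
  by (meson mult_right_mono norm_ge_zero order_trans)

text \<open>The squared norm is the inner product of \<open>v x\<close> applied to this vector with
  w; Cauchy-Schwarz and one cancellation transfer the bound to the adjoint.\<close>

lemma norm_v_adj_vec:
  assumes "0 \<le> x" shows "norm (cadj (v x) *v w) \<le> M * norm w"
proof -
  have "norm (cadj (v x) *v w) ^ 2 = (v x *v (cadj (v x) *v w)) \<bullet> w"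
    by (simp add: power2_norm_eq_inner inner_matrix_cadj)
  also have "\<dots> \<le> norm (v x *v (cadj (v x) *v w)) * norm w" by (rule norm_cauchy_schwarz)
  also have "\<dots> \<le> (M * norm (cadj (v x) *v w)) * norm w" by (intro mult_right_mono norm_v_vec assms) auto
  finally show ?thesis
    using M_pos by (cases "norm (cadj (v x) *v w) = 0") (auto simp: power2_eq_square field_simps)
qed

definition rhs :: "complex \<Rightarrow> real \<Rightarrow> complex^('m1 + 'm2) \<Rightarrow> complex^('m1 + 'm2)" where
  "rhs z x y = vjoin ((\<i> * z) *s upr y + v x *v lwr y) (- ((\<i> * z) *s lwr y) - cadj (v x) *v upr y)"

lemma upr_rhs [simp]: "upr (rhs z x y) = (\<i> * z) *s upr y + v x *v lwr y"
  and lwr_rhs [simp]: "lwr (rhs z x y) = - ((\<i> * z) *s lwr y) - cadj (v x) *v upr y"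
  by (simp_all add: rhs_def)

lemma coefficient_vec: "(cscale (\<i> * z) jmat + jmat ** Vmat (v x)) *v y = rhs z x y"
  by (rule blocks_eqI)
    (simp_all add: matrix_vector_mult_add_rdistrib cscale_vec jmat_vec Vmat_vec vector_smult_rneg
      flip: matrix_vector_mul_assoc)

lemma norm_rhs_le:
  assumes "0 \<le> x" shows "norm (rhs z x y) \<le> 2 * (cmod z + M) * norm y"
proof -
  have "norm (upr (rhs z x y)) \<le> cmod z * norm y + M * norm y"
    using norm_v_vec[OF assms, of "lwr y"] norm_upr_le[of y] norm_lwr_le[of y] M_pos
    by (auto intro!: order_trans[OF norm_triangle_ineq] add_mono mult_left_mono simp: norm_cmult_vec norm_mult
        elim: order_trans)
  moreover have "norm (lwr (rhs z x y)) \<le> cmod z * norm y + M * norm y"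
    using norm_v_adj_vec[OF assms, of "upr y"] norm_upr_le[of y] norm_lwr_le[of y] M_pos
    by (auto intro!: order_trans[OF norm_triangle_ineq4] add_mono mult_left_mono simp: norm_cmult_vec norm_mult
        elim: order_trans)
  moreover have "norm (rhs z x y) \<le> norm (upr (rhs z x y)) + norm (lwr (rhs z x y))"
    by (rule power2_le_imp_le) (auto simp: norm_blocks[of "rhs z x y"] power2_sum)
  ultimately show ?thesis by (simp add: algebra_simps)
qed

lemma u_0 [simp]: "u 0 z = mat 1"
  using fund by (simp add: fundamental_solution_def)

text \<open>By continuity u is bounded on [0, l], hence so is the right side of the system, and the
  absolutely continuous solution is in fact Lipschitz.\<close>

lemma u_deriv: "has_ae_deriv 0 l (\<lambda>x. u x z) (\<lambda>x. (cscale (\<i> * z) jmat + jmat ** Vmat (v x)) ** u x z)"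
proof (cases "l > 0")
  case True
  define D where "D x = (cscale (\<i> * z) jmat + jmat ** Vmat (v x)) ** u x z" for x
  have Dc: "D x *v c = rhs z x (u x z *v c)" for x c
    by (simp add: D_def coefficient_vec flip: matrix_vector_mul_assoc)
  have ac: "abs_cont_on 0 l (\<lambda>x. u x z)"
    using fund True by (simp add: fundamental_solution_def)
  have cont: "continuous_on {0..l} (\<lambda>x. u x z)" by (rule abs_cont_on_continuous[OF ac])
  have "AE x in lebesgue_on {0..}. ((\<lambda>x. u x z) has_vector_derivative D x) (at x within {0..})"
    using fund by (simp add: fundamental_solution_def D_def)
  then have ae: "AE x in Leb l. ((\<lambda>x. u x z) has_vector_derivative D x) (at x within {0..})"
    by (rule AE_lebesgue_on_subset) auto
  obtain C where C: "\<And>x. x \<in> {0..l} \<Longrightarrow> norm (u x z) \<le> C" using continuous_on_Icc_bounded[OF cont] by blast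
  define B where "B = 2 * (cmod z + M) * C"
  have DB: "norm (D x) \<le> real CARD('m1 + 'm2) * (real CARD('m1 + 'm2) * B)" if "x \<in> {0..l}" for x
  proof (rule norm_matrix_entry_le(2))
    fix c :: "complex^('m1 + 'm2)"
    have "norm (D x *v c) \<le> 2 * (cmod z + M) * norm (u x z *v c)"
      unfolding Dc by (rule norm_rhs_le) (use that in auto)
    also have "\<dots> \<le> 2 * (cmod z + M) * (C * norm c)"
      using M_pos by (intro mult_left_mono order_trans[OF norm_matrix_vector_le mult_right_mono[OF C[OF that]]]) auto
    finally show "norm (D x *v c) \<le> B * norm c"
      by (simp add: B_def mult_ac)
  qed
  have "has_ae_deriv 0 l (\<lambda>x. u x z) D"
  proof (rule abs_cont_bounded_has_ae_deriv[OF ac])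
    show "AE x in Leb l. ((\<lambda>x. u x z) has_vector_derivative D x) (at x within {0..l}) \<and>
         norm (D x) \<le> real CARD('m1 + 'm2) * (real CARD('m1 + 'm2) * B)"
      using ae AE_mem
    proof eventually_elim
      case (elim x)
      then show ?case using DB has_vector_derivative_within_subset[of "\<lambda>x. u x z" "D x" x "{0..}" "{0..l}"] by auto
    qed
  qed
  then show ?thesis unfolding D_def[abs_def] .
next
  case False
  then show ?thesis by (intro has_ae_deriv_degenerate) simp
qed

lemma solution_deriv: "has_ae_deriv 0 l (\<lambda>x. u x z *v c) (\<lambda>x. rhs z x (u x z *v c))"
  using has_ae_deriv_bounded_linear[OF bounded_bilinear.bounded_linear_left[OF bounded_bilinear_matrix_vector, of c] u_deriv[of l z]]
  by (simp add: coefficient_vec flip: matrix_vector_mul_assoc)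

lemmas upr_deriv = has_ae_deriv_bounded_linear[OF bounded_linear_upr solution_deriv]
lemmas lwr_deriv = has_ae_deriv_bounded_linear[OF bounded_linear_lwr solution_deriv]

text \<open>The matrix j V is skew-adjoint, so the terms with v cancel and only the spectral
  parameters remain. They cancel as well when w is the conjugate of z.\<close>

lemma inner_rhs:
  "y \<bullet> rhs w x y' + rhs z x y \<bullet> y' =
     ((\<i> * (z - cnj w)) *s upr y) \<bullet> upr y' - ((\<i> * (z - cnj w)) *s lwr y) \<bullet> lwr y'"
proof -
  have *: "a \<bullet> (c *s b) = (cnj c *s a) \<bullet> b" for a b :: "complex^'k::finite" and c
    by (simp add: inner_cmult_vec)
  have **: "(cnj (\<i> * w) *s a) \<bullet> b + ((\<i> * z) *s a) \<bullet> b = ((\<i> * (z - cnj w)) *s a) \<bullet> b"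
    for a b :: "complex^'k::finite"
    by (simp add: vector_ssub_ldistrib vector_sadd_rdistrib algebra_simps flip: inner_add_left)
  have a: "(v x *v lwr y) \<bullet> upr y' = lwr y \<bullet> (cadj (v x) *v upr y')"
          "(cadj (v x) *v upr y) \<bullet> lwr y' = upr y \<bullet> (v x *v lwr y')"
    by (simp_all add: inner_matrix_cadj)
  show ?thesis
    unfolding inner_blocks[of y] inner_blocks[of _ y'] upr_rhs lwr_rhs
      inner_add_left inner_add_right inner_diff_left inner_diff_right inner_minus_left inner_minus_right a
      **[symmetric] *
    by simp
qed

lemma inner_solutions_deriv:
  "has_ae_deriv 0 l (\<lambda>x. (u x z *v c) \<bullet> (u x w *v d))
     (\<lambda>x. ((\<i> * (z - cnj w)) *s upr (u x z *v c)) \<bullet> upr (u x w *v d)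
        - ((\<i> * (z - cnj w)) *s lwr (u x z *v c)) \<bullet> lwr (u x w *v d))"
  using has_ae_deriv_bilinear[OF bounded_bilinear_inner solution_deriv[of l z c] solution_deriv[of l w d]]
  by (simp only: inner_rhs)

lemma inner_solutions_conj: "x \<ge> 0 \<Longrightarrow> (u x z *v c) \<bullet> (u x (cnj z) *v d) = c \<bullet> d"
  using has_ae_deriv_0[OF inner_solutions_deriv[of x z c "cnj z" d], of x] by simp

text \<open>Solutions at z and at the conjugate of z have constant inner product, which is the left
  inverse identity; square matrices have the same right inverse.\<close>

lemma u_inverse:
  assumes "x \<ge> 0" shows "cadj (u x (cnj z)) ** u x z = mat 1" "u x z ** cadj (u x (cnj z)) = mat 1"
    "matrix_inv (u x z) = cadj (u x (cnj z))"
proof -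
  show 1: "cadj (u x (cnj z)) ** u x z = mat 1"
  proof (rule matrix_eq_vectorI)
    fix c :: "complex^('m1 + 'm2)"
    have "((cadj (u x (cnj z)) ** u x z) *v c - c) \<bullet> d = 0" for d
      using inner_solutions_conj[OF assms, of z c d] inner_matrix_cadj[of "cadj (u x (cnj z))" "u x z *v c" d]
      by (simp add: inner_diff_left flip: matrix_vector_mul_assoc)
    from this[of "(cadj (u x (cnj z)) ** u x z) *v c - c"]
    show "(cadj (u x (cnj z)) ** u x z) *v c = mat 1 *v c" by simp
  qed
  show "u x z ** cadj (u x (cnj z)) = mat 1"
    using 1 matrix_left_right_inverse by blast
  then show "matrix_inv (u x z) = cadj (u x (cnj z))"
    using 1 by (intro matrix_inv_unique)
qed

lemma norm_solution_deriv:
  "has_ae_deriv 0 l (\<lambda>x. (norm (u x z *v c))\<^sup>2)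
     (\<lambda>x. 2 * Im z * ((norm (lwr (u x z *v c)))\<^sup>2 - (norm (upr (u x z *v c)))\<^sup>2))"
  using inner_solutions_deriv[of l z c z c]
  by (simp add: power2_norm_eq_inner inner_cmult_self[unfolded power2_norm_eq_inner] algebra_simps)

text \<open>The growth does not depend on v: only the spectral part contributes to the derivative of
  the squared norm, and its modulus is at most 2 |Im z| times the squared norm. Hence the weight
  with exponent \<open>k\<close>.\<close>

lemma norm_solution_le:
  assumes "0 \<le> x" shows "norm (u x z *v c) \<le> exp (\<bar>Im z\<bar> * x) * norm c"
proof -
  define k where "k = - (2 * \<bar>Im z\<bar>)"
  have e: "has_ae_deriv 0 x (\<lambda>x. exp (k * x)) (\<lambda>x. k * exp (k * x))"
    by (rule has_ae_deriv_C1)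
      (auto intro!: derivative_eq_intros continuous_intros simp: has_real_derivative_iff_has_vector_derivative[symmetric])
  have d: "has_ae_deriv 0 x (\<lambda>x. exp (k * x) * (norm (u x z *v c))\<^sup>2)
     (\<lambda>t. exp (k * t) * (2 * Im z * ((norm (lwr (u t z *v c)))\<^sup>2 - (norm (upr (u t z *v c)))\<^sup>2))
       + k * exp (k * t) * (norm (u t z *v c))\<^sup>2)"
    using has_ae_deriv_bilinear[OF bounded_bilinear_mult e norm_solution_deriv[of x z c]] by simp
  have "exp (k * t) * (2 * Im z * ((norm (lwr (u t z *v c)))\<^sup>2 - (norm (upr (u t z *v c)))\<^sup>2))
       + k * exp (k * t) * (norm (u t z *v c))\<^sup>2 \<le> 0" for t
    proof -
      define A B where "A = (norm (lwr (u t z *v c)))\<^sup>2" and "B = (norm (upr (u t z *v c)))\<^sup>2"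
      have "A \<ge> 0" "B \<ge> 0" by (auto simp: A_def B_def)
      then have "\<bar>Im z * (A - B)\<bar> \<le> \<bar>Im z\<bar> * (A + B)"
        by (auto simp: abs_mult intro!: mult_left_mono)
      then have "Im z * (A - B) \<le> \<bar>Im z\<bar> * (A + B)" by linarith
      then have "2 * Im z * (A - B) + k * (A + B) \<le> 0"
        by (simp add: k_def)
      then have "exp (k * t) * (2 * Im z * (A - B) + k * (A + B)) \<le> 0"
        by (intro mult_nonneg_nonpos) auto
      then have "exp (k * t) * (2 * Im z * (A - B)) + k * exp (k * t) * (B + A) \<le> 0"
        by (simp add: algebra_simps)
      moreover have n: "(norm (u t z *v c))\<^sup>2 = B + A"
        unfolding A_def B_def by (rule norm_blocks)
      ultimately show "exp (k * t) * (2 * Im z * ((norm (lwr (u t z *v c)))\<^sup>2 - (norm (upr (u t z *v c)))\<^sup>2))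
       + k * exp (k * t) * (norm (u t z *v c))\<^sup>2 \<le> 0"
        unfolding n by (simp only: A_def B_def)
    qed
  note ae = AE_I2[where M = "Leb x", OF this]
  have "exp (k * x) * (norm (u x z *v c))\<^sup>2 \<le> exp (k * 0) * (norm (u 0 z *v c))\<^sup>2"
    using has_ae_deriv_le_0[OF d ae assms] .
  then have "(norm (u x z *v c))\<^sup>2 \<le> exp (2 * (\<bar>Im z\<bar> * x)) * (norm c)\<^sup>2"
    by (simp add: k_def exp_minus field_simps)
  also have "\<dots> = (exp (\<bar>Im z\<bar> * x) * norm c)\<^sup>2"
    by (simp add: power_mult_distrib exp_double)
  finally show ?thesis by (rule power2_le_imp_le) simp
qed

end

section \<open>Weyl functions\<close>

lemma norm_cadj_vec_le:
  fixes A :: "complex^'q::finite^'p::finite"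
  assumes "\<And>x. norm (A *v x) \<le> B * norm x" shows "norm (cadj A *v y) \<le> B * norm y"
proof (cases "norm (cadj A *v y) = 0")
  case False
  have "norm (cadj A *v y) ^ 2 = (A *v (cadj A *v y)) \<bullet> y"
    by (simp add: power2_norm_eq_inner inner_matrix_cadj)
  also have "\<dots> \<le> norm (A *v (cadj A *v y)) * norm y" by (rule norm_cauchy_schwarz)
  also have "\<dots> \<le> (B * norm (cadj A *v y)) * norm y" by (intro mult_right_mono assms) auto
  finally show ?thesis using False by (simp add: power2_eq_square)
next
  case True
  have "0 \<le> norm (A *v axis undefined 1)" by simp
  also have "\<dots> \<le> B * norm (axis undefined (1::complex) :: complex^'q)" by (rule assms)
  finally show ?thesis using True by simp
qed

lemma Re_quad_form: "Re (quad_form A h) = (A *v h) \<bullet> h"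
  by (simp add: quad_form_def inner_vec_def inner_complex_def mult.commute)

text \<open>The indefinite form of j at y. Its decrease along solutions with Im z > M is what
  confines the Weyl discs.\<close>

definition jform :: "complex^('a::finite + 'b::finite) \<Rightarrow> real" where
  "jform y = (norm (upr y))\<^sup>2 - (norm (lwr y))\<^sup>2"

lemma inner_jmat: "(jmat *v y) \<bullet> y = jform y"
  by (simp add: jmat_vec inner_blocks[of _ y] jform_def power2_norm_eq_inner)

lemma Re_quad_form_jmat: "Re (quad_form (cadj P ** jmat ** P) h) = jform (P *v h)"
proof -
  have "((cadj P ** jmat ** P) *v h) \<bullet> h = (jmat *v (P *v h)) \<bullet> (P *v h)"
    using inner_matrix_cadj[of "cadj P" "jmat *v (P *v h)" h]
    by (simp flip: matrix_vector_mul_assoc)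
  then show ?thesis by (simp add: Re_quad_form inner_jmat)
qed

lemma Re_quad_form_gram: "Re (quad_form (cadj P ** P) h) = (norm (P *v h))\<^sup>2"
  using inner_matrix_cadj[of "cadj P" "P *v h" h]
  by (simp add: Re_quad_form power2_norm_eq_inner flip: matrix_vector_mul_assoc)

section \<open>Decrease of the indefinite form along solutions\<close>

context dirac_system
begin

lemma jform_deriv:
  "has_ae_deriv 0 l (\<lambda>x. jform (u x z *v c))
     (\<lambda>x. - 2 * Im z * (norm (u x z *v c))\<^sup>2 + 4 * ((v x *v lwr (u x z *v c)) \<bullet> upr (u x z *v c)))"
proof -
  have *: "(upr y \<bullet> upr (rhs z x y) + upr (rhs z x y) \<bullet> upr y) - (lwr y \<bullet> lwr (rhs z x y) + lwr (rhs z x y) \<bullet> lwr y)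
      = - 2 * Im z * (norm y)\<^sup>2 + 4 * ((v x *v lwr y) \<bullet> upr y)" for x y
  proof -
    have "(cadj (v x) *v upr y) \<bullet> lwr y = (v x *v lwr y) \<bullet> upr y"
      using inner_matrix_cadj[of "v x" "lwr y" "upr y"] by (simp add: inner_commute)
    then show ?thesis
      unfolding norm_blocks[of y] by (simp add: inner_commute[of "upr y"] inner_commute[of "lwr y"]
        inner_add_left inner_diff_left inner_cmult_self algebra_simps)
  qed
  show ?thesis
    unfolding jform_def power2_norm_eq_inner
    using has_ae_deriv_diff[OF
      has_ae_deriv_bilinear[OF bounded_bilinear_inner upr_deriv[of l z c] upr_deriv[of l z c]]
      has_ae_deriv_bilinear[OF bounded_bilinear_inner lwr_deriv[of l z c] lwr_deriv[of l z c]]]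
    by (simp only: * flip: power2_norm_eq_inner)
qed

lemma v_form_le: "0 \<le> x \<Longrightarrow> 2 * \<bar>(v x *v b) \<bullet> a\<bar> \<le> M * ((norm a)\<^sup>2 + (norm b)\<^sup>2)"
proof -
  assume "0 \<le> x"
  have "\<bar>(v x *v b) \<bullet> a\<bar> \<le> norm (v x *v b) * norm a" by (rule Cauchy_Schwarz_ineq2)
  also have "\<dots> \<le> (M * norm b) * norm a" by (intro mult_right_mono norm_v_vec \<open>0 \<le> x\<close>) auto
  finally have "2 * \<bar>(v x *v b) \<bullet> a\<bar> \<le> M * (2 * norm b * norm a)" by simp
  also have "\<dots> \<le> M * ((norm a)\<^sup>2 + (norm b)\<^sup>2)"
    using M_pos sum_squares_bound[of "norm b" "norm a"] by (intro mult_left_mono) auto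
  finally show ?thesis .
qed

lemma solution_cont: "continuous_on {0..l} (\<lambda>x. u x z *v c)"
  by (rule has_ae_deriv_cont[OF solution_deriv])

text \<open>The term with v in the derivative of the form is at most 2 M times the squared norm,
  while the spectral term is - 2 Im z times it. This comparison is where the half-plane Im z > M
  comes from.\<close>

lemma jform_integral_le:
  assumes "0 \<le> x"
  shows "jform (u x z *v c) + 2 * (Im z - M) * integral {0..x} (\<lambda>t. (norm (u t z *v c))\<^sup>2) \<le> jform c"
proof -
  let ?n = "\<lambda>t. (norm (u t z *v c))\<^sup>2"
  have cn: "continuous_on {0..x} ?n" by (intro continuous_intros solution_cont)
  have i: "has_ae_deriv 0 x (\<lambda>x. integral {0..x} ?n) ?n"
    by (rule has_ae_deriv_C1[OF _ cn]) (use cn in \<open>auto intro: integral_has_vector_derivative\<close>)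
  have d: "has_ae_deriv 0 x (\<lambda>x. jform (u x z *v c) + (2 * (Im z - M)) *\<^sub>R integral {0..x} ?n)
     (\<lambda>x. (- 2 * Im z * ?n x + 4 * ((v x *v lwr (u x z *v c)) \<bullet> upr (u x z *v c))) + (2 * (Im z - M)) *\<^sub>R ?n x)"
    by (intro has_ae_deriv_add jform_deriv has_ae_deriv_bounded_linear[OF bounded_linear_scaleR_right i])
  have "(- 2 * Im z * ?n t + 4 * ((v t *v lwr (u t z *v c)) \<bullet> upr (u t z *v c))) + (2 * (Im z - M)) *\<^sub>R ?n t \<le> 0"
    if "t \<in> {0..x}" for t
    using v_form_le[of t "lwr (u t z *v c)" "upr (u t z *v c)"] that
    by (simp add: norm_blocks[of "u t z *v c"] algebra_simps)
  then have ae: "AE t in Leb x. (- 2 * Im z * ?n t + 4 * ((v t *v lwr (u t z *v c)) \<bullet> upr (u t z *v c)))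
      + (2 * (Im z - M)) *\<^sub>R ?n t \<le> 0"
    by (intro AE_I2) auto
  show ?thesis using has_ae_deriv_le_0[OF d ae assms] by simp
qed

text \<open>\<open>N_set\<close> takes limits in the spectral parameter, whereas
  \<open>fundamental_solution\<close> fixes each parameter separately. Pairing a solution at \<zeta>
  with one at the conjugate of z gives a quantity whose derivative carries the factor \<zeta> - z,
  which yields a Lipschitz estimate near z.\<close>

lemma solution_tendsto:
  assumes "0 \<le> x" shows "((\<lambda>\<zeta>. u x \<zeta> *v c) \<longlongrightarrow> u x z *v c) (at z)"
proof -
  \<comment> \<open>Bounds the growth on [0, x] for all parameters whose imaginary part is, in
    modulus, at most one larger than that of z.\<close>
  define E where "E = exp ((\<bar>Im z\<bar> + 1) * x)"
  have E: "E \<ge> 1" using assms by (simp add: E_def)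
  define K where "K = 2 * (E * norm c) * (E * E) * x"
  have "norm (u x \<zeta> *v c - u x z *v c) \<le> norm (\<zeta> - z) * K" if "norm (\<zeta> - z) < 1" for \<zeta>
  proof -
    have "\<bar>Im \<zeta> - Im z\<bar> \<le> norm (\<zeta> - z)" using abs_Im_le_cmod[of "\<zeta> - z"] by simp
    then have im: "\<bar>Im \<zeta>\<bar> \<le> \<bar>Im z\<bar> + 1" using that by linarith
    have bd: "norm (u t w *v b) \<le> E * norm b" if "\<bar>Im w\<bar> \<le> \<bar>Im z\<bar> + 1" "t \<in> {0..x}" for w b t
    proof -
      have "norm (u t w *v b) \<le> exp (\<bar>Im w\<bar> * t) * norm b" using that by (intro norm_solution_le) auto
      also have "\<dots> \<le> E * norm b" using that
        by (auto simp: E_def intro!: mult_right_mono mult_mono)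
      finally show ?thesis .
    qed
    define e where "e = u x \<zeta> *v c - u x z *v c"
    \<comment> \<open>The initial vector whose solution at the conjugate of z equals the error e at
      x; the squared error thus becomes the change of an inner product of two solutions.\<close>
    define d where "d = cadj (u x z) *v e"
    have d: "norm d \<le> E * norm e"
      unfolding d_def by (rule norm_cadj_vec_le) (use bd[of z x] assms in auto)
    have ud: "u x (cnj z) *v d = e"
      using u_inverse(2)[OF assms, of "cnj z"] by (simp add: d_def matrix_vector_mul_assoc)
    have "(norm e)\<^sup>2 = (u x \<zeta> *v c) \<bullet> e - (u x z *v c) \<bullet> e"
      by (simp add: power2_norm_eq_inner e_def inner_diff_left inner_diff_right)
    also have "\<dots> = (u x \<zeta> *v c) \<bullet> (u x (cnj z) *v d) - c \<bullet> d"
      using inner_solutions_conj[OF assms, of z c d] by (simp add: ud)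
    also have "\<dots> \<le> norm ((u x \<zeta> *v c) \<bullet> (u x (cnj z) *v d) - (u 0 \<zeta> *v c) \<bullet> (u 0 (cnj z) *v d))"
      by simp
    also have "\<dots> \<le> (2 * norm (\<zeta> - z) * (E * norm c) * (E * norm d)) * \<bar>x - 0\<bar>"
    proof (rule has_ae_deriv_norm_le[OF inner_solutions_deriv[of x \<zeta> c "cnj z" d]])
      show "AE t in Leb x. norm (((\<i> * (\<zeta> - cnj (cnj z))) *s upr (u t \<zeta> *v c)) \<bullet> upr (u t (cnj z) *v d) -
              ((\<i> * (\<zeta> - cnj (cnj z))) *s lwr (u t \<zeta> *v c)) \<bullet> lwr (u t (cnj z) *v d))
              \<le> 2 * norm (\<zeta> - z) * (E * norm c) * (E * norm d)"
      proof (rule AE_I2)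
        fix t assume "t \<in> space (Leb x)"
        then have t: "t \<in> {0..x}" by simp
        have p: "\<bar>((\<i> * (\<zeta> - cnj (cnj z))) *s a) \<bullet> b\<bar> \<le> norm (\<zeta> - z) * (E * norm c) * (E * norm d)"
          if "norm a \<le> E * norm c" "norm b \<le> E * norm d" for a b :: "complex^'k::finite"
        proof -
          have "\<bar>((\<i> * (\<zeta> - cnj (cnj z))) *s a) \<bullet> b\<bar> \<le> norm (\<zeta> - z) * norm a * norm b"
            using Cauchy_Schwarz_ineq2[of "(\<i> * (\<zeta> - cnj (cnj z))) *s a" b] by (simp add: norm_cmult_vec norm_mult)
          also have "\<dots> \<le> norm (\<zeta> - z) * (E * norm c) * (E * norm d)"
            using that E by (intro mult_mono) auto
          finally show ?thesis .
        qed
        have y: "norm (u t \<zeta> *v c) \<le> E * norm c" and w: "norm (u t (cnj z) *v d) \<le> E * norm d"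
          using bd[of \<zeta> t c] bd[of "cnj z" t d] im t by auto
        show "norm (((\<i> * (\<zeta> - cnj (cnj z))) *s upr (u t \<zeta> *v c)) \<bullet> upr (u t (cnj z) *v d) -
              ((\<i> * (\<zeta> - cnj (cnj z))) *s lwr (u t \<zeta> *v c)) \<bullet> lwr (u t (cnj z) *v d))
              \<le> 2 * norm (\<zeta> - z) * (E * norm c) * (E * norm d)"
          using p[of "upr (u t \<zeta> *v c)" "upr (u t (cnj z) *v d)"]
                p[of "lwr (u t \<zeta> *v c)" "lwr (u t (cnj z) *v d)"]
                order_trans[OF norm_upr_le y] order_trans[OF norm_upr_le w]
                order_trans[OF norm_lwr_le y] order_trans[OF norm_lwr_le w]
          unfolding real_norm_def by linarith
      qed
    qed (use assms E in auto)
    also have "\<bar>x - 0\<bar> = x" using assms by simp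
    also have "(2 * norm (\<zeta> - z) * (E * norm c) * (E * norm d)) * x
        \<le> (2 * norm (\<zeta> - z) * (E * norm c) * (E * (E * norm e))) * x"
      using assms E d by (intro mult_right_mono mult_left_mono mult_nonneg_nonneg) auto
    also have "\<dots> = (norm (\<zeta> - z) * K) * norm e" by (simp add: K_def)
    finally have "norm e * norm e \<le> (norm (\<zeta> - z) * K) * norm e" by (simp add: power2_eq_square)
    moreover have "0 \<le> norm (\<zeta> - z) * K" using E assms by (auto simp: K_def)
    ultimately show ?thesis
      unfolding e_def[symmetric] by (cases "norm e = 0") (auto dest: mult_right_le_imp_le)
  qed
  then have "\<forall>\<^sub>F \<zeta> in at z. norm (u x \<zeta> *v c - u x z *v c) \<le> norm (\<zeta> - z) * K"
    unfolding eventually_at by (intro exI[of _ 1]) (auto simp: dist_norm)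
  moreover have "((\<lambda>\<zeta>. norm (\<zeta> - z) * K) \<longlongrightarrow> norm (z - z) * K) (at z)"
    by (intro tendsto_intros)
  ultimately have "((\<lambda>\<zeta>. u x \<zeta> *v c - u x z *v c) \<longlongrightarrow> 0) (at z)"
    by - (rule Lim_null_comparison, assumption, simp)
  then show ?thesis by (simp add: LIM_zero_iff)
qed

text \<open>The vector in the statement is the inverse of u applied to P h, where h makes its upper
  block equal to g; applying u returns P h, on which the form is nonnegative. The upper block is
  invertible because the form does not decrease when going back from x to 0: a kernel vector has
  nonnegative form and zero upper block, so its lower block vanishes too, and P is
  injective.\<close>

lemma jform_lin_frac_nonneg:
  assumes "0 \<le> x" "Im \<zeta> > M"
    and pd: "pos_definite (cadj P ** P)" and psd: "pos_semidefinite (cadj P ** jmat ** P)"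
  shows "0 \<le> jform (u x \<zeta> *v vjoin g (lin_frac (u x \<zeta>) P *v g))"
proof -
  define U where "U = matrix_inv (u x \<zeta>)"
  have uU: "u x \<zeta> *v (U *v c) = c" for c
    using u_inverse[OF assms(1), of \<zeta>] by (simp add: U_def matrix_vector_mul_assoc)
  define B where "B = hcat (mat 1) 0 ** U ** P"
  have B: "B *v h = upr (U *v (P *v h))" for h
    by (simp add: B_def hcat_vec flip: matrix_vector_mul_assoc)
  have Ppos: "jform (P *v h) \<ge> 0" for h
    using psd[unfolded pos_semidefinite_def] Re_quad_form_jmat[of P h] by metis
  have ge: "jform (P *v h) \<le> jform (U *v (P *v h))" for h
  proof -
    have "integral {0..x} (\<lambda>t. (norm (u t \<zeta> *v (U *v (P *v h))))\<^sup>2) \<ge> 0"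
      by (intro integral_nonneg integrable_continuous_real continuous_intros solution_cont) auto
    then have "0 \<le> 2 * (Im \<zeta> - M) * integral {0..x} (\<lambda>t. (norm (u t \<zeta> *v (U *v (P *v h))))\<^sup>2)"
      using assms(2) by (intro mult_nonneg_nonneg) auto
    with jform_integral_le[OF assms(1), of \<zeta> "U *v (P *v h)"] show ?thesis
      unfolding uU by linarith
  qed
  have inj: "h = 0" if "B *v h = 0" for h
  proof -
    have "jform (U *v (P *v h)) \<ge> 0" using Ppos ge order_trans by blast
    then have "lwr (U *v (P *v h)) = 0" using that by (simp add: B jform_def)
    then have "U *v (P *v h) = 0" using that B by (intro blocks_eqI) auto
    then have "P *v h = 0" using uU[of "P *v h"] by simp
    then show ?thesis using pd Re_quad_form_gram[of P h] by (auto simp: pos_definite_def)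
  qed
  then obtain B' where B': "B' ** B = mat 1"
    using matrix_left_invertible_ker[of B] by blast
  then have BB': "B ** B' = mat 1" by (simp add: matrix_left_right_inverse)
  have inv: "matrix_inv B = B'" using B' BB' by (intro matrix_inv_unique)
  define h where "h = B' *v g"
  have up: "upr (U *v (P *v h)) = g"
    using BB' by (simp add: h_def flip: B) (simp add: matrix_vector_mul_assoc)
  have "lin_frac (u x \<zeta>) P *v g = lwr (U *v (P *v h))"
    by (simp add: lin_frac_def inv[unfolded B_def] U_def[symmetric] h_def hcat_vec B_def flip: matrix_vector_mul_assoc)
  then have "vjoin g (lin_frac (u x \<zeta>) P *v g) = U *v (P *v h)"
    using up by (intro blocks_eqI) auto
  then show ?thesis using Ppos[of h] by (simp add: uU)
qed

text \<open>The inequality holds at all \<zeta> near z other than z itself, because the conditions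
  on P fail only on a discrete set, and it survives the limit that defines
  \<open>N_set\<close>.\<close>

lemma jform_Weyl_nonneg:
  assumes "0 \<le> x" "Im z > M" and W: "W \<in> N_set M u x z"
  shows "0 \<le> jform (u x z *v vjoin g (W *v g))"
proof -
  from W obtain P where P: "P \<in> P_class M" and lim: "((\<lambda>\<zeta>. lin_frac (u x \<zeta>) (P \<zeta>)) \<longlongrightarrow> W) (at z)"
    by (auto simp: N_set_def)
  define w where "w \<zeta> = vjoin g (lin_frac (u x \<zeta>) (P \<zeta>) *v g)" for \<zeta>
  have op: "open (upper_plane M)"
    using open_halfspace_Im_gt by (simp add: upper_plane_def)
  have "z \<in> upper_plane M" using assms by (simp add: upper_plane_def)
  have "\<forall>\<^sub>\<approx>z\<in>upper_plane M. pos_definite (cadj (P z) ** P z) \<and> pos_semidefinite (cadj (P z) ** jmat ** P z)"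
    using P by (simp add: P_class_def)
  then have "\<forall>\<^sub>F \<zeta> in at z. pos_definite (cadj (P \<zeta>) ** P \<zeta>) \<and> pos_semidefinite (cadj (P \<zeta>) ** jmat ** P \<zeta>)"
    using \<open>z \<in> upper_plane M\<close> op by (auto simp: eventually_cosparse_open_eq)
  moreover have "\<forall>\<^sub>F \<zeta> in at z. \<zeta> \<in> upper_plane M"
    using op \<open>z \<in> upper_plane M\<close> by (rule eventually_at_in_open')
  ultimately have ev: "\<forall>\<^sub>F \<zeta> in at z. 0 \<le> jform (u x \<zeta> *v w \<zeta>)"
    by eventually_elim (use assms(1) in \<open>auto simp: w_def upper_plane_def intro!: jform_lin_frac_nonneg\<close>)
  define k where "k = \<bar>Im z\<bar> + 1"
  have vl: "bounded_linear (\<lambda>b. vjoin (0 :: complex^'m1) (b :: complex^'m2))"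
    by (auto simp: linear_conv_bounded_linear[symmetric] intro!: linearI blocks_eqI)
  have wlim: "(w \<longlongrightarrow> vjoin g (W *v g)) (at z)"
  proof -
    have "((\<lambda>\<zeta>. vjoin g 0 + vjoin 0 (lin_frac (u x \<zeta>) (P \<zeta>) *v g)) \<longlongrightarrow> vjoin g 0 + vjoin 0 (W *v g)) (at z)"
      by (intro tendsto_intros bounded_linear.tendsto[OF vl]
         bounded_bilinear.tendsto[OF bounded_bilinear_matrix_vector] lim)
    then show ?thesis by (simp add: vjoin_add w_def[abs_def])
  qed
  have ulim: "((\<lambda>\<zeta>. u x \<zeta> *v w \<zeta>) \<longlongrightarrow> u x z *v vjoin g (W *v g)) (at z)"
  proof -
    \<comment> \<open>Both u and the vector depend on \<zeta>: the change of the vector is absorbed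
      by the locally uniform growth bound, and the fixed limit vector is handled by continuity of
      solutions in the parameter.\<close>
    have "((\<lambda>\<zeta>. u x \<zeta> *v (w \<zeta> - vjoin g (W *v g))) \<longlongrightarrow> 0) (at z)"
    proof (rule Lim_null_comparison)
      have "\<forall>\<^sub>F \<zeta> in at z. dist \<zeta> z < 1" unfolding eventually_at by (intro exI[of _ 1]) auto
      then show "\<forall>\<^sub>F \<zeta> in at z. norm (u x \<zeta> *v (w \<zeta> - vjoin g (W *v g))) \<le> exp (k * x) * norm (w \<zeta> - vjoin g (W *v g))"
      proof eventually_elim
        case (elim \<zeta>)
        have "\<bar>Im \<zeta> - Im z\<bar> \<le> norm (\<zeta> - z)" using abs_Im_le_cmod[of "\<zeta> - z"] by simp
        then have im: "\<bar>Im \<zeta>\<bar> \<le> k" using elim unfolding k_def dist_norm by linarith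
        show ?case
          by (rule order_trans[OF norm_solution_le[OF assms(1)]])
            (use im assms(1) in \<open>auto intro!: mult_right_mono\<close>)
      qed
      have "((\<lambda>\<zeta>. exp (k * x) * norm (w \<zeta> - vjoin g (W *v g))) \<longlongrightarrow> exp (k * x) * norm (vjoin g (W *v g) - vjoin g (W *v g))) (at z)"
        by (intro tendsto_intros wlim)
      then show "((\<lambda>\<zeta>. exp (k * x) * norm (w \<zeta> - vjoin g (W *v g))) \<longlongrightarrow> 0) (at z)" by simp
    qed
    from tendsto_add[OF this solution_tendsto[OF assms(1), where c = "vjoin g (W *v g)"]]
    show ?thesis by (simp add: matrix_vector_mult_diff_distrib)
  qed
  have "((\<lambda>\<zeta>. jform (u x \<zeta> *v w \<zeta>)) \<longlongrightarrow> jform (u x z *v vjoin g (W *v g))) (at z)"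
    unfolding jform_def
    by (intro tendsto_intros bounded_linear.tendsto[OF bounded_linear_upr] bounded_linear.tendsto[OF bounded_linear_lwr] ulim)
  then show ?thesis
    by (rule tendsto_lowerbound[OF _ ev]) simp
qed

text \<open>The bound is independent of x. For a Weyl value W it says that the solution started at
  this vector is square integrable on the half-line.\<close>

lemma Weyl_integral_bound:
  assumes "0 \<le> x" "Im z > M" and W: "W \<in> N_set M u x z"
  shows "integral {0..x} (\<lambda>t. (norm (u t z *v vjoin g (W *v g)))\<^sup>2) \<le> (norm g)\<^sup>2 / (2 * (Im z - M))"
proof -
  have "2 * (Im z - M) * integral {0..x} (\<lambda>t. (norm (u t z *v vjoin g (W *v g)))\<^sup>2) \<le> jform (vjoin g (W *v g))"
    using jform_Weyl_nonneg[OF assms, of g] jform_integral_le[OF assms(1), of z "vjoin g (W *v g)"] by linarith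
  also have "\<dots> \<le> (norm g)\<^sup>2" by (simp add: jform_def)
  finally show ?thesis using assms(2) by (simp add: field_simps)
qed

end

section \<open>Square-integrable functions and Volterra operators\<close>

lemma integrable_lebesgue_on_iff: "S \<in> sets lebesgue \<Longrightarrow>
    integrable (lebesgue_on S) (f :: real \<Rightarrow> 'a::euclidean_space) \<longleftrightarrow> set_integrable lebesgue S f"
  by (simp add: integrable_restrict_space set_integrable_def)

lemma lint_eq_integral:
  fixes f :: "real \<Rightarrow> 'a::euclidean_space"
  assumes "integrable (Leb l) f" "x \<le> l"
  shows "(LINT t:{0..x}|lebesgue. f t) = integral {0..x} f" "f integrable_on {0..x}"
proof -
  have "set_integrable lebesgue {0..x} f"
    using assms by - (rule set_integrable_subset[of lebesgue "{0..l}"], auto simp: integrable_lebesgue_on_iff)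
  then show "(LINT t:{0..x}|lebesgue. f t) = integral {0..x} f" "f integrable_on {0..x}"
    by (simp_all add: set_lebesgue_integral_eq_integral)
qed

lemma integral_cong_AE_HK:
  fixes f g :: "real \<Rightarrow> 'a::euclidean_space"
  assumes "AE t in lebesgue_on {a..b}. f t = g t"
  shows "integral {a..b} f = integral {a..b} g"
proof -
  define N where "N = {t \<in> {a..b}. f t \<noteq> g t}"
  have "AE t in lebesgue. t \<in> {a..b} \<longrightarrow> f t = g t"
    using assms by (subst (asm) AE_restrict_space_iff) auto
  then have "negligible N"
    by (simp add: negligible_iff_null_sets N_def completion.AE_iff_null_sets)
  then show ?thesis by (rule integral_spike) (auto simp: N_def)
qed

text \<open>Lebesgue measure is complete: preimages under f and g differ by a subset of a null set,
  and such subsets are measurable.\<close>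

lemma borel_measurable_lebesgue_on_AE:
  fixes f g :: "real \<Rightarrow> 'a::euclidean_space"
  assumes "f \<in> borel_measurable (lebesgue_on S)" "AE x in lebesgue_on S. f x = g x" "S \<in> sets lebesgue"
  shows "g \<in> borel_measurable (lebesgue_on S)"
proof -
  have "AE t in lebesgue. t \<in> S \<longrightarrow> f t = g t"
    using assms(2,3) by (subst (asm) AE_restrict_space_iff) auto
  then have N: "negligible {t \<in> S. f t \<noteq> g t}" (is "negligible ?N")
    by (simp add: negligible_iff_null_sets completion.AE_iff_null_sets)
  show ?thesis
  proof (rule measurableI)
    fix A :: "'a set" assume "A \<in> sets borel"
    then have "f -` A \<inter> S \<in> sets lebesgue"
      using measurable_sets[OF assms(1), of A] assms(3) by (simp add: sets_restrict_space_iff)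
    moreover have "g -` A \<inter> ?N \<in> sets lebesgue"
      by (rule negligible_imp_sets, rule negligible_subset[OF N]) auto
    moreover have "g -` A \<inter> S = (f -` A \<inter> S - ?N) \<union> (g -` A \<inter> ?N)" by auto
    ultimately have "g -` A \<inter> S \<in> sets lebesgue"
      using negligible_imp_sets[OF N] by auto
    then show "g -` A \<inter> space (lebesgue_on S) \<in> sets (lebesgue_on S)"
      using assms(3) by (simp add: sets_restrict_space_iff)
  qed simp
qed

section \<open>Square-integrable functions\<close>

lemma L2_onD:
  assumes "f \<in> L2_on S"
  shows "f \<in> borel_measurable (lebesgue_on S)" "integrable (lebesgue_on S) (\<lambda>x. (norm (f x))\<^sup>2)"
  using assms by (auto simp: L2_on_def)

lemma L2_on_integrable:
  assumes "f \<in> L2_on S" "S \<in> lmeasurable" shows "integrable (lebesgue_on S) f"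
proof (rule Bochner_Integration.integrable_bound)
  interpret finite_measure "lebesgue_on S"
    using assms(2) by (rule finite_measure_lebesgue_on)
  show "integrable (lebesgue_on S) (\<lambda>x. 1 + (norm (f x))\<^sup>2)"
    using L2_onD(2)[OF assms(1)] by (intro Bochner_Integration.integrable_add) auto
  have "norm (f x) \<le> 1 + (norm (f x))\<^sup>2" for x
    using sum_squares_bound[of 1 "norm (f x)"] by (simp add: power2_eq_square) (smt (verit) norm_ge_zero)
  then show "AE x in lebesgue_on S. norm (f x) \<le> norm (1 + (norm (f x))\<^sup>2)"
    by (intro AE_I2) (simp add: abs_of_nonneg)
qed (use L2_onD[OF assms(1)] in auto)

lemma norm_add_sq_le: "(norm (x + y))\<^sup>2 \<le> 2 * (norm x)\<^sup>2 + 2 * (norm y)\<^sup>2"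
proof -
  have "(norm (x + y))\<^sup>2 \<le> (norm x + norm y)\<^sup>2" by (intro power_mono norm_triangle_ineq) auto
  also have "\<dots> \<le> 2 * (norm x)\<^sup>2 + 2 * (norm y)\<^sup>2"
    using sum_squares_bound[of "norm x" "norm y"] by (simp add: power2_sum)
  finally show ?thesis .
qed

lemma L2_on_add:
  fixes f g :: "real \<Rightarrow> 'a::euclidean_space"
  assumes "f \<in> L2_on S" "g \<in> L2_on S" shows "(\<lambda>x. f x + g x) \<in> L2_on S"
proof -
  note fg = L2_onD[OF assms(1)] L2_onD[OF assms(2)]
  have "integrable (lebesgue_on S) (\<lambda>x. (norm (f x + g x))\<^sup>2)"
  proof (rule Bochner_Integration.integrable_bound)
    show "integrable (lebesgue_on S) (\<lambda>x. 2 * (norm (f x))\<^sup>2 + 2 * (norm (g x))\<^sup>2)"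
      using fg by (intro Bochner_Integration.integrable_add integrable_mult_right) auto
    show "(\<lambda>x. (norm (f x + g x))\<^sup>2) \<in> borel_measurable (lebesgue_on S)"
      using fg by measurable
    show "AE x in lebesgue_on S. norm ((norm (f x + g x))\<^sup>2) \<le> norm (2 * (norm (f x))\<^sup>2 + 2 * (norm (g x))\<^sup>2)"
      by (intro AE_I2) (simp add: norm_add_sq_le)
  qed
  then show ?thesis using fg by (auto simp: L2_on_def)
qed

lemma L2_on_bounded_linear:
  fixes f :: "real \<Rightarrow> 'a::euclidean_space" and h :: "'a \<Rightarrow> 'b::euclidean_space"
  assumes h: "bounded_linear h" and f: "f \<in> L2_on S" shows "(\<lambda>x. h (f x)) \<in> L2_on S"
proof -
  obtain K where K: "K \<ge> 0" "\<And>x. norm (h x) \<le> norm x * K"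
    using bounded_linear.nonneg_bounded[OF h] by blast
  note fm = L2_onD[OF f]
  have m: "(\<lambda>x. h (f x)) \<in> borel_measurable (lebesgue_on S)"
    using measurable_compose[OF fm(1) borel_measurable_continuous_onI[OF linear_continuous_on[OF h]]] .
  have "integrable (lebesgue_on S) (\<lambda>x. (norm (h (f x)))\<^sup>2)"
  proof (rule Bochner_Integration.integrable_bound)
    show "integrable (lebesgue_on S) (\<lambda>x. K\<^sup>2 * (norm (f x))\<^sup>2)"
      using fm by (intro integrable_mult_right) auto
    show "AE x in lebesgue_on S. norm ((norm (h (f x)))\<^sup>2) \<le> norm (K\<^sup>2 * (norm (f x))\<^sup>2)"
      using power_mono[OF K(2), of _ 2] by (intro AE_I2) (simp add: power_mult_distrib mult.commute)
    show "(\<lambda>x. (norm (h (f x)))\<^sup>2) \<in> borel_measurable (lebesgue_on S)" using m by measurable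
  qed
  then show ?thesis using m by (simp add: L2_on_def)
qed

lemma bounded_linear_cmult_vec: "bounded_linear (\<lambda>x. c *s (x :: complex^'n::finite))"
  by (simp add: linear_conv_bounded_linear[symmetric])
    (auto intro!: linearI simp: vector_add_ldistrib vec_eq_iff)

lemma L2_on_cmult: "f \<in> L2_on S \<Longrightarrow> (\<lambda>x. c *s f x) \<in> L2_on (S :: real set)"
  for f :: "real \<Rightarrow> complex^'n::finite"
  by (rule L2_on_bounded_linear[OF bounded_linear_cmult_vec])

lemma L2_on_minus: "f \<in> L2_on S \<Longrightarrow> (\<lambda>x. - f x) \<in> L2_on S"
  by (simp add: L2_on_def)

lemma L2_on_diff: "f \<in> L2_on S \<Longrightarrow> g \<in> L2_on S \<Longrightarrow> (\<lambda>x. f x - g x) \<in> L2_on S"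
  using L2_on_add[of f S "\<lambda>x. - g x"] L2_on_minus by auto

lemma L2_on_bounded:
  fixes f :: "real \<Rightarrow> 'a::euclidean_space"
  assumes m: "f \<in> borel_measurable (lebesgue_on S)" and S: "S \<in> lmeasurable"
    and B: "AE x in lebesgue_on S. norm (f x) \<le> B"
  shows "f \<in> L2_on S"
proof -
  interpret finite_measure "lebesgue_on S" using S by (rule finite_measure_lebesgue_on)
  have "integrable (lebesgue_on S) (\<lambda>x. (norm (f x))\<^sup>2)"
  proof (rule Bochner_Integration.integrable_bound)
    show "integrable (lebesgue_on S) (\<lambda>x. B\<^sup>2)" by simp
    show "AE x in lebesgue_on S. norm ((norm (f x))\<^sup>2) \<le> norm (B\<^sup>2)"
      using B by eventually_elim (simp add: power_mono)
  qed (use m in measurable)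
  then show ?thesis using m by (simp add: L2_on_def)
qed

lemma L2_on_continuous:
  fixes f :: "real \<Rightarrow> 'a::euclidean_space"
  assumes "continuous_on {a..b} f" shows "f \<in> L2_on {a..b}"
proof -
  obtain B where "\<And>x. x \<in> {a..b} \<Longrightarrow> norm (f x) \<le> B" using continuous_on_Icc_bounded[OF assms] by blast
  then show ?thesis
    using assms by (intro L2_on_bounded[where B = B] continuous_imp_measurable_on_sets_lebesgue AE_I2) auto
qed

lemma L2_on_cong_AE:
  fixes f :: "real \<Rightarrow> 'a::euclidean_space"
  assumes "f \<in> L2_on S" "AE x in lebesgue_on S. f x = g x" "S \<in> sets lebesgue"
  shows "g \<in> L2_on S"
proof -
  have m: "g \<in> borel_measurable (lebesgue_on S)"
    using L2_onD(1)[OF assms(1)] assms(2)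
    by (rule borel_measurable_lebesgue_on_AE[OF _ _ assms(3)])
  have "integrable (lebesgue_on S) (\<lambda>x. (norm (g x))\<^sup>2)"
    by (rule integrable_cong_AE_imp[OF L2_onD(2)[OF assms(1)]])
      (use m assms(2) in \<open>auto elim!: eventually_mono\<close>)
  then show ?thesis using m by (simp add: L2_on_def)
qed

section \<open>Bounded operators on L2\<close>

lemma L2_bounded_op_add:
  assumes "L2_bounded_op l T" "f \<in> L2_on {0..l}" "g \<in> L2_on {0..l}"
  shows "AE x in Leb l. T (\<lambda>t. f t + g t) x = T f x + T g x"
  using assms unfolding L2_bounded_op_def by blast

lemma L2_bounded_op_cmult:
  assumes "L2_bounded_op l T" "f \<in> L2_on {0..l}"
  shows "AE x in Leb l. T (\<lambda>t. c *s f t) x = c *s T f x"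
  using assms unfolding L2_bounded_op_def by blast

lemma L2_bounded_op_L2: "L2_bounded_op l T \<Longrightarrow> f \<in> L2_on {0..l} \<Longrightarrow> T f \<in> L2_on {0..l}"
  by (simp add: L2_bounded_op_def)

text \<open>Operators act on functions, not on classes. That they respect a.e. equality follows from
  the norm bound applied to the difference, written with the scalar -1 because linearity is given
  for sums and multiples.\<close>

lemma L2_bounded_op_cong:
  fixes T :: "'n::finite oper"
  assumes T: "L2_bounded_op l T" and f: "f \<in> L2_on {0..l}" and g: "g \<in> L2_on {0..l}"
    and eq: "AE x in Leb l. f x = g x"
  shows "AE x in Leb l. T f x = T g x"
proof -
  define h where "h x = f x + (- 1) *s g x" for x
  have h: "h \<in> L2_on {0..l}" unfolding h_def by (intro L2_on_add L2_on_cmult f g)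
  obtain C where C: "L2_norm_on {0..l} (T h) \<le> C * L2_norm_on {0..l} h"
    using T h unfolding L2_bounded_op_def by blast
  have "(\<integral>x. (norm (h x))\<^sup>2 \<partial>Leb l) = 0"
    by (rule integral_eq_zero_AE) (use eq in \<open>eventually_elim, simp add: h_def\<close>)
  then have "L2_norm_on {0..l} (T h) \<le> 0" using C by (simp add: L2_norm_on_def)
  then have "(\<integral>x. (norm (T h x))\<^sup>2 \<partial>Leb l) \<le> 0" by (simp add: L2_norm_on_def)
  then have z: "(\<integral>x. (norm (T h x))\<^sup>2 \<partial>Leb l) = 0" by (simp add: antisym)
  have Th: "T h \<in> L2_on {0..l}" using T h by (simp add: L2_bounded_op_def)
  have 0: "AE x in Leb l. T h x = 0"
    using integral_nonneg_eq_0_iff_AE[OF L2_onD(2)[OF Th]] z by auto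
  have "AE x in Leb l. T h x = T f x + T (\<lambda>t. (- 1) *s g t) x"
    unfolding h_def by (rule L2_bounded_op_add[OF T f L2_on_cmult[OF g]])
  moreover have "AE x in Leb l. T (\<lambda>t. (- 1) *s g t) x = (- 1) *s T g x"
    by (rule L2_bounded_op_cmult[OF T g])
  ultimately show ?thesis using 0 by eventually_elim (simp add: vec_eq_iff)
qed

lemma L2_bounded_op_sum:
  fixes T :: "'n::finite oper"
  assumes T: "L2_bounded_op l T" and f: "\<And>k. k \<in> I \<Longrightarrow> f k \<in> L2_on {0..l}" and "finite I"
  shows "AE x in Leb l. T (\<lambda>t. \<Sum>k\<in>I. f k t) x = (\<Sum>k\<in>I. T (f k) x)"
  using \<open>finite I\<close> f
proof (induction I rule: finite_induct)
  case empty
  have z: "(\<lambda>t. 0 *s (0 :: complex^'n)) \<in> L2_on {0..l}" by (rule L2_on_continuous) auto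
  from L2_bounded_op_cmult[OF T z, of 0] show ?case by simp
next
  case (insert i I)
  have s: "(\<lambda>t. \<Sum>k\<in>I. f k t) \<in> L2_on {0..l}"
    using insert.hyps(1) insert.prems
  proof (induction I rule: finite_induct)
    case empty then show ?case by (auto intro: L2_on_continuous)
  next
    case (insert j J) then show ?case by (auto intro!: L2_on_add)
  qed
  have "AE x in Leb l. T (\<lambda>t. f i t + (\<Sum>k\<in>I. f k t)) x = T (f i) x + T (\<lambda>t. \<Sum>k\<in>I. f k t) x"
    by (rule L2_bounded_op_add[OF T _ s]) (use insert in auto)
  with insert.IH[OF insert.prems] show ?case
    using insert.hyps by (auto elim!: eventually_elim2)
qed

text \<open>Gronwall for the primitive F of d: the equation gives F' = - c F almost everywhere and F
  0 = 0.\<close>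

lemma volterra_integral_unique:
  fixes d :: "real \<Rightarrow> complex^'n::finite"
  assumes d: "integrable (Leb l) d"
    and eq: "AE x in Leb l. d x + c *s (LINT t:{0..x}|lebesgue. d t) = 0"
  shows "AE x in Leb l. d x = 0"
proof -
  define F where "F x = integral {0..x} d" for x
  have F: "(LINT t:{0..x}|lebesgue. d t) = F x" if "x \<le> l" for x
    using lint_eq_integral(1)[OF d that] by (simp add: F_def)
  have dF: "AE x in Leb l. d x = - (c *s F x)"
  proof -
    from eq AE_mem show ?thesis
      by eventually_elim (use F in \<open>auto simp: eq_neg_iff_add_eq_0\<close>)
  qed
  show ?thesis
  proof (cases "0 \<le> l")
    case True
    have int: "d integrable_on {0..l}" using lint_eq_integral(2)[OF d] by auto
    then have contF: "continuous_on {0..l} F" unfolding F_def by (rule indefinite_integral_continuous_1)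
    \<comment> \<open>The continuous version of d. It agrees with d almost everywhere and makes the
      primitive continuously differentiable.\<close>
    define G where "G x = - (c *s F x)" for x
    have contG: "continuous_on {0..l} G"
      unfolding G_def by (intro continuous_intros contF bounded_linear.continuous_on[OF bounded_linear_cmult_vec])
    have FG: "F x = integral {0..x} G" if "x \<in> {0..l}" for x
    proof -
      have "AE t in Leb x. d t = G t"
        by (rule AE_lebesgue_on_subset[where A="{0..l}"]) (use that dF in \<open>auto simp: G_def\<close>)
      then have "integral {0..x} d = integral {0..x} G"
        using that d lint_eq_integral(1)[of x d x]
        by (intro integral_cong_AE_HK) auto
      then show ?thesis by (simp add: F_def)
    qed
    have derF: "has_ae_deriv 0 l F G"
    proof -
      have "has_ae_deriv 0 l (\<lambda>x. integral {0..x} G) G"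
        by (rule has_ae_deriv_C1[OF _ contG]) (use contG in \<open>auto intro: integral_has_vector_derivative\<close>)
      then show ?thesis by (rule has_ae_deriv_transform) (use FG in auto)
    qed
    define k where "k = 2 * cmod c"
    have e: "has_ae_deriv 0 l (\<lambda>x. exp (- k * x)) (\<lambda>x. - k * exp (- k * x))"
      by (rule has_ae_deriv_C1)
        (auto intro!: derivative_eq_intros continuous_intros simp: has_real_derivative_iff_has_vector_derivative[symmetric])
    note n = has_ae_deriv_bilinear[OF bounded_bilinear_inner derF derF]
    have F0: "F x = 0" if x: "x \<in> {0..l}" for x
    proof -
      have dn: "has_ae_deriv 0 x (\<lambda>x. exp (- k * x) * (F x \<bullet> F x))
          (\<lambda>x. exp (- k * x) * (F x \<bullet> G x + G x \<bullet> F x) + - k * exp (- k * x) * (F x \<bullet> F x))"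
        by (rule has_ae_deriv_subset[OF has_ae_deriv_bilinear[OF bounded_bilinear_mult e n]]) (use x in auto)
      have "exp (- k * x) * (F x \<bullet> G x + G x \<bullet> F x) + - k * exp (- k * x) * (F x \<bullet> F x) \<le> 0" for x
      proof -
        have "F x \<bullet> G x \<le> norm (F x) * norm (G x)" by (rule norm_cauchy_schwarz)
        also have "\<dots> = cmod c * (F x \<bullet> F x)"
          by (simp add: G_def norm_cmult_vec power2_norm_eq_inner[symmetric] power2_eq_square)
        finally have "F x \<bullet> G x + G x \<bullet> F x - k * (F x \<bullet> F x) \<le> 0"
          by (simp add: k_def inner_commute)
        then have "exp (- k * x) * (F x \<bullet> G x + G x \<bullet> F x - k * (F x \<bullet> F x)) \<le> 0"
          by (simp add: mult_nonneg_nonpos)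
        then show ?thesis by (simp add: algebra_simps)
      qed
      then have "exp (- k * x) * (F x \<bullet> F x) \<le> exp (- k * 0) * (F 0 \<bullet> F 0)"
        by (intro has_ae_deriv_le_0[OF dn] AE_I2) (use x in auto)
      moreover have "F 0 = 0" by (simp add: F_def)
      ultimately have "exp (- k * x) * (F x \<bullet> F x) \<le> 0" by simp
      then have "F x \<bullet> F x \<le> 0" by (simp add: mult_le_0_iff)
      then show ?thesis using inner_ge_zero[of "F x"] by (metis antisym inner_eq_zero_iff)
    qed
    from dF AE_mem show ?thesis by eventually_elim (simp add: F0)
  next
    case False
    then show ?thesis by (intro AE_I2) auto
  qed
qed

section \<open>The transformation operator\<close>

lemma bounded_bilinear_cmult_vec: "bounded_bilinear ((*s) :: complex \<Rightarrow> complex^'n::finite \<Rightarrow> _)"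
  by (intro bilinear_conv_bounded_bilinear[THEN iffD1])
    (auto simp: bilinear_def vector_add_ldistrib vector_sadd_rdistrib vec_eq_iff intro!: linearI)

lemmas continuous_on_cmult_vec = bounded_bilinear.continuous_on[OF bounded_bilinear_cmult_vec]

lemma has_ae_deriv_exp: "has_ae_deriv a b (\<lambda>x. exp (of_real x * c)) (\<lambda>x. exp (of_real x * c) * (c :: complex))"
  using exp_scaleR_has_vector_derivative_right[of c]
  by (intro has_ae_deriv_C1) (auto simp: scaleR_conv_of_real intro!: continuous_intros)

lemma matrix_vec_cmult: "A *v (c *s x) = c *s (A *v (x :: complex^'n::finite))"
  by (simp add: matrix_vector_mult_def vec_eq_iff sum_distrib_left algebra_simps)

lemma matrix_vec_columns: "A *v c = (\<Sum>j\<in>UNIV. c $ j *s column j (A :: complex^'n::finite^'m))"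
  by (simp add: matrix_vector_mult_def vec_eq_iff column_def mult.commute)

lemma cmult_vec_diff: "(a - b) + c *s (p - q) = (a + c *s p) - (b + c *s (q :: complex^'n::finite))"
  by (simp add: vec_eq_iff algebra_simps)

lemma vec_eq_inner: "(\<And>d. x \<bullet> d = y \<bullet> d) \<Longrightarrow> x = (y :: 'a::real_inner)"
  by (metis inner_diff_left inner_eq_zero_iff right_minus_eq)

lemma bounded_linear_left_block: "bounded_linear (left_block :: complex^('q::finite+'r::finite)^'p::finite \<Rightarrow> _)"
  and bounded_linear_right_block: "bounded_linear (right_block :: complex^('q::finite+'r::finite)^'p::finite \<Rightarrow> _)"
  unfolding linear_conv_bounded_linear[symmetric]
  by (auto intro!: linearI simp: left_block_def right_block_def vec_eq_iff)

lemma bounded_linear_column: "bounded_linear (column j :: complex^'q::finite^'p::finite \<Rightarrow> _)"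
  unfolding linear_conv_bounded_linear[symmetric]
  by (auto intro!: linearI simp: column_def vec_eq_iff)

lemmas continuous_on_column = bounded_linear.continuous_on[OF bounded_linear_column]

context dirac_system
begin

abbreviation \<gamma> where "\<gamma> \<equiv> gamma_of u"
abbreviation \<beta> where "\<beta> \<equiv> beta_of u"

lemma u_cont: "continuous_on {0..l} (\<lambda>x. u x z)"
  by (rule has_ae_deriv_cont[OF u_deriv])

lemma gamma_cont: "continuous_on {0..l} \<gamma>" and beta_cont: "continuous_on {0..l} \<beta>"
  unfolding gamma_of_def beta_of_def
  by (intro continuous_on_matrix_matrix continuous_intros u_cont)+

lemma gamma_0: "\<gamma> 0 = hcat 0 (mat 1)" and beta_0: "\<beta> 0 = hcat (mat 1) 0"
  by (simp_all add: gamma_of_def beta_of_def)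

text \<open>The transfer function: \<open>exp (- \<i> z x) [0 I] u(x,z) c\<close> solves \<open>(I - 2 z K) g = \<gamma> c\<close>.\<close>

lemma transfer_equation:
  fixes z :: complex and c :: "complex^('m1 + 'm2)"
  assumes x: "0 \<le> x"
  defines "g \<equiv> \<lambda>x. exp (of_real x * (- (\<i> * z))) *s lwr (u x z *v c)"
  shows "g x + (2 * \<i> * z) *s (\<gamma> x *v integral {0..x} (\<lambda>t. cadj (\<gamma> t) *v g t)) = \<gamma> x *v c"
proof -
  \<comment> \<open>The factor exp(a x) cancels the upper diagonal term \<i> z of the system and
    doubles the lower one to - 2 \<i> z.\<close>
  define a where "a = - (\<i> * z)"
  define Y where "Y x = exp (of_real x * a) *s (u x z *v c)" for x
  define Y' where "Y' x = exp (of_real x * a) *s rhs z x (u x z *v c) + (exp (of_real x * a) * a) *s (u x z *v c)" for x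
  have dY: "has_ae_deriv 0 x Y Y'"
    unfolding Y_def Y'_def
    by (rule has_ae_deriv_bilinear[OF bounded_bilinear_cmult_vec has_ae_deriv_exp solution_deriv])
  have gY: "g t = lwr (Y t)" for t by (simp add: g_def Y_def a_def)
  have contg: "continuous_on {0..x} g"
    unfolding gY using has_ae_deriv_cont[OF dY]
    by (rule continuous_on_lwr)
  define h where "h t = cadj (\<gamma> t) *v g t" for t
  have conth: "continuous_on {0..x} h"
    unfolding h_def by (intro continuous_on_matrix_vector contg
      continuous_on_cadj gamma_cont)
  define H where "H x = integral {0..x} h" for x
  have dH: "has_ae_deriv 0 x H h"
    unfolding H_def by (rule has_ae_deriv_C1[OF _ conth]) (use conth in \<open>auto intro: integral_has_vector_derivative\<close>)
  \<comment> \<open>Testing against solutions at parameter 0 removes v from the derivative. What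
    remains is a multiple of the lower blocks, exactly compensated by the derivative of H, so the
    sum is constant.\<close>
  have key: "Y x \<bullet> (u x 0 *v d) + ((2 * \<i> * z) *s H x) \<bullet> d = c \<bullet> d" for d
  proof -
    have dF: "has_ae_deriv 0 x (\<lambda>x. Y x \<bullet> (u x 0 *v d) + ((2 * \<i> * z) *s H x) \<bullet> d)
       (\<lambda>x. (Y x \<bullet> rhs 0 x (u x 0 *v d) + Y' x \<bullet> (u x 0 *v d)) + ((2 * \<i> * z) *s h x) \<bullet> d)"
      by (intro has_ae_deriv_add has_ae_deriv_bilinear[OF bounded_bilinear_inner] dY solution_deriv
        has_ae_deriv_bounded_linear[OF bounded_linear_inner_left]
        has_ae_deriv_bounded_linear[OF bounded_linear_cmult_vec] dH)
    have rY: "exp (of_real t * a) *s rhs z t (u t z *v c) = rhs z t (Y t)" for t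
      by (rule blocks_eqI)
        (simp_all add: Y_def matrix_vec_cmult vec_eq_iff algebra_simps)
    have z: "(Y t \<bullet> rhs 0 t (u t 0 *v d) + Y' t \<bullet> (u t 0 *v d)) + ((2 * \<i> * z) *s h t) \<bullet> d = 0" for t
    proof -
      define w where "w = u t 0 *v d"
      have y': "Y' t = rhs z t (Y t) + a *s Y t"
        unfolding Y'_def rY by (simp add: Y_def vector_smult_assoc mult.commute)
      have hd: "((2 * \<i> * z) *s h t) \<bullet> d = ((2 * \<i> * z) *s lwr (Y t)) \<bullet> lwr w"
        using inner_matrix_cadj[of "cadj (\<gamma> t)" "(2 * \<i> * z) *s g t" d]
        by (simp add: h_def matrix_vec_cmult gamma_of_vec w_def gY)
      have "Y t \<bullet> rhs 0 t w + Y' t \<bullet> w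
         = ((\<i> * z) *s upr (Y t)) \<bullet> upr w - ((\<i> * z) *s lwr (Y t)) \<bullet> lwr w + (a *s Y t) \<bullet> w"
        unfolding y' using inner_rhs[of "Y t" 0 t w z] by (simp add: inner_add_left)
      also have "(a *s Y t) \<bullet> w = - (((\<i> * z) *s upr (Y t)) \<bullet> upr w) - ((\<i> * z) *s lwr (Y t)) \<bullet> lwr w"
        by (simp add: inner_blocks[of _ w] a_def flip: inner_minus_left)
      finally have "Y t \<bullet> rhs 0 t w + Y' t \<bullet> w = - (2 * (((\<i> * z) *s lwr (Y t)) \<bullet> lwr w))" by simp
      moreover have "((2 * \<i> * z) *s lwr (Y t)) \<bullet> lwr w = 2 * (((\<i> * z) *s lwr (Y t)) \<bullet> lwr w)"
      proof -
        have "(2 * \<i> * z) *s lwr (Y t) = 2 *\<^sub>R ((\<i> * z) *s lwr (Y t))" by (simp add: vec_eq_iff scaleR_conv_of_real)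
        then show ?thesis by simp
      qed
      ultimately show ?thesis unfolding hd w_def[symmetric] by simp
    qed
    have "Y x \<bullet> (u x 0 *v d) + ((2 * \<i> * z) *s H x) \<bullet> d = Y 0 \<bullet> (u 0 0 *v d) + ((2 * \<i> * z) *s H 0) \<bullet> d"
      using has_ae_deriv_0[OF dF AE_I2[OF z], of x] x by simp
    then show ?thesis by (simp add: Y_def H_def)
  qed
  have "cadj (u x 0) *v Y x = c - (2 * \<i> * z) *s H x"
    by (rule vec_eq_inner) (use key inner_matrix_cadj[of "cadj (u x 0)" "Y x"] in
       \<open>simp add: inner_diff_left algebra_simps\<close>)
  moreover have "u x 0 *v (cadj (u x 0) *v Y x) = Y x"
    using u_inverse(2)[OF x, of 0] by (simp add: matrix_vector_mul_assoc)
  ultimately have "Y x = u x 0 *v c - (2 * \<i> * z) *s (u x 0 *v H x)"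
    by (simp add: matrix_vector_mult_diff_distrib matrix_vec_cmult)
  then have "g x = \<gamma> x *v c - (2 * \<i> * z) *s (\<gamma> x *v H x)"
    by (simp add: gY gamma_of_vec)
  then show ?thesis by (simp add: H_def h_def[abs_def])
qed

end

text \<open>One interval length with its operator E and inverse R. The function \<Phi> is common to
  all lengths, so the locale can be entered anew for each l while conclusions about \<Phi>
  accumulate.\<close>

locale dirac_similarity = dirac_system M v u
  for M v and u :: "real \<Rightarrow> complex \<Rightarrow> complex^('m1::finite + 'm2::finite)^('m1 + 'm2)" +
  fixes \<Phi> :: "real \<Rightarrow> complex^'m1^'m2" and l :: real and k :: "real \<Rightarrow> real \<Rightarrow> complex^'m2^'m2"
    and R :: "'m2 oper"
  assumes l_pos: "0 < l" and Phi_bd: "boundedly_diff l \<Phi>"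
    and sim: "similarity_op l \<gamma> k R"
    and R_gamma1: "AE x in Leb l. colwise R (\<lambda>t. left_block (\<gamma> t)) x = \<Phi> x"
begin

abbreviation "E \<equiv> volterra_op k"

lemma kernel: "bounded_kernel l k"
  and E_bdd: "L2_bounded_op l E" and R_bdd: "L2_bounded_op l R"
  and E_R: "\<And>f. f \<in> L2_on {0..l} \<Longrightarrow> AE x in Leb l. E (R f) x = f x"
  and R_E: "\<And>f. f \<in> L2_on {0..l} \<Longrightarrow> AE x in Leb l. R (E f) x = f x"
  and intertwine: "\<And>f. f \<in> L2_on {0..l} \<Longrightarrow> AE x in Leb l. K_op \<gamma> f x = E (A_op (R f)) x"
  and R_gamma2: "AE x in Leb l. colwise R (\<lambda>t. right_block (\<gamma> t)) x = mat 1"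
  using sim by (auto simp: similarity_op_def L2_inverse_def)

lemma kernel_bound:
  obtains C where "0 \<le> C" "\<And>x t w. 0 \<le> t \<Longrightarrow> t \<le> x \<Longrightarrow> x \<le> l \<Longrightarrow> norm (k x t *v w) \<le> C * norm w"
proof -
  obtain C where C: "\<And>x t. 0 \<le> t \<Longrightarrow> t \<le> x \<Longrightarrow> x \<le> l \<Longrightarrow> norm (k x t) \<le> C"
    using kernel unfolding bounded_kernel_def by blast
  have "norm (k x t *v w) \<le> max C 0 * norm w" if "0 \<le> t" "t \<le> x" "x \<le> l" for x t w
    by (rule order_trans[OF norm_matrix_vector_le mult_right_mono]) (use C[OF that] in \<open>auto simp: le_max_iff_disj\<close>)
  then show ?thesis by (intro that[of "max C 0"]) auto
qed

lemma Phi_deriv: "has_ae_deriv 0 l \<Phi> (\<lambda>x. vector_derivative \<Phi> (at x within {0..l}))"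
  by (rule boundedly_diff_has_ae_deriv[OF Phi_bd])

lemma Phi_cont: "continuous_on {0..l} \<Phi>"
  by (rule has_ae_deriv_cont[OF Phi_deriv])

lemma Phi_vec_cont: "continuous_on {0..l} (\<lambda>x. \<Phi> x *v c)"
  by (intro continuous_on_matrix_vector Phi_cont continuous_intros)

lemma E_colwise:
  fixes F \<Psi> :: "real \<Rightarrow> complex^'q::finite^'m2"
  assumes "continuous_on {0..l} F" "continuous_on {0..l} \<Psi>"
    and eq: "AE x in Leb l. colwise R F x = \<Psi> x"
  shows "AE x in Leb l. E (\<lambda>t. \<Psi> t *v c) x = F x *v c"
proof -
  have L2: "(\<lambda>t. column j (F t)) \<in> L2_on {0..l}" "(\<lambda>t. column j (\<Psi> t)) \<in> L2_on {0..l}" for j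
    using assms by (auto intro!: L2_on_continuous continuous_on_column)
  have col: "AE x in Leb l. E (\<lambda>t. column j (\<Psi> t)) x = column j (F x)" for j
  proof -
    have "AE x in Leb l. R (\<lambda>t. column j (F t)) x = column j (\<Psi> x)"
      using eq by eventually_elim (auto simp: colwise_def column_def vec_eq_iff)
    then have "AE x in Leb l. E (R (\<lambda>t. column j (F t))) x = E (\<lambda>t. column j (\<Psi> t)) x"
      by (intro L2_bounded_op_cong[OF E_bdd] L2 L2_bounded_op_L2[OF R_bdd])
    with E_R[OF L2(1)[of j]] show ?thesis by eventually_elim simp
  qed
  have "AE x in Leb l. E (\<lambda>t. c $ j *s column j (\<Psi> t)) x = c $ j *s column j (F x)" for j
    using L2_bounded_op_cmult[OF E_bdd L2(2)[of j], of "c $ j"] col[of j] by eventually_elim simp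
  then have "AE x in Leb l. \<forall>j\<in>UNIV. E (\<lambda>t. c $ j *s column j (\<Psi> t)) x = c $ j *s column j (F x)"
    by (subst AE_finite_all) auto
  moreover have "AE x in Leb l. E (\<lambda>t. \<Sum>j\<in>UNIV. c $ j *s column j (\<Psi> t)) x =
      (\<Sum>j\<in>UNIV. E (\<lambda>t. c $ j *s column j (\<Psi> t)) x)"
    by (intro L2_bounded_op_sum[OF E_bdd]) (auto intro!: L2_on_cmult L2)
  ultimately show ?thesis by eventually_elim (simp add: matrix_vec_columns)
qed

lemma E_const: "AE x in Leb l. E (\<lambda>t. c) x = \<gamma> x *v vjoin 0 c"
proof -
  have "continuous_on {0..l} (\<lambda>t. right_block (\<gamma> t))"
    by (rule bounded_linear.continuous_on[OF bounded_linear_right_block gamma_cont])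
  from E_colwise[OF this _ R_gamma2, of c] show ?thesis by (simp add: right_block_vec)
qed

lemma E_Phi: "AE x in Leb l. E (\<lambda>t. \<Phi> t *v c) x = \<gamma> x *v vjoin c 0"
proof -
  have "continuous_on {0..l} (\<lambda>t. left_block (\<gamma> t))"
    by (rule bounded_linear.continuous_on[OF bounded_linear_left_block gamma_cont])
  from E_colwise[OF this Phi_cont R_gamma1, of c] show ?thesis by (simp add: left_block_vec)
qed

lemma A_op_eq: "f \<in> L2_on {0..l} \<Longrightarrow> x \<le> l \<Longrightarrow> A_op f x = (- \<i>) *s integral {0..x} f"
  unfolding A_op_def by (subst lint_eq_integral(1)[OF L2_on_integrable]) auto

lemma A_op_L2: assumes "f \<in> L2_on {0..l}" shows "A_op f \<in> L2_on {0..l}"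
proof -
  have "f integrable_on {0..l}"
    using lint_eq_integral(2)[OF L2_on_integrable[OF assms]] by auto
  then have "continuous_on {0..l} (\<lambda>x. (- \<i>) *s integral {0..x} f)"
    by (intro bounded_linear.continuous_on[OF bounded_linear_cmult_vec] indefinite_integral_continuous_1)
  then have "continuous_on {0..l} (A_op f)"
    by (rule continuous_on_eq) (auto simp: A_op_eq[OF assms])
  then show ?thesis by (rule L2_on_continuous)
qed

text \<open>E turns (I - 2 z A) f = \<Phi> c1 + c2 into (I - 2 z K) E f = \<gamma> c with c =
  \<open>vjoin c1 c2\<close>, and \<open>transfer_equation\<close> supplies a solution of the
  latter.\<close>

lemma E_solution:
  assumes f: "continuous_on {0..l} f"
    and eq: "\<And>x. x \<in> {0..l} \<Longrightarrow> f x + (2 * \<i> * z) *s integral {0..x} f = \<Phi> x *v c1 + c2"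
  shows "AE x in Leb l. E f x = exp (of_real x * (- (\<i> * z))) *s lwr (u x z *v vjoin c1 c2)"
proof -
  define c where "c = vjoin c1 c2"
  define g where "g = (\<lambda>x. exp (of_real x * (- (\<i> * z))) *s lwr (u x z *v c))"
  have contg: "continuous_on {0..l} g"
    unfolding g_def
    by (intro continuous_on_cmult_vec continuous_intros
       continuous_on_lwr solution_cont)
  have g: "g \<in> L2_on {0..l}" and fL: "f \<in> L2_on {0..l}"
    using contg f by (auto intro: L2_on_continuous)
  \<comment> \<open>Uniqueness is easier before applying E: r and f satisfy the same scalar Volterra
    equation, so their difference solves the homogeneous one.\<close>
  define r where "r = R g"
  have r: "r \<in> L2_on {0..l}" unfolding r_def by (rule L2_bounded_op_L2[OF R_bdd g])
  have Er: "AE x in Leb l. E r x = g x" unfolding r_def by (rule E_R[OF g])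
  have Kg: "g x + (- (2 * z)) *s K_op \<gamma> g x = \<gamma> x *v c" if "x \<in> {0..l}" for x
  proof -
    have "continuous_on {0..l} (\<lambda>t. cadj (\<gamma> t) *v g t)"
      by (intro continuous_on_matrix_vector contg
        continuous_on_cadj gamma_cont)
    then have "(LINT t:{0..x}|lebesgue. cadj (\<gamma> t) *v g t) = integral {0..x} (\<lambda>t. cadj (\<gamma> t) *v g t)"
      using that by (intro lint_eq_integral(1)[where l=l] L2_on_integrable L2_on_continuous) auto
    then have "K_op \<gamma> g x = (- \<i>) *s (\<gamma> x *v integral {0..x} (\<lambda>t. cadj (\<gamma> t) *v g t))"
      by (simp add: K_op_def)
    then have "(- (2 * z)) *s K_op \<gamma> g x = (2 * \<i> * z) *s (\<gamma> x *v integral {0..x} (\<lambda>t. cadj (\<gamma> t) *v g t))"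
      by (simp add: vector_smult_assoc mult_ac)
    then show ?thesis
      using transfer_equation[of x z c] that by (simp add: g_def)
  qed
  have Ar: "A_op r \<in> L2_on {0..l}" by (rule A_op_L2[OF r])
  have cAr: "(\<lambda>x. (- (2 * z)) *s A_op r x) \<in> L2_on {0..l}" by (rule L2_on_cmult[OF Ar])
  have Phi: "(\<lambda>x. \<Phi> x *v c1) \<in> L2_on {0..l}" "(\<lambda>x. c2) \<in> L2_on {0..l}"
    by (auto intro!: L2_on_continuous continuous_on_matrix_vector Phi_cont)
  have L: "(\<lambda>x. r x + (- (2 * z)) *s A_op r x) \<in> L2_on {0..l}" "(\<lambda>x. \<Phi> x *v c1 + c2) \<in> L2_on {0..l}"
    by (intro L2_on_add r cAr Phi)+
  have "AE x in Leb l. E (\<lambda>x. r x + (- (2 * z)) *s A_op r x) x = E (\<lambda>x. \<Phi> x *v c1 + c2) x"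
    using L2_bounded_op_add[OF E_bdd r cAr] L2_bounded_op_cmult[OF E_bdd Ar, of "- (2 * z)"] Er
      intertwine[OF g] L2_bounded_op_add[OF E_bdd Phi] E_Phi[of c1] E_const[of c2] AE_mem
  proof eventually_elim
    case (elim x)
    have "K_op \<gamma> g x = E (A_op r) x" using elim by (simp only: r_def)
    then have "E (\<lambda>x. r x + (- (2 * z)) *s A_op r x) x = g x + (- (2 * z)) *s K_op \<gamma> g x"
      using elim by (simp only:)
    also have "\<dots> = \<gamma> x *v c" by (rule Kg) (use elim in auto)
    also have "c = vjoin c1 0 + vjoin 0 c2" by (simp add: c_def vjoin_add)
    also have "\<gamma> x *v \<dots> = E (\<lambda>x. \<Phi> x *v c1 + c2) x"
      using elim by (simp add: matrix_vector_right_distrib)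
    finally show ?case .
  qed
  then have "AE x in Leb l. R (E (\<lambda>x. r x + (- (2 * z)) *s A_op r x)) x = R (E (\<lambda>x. \<Phi> x *v c1 + c2)) x"
    by (intro L2_bounded_op_cong[OF R_bdd] L2_bounded_op_L2[OF E_bdd] L)
  then have rA: "AE x in Leb l. r x + (- (2 * z)) *s A_op r x = \<Phi> x *v c1 + c2"
    using R_E[OF L(1)] R_E[OF L(2)] by eventually_elim simp
  define d where "d x = r x - f x" for x
  have dL: "d \<in> L2_on {0..l}" unfolding d_def by (intro L2_on_diff r fL)
  have di: "integrable (Leb l) d" by (rule L2_on_integrable[OF dL]) auto
  have "AE x in Leb l. d x + (2 * \<i> * z) *s (LINT t:{0..x}|lebesgue. d t) = 0"
    using rA AE_mem
  proof eventually_elim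
    case (elim x)
    have e1: "(LINT t:{0..x}|lebesgue. d t) = integral {0..x} r - integral {0..x} f"
      using elim lint_eq_integral[OF di, of x] lint_eq_integral(2)[OF L2_on_integrable[OF r], of x]
        lint_eq_integral(2)[OF L2_on_integrable[OF fL], of x]
      by (simp add: d_def[abs_def] Henstock_Kurzweil_Integration.integral_diff)
    have e2: "(- (2 * z)) *s A_op r x = (2 * \<i> * z) *s integral {0..x} r"
      using elim A_op_eq[OF r] by (simp add: vector_smult_assoc mult_ac)
    have "d x + (2 * \<i> * z) *s (LINT t:{0..x}|lebesgue. d t)
       = (r x + (- (2 * z)) *s A_op r x) - (f x + (2 * \<i> * z) *s integral {0..x} f)"
      unfolding d_def[of x] e1 e2 by (rule cmult_vec_diff)
    then show ?case using eq[of x] elim by simp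
  qed
  then have "AE x in Leb l. d x = 0" by (rule volterra_integral_unique[OF di])
  then have "AE x in Leb l. r x = f x" by eventually_elim (simp add: d_def)
  then have "AE x in Leb l. E r x = E f x"
    by (rule L2_bounded_op_cong[OF E_bdd r fL])
  with Er show ?thesis by eventually_elim (simp add: g_def c_def)
qed

end

section \<open>The energy estimate\<close>

text \<open>The integral of exp(r t) over [0, s], including r = 0, so that coinciding exponents need
  no separate treatment later.\<close>

definition expint :: "real \<Rightarrow> real \<Rightarrow> real" where
  "expint r s = (if r = 0 then s else (exp (r * s) - 1) / r)"

lemma expint_mult: "r * expint r s = exp (r * s) - 1"
  by (simp add: expint_def)

lemma expint_deriv: "(expint r has_real_derivative exp (r * s)) (at s within S)"
  unfolding expint_def[abs_def]
  by (cases "r = 0") (auto intro!: derivative_eq_intros)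

lemma expint_integral:
  assumes "a \<le> b" shows "((\<lambda>t. exp (r * t)) has_integral (expint r b - expint r a)) {a..b}"
  using expint_deriv by (intro fundamental_theorem_of_calculus assms)
    (auto simp: has_real_derivative_iff_has_vector_derivative[symmetric])

abbreviation "weighted_sq l r f \<equiv> integral {0..l} (\<lambda>t. exp (- r * t) * (norm (f t))\<^sup>2)"

text \<open>Quadratic expressions in exponential sums integrate in closed form. The energy on a
  slice is therefore a finite sum and can be differentiated termwise, with no differentiation under
  the integral.\<close>

lemma double_sum_expint:
  assumes "finite K" "a \<le> b"
  shows "((\<lambda>t. exp (- c * t) * (\<Sum>k\<in>K. \<Sum>j\<in>K. exp (q k * t) * exp (q j * t) * w k j)) has_integral
     (\<Sum>k\<in>K. \<Sum>j\<in>K. w k j * (expint (q k + q j - c) b - expint (q k + q j - c) a))) {a..b}"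
proof -
  have "exp (- c * t) * (\<Sum>k\<in>K. \<Sum>j\<in>K. exp (q k * t) * exp (q j * t) * w k j)
      = (\<Sum>k\<in>K. \<Sum>j\<in>K. w k j * exp ((q k + q j - c) * t))" for t
  proof -
    have *: "exp (- c * t) * (exp (q k * t) * exp (q j * t) * w k j) = w k j * exp ((q k + q j - c) * t)" for k j
    proof -
      have "exp ((q k + q j - c) * t) = exp (- c * t) * (exp (q k * t) * exp (q j * t))"
        unfolding exp_add[symmetric] by (simp add: algebra_simps)
      then show ?thesis by simp
    qed
    show ?thesis unfolding sum_distrib_left by (intro sum.cong refl *)
  qed
  then show ?thesis
    using assms by (auto intro!: has_integral_sum has_integral_mult_right expint_integral)
qed

lemma inner_exp_sums:
  "(\<Sum>k\<in>K. \<Sum>j\<in>K. exp (q k * t) * exp (q j * t) * (p k \<bullet> r j)) =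
    (\<Sum>k\<in>K. exp (q k * t) *\<^sub>R p k) \<bullet> (\<Sum>j\<in>K. exp (q j * t) *\<^sub>R r j)"
  by (simp add: inner_sum_left inner_sum_right sum_distrib_left mult.assoc)
    (subst sum.swap, simp add: mult.left_commute)

context dirac_system
begin

text \<open>
  A sum of the solutions \<open>exp (q t) u(x, \<i> q / 2) c\<close> solves the hyperbolic system
  \<open>2 \<partial>\<^sub>x Y = - j \<partial>\<^sub>t Y + 2 j V Y\<close>. The estimate is its weighted energy balance on the triangle
  with vertices \<open>(0,0)\<close>, \<open>(0,l)\<close> and \<open>(l,l/2)\<close>.
\<close>

lemma energy_exp_sum:
  fixes K :: "'k set" and q :: "'k \<Rightarrow> real" and c :: "'k \<Rightarrow> complex^('m1 + 'm2)"
  assumes K: "finite K" and l: "0 \<le> l" and \<eta>: "M \<le> \<eta>"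
  defines "Y \<equiv> \<lambda>x t. \<Sum>k\<in>K. exp (q k * t) *\<^sub>R (u x (\<i> * of_real (q k) / 2) *v c k)"
  shows "weighted_sq l (4 * \<eta>) (\<lambda>t. lwr (Y 0 t))
       - weighted_sq l (4 * \<eta>) (\<lambda>t. upr (Y 0 t))
      \<le> weighted_sq l (2 * \<eta>) (\<lambda>x. lwr (Y x (x / 2)))"
proof -
  define z where "z k = \<i> * of_real (q k) / 2" for k
  define y where "y k x = u x (z k) *v c k" for k x
  \<comment> \<open>In the interior of the triangle the weight contributes - C/2 times the squared
    norm of Y, and the term with v at most 2 M times it. Hence C = 4 \<eta> with M \<le>
    \<eta>.\<close>
  define C where "C = 4 * \<eta>"
  have iz: "\<i> * z k = of_real (- q k / 2)" for k
    by (simp add: z_def algebra_simps)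
  have izs: "(\<i> * z k) *s w = (- q k / 2) *\<^sub>R w" for k and w :: "complex^'n::finite"
    unfolding iz vec_eq_iff vector_smult_component vector_scaleR_component by (simp only: scaleR_conv_of_real) simp
  have Y: "Y x t = (\<Sum>k\<in>K. exp (q k * t) *\<^sub>R y k x)" for x t
    by (simp add: Y_def y_def z_def)
  have upY: "upr (Y x t) = (\<Sum>k\<in>K. exp (q k * t) *\<^sub>R upr (y k x))"
    and lwY: "lwr (Y x t) = (\<Sum>k\<in>K. exp (q k * t) *\<^sub>R lwr (y k x))" for x t
    by (simp_all add: Y linear_sum[OF linear_upr] linear_sum[OF linear_lwr])
  have vlwY: "v x *v lwr (Y x t) = (\<Sum>k\<in>K. exp (q k * t) *\<^sub>R (v x *v lwr (y k x)))" for x t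
    by (simp add: lwY linear_sum[OF bounded_linear.linear[OF bounded_linear_matrix_vector]]
       matrix_vector_mult_scaleR_right)
  define uu where "uu x k j = upr (y k x) \<bullet> upr (y j x)" for x k j
  define ll where "ll x k j = lwr (y k x) \<bullet> lwr (y j x)" for x k j
  define V where "V x k j = upr (y k x) \<bullet> (v x *v lwr (y j x)) + upr (y j x) \<bullet> (v x *v lwr (y k x))" for x k j
  \<comment> \<open>Weighted integral over the slice x/2 \<le> t \<le> l - x/2 of the triangle;
    \<open>eR\<close> and \<open>eL\<close> are the weights at its two ends, which move inwards with
    speed 1/2.\<close>
  define I where "I x k j = expint (q k + q j - C) (l - x / 2) - expint (q k + q j - C) (x / 2)" for x k j
  define eR where "eR x k j = exp ((q k + q j - C) * (l - x / 2))" for x k j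
  define eL where "eL x k j = exp ((q k + q j - C) * (x / 2))" for x k j
  have dy: "has_ae_deriv 0 l (y k) (\<lambda>x. rhs (z k) x (y k x))" for k
    unfolding y_def by (rule solution_deriv)
  note duy = has_ae_deriv_bounded_linear[OF bounded_linear_upr dy]
   and dly = has_ae_deriv_bounded_linear[OF bounded_linear_lwr dy]
  have da: "has_ae_deriv 0 l (\<lambda>x. uu x k j - ll x k j)
     (\<lambda>x. - (q k + q j) / 2 * (uu x k j + ll x k j) + 2 * V x k j)" for k j
  proof -
    have a: "lwr p \<bullet> (cadj (v x) *v upr r) = upr r \<bullet> (v x *v lwr p)" for x p r
      using inner_matrix_cadj[of "v x" "lwr p" "upr r"] by (simp add: inner_commute)
    have "(upr (y k x) \<bullet> upr (rhs (z j) x (y j x)) + upr (rhs (z k) x (y k x)) \<bullet> upr (y j x))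
        - (lwr (y k x) \<bullet> lwr (rhs (z j) x (y j x)) + lwr (rhs (z k) x (y k x)) \<bullet> lwr (y j x))
      = - (q k + q j) / 2 * (uu x k j + ll x k j) + 2 * V x k j" for x
      unfolding upr_rhs lwr_rhs izs uu_def ll_def V_def
      using a[of "y k x" x "y j x"] a[of "y j x" x "y k x"]
      by (simp add: inner_add_left inner_add_right inner_diff_left inner_diff_right
         inner_commute[of "cadj (v x) *v upr (y k x)"] inner_commute[of "v x *v lwr (y k x)"] field_simps)
    then show ?thesis
      unfolding uu_def ll_def
      using has_ae_deriv_diff[OF has_ae_deriv_bilinear[OF bounded_bilinear_inner duy[of k] duy[of j]]
        has_ae_deriv_bilinear[OF bounded_bilinear_inner dly[of k] dly[of j]]]
      by (simp only: uu_def ll_def)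
  qed
  have dI: "has_ae_deriv 0 l (\<lambda>x. I x k j) (\<lambda>x. - (eR x k j + eL x k j) / 2)" for k j
  proof (rule has_ae_deriv_C1)
    fix x
    have "((\<lambda>x. I x k j) has_real_derivative (- (eR x k j + eL x k j) / 2)) (at x within {0..l})"
      unfolding I_def eR_def eL_def
      by (auto intro!: derivative_eq_intros DERIV_chain2[OF expint_deriv] simp: field_simps)
    then show "((\<lambda>x. I x k j) has_vector_derivative (- (eR x k j + eL x k j) / 2)) (at x within {0..l})"
      by (simp add: has_real_derivative_iff_has_vector_derivative)
  next
    show "continuous_on {0..l} (\<lambda>x. - (eR x k j + eL x k j) / 2)"
      unfolding eR_def eL_def by (intro continuous_intros) auto
  qed
  \<comment> \<open>The energy density on the left edge t = x/2, where the weight exp(- 4 \<eta> t)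
    becomes exp(- 2 \<eta> x).\<close>
  define \<psi> where "\<psi> x = exp (- (2 * \<eta>) * x) * (norm (lwr (Y x (x / 2))))\<^sup>2" for x
  have "continuous_on {0..l} (\<lambda>x. lwr (Y x (x / 2)))"
    unfolding lwY by (intro continuous_intros has_ae_deriv_cont[OF dly]) auto
  then have cont\<psi>: "continuous_on {0..l} \<psi>"
    unfolding \<psi>_def by (intro continuous_intros)
  have d\<psi>: "has_ae_deriv 0 l (\<lambda>x. integral {0..x} \<psi>) \<psi>"
    by (rule has_ae_deriv_C1[OF _ cont\<psi>]) (use cont\<psi> in \<open>auto intro: integral_has_vector_derivative\<close>)
  \<comment> \<open>The weighted integral of the indefinite form of Y over the slice at x. It
    vanishes at x = l, where the slice is a single point.\<close>
  define Q where "Q x = (\<Sum>k\<in>K. \<Sum>j\<in>K. (uu x k j - ll x k j) * I x k j)" for x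
  define Q' where "Q' x = (\<Sum>k\<in>K. \<Sum>j\<in>K. (uu x k j - ll x k j) * (- (eR x k j + eL x k j) / 2)
     + (- (q k + q j) / 2 * (uu x k j + ll x k j) + 2 * V x k j) * I x k j)" for x
  have dQ: "has_ae_deriv 0 l Q Q'"
    unfolding Q_def Q'_def
    by (intro has_ae_deriv_sum has_ae_deriv_bilinear[OF bounded_bilinear_mult] da dI)
  \<comment> \<open>The right edge contributes only the upper block and with a negative sign, the
    left edge only the lower block; the interior contribution is nonpositive by the choice of
    C.\<close>
  have bal: "Q' x \<le> \<psi> x" if x: "x \<in> {0..l}" for x
  proof -
    have ab: "x / 2 \<le> l - x / 2" using x by simp
    have term_eq: "(uu x k j - ll x k j) * (- (eR x k j + eL x k j) / 2)
       + (- (q k + q j) / 2 * (uu x k j + ll x k j) + 2 * V x k j) * I x k j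
       = - (uu x k j * eR x k j) + ll x k j * eL x k j + (2 * V x k j - C / 2 * (uu x k j + ll x k j)) * I x k j" for k j
    proof -
      have "(q k + q j - C) * I x k j = eR x k j - eL x k j"
        unfolding I_def eR_def eL_def right_diff_distrib expint_mult by simp
      then have e: "(q k + q j) * I x k j = eR x k j - eL x k j + C * I x k j" by (simp add: algebra_simps)
      have "(uu x k j - ll x k j) * (- (eR x k j + eL x k j) / 2)
       + (- (q k + q j) / 2 * (uu x k j + ll x k j) + 2 * V x k j) * I x k j
       = (uu x k j - ll x k j) * (- (eR x k j + eL x k j) / 2)
        - ((q k + q j) * I x k j) * (uu x k j + ll x k j) / 2 + 2 * V x k j * I x k j"
        by (simp add: algebra_simps add_divide_distrib diff_divide_distrib)
      also have "\<dots> = - (uu x k j * eR x k j) + ll x k j * eL x k j + (2 * V x k j - C / 2 * (uu x k j + ll x k j)) * I x k j"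
        unfolding e by (simp add: field_simps)
      finally show ?thesis .
    qed
    have ex: "exp ((q k + q j - C) * s) = exp (- C * s) * (exp (q k * s) * exp (q j * s))" for k j s
      unfolding exp_add[symmetric] by (simp add: algebra_simps)
    have S1: "(\<Sum>k\<in>K. \<Sum>j\<in>K. uu x k j * eR x k j) = exp (- C * (l - x / 2)) * (norm (upr (Y x (l - x / 2))))\<^sup>2"
      unfolding upY power2_norm_eq_inner inner_exp_sums[symmetric] sum_distrib_left uu_def eR_def ex
      by (intro sum.cong refl) (simp only: mult_ac)
    have S2: "(\<Sum>k\<in>K. \<Sum>j\<in>K. ll x k j * eL x k j) = \<psi> x"
    proof -
      have "\<psi> x = exp (- C * (x / 2)) * (norm (lwr (Y x (x / 2))))\<^sup>2" by (simp add: \<psi>_def C_def)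
      also have "\<dots> = (\<Sum>k\<in>K. \<Sum>j\<in>K. ll x k j * eL x k j)"
        unfolding lwY power2_norm_eq_inner inner_exp_sums[symmetric] sum_distrib_left ll_def eL_def ex
        by (intro sum.cong refl) (simp only: mult_ac)
      finally show ?thesis by (rule sym)
    qed
    have S3: "(\<Sum>k\<in>K. \<Sum>j\<in>K. (2 * V x k j - C / 2 * (uu x k j + ll x k j)) * I x k j) \<le> 0"
    proof -
      let ?D = "\<lambda>t W. \<Sum>k\<in>K. \<Sum>j\<in>K. exp (q k * t) * exp (q j * t) * W k j"
      let ?W = "\<lambda>k j. 2 * V x k j - C / 2 * (uu x k j + ll x k j)"
      have "?D t ?W \<le> 0" for t
      proof -
        have V: "?D t (V x) = 2 * ((v x *v lwr (Y x t)) \<bullet> upr (Y x t))"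
        proof -
          have "?D t (V x)
             = ?D t (\<lambda>k j. upr (y k x) \<bullet> (v x *v lwr (y j x)))
              + ?D t (\<lambda>k j. upr (y j x) \<bullet> (v x *v lwr (y k x)))"
            by (simp add: V_def distrib_left sum.distrib)
          also have "?D t (\<lambda>k j. upr (y j x) \<bullet> (v x *v lwr (y k x)))
             = ?D t (\<lambda>k j. (v x *v lwr (y k x)) \<bullet> upr (y j x))"
            by (simp add: inner_commute)
          finally show ?thesis
            unfolding inner_exp_sums upY[symmetric] vlwY[symmetric] by (simp add: inner_commute)
        qed
        have s: "?D t (\<lambda>k j. uu x k j + ll x k j) = (norm (Y x t))\<^sup>2"
          unfolding norm_blocks[of "Y x t"] unfolding upY lwY power2_norm_eq_inner inner_exp_sums[symmetric]
          by (simp add: uu_def ll_def distrib_left sum.distrib)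
        have "?D t ?W
          = 2 * ?D t (V x)
           - C / 2 * ?D t (\<lambda>k j. uu x k j + ll x k j)"
          unfolding sum_distrib_left sum_subtractf[symmetric]
          by (intro sum.cong refl) (simp add: right_diff_distrib mult_ac)
        also have "\<dots> = 4 * ((v x *v lwr (Y x t)) \<bullet> upr (Y x t)) - 2 * \<eta> * (norm (Y x t))\<^sup>2"
          unfolding V s by (simp add: C_def)
        also have "\<dots> \<le> 2 * M * (norm (Y x t))\<^sup>2 - 2 * \<eta> * (norm (Y x t))\<^sup>2"
          using v_form_le[of x "lwr (Y x t)" "upr (Y x t)"] x
          unfolding norm_blocks[of "Y x t"] by simp
        also have "\<dots> \<le> 0" using \<eta> by (simp add: mult_right_mono)
        finally show ?thesis .
      qed
      then have "exp (- C * t) * ?D t ?W \<le> 0" for t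
        by (simp add: mult_nonneg_nonpos)
      from has_integral_le[OF double_sum_expint[OF K ab] has_integral_0 this]
      show ?thesis unfolding I_def by simp
    qed
    have "Q' x = - (\<Sum>k\<in>K. \<Sum>j\<in>K. uu x k j * eR x k j) + (\<Sum>k\<in>K. \<Sum>j\<in>K. ll x k j * eL x k j)
        + (\<Sum>k\<in>K. \<Sum>j\<in>K. (2 * V x k j - C / 2 * (uu x k j + ll x k j)) * I x k j)"
      unfolding Q'_def term_eq sum.distrib sum_negf by simp
    also have "\<dots> \<le> \<psi> x"
    proof -
      have "0 \<le> exp (- C * (l - x / 2)) * (norm (upr (Y x (l - x / 2))))\<^sup>2" by simp
      then show ?thesis unfolding S1 S2 using S3 by linarith
    qed
    finally show ?thesis .
  qed
  have dH: "has_ae_deriv 0 l (\<lambda>x. Q x - integral {0..x} \<psi>) (\<lambda>x. Q' x - \<psi> x)"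
    by (rule has_ae_deriv_diff[OF dQ d\<psi>])
  have "AE x in Leb l. Q' x - \<psi> x \<le> 0"
    by (rule AE_I2) (use bal in auto)
  from has_ae_deriv_le_0[OF dH this l]
  have "Q l - integral {0..l} \<psi> \<le> Q 0" by simp
  moreover have "Q l = 0" by (simp add: Q_def I_def)
  moreover have "Q 0 = integral {0..l} (\<lambda>t. exp (- C * t) * (norm (upr (Y 0 t)))\<^sup>2)
       - integral {0..l} (\<lambda>t. exp (- C * t) * (norm (lwr (Y 0 t)))\<^sup>2)"
  proof -
    have "(\<Sum>k\<in>K. \<Sum>j\<in>K. uu 0 k j * I 0 k j) = integral {0..l} (\<lambda>t. exp (- C * t) * (norm (upr (Y 0 t)))\<^sup>2)"
      using integral_unique[OF double_sum_expint[OF K l, of C q "uu 0"]]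
      unfolding upY power2_norm_eq_inner inner_exp_sums[symmetric] by (simp add: I_def uu_def)
    moreover have "(\<Sum>k\<in>K. \<Sum>j\<in>K. ll 0 k j * I 0 k j) = integral {0..l} (\<lambda>t. exp (- C * t) * (norm (lwr (Y 0 t)))\<^sup>2)"
      using integral_unique[OF double_sum_expint[OF K l, of C q "ll 0"]]
      unfolding lwY power2_norm_eq_inner inner_exp_sums[symmetric] by (simp add: I_def ll_def)
    ultimately show ?thesis by (simp add: Q_def left_diff_distrib sum_subtractf)
  qed
  ultimately show ?thesis by (simp add: C_def \<psi>_def[abs_def])
qed

end

text \<open>Substituting s = exp t turns sums of exponentials with natural exponents into
  polynomials on [1, exp l], where Stone-Weierstrass applies. An index consists of a basis vector
  and a degree.\<close>

lemma exp_sum_dense: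
  fixes f :: "real \<Rightarrow> 'a::euclidean_space"
  assumes f: "continuous_on {0..l} f" and e: "e > 0"
  shows "\<exists>(K :: ('a \<times> nat) set) q c. finite K \<and> (\<forall>t\<in>{0..l}. norm ((\<Sum>k\<in>K. exp (q k * t) *\<^sub>R c k) - f t) < e)"
proof -
  have "continuous_on {1..exp l} (f \<circ> ln)"
  proof (rule continuous_on_compose)
    show "continuous_on {1..exp l} (ln :: real \<Rightarrow> real)" by (intro continuous_intros) auto
    have "ln ` {1..exp l} \<subseteq> {0..l}"
    proof safe
      fix x assume "x \<in> {1..exp l}"
      then show "ln x \<in> {0..l}" using ln_le_cancel_iff[of x "exp l"] by auto
    qed
    then show "continuous_on (ln ` {1..exp l}) f" using f continuous_on_subset by blast
  qed
  then obtain p where p: "polynomial_function p" and pf: "\<And>x. x \<in> {1..exp l} \<Longrightarrow> norm ((f \<circ> ln) x - p x) < e"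
    using Stone_Weierstrass_polynomial_function[of "{1..exp l}" "f \<circ> ln" e] e by auto
  have "\<forall>b\<in>Basis. real_polynomial_function (\<lambda>x. p x \<bullet> b)"
    using p by (simp add: polynomial_function_iff_Basis_inner)
  then have "\<forall>b\<in>Basis. \<exists>an :: (nat \<Rightarrow> real) \<times> nat. (\<lambda>x. p x \<bullet> b) = (\<lambda>x. \<Sum>i\<le>snd an. fst an i * x ^ i)"
    by (simp add: real_polynomial_function_iff_sum)
  then obtain an where an0: "\<forall>b\<in>Basis. (\<lambda>x. p x \<bullet> b) = (\<lambda>x. \<Sum>i\<le>snd (an b). fst (an b) i * x ^ i)"
    by (rule bchoice[THEN exE])
  define a where "a b = fst (an b)" for b
  define n where "n b = snd (an b)" for b
  have an: "p x \<bullet> b = (\<Sum>i\<le>n b. a b i * x ^ i)" if "b \<in> Basis" for b x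
    using fun_cong[OF an0[rule_format, OF that]] by (simp add: a_def n_def)
  define K where "K = (SIGMA b:(Basis :: 'a set). {..n b})"
  define c where "c k = (case k of (b, i) \<Rightarrow> a b i *\<^sub>R b)" for k :: "'a \<times> nat"
  have eq: "(\<Sum>k\<in>K. exp (real (snd k) * t) *\<^sub>R c k) = p (exp t)" for t
  proof -
    have "(\<Sum>k\<in>K. exp (real (snd k) * t) *\<^sub>R c k) = (\<Sum>(b, i)\<in>K. (a b i * exp t ^ i) *\<^sub>R b)"
      by (intro sum.cong refl) (auto simp: c_def exp_of_nat_mult[symmetric] mult.commute)
    also have "\<dots> = (\<Sum>b\<in>Basis. \<Sum>i\<le>n b. (a b i * exp t ^ i) *\<^sub>R b)"
      unfolding K_def by (rule sum.Sigma[symmetric]) auto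
    also have "\<dots> = (\<Sum>b\<in>Basis. (p (exp t) \<bullet> b) *\<^sub>R b)"
      by (intro sum.cong refl) (simp add: an scaleR_sum_left)
    finally show ?thesis by (simp add: euclidean_representation)
  qed
  have "norm ((\<Sum>k\<in>K. exp (real (snd k) * t) *\<^sub>R c k) - f t) < e" if "t \<in> {0..l}" for t
    using pf[of "exp t"] that unfolding eq by (simp add: norm_minus_commute)
  moreover have "finite K" by (simp add: K_def)
  ultimately show ?thesis by (intro exI[of _ K] exI[of _ "\<lambda>k. real (snd k)"] exI[of _ c]) blast
qed

text \<open>If the integrand is not integrable, the integral is 0 by convention and the bound still
  holds. Estimates for E thus require no measurability of sections of the kernel.\<close>

lemma norm_lint_le:
  fixes f :: "real \<Rightarrow> 'a::euclidean_space"
  assumes "\<And>t. t \<in> {0..x} \<Longrightarrow> norm (f t) \<le> B" "0 \<le> x" "0 \<le> B"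
  shows "norm (LINT t:{0..x}|lebesgue. f t) \<le> B * x"
proof (cases "set_integrable lebesgue {0..x} f")
  case True
  have "norm (LINT t:{0..x}|lebesgue. f t) = norm (integral {0..x} f)"
    using set_lebesgue_integral_eq_integral(2)[OF True] by simp
  also have "\<dots> \<le> B * (x - 0)"
    using has_integral_bound_real[OF assms(3) finite.emptyI integrable_integral[OF set_lebesgue_integral_eq_integral(1)[OF True]]]
      assms by simp
  finally show ?thesis by simp
next
  case False
  then have "(LINT t:{0..x}|lebesgue. f t) = 0"
    by (simp add: set_integrable_def set_lebesgue_integral_def not_integrable_integral_eq)
  then show ?thesis using assms by simp
qed

lemma weighted_integral_tendsto:
  fixes F :: "nat \<Rightarrow> real \<Rightarrow> 'a::euclidean_space"
  assumes cont: "\<And>n. continuous_on {0..l} (F n)" "continuous_on {0..l} G" "continuous_on {0..l} w"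
    and close: "\<And>n. AE x in Leb l. norm (F n x - G x) \<le> C / real (Suc n)"
  shows "(\<lambda>n. integral {0..l} (\<lambda>x. w x * (norm (F n x))\<^sup>2)) \<longlonglongrightarrow> integral {0..l} (\<lambda>x. w x * (norm (G x))\<^sup>2)"
proof -
  let ?M = "Leb l"
  have int: "integrable ?M h" if "continuous_on {0..l} h" for h :: "real \<Rightarrow> real"
    using L2_on_integrable[OF L2_on_continuous[OF that]] by simp
  have eq: "integral {0..l} h = integral\<^sup>L ?M h" if "continuous_on {0..l} h" for h :: "real \<Rightarrow> real"
    using lebesgue_integral_eq_integral[OF int[OF that]] by simp
  have c1: "continuous_on {0..l} (\<lambda>x. w x * (norm (F n x))\<^sup>2)" for n
    using cont by (intro continuous_intros) auto
  have c2: "continuous_on {0..l} (\<lambda>x. w x * (norm (G x))\<^sup>2)"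
    using cont by (intro continuous_intros) auto
  define D where "D = max C 0"
  \<comment> \<open>One null set for all n at once; the bounds themselves hold only almost
    everywhere, as identities for E do.\<close>
  have cl: "AE x in ?M. \<forall>n. norm (F n x - G x) \<le> D / real (Suc n)"
    unfolding AE_all_countable
  proof
    fix n show "AE x in ?M. norm (F n x - G x) \<le> D / real (Suc n)"
      using close[of n] by eventually_elim (erule order_trans, simp add: D_def divide_right_mono)
  qed
  have D0: "(\<lambda>n. D / real (Suc n)) \<longlonglongrightarrow> 0"
    using tendsto_mult_left[OF LIMSEQ_inverse_real_of_nat, of D] by (simp add: divide_inverse)
  have "(\<lambda>n. integral\<^sup>L ?M (\<lambda>x. w x * (norm (F n x))\<^sup>2)) \<longlonglongrightarrow> integral\<^sup>L ?M (\<lambda>x. w x * (norm (G x))\<^sup>2)"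
  proof (rule integral_dominated_convergence[where w = "\<lambda>x. \<bar>w x\<bar> * (norm (G x) + D)\<^sup>2"])
    show "integrable ?M (\<lambda>x. \<bar>w x\<bar> * (norm (G x) + D)\<^sup>2)"
      using cont by (intro int continuous_intros) auto
    show "AE x in ?M. (\<lambda>n. w x * (norm (F n x))\<^sup>2) \<longlonglongrightarrow> w x * (norm (G x))\<^sup>2"
      using cl
    proof eventually_elim
      case (elim x)
      have "(\<lambda>n. F n x - G x) \<longlonglongrightarrow> 0"
        by (rule Lim_null_comparison[OF _ D0]) (use elim in auto)
      then have "(\<lambda>n. F n x) \<longlonglongrightarrow> G x" by (simp add: LIM_zero_iff)
      then show ?case by (intro tendsto_intros)
    qed
    fix n
    show "AE x in ?M. norm (w x * (norm (F n x))\<^sup>2) \<le> \<bar>w x\<bar> * (norm (G x) + D)\<^sup>2"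
      using cl
    proof eventually_elim
      case (elim x)
      have "norm (F n x) \<le> norm (G x) + norm (F n x - G x)"
        by (metis add.commute diff_add_cancel norm_triangle_ineq)
      also have "norm (F n x - G x) \<le> D / real (Suc n)" using elim by blast
      also have "D / real (Suc n) \<le> D" by (simp add: D_def divide_le_eq mult_le_cancel_left1)
      finally have "(norm (F n x))\<^sup>2 \<le> (norm (G x) + D)\<^sup>2" by (intro power_mono) auto
      then show ?case by (simp add: abs_mult mult_left_mono)
    qed
  qed (use int[OF c1] int[OF c2] in auto)
  then show ?thesis by (simp add: eq c1 c2)
qed

context dirac_similarity
begin

text \<open>Uniform approximation of f carries over to E f. The constant depends on l, but it
  multiplies an error that tends to 0 and leaves no trace in the energy estimate.\<close>

lemma E_sup_bound:
  "\<exists>C\<ge>0. \<forall>h B. 0 \<le> B \<longrightarrow> (\<forall>t\<in>{0..l}. norm (h t) \<le> B) \<longrightarrow> (\<forall>x\<in>{0..l}. norm (E h x) \<le> C * B)"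
proof -
  obtain C0 where C0: "0 \<le> C0" "\<And>x t w. 0 \<le> t \<Longrightarrow> t \<le> x \<Longrightarrow> x \<le> l \<Longrightarrow> norm (k x t *v w) \<le> C0 * norm w"
    by (rule kernel_bound) blast
  show ?thesis
  proof (intro exI[of _ "1 + C0 * l"] conjI allI impI ballI)
    show "0 \<le> 1 + C0 * l" using C0(1) l_pos by simp
    fix h :: "real \<Rightarrow> complex^'m2" and B x assume h: "\<forall>t\<in>{0..l}. norm (h t) \<le> B" "0 \<le> B" and x: "x \<in> {0..l}"
    have "norm (LINT t:{0..x}|lebesgue. k x t *v h t) \<le> (C0 * B) * x"
      by (rule norm_lint_le) (use x h C0 in \<open>auto intro!: order_trans[OF C0(2)] mult_left_mono\<close>)
    also have "\<dots> \<le> (C0 * B) * l" using x h C0(1) by (intro mult_left_mono) auto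
    finally show "norm (E h x) \<le> (1 + C0 * l) * B"
      using h(1)[rule_format, OF x] unfolding volterra_op_def
      by (intro order_trans[OF norm_triangle_ineq]) (simp add: algebra_simps)
  qed
qed

text \<open>With z = \<i> q / 2 the function exp(q t) c solves the integral equation of
  \<open>E_solution\<close> with c1 = 0. The result is the lower block of the separated hyperbolic
  solution read off on the edge t = x/2.\<close>

lemma E_exp: "AE x in Leb l. E (\<lambda>t. exp (q * t) *\<^sub>R c) x
    = exp (q * (x / 2)) *\<^sub>R lwr (u x (\<i> * of_real q / 2) *v vjoin 0 c)"
proof -
  define z where "z = \<i> * of_real q / 2"
  have z2: "2 * \<i> * z = of_real (- q)" by (simp add: z_def algebra_simps)
  have e: "of_real x * (- (\<i> * z)) = of_real (q * (x / 2))" for x by (simp add: z_def algebra_simps)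
  have s: "of_real a *s w = a *\<^sub>R w" for a and w :: "complex^'n::finite"
    unfolding vec_eq_iff vector_smult_component vector_scaleR_component by (simp only: scaleR_conv_of_real) simp
  have "AE x in Leb l. E (\<lambda>t. exp (q * t) *\<^sub>R c) x
      = exp (of_real x * (- (\<i> * z))) *s lwr (u x z *v vjoin 0 c)"
  proof (rule E_solution)
    show "continuous_on {0..l} (\<lambda>t. exp (q * t) *\<^sub>R c)" by (intro continuous_intros)
    fix x assume x: "x \<in> {0..l}"
    have "((\<lambda>t. exp (q * t) *\<^sub>R c) has_integral (expint q x - expint q 0) *\<^sub>R c) {0..x}"
      using x by (intro has_integral_scaleR_left expint_integral) auto
    then have "integral {0..x} (\<lambda>t. exp (q * t) *\<^sub>R c) = expint q x *\<^sub>R c"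
      by (simp add: integral_unique expint_def)
    then have "(2 * \<i> * z) *s integral {0..x} (\<lambda>t. exp (q * t) *\<^sub>R c) = - ((q * expint q x) *\<^sub>R c)"
      unfolding z2 s by simp
    then show "exp (q * x) *\<^sub>R c + (2 * \<i> * z) *s integral {0..x} (\<lambda>t. exp (q * t) *\<^sub>R c) = \<Phi> x *v 0 + c"
      unfolding expint_mult by (simp add: algebra_simps)
  qed
  then show ?thesis unfolding e exp_of_real s unfolding z_def .
qed

text \<open>By \<open>E_exp\<close> the left side of the hypothesis on g is, for an exponential sum
  f, the trace of a hyperbolic solution on the edge t = x/2, so the triangle balance applies;
  uniform approximation gives the general case. The weights are explicit and the kernel of E does
  not appear.\<close>

theorem energy_estimate:
  assumes f: "continuous_on {0..l} f" and g: "continuous_on {0..l} g" and \<eta>: "M \<le> \<eta>"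
    and Ef: "AE x in Leb l. E f x + \<gamma> x *v vjoin c0 0 = g x"
  shows "weighted_sq l (4 * \<eta>) f
     \<le> weighted_sq l (4 * \<eta>) (\<lambda>t. c0)
      + weighted_sq l (2 * \<eta>) g"
proof -
  obtain C where C: "C \<ge> 0" "\<And>h B x. 0 \<le> B \<Longrightarrow> (\<forall>t\<in>{0..l}. norm (h t) \<le> B) \<Longrightarrow> x \<in> {0..l} \<Longrightarrow> norm (E h x) \<le> C * B"
    using E_sup_bound by blast
  define P where "P n F G \<longleftrightarrow> continuous_on {0..l} F \<and> continuous_on {0..l} G \<and>
       (\<forall>t\<in>{0..l}. norm (F t - f t) \<le> 1 / real (Suc n)) \<and>
       (AE x in Leb l. norm (G x - g x) \<le> C / real (Suc n)) \<and>
       weighted_sq l (4 * \<eta>) F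
       \<le> weighted_sq l (4 * \<eta>) (\<lambda>t. c0)
        + weighted_sq l (2 * \<eta>) G" for n F G
  have "\<exists>FG. P n (fst FG) (snd FG)" for n
  proof -
    obtain K :: "((complex^'m2) \<times> nat) set" and q c where K: "finite K" and
      ap: "\<forall>t\<in>{0..l}. norm ((\<Sum>k\<in>K. exp (q k * t) *\<^sub>R c k) - f t) < 1 / real (Suc n)"
      using exp_sum_dense[OF f, of "1 / real (Suc n)"] by (auto simp del: of_nat_Suc)
    define F where "F t = (\<Sum>k\<in>K. exp (q k * t) *\<^sub>R c k)" for t
    \<comment> \<open>The extra index \<open>None\<close> has exponent 0 and initial vector
      \<open>vjoin c0 0\<close>: it adds c0 to the upper block at x = 0 and the first block column
      of \<gamma>, applied to c0, to the trace on the edge.\<close>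
    define q' where "q' = case_option 0 q"
    define c' where "c' = case_option (vjoin c0 0) (\<lambda>k. vjoin 0 (c k))"
    define L where "L = insert None (Some ` K)"
    define G where "G x = lwr (\<Sum>k\<in>L. exp (q' k * (x / 2)) *\<^sub>R (u x (\<i> * of_real (q' k) / 2) *v c' k))" for x
    have finL: "finite L" using K by (simp add: L_def)
    have sumL: "(\<Sum>k\<in>L. h k) = h None + (\<Sum>k\<in>K. h (Some k))" for h :: "_ \<Rightarrow> 'z::comm_monoid_add"
      unfolding L_def using K by (subst sum.insert) (auto simp: sum.reindex)
    have cF: "continuous_on {0..l} F" unfolding F_def by (intro continuous_intros)
    have cG: "continuous_on {0..l} G"
      unfolding G_def
      by (intro continuous_on_lwr continuous_intros solution_cont) auto
    have L2: "(\<lambda>t. exp (q k * t) *\<^sub>R c k) \<in> L2_on {0..l}" for k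
      by (intro L2_on_continuous continuous_intros)
    have FL: "F \<in> L2_on {0..l}" "f \<in> L2_on {0..l}" using cF f by (auto intro: L2_on_continuous)
    have "AE x in Leb l. \<forall>k\<in>K. E (\<lambda>t. exp (q k * t) *\<^sub>R c k) x
       = exp (q k * (x / 2)) *\<^sub>R lwr (u x (\<i> * of_real (q k) / 2) *v vjoin 0 (c k))"
      using K E_exp by (subst AE_finite_all) auto
    moreover have "AE x in Leb l. E F x = (\<Sum>k\<in>K. E (\<lambda>t. exp (q k * t) *\<^sub>R c k) x)"
      unfolding F_def by (rule L2_bounded_op_sum[OF E_bdd L2 K])
    ultimately have EF: "AE x in Leb l. E F x + \<gamma> x *v vjoin c0 0 = G x"
    proof eventually_elim
      case (elim x)
      show ?case
        unfolding G_def sumL linear_sum[OF linear_lwr] lwr_simps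
        using elim by (simp add: q'_def c'_def gamma_of_vec linear_sum[OF linear_lwr])
    qed
    have ED: "AE x in Leb l. E (\<lambda>t. F t + (- 1) *s f t) x = E F x + (- 1) *s E f x"
      using L2_bounded_op_add[OF E_bdd FL(1) L2_on_cmult[OF FL(2), of "- 1"]]
         L2_bounded_op_cmult[OF E_bdd FL(2), of "- 1"] by eventually_elim simp
    have "AE x in Leb l. norm (G x - g x) \<le> C / real (Suc n)"
      using EF Ef ED AE_mem
    proof eventually_elim
      case (elim x)
      have "G x - g x = E (\<lambda>t. F t + (- 1) *s f t) x"
        using elim by (simp add: vec_eq_iff) (metis add_diff_cancel_right)
      also have "norm \<dots> \<le> C * (1 / real (Suc n))"
      proof (rule C(2), simp, rule ballI)
        fix t assume "t \<in> {0..l}"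
        from ap[rule_format, OF this] show "norm (F t + (- 1) *s f t) \<le> 1 / real (Suc n)"
          by (simp add: F_def del: of_nat_Suc)
      qed (use elim in auto)
      finally show ?case by simp
    qed
    moreover have "weighted_sq l (4 * \<eta>) F
       \<le> weighted_sq l (4 * \<eta>) (\<lambda>t. c0)
        + weighted_sq l (2 * \<eta>) G"
    proof -
      have lw: "lwr (\<Sum>k\<in>L. exp (q' k * t) *\<^sub>R (u 0 (\<i> * of_real (q' k) / 2) *v c' k)) = F t" for t
        by (simp add: sumL linear_sum[OF linear_lwr] F_def q'_def c'_def)
      have up: "upr (\<Sum>k\<in>L. exp (q' k * t) *\<^sub>R (u 0 (\<i> * of_real (q' k) / 2) *v c' k)) = c0" for t
        by (simp add: sumL linear_sum[OF linear_upr] q'_def c'_def)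
      show ?thesis
        using energy_exp_sum[OF finL _ \<eta>, of l q' c'] l_pos unfolding lw up G_def[symmetric] by linarith
    qed
    moreover have "\<forall>t\<in>{0..l}. norm (F t - f t) \<le> 1 / real (Suc n)"
      using ap unfolding F_def by (auto intro: less_imp_le simp del: of_nat_Suc)
    ultimately have "P n F G" using cF cG by (simp add: P_def)
    then show ?thesis by (intro exI[of _ "(F, G)"]) simp
  qed
  then obtain FG where "\<And>n. P n (fst (FG n)) (snd (FG n))" by metis
  then have "\<exists>F G. \<forall>n. P n (F n) (G n)"
    by (intro exI[of _ "\<lambda>n. fst (FG n)"] exI[of _ "\<lambda>n. snd (FG n)"]) simp
  then obtain F G where "\<And>n. P n (F n) (G n)" by metis
  then have FG: "\<And>n. continuous_on {0..l} (F n)" "\<And>n. continuous_on {0..l} (G n)"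
       "\<And>n t. t \<in> {0..l} \<Longrightarrow> norm (F n t - f t) \<le> 1 / real (Suc n)"
       "\<And>n. AE x in Leb l. norm (G n x - g x) \<le> C / real (Suc n)"
       "\<And>n. weighted_sq l (4 * \<eta>) (F n)
       \<le> weighted_sq l (4 * \<eta>) (\<lambda>t. c0)
        + weighted_sq l (2 * \<eta>) (G n)"
    unfolding P_def by blast+
  show ?thesis
  proof (rule LIMSEQ_le)
    show "(\<lambda>n. weighted_sq l (4 * \<eta>) (F n)) \<longlonglongrightarrow>
        weighted_sq l (4 * \<eta>) f"
      using FG(3) by (intro weighted_integral_tendsto[where C = 1] FG(1) f continuous_intros AE_I2) auto
    show "(\<lambda>n. weighted_sq l (4 * \<eta>) (\<lambda>t. c0)
        + weighted_sq l (2 * \<eta>) (G n)) \<longlonglongrightarrow>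
       weighted_sq l (4 * \<eta>) (\<lambda>t. c0)
        + weighted_sq l (2 * \<eta>) g"
      by (intro tendsto_intros weighted_integral_tendsto[where C = C] FG(2,4) g continuous_intros)
  qed (use FG(5) in auto)
qed

end

section \<open>The Weyl function as a Laplace transform\<close>

abbreviation "wave z x \<equiv> exp (2 * \<i> * of_real x * z)"

section \<open>Integrals over the half-line\<close>

lemma continuous_on_halfline:
  fixes f :: "real \<Rightarrow> 'a::topological_space"
  assumes "\<And>l. l > 0 \<Longrightarrow> continuous_on {0..l} f"
  shows "continuous_on {0..} f"
  unfolding continuous_on_eq_continuous_within
proof
  fix x :: real assume x: "x \<in> {0..}"
  have "at x within {0..} = at x within {0..x + 1}"
    by (rule at_within_nhd[of x "{..<x + 1}"]) auto
  moreover have "continuous (at x within {0..x + 1}) f"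
    using assms[of "x + 1"] x by (simp add: continuous_on_eq_continuous_within)
  ultimately show "continuous (at x within {0..}) f" by (simp add: continuous_within)
qed

lemma integrable_halfline:
  fixes h :: "real \<Rightarrow> real"
  assumes cont: "continuous_on {0..} h" and pos: "\<And>x. 0 \<le> x \<Longrightarrow> 0 \<le> h x"
    and B: "\<And>n. integral {0..real n} h \<le> B"
  shows "integrable (lebesgue_on {0..}) h"
proof -
  have ion: "h integrable_on {0..a}" for a
    using continuous_on_subset[OF cont] by (intro integrable_continuous_real) auto
  define f where "f n x = (if x \<in> {0..real n} then h x else 0)" for n x
  have fint: "f n integrable_on {0..}" and fval: "integral {0..} (f n) = integral {0..real n} h" for n
  proof -
    have "{0..real n} \<inter> {0..} = {0..real n}" by auto
    then show "f n integrable_on {0..}" "integral {0..} (f n) = integral {0..real n} h"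
      unfolding f_def[abs_def] using ion[of "real n"]
      by (simp_all only: integrable_restrict_Int integral_restrict_Int)
  qed
  have "h integrable_on {0..} \<and> (\<lambda>n. integral {0..} (f n)) \<longlonglongrightarrow> integral {0..} h"
  proof (rule monotone_convergence_increasing[OF fint])
    show "f k x \<le> f (Suc k) x" if "x \<in> {0..}" for k x using pos[of x] that by (auto simp: f_def)
    show "(\<lambda>k. f k x) \<longlonglongrightarrow> h x" if "x \<in> {0..}" for x
    proof (rule tendsto_eventually)
      obtain N where "x \<le> real N" using real_arch_simple by blast
      then show "\<forall>\<^sub>F k in sequentially. f k x = h x"
        unfolding eventually_sequentially using that by (intro exI[of _ N]) (auto simp: f_def)
    qed
    have "norm (integral {0..real n} h) \<le> B" for n
      using B[of n] integral_nonneg[OF ion[of "real n"]] pos by auto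
    then show "bounded (range (\<lambda>k. integral {0..} (f k)))"
      unfolding fval bounded_iff by (intro exI[of _ B]) auto
  qed
  then have "h absolutely_integrable_on {0..}"
    using pos by (intro nonnegative_absolutely_integrable_1) auto
  then show ?thesis by (simp add: integrable_lebesgue_on_iff)
qed

lemma L2_on_halfline:
  fixes h :: "real \<Rightarrow> 'a::euclidean_space"
  assumes cont: "continuous_on {0..} h"
    and B: "\<And>n. integral {0..real n} (\<lambda>x. (norm (h x))\<^sup>2) \<le> B"
  shows "h \<in> L2_on {0..}"
proof -
  have "h \<in> borel_measurable (lebesgue_on {0..})"
    using cont by (intro continuous_imp_measurable_on_sets_lebesgue) auto
  moreover have "integrable (lebesgue_on {0..}) (\<lambda>x. (norm (h x))\<^sup>2)"
    by (rule integrable_halfline[OF _ _ B]) (use cont in \<open>auto intro!: continuous_intros\<close>)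
  ultimately show ?thesis by (simp add: L2_on_def)
qed

lemma L2_on_mult_integrable:
  fixes f :: "real \<Rightarrow> real" and g :: "real \<Rightarrow> 'a::euclidean_space"
  assumes "f \<in> L2_on S" "g \<in> L2_on S"
  shows "integrable (lebesgue_on S) (\<lambda>x. f x *\<^sub>R g x)"
proof (rule Bochner_Integration.integrable_bound)
  note fg = L2_onD[OF assms(1)] L2_onD[OF assms(2)]
  show "integrable (lebesgue_on S) (\<lambda>x. (norm (f x))\<^sup>2 + (norm (g x))\<^sup>2)"
    using fg by (intro Bochner_Integration.integrable_add) auto
  show "(\<lambda>x. f x *\<^sub>R g x) \<in> borel_measurable (lebesgue_on S)" using fg by measurable
  have "norm (f x *\<^sub>R g x) \<le> norm ((norm (f x))\<^sup>2 + (norm (g x))\<^sup>2)" for x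
  proof -
    have "0 \<le> \<bar>f x\<bar> * norm (g x)" by simp
    moreover have "2 * (\<bar>f x\<bar> * norm (g x)) \<le> (f x)\<^sup>2 + (norm (g x))\<^sup>2"
      using sum_squares_bound[of "\<bar>f x\<bar>" "norm (g x)"] by (simp add: mult.assoc)
    ultimately have "\<bar>f x\<bar> * norm (g x) \<le> (f x)\<^sup>2 + (norm (g x))\<^sup>2" by linarith
    then show ?thesis by simp
  qed
  then show "AE x in lebesgue_on S. norm (f x *\<^sub>R g x) \<le> norm ((norm (f x))\<^sup>2 + (norm (g x))\<^sup>2)"
    by simp
qed

lemma exp_L2_halfline: "a > 0 \<Longrightarrow> (\<lambda>x. exp (- a * x) :: real) \<in> L2_on {0..}"
proof (rule L2_on_halfline[where B = "1 / (2 * a)"])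
  fix n assume a: "a > 0"
  have "((\<lambda>x. exp (- (2 * a) * x)) has_integral (expint (- (2 * a)) (real n) - expint (- (2 * a)) 0)) {0..real n}"
    by (rule expint_integral) simp
  moreover have "(norm (exp (- a * x)))\<^sup>2 = exp (- (2 * a) * x)" for x
    by (simp add: exp_double[symmetric] mult.assoc)
  ultimately have "integral {0..real n} (\<lambda>x. (norm (exp (- a * x)))\<^sup>2) = expint (- (2 * a)) (real n)"
    by (simp add: integral_unique expint_def)
  also have "\<dots> \<le> 1 / (2 * a)" using a by (simp add: expint_def field_simps)
  finally show "integral {0..real n} (\<lambda>x. (norm (exp (- a * x)))\<^sup>2) \<le> 1 / (2 * a)" .
qed (intro continuous_intros)

lemma expint_0: "expint r 0 = 0" by (simp add: expint_def)

lemma matrix_vec_minus: "A *v (- x) = - (A *v (x :: complex^'n::finite))"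
  by (simp add: matrix_vector_mult_def vec_eq_iff sum_negf)

lemma norm_matrix_columns: "(norm A)\<^sup>2 = (\<Sum>j\<in>UNIV. (norm (A *v axis j 1))\<^sup>2)"
  for A :: "complex^'q::finite^'p::finite"
proof -
  have "(norm A)\<^sup>2 = (\<Sum>i\<in>UNIV. \<Sum>j\<in>UNIV. (norm (A $ i $ j))\<^sup>2)"
    by (simp add: norm_vec_def[of A] norm_vec_def[of "A $ _"] L2_set_def sum_nonneg)
  also have "\<dots> = (\<Sum>j\<in>UNIV. \<Sum>i\<in>UNIV. (norm (A $ i $ j))\<^sup>2)" by (rule sum.swap)
  also have "\<dots> = (\<Sum>j\<in>UNIV. (norm (A *v axis j 1))\<^sup>2)"
    by (simp add: norm_vec_def L2_set_def sum_nonneg matrix_vector_mult_def axis_def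
       if_distrib[of "\<lambda>x. _ * x"] cong: if_cong)
  finally show ?thesis .
qed

lemma limit_square_integrable_eq_0:
  fixes G :: "real \<Rightarrow> 'a::real_normed_vector"
  assumes int: "integrable (lebesgue_on {0..}) (\<lambda>x. (norm (G x))\<^sup>2)" and lim: "(G \<longlongrightarrow> L) at_top"
  shows "L = 0"
proof (rule ccontr)
  assume "L \<noteq> 0"
  define e where "e = (norm L)\<^sup>2 / 2"
  have e: "e > 0" using \<open>L \<noteq> 0\<close> by (simp add: e_def)
  have "((\<lambda>x. (norm (G x))\<^sup>2) \<longlongrightarrow> (norm L)\<^sup>2) at_top" by (intro tendsto_intros lim)
  moreover have "e < (norm L)\<^sup>2" using e by (simp add: e_def)
  ultimately have "\<forall>\<^sub>F x in at_top. e < (norm (G x))\<^sup>2" by (rule order_tendstoD)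
  then obtain N where N: "\<And>x. x \<ge> N \<Longrightarrow> e < (norm (G x))\<^sup>2"
    by (auto simp: eventually_at_top_linorder)
  define I where "I = integral\<^sup>L (lebesgue_on {0..}) (\<lambda>x. (norm (G x))\<^sup>2)"
  define N0 where "N0 = max N 0"
  \<comment> \<open>The length is chosen so that the lower bound e on this interval already
    integrates to |I| + 1.\<close>
  define b where "b = N0 + (\<bar>I\<bar> + 1) / e"
  have b: "N0 \<le> b" using e by (simp add: b_def)
  have si: "set_integrable lebesgue {0..} (\<lambda>x. (norm (G x))\<^sup>2)"
    using int by (simp add: integrable_restrict_space set_integrable_def)
  have ie: "set_integrable lebesgue {N0..b} (\<lambda>x. e)"
    by (intro absolutely_integrable_continuous_real continuous_intros)
  have "e * (b - N0) = (LINT x:{N0..b}|lebesgue. e)"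
    using b set_lebesgue_integral_eq_integral(2)[OF ie] by simp
  also have "\<dots> \<le> (LINT x:{N0..b}|lebesgue. (norm (G x))\<^sup>2)"
  proof (rule set_integral_mono)
    show "set_integrable lebesgue {N0..b} (\<lambda>x. e)" by (rule ie)
    show "set_integrable lebesgue {N0..b} (\<lambda>x. (norm (G x))\<^sup>2)"
      by (rule set_integrable_subset[OF si]) (auto simp: N0_def)
    show "e \<le> (norm (G x))\<^sup>2" if "x \<in> {N0..b}" for x using N[of x] that by (auto simp: N0_def)
  qed
  also have "\<dots> \<le> (LINT x:{0..}|lebesgue. (norm (G x))\<^sup>2)"
    unfolding set_lebesgue_integral_def
  proof (rule integral_mono)
    show "integrable lebesgue (\<lambda>x. indicat_real {N0..b} x *\<^sub>R (norm (G x))\<^sup>2)"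
      using set_integrable_subset[OF si, of "{N0..b}"] by (simp add: set_integrable_def N0_def)
    show "integrable lebesgue (\<lambda>x. indicat_real {0..} x *\<^sub>R (norm (G x))\<^sup>2)"
      using si by (simp add: set_integrable_def)
  qed (auto simp: indicator_def N0_def)
  also have "\<dots> = I" by (simp add: I_def integral_restrict_space set_lebesgue_integral_def)
  finally show False using e by (simp add: b_def)
qed

section \<open>Weighted square integrability of \<Phi>1\<close>

context dirac_system
begin

lemma similarity_exists:
  assumes "is_Phi1 \<gamma> \<Phi>" "0 < l"
  obtains k R where "dirac_similarity M v u \<Phi> l k R"
proof -
  obtain k R where "similarity_op l \<gamma> k R" "AE x in Leb l. colwise R (\<lambda>t. left_block (\<gamma> t)) x = \<Phi> x"
    and "boundedly_diff l \<Phi>"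
    using assms unfolding is_Phi1_def by blast
  then have "dirac_similarity M v u \<Phi> l k R"
    using \<open>0 < l\<close> by (intro dirac_similarity.intro dirac_system_axioms dirac_similarity_axioms.intro)
  then show ?thesis by (rule that)
qed

lemma Phi_cont_on:
  assumes "is_Phi1 \<gamma> \<Phi>" shows "continuous_on {0..} \<Phi>"
proof (rule continuous_on_halfline)
  fix l :: real assume "l > 0"
  then obtain k R where "dirac_similarity M v u \<Phi> l k R" using similarity_exists[OF assms] by blast
  then show "continuous_on {0..l} \<Phi>" by (rule dirac_similarity.Phi_cont)
qed

text \<open>Take f = \<Phi> c and c0 = - c in the energy estimate. Then E f + \<gamma>1 c0 = 0, so
  only the integral of the constant remains, and the bound is free of l. The endpoint \<eta> = M is
  included, which is used for integrability at every Im z > M.\<close>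

lemma Phi_weighted_integral_le:
  assumes Phi: "is_Phi1 \<gamma> \<Phi>" and l: "0 \<le> l" and \<eta>: "M \<le> \<eta>"
  shows "weighted_sq l (4 * \<eta>) (\<lambda>t. \<Phi> t *v c) \<le> (norm c)\<^sup>2 / (4 * \<eta>)"
proof (cases "l = 0")
  case False
  then have "0 < l" using l by simp
  then obtain k R where "dirac_similarity M v u \<Phi> l k R" using similarity_exists[OF Phi] by blast
  then interpret dirac_similarity M v u \<Phi> l k R .
  have cP: "continuous_on {0..l} (\<lambda>t. \<Phi> t *v c)"
    by (intro continuous_on_matrix_vector Phi_cont continuous_intros)
  have "AE x in Leb l. E (\<lambda>t. \<Phi> t *v c) x + \<gamma> x *v vjoin (- c) 0 = 0"
    using E_Phi[of c]
  proof eventually_elim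
    case (elim x)
    have "vjoin (- c) 0 = - vjoin c (0 :: complex^'m2)" by (rule blocks_eqI) auto
    then show ?case using elim by (simp add: matrix_vec_minus)
  qed
  from energy_estimate[OF cP _ \<eta> this]
  have "weighted_sq l (4 * \<eta>) (\<lambda>t. \<Phi> t *v c)
      \<le> weighted_sq l (4 * \<eta>) (\<lambda>t. c)"
    by (simp add: continuous_on_const)
  also have "\<dots> = expint (- (4 * \<eta>)) l * (norm c)\<^sup>2"
    using integral_unique[OF has_integral_mult_left[OF expint_integral[OF l, of "- (4 * \<eta>)"], of "(norm c)\<^sup>2"]]
    by (simp only: expint_0 diff_zero)
  also have "\<dots> \<le> (1 / (4 * \<eta>)) * (norm c)\<^sup>2"
    using M_pos \<eta> by (intro mult_right_mono) (auto simp: expint_def field_simps)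
  finally show ?thesis by simp
qed (use M_pos \<eta> in auto)

lemma Phi_vec_L2:
  assumes Phi: "is_Phi1 \<gamma> \<Phi>" and \<eta>: "M \<le> \<eta>"
  shows "(\<lambda>x. exp (- 2 * \<eta> * x) *\<^sub>R (\<Phi> x *v c)) \<in> L2_on {0..}"
proof (rule L2_on_halfline)
  show "continuous_on {0..} (\<lambda>x. exp (- 2 * \<eta> * x) *\<^sub>R (\<Phi> x *v c))"
    by (intro continuous_intros continuous_on_matrix_vector Phi_cont_on[OF Phi])
  fix n
  have "(norm (exp (- 2 * \<eta> * x) *\<^sub>R (\<Phi> x *v c)))\<^sup>2 = exp (- (4 * \<eta>) * x) * (norm (\<Phi> x *v c))\<^sup>2" for x
    by (simp add: power_mult_distrib exp_double[symmetric] mult.assoc)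
  then show "integral {0..real n} (\<lambda>x. (norm (exp (- 2 * \<eta> * x) *\<^sub>R (\<Phi> x *v c)))\<^sup>2) \<le> (norm c)\<^sup>2 / (4 * \<eta>)"
    using Phi_weighted_integral_le[OF Phi _ \<eta>, of "real n" c] by simp
qed

theorem Phi_L2:
  assumes Phi: "is_Phi1 \<gamma> \<Phi>" and \<eta>: "M \<le> \<eta>"
  shows "(\<lambda>x. exp (- 2 * \<eta> * x) *\<^sub>R \<Phi> x) \<in> L2_on {0..}"
proof -
  have c: "continuous_on {0..} (\<lambda>x. exp (- 2 * \<eta> * x) *\<^sub>R \<Phi> x)"
    by (intro continuous_intros Phi_cont_on[OF Phi])
  have "integrable (lebesgue_on {0..}) (\<lambda>x. \<Sum>j\<in>UNIV. (norm (exp (- 2 * \<eta> * x) *\<^sub>R (\<Phi> x *v axis j 1)))\<^sup>2)"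
    by (intro Bochner_Integration.integrable_sum L2_onD(2)[OF Phi_vec_L2[OF assms]])
  then have "integrable (lebesgue_on {0..}) (\<lambda>x. (norm (exp (- 2 * \<eta> * x) *\<^sub>R \<Phi> x))\<^sup>2)"
    by (simp only: norm_matrix_columns matrix_vector_mult_scaleR)
  moreover have "(\<lambda>x. exp (- 2 * \<eta> * x) *\<^sub>R \<Phi> x) \<in> borel_measurable (lebesgue_on {0..})"
    using c by (intro continuous_imp_measurable_on_sets_lebesgue) auto
  ultimately show ?thesis by (simp add: L2_on_def)
qed

lemma norm_exp_2iz: "norm (wave z x) = exp (- 2 * Im z * x)"
  by (simp add: norm_exp_eq_Re algebra_simps)

text \<open>The decay exp(- 2 Im z x) splits into exp(- 2 M x), which makes \<Phi> square
  integrable, and the square-integrable factor exp(- 2 (Im z - M) x).\<close>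

lemma Phi_exp_integrable:
  assumes Phi: "is_Phi1 \<gamma> \<Phi>" and z: "M < Im z"
  shows "integrable (lebesgue_on {0..}) (\<lambda>x. cscale (wave z x) (\<Phi> x))"
proof -
  define d where "d = Im z - M"
  have d: "d > 0" using z by (simp add: d_def)
  have i: "integrable (lebesgue_on {0..}) (\<lambda>x. exp (- (2 * d) * x) *\<^sub>R (exp (- 2 * M * x) *\<^sub>R \<Phi> x))"
    using d by (intro L2_on_mult_integrable exp_L2_halfline Phi_L2[OF Phi]) auto
  have nc: "norm (cscale c A) = cmod c * norm A" for c and A :: "complex^'m1^'m2"
  proof -
    have "(norm (cscale c A))\<^sup>2 = (cmod c * norm A)\<^sup>2"
      unfolding norm_matrix_columns[of "cscale c A"] power_mult_distrib norm_matrix_columns[of A]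
      by (simp add: cscale_vec norm_cmult_vec power_mult_distrib sum_distrib_left)
    then show ?thesis by (simp add: power2_eq_iff_nonneg)
  qed
  have cb: "bounded_bilinear (cscale :: complex \<Rightarrow> complex^'m1^'m2 \<Rightarrow> _)"
    by (intro bilinear_conv_bounded_bilinear[THEN iffD1])
      (auto simp: bilinear_def cscale_def vec_eq_iff algebra_simps intro!: linearI)
  show ?thesis
  proof (rule Bochner_Integration.integrable_bound[OF i])
    have "continuous_on {0..} (\<lambda>x. cscale (wave z x) (\<Phi> x))"
      by (intro bounded_bilinear.continuous_on[OF cb] continuous_intros Phi_cont_on[OF Phi])
    then show "(\<lambda>x. cscale (wave z x) (\<Phi> x)) \<in> borel_measurable (lebesgue_on {0..})"
      by (intro continuous_imp_measurable_on_sets_lebesgue) auto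
    have "norm (exp (- (2 * d) * x) *\<^sub>R (exp (- 2 * M * x) *\<^sub>R \<Phi> x)) = exp (- 2 * Im z * x) * norm (\<Phi> x)" for x
    proof -
      have "exp (- (2 * d) * x) * exp (- 2 * M * x) = exp (- 2 * Im z * x)"
        unfolding exp_add[symmetric] by (simp add: d_def algebra_simps)
      then show ?thesis by (simp flip: mult.assoc)
    qed
    then show "AE x in lebesgue_on {0..}. norm (cscale (wave z x) (\<Phi> x))
       \<le> norm (exp (- (2 * d) * x) *\<^sub>R (exp (- 2 * M * x) *\<^sub>R \<Phi> x))"
      by (intro AE_I2) (simp only: nc norm_exp_2iz order_refl)
  qed
qed

end

lemma lint_exp_halfline:
  assumes "0 < Im z"
  shows "set_integrable lebesgue {0..} (wave z)"
    and "(LINT x:{0..}|lebesgue. wave z x) = - (1 / (2 * \<i> * z))"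
proof -
  have c: "continuous_on {0..} (wave z)" by (intro continuous_intros)
  have n: "norm (wave z x) = exp (- (2 * Im z) * x)" for x
    by (simp add: norm_exp_eq_Re algebra_simps)
  have "integrable (lebesgue_on {0..}) (wave z)"
  proof (rule Bochner_Integration.integrable_bound)
    show "integrable (lebesgue_on {0..}) (\<lambda>x. exp (- Im z * x) *\<^sub>R exp (- Im z * x))"
      using assms by (intro L2_on_mult_integrable exp_L2_halfline)
    show "(wave z) \<in> borel_measurable (lebesgue_on {0..})"
      using c by (intro continuous_imp_measurable_on_sets_lebesgue) auto
    show "AE x in lebesgue_on {0..}. norm (wave z x) \<le> norm (exp (- Im z * x) *\<^sub>R exp (- Im z * x))"
      by (intro AE_I2) (simp add: n exp_add[symmetric] del: norm_exp_eq_Re)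
  qed
  then show si: "set_integrable lebesgue {0..} (wave z)"
    by (simp add: integrable_lebesgue_on_iff)
  have z: "z \<noteq> 0" using assms by auto
  have fin: "(LINT t:{0..x}|lebesgue. wave z t) = wave z x / (2 * \<i> * z) - 1 / (2 * \<i> * z)"
    if "0 \<le> x" for x
  proof -
    have "((\<lambda>t. exp (of_real t * (2 * \<i> * z)) * (2 * \<i> * z)) has_integral
        exp (of_real x * (2 * \<i> * z)) - exp (of_real 0 * (2 * \<i> * z))) {0..x}"
      using exp_scaleR_has_vector_derivative_right[of "2 * \<i> * z"] that
      by (intro fundamental_theorem_of_calculus) (auto simp: scaleR_conv_of_real)
    from has_integral_mult_left[OF this, of "1 / (2 * \<i> * z)"]
    have "((wave z) has_integral (wave z x - 1) * (1 / (2 * \<i> * z))) {0..x}"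
      using z by (simp add: mult_ac)
    moreover have "set_integrable lebesgue {0..x} (wave z)"
      by (rule set_integrable_subset[OF si]) auto
    ultimately show ?thesis
      by (simp add: set_lebesgue_integral_eq_integral integral_unique diff_divide_distrib)
  qed
  have "((\<lambda>x. wave z x / (2 * \<i> * z) - 1 / (2 * \<i> * z)) \<longlongrightarrow> 0 / (2 * \<i> * z) - 1 / (2 * \<i> * z)) at_top"
  proof (intro tendsto_intros)
    have "((\<lambda>x. exp (- (2 * Im z) * x)) \<longlongrightarrow> 0) at_top"
      using assms by real_asymp
    then show "((wave z) \<longlongrightarrow> 0) at_top"
      by (intro tendsto_norm_zero_cancel[of "\<lambda>x. wave z x"]) (simp only: n)
  qed (use z in auto)
  then have "((\<lambda>x. wave z x / (2 * \<i> * z) - 1 / (2 * \<i> * z)) \<longlongrightarrow> - (1 / (2 * \<i> * z))) at_top"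
    by simp
  then have "((\<lambda>x. LINT t:{0..x}|lebesgue. wave z t) \<longlongrightarrow> - (1 / (2 * \<i> * z))) at_top"
    by (rule Lim_transform_eventually)
      (use fin in \<open>auto intro!: eventually_mono[OF eventually_ge_at_top[of 0]]\<close>)
  moreover have "((\<lambda>x. LINT t:{0..x}|lebesgue. wave z t) \<longlongrightarrow> (LINT x:{0..}|lebesgue. wave z x)) at_top"
    by (rule tendsto_set_lebesgue_integral_at_top[OF _ si]) auto
  ultimately show "(LINT x:{0..}|lebesgue. wave z x) = - (1 / (2 * \<i> * z))"
    by (intro tendsto_unique[OF trivial_limit_at_top_linorder])
qed

section \<open>The Laplace representation\<close>

context dirac_system
begin

text \<open>For w = \<phi>(z) h, the solution f of f + 2 \<i> z (integral of f) = \<Phi> h + w is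
  mapped by E to exp(- \<i> z x) times the lower block of a square-integrable solution. The energy
  estimate then makes exp(2 \<i> z x) f square integrable, hence also the truncated transform G of
  \<Phi> h + w. As G converges, its limit is 0, and this is the representation applied to h.\<close>

theorem Weyl_representation:
  assumes Phi: "is_Phi1 \<gamma> \<Phi>" and W: "weyl_function M u \<phi>" and z: "M < Im z"
  shows "\<phi> z = cscale (2 * \<i> * z) (LINT x:{0..}|lebesgue. cscale (wave z x) (\<Phi> x))"
proof (rule matrix_eq_vectorI)
  fix h :: "complex^'m1"
  have Im_pos: "0 < Im z" using z M_pos by simp
  then have z0: "z \<noteq> 0" by auto
  have N: "\<phi> z \<in> N_set M u x z" if "0 \<le> x" for x
    using W z that unfolding weyl_function_def upper_plane_def by auto
  define w where "w = \<phi> z *v h"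
  define c where "c = vjoin h w"
  define e where "e x = exp (of_real x * (2 * \<i> * z))" for x
  define e' where "e' x = exp (of_real x * (- (2 * \<i> * z)))" for x
  have ee': "e' x * e x = 1" "e x * e' x = 1" for x by (simp_all add: e_def e'_def exp_add[symmetric])
  have e_eq: "wave z x = e x" for x by (simp add: e_def mult_ac)
  have ne: "norm (e x) = exp (- 2 * Im z * x)" for x
    unfolding e_eq[symmetric] by (rule norm_exp_2iz)
  define b where "b x = \<Phi> x *v h + w" for x
  have contP: "continuous_on {0..} (\<lambda>x. \<Phi> x *v h)"
    by (intro continuous_on_matrix_vector Phi_cont_on[OF Phi] continuous_intros)
  have contb: "continuous_on {0..} b" unfolding b_def by (intro continuous_intros contP)
  have conte: "continuous_on S e" "continuous_on S e'" for S
    unfolding e_def e'_def by (intro continuous_intros)+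
  have conteb: "continuous_on {0..} (\<lambda>t. e t *s b t)"
    by (intro continuous_on_cmult_vec conte contb)
  define G where "G x = integral {0..x} (\<lambda>t. e t *s b t)" for x
  have dG: "has_ae_deriv 0 l G (\<lambda>t. e t *s b t)" for l
  proof -
    have c: "continuous_on {0..l} (\<lambda>t. e t *s b t)" using continuous_on_subset[OF conteb] by auto
    show ?thesis unfolding G_def
      by (rule has_ae_deriv_C1[OF _ c]) (use c in \<open>auto intro: integral_has_vector_derivative\<close>)
  qed
  have contG: "continuous_on {0..} G"
    by (rule continuous_on_halfline) (rule has_ae_deriv_cont[OF dG])
  \<comment> \<open>Variation of constants: \<open>e' x *s G x\<close> is the primitive of f, and f
    solves the integral equation with right side b.\<close>
  define f where "f x = b x - (2 * \<i> * z) *s (e' x *s G x)" for x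
  have contf: "continuous_on {0..} f"
    unfolding f_def
    by (intro continuous_intros contb bounded_linear.continuous_on[OF bounded_linear_cmult_vec]
      continuous_on_cmult_vec conte contG)
  have f_int: "f x + (2 * \<i> * z) *s integral {0..x} f = \<Phi> x *v h + w" if "0 \<le> x" for x
  proof -
    have "has_ae_deriv 0 x (\<lambda>x. e' x *s G x) (\<lambda>x. e' x *s (e x *s b x) + (e' x * (- (2 * \<i> * z))) *s G x)"
      unfolding e'_def by (rule has_ae_deriv_bilinear[OF bounded_bilinear_cmult_vec has_ae_deriv_exp dG])
    moreover have "e' x *s (e x *s b x) + (e' x * (- (2 * \<i> * z))) *s G x = f x" for x
      by (simp add: f_def vector_smult_assoc ee' mult.commute)
    ultimately have "has_ae_deriv 0 x (\<lambda>x. e' x *s G x) f" by simp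
    from has_ae_deriv_integral[OF this order_refl that order_refl]
    have "integral {0..x} f = e' x *s G x" by (simp add: integral_unique G_def)
    then show ?thesis by (simp add: f_def b_def)
  qed
  define B where "B = (norm h)\<^sup>2 / (2 * (Im z - M))"
  have B0: "0 \<le> B" using z by (simp add: B_def)
  \<comment> \<open>The factor exp(- \<i> z x) of g and the weight exp(- 2 Im z x) cancel, so the
    right side is at most the squared norm of the Weyl solution, bounded independently of l.\<close>
  have energy: "integral {0..l} (\<lambda>t. exp (- (4 * Im z) * t) * (norm (f t))\<^sup>2) \<le> B" if l: "0 < l" for l
  proof -
    obtain k R where "dirac_similarity M v u \<Phi> l k R" using similarity_exists[OF Phi l] by blast
    then interpret dirac_similarity M v u \<Phi> l k R .
    define g where "g x = exp (of_real x * (- (\<i> * z))) *s lwr (u x z *v c)" for x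
    have contf': "continuous_on {0..l} f" using continuous_on_subset[OF contf] by auto
    have contg: "continuous_on {0..l} g"
      unfolding g_def
      by (intro continuous_on_cmult_vec continuous_intros
        continuous_on_lwr solution_cont)
    have "AE x in Leb l. E f x = g x"
      unfolding g_def c_def by (rule E_solution[OF contf']) (use f_int in auto)
    moreover have "vjoin 0 0 = (0 :: complex^('m1 + 'm2))" by (rule blocks_eqI) auto
    ultimately have "AE x in Leb l. E f x + \<gamma> x *v vjoin 0 0 = g x" by simp
    from energy_estimate[OF contf' contg _ this, of "Im z"] z
    have "integral {0..l} (\<lambda>t. exp (- (4 * Im z) * t) * (norm (f t))\<^sup>2)
      \<le> integral {0..l} (\<lambda>x. exp (- (2 * Im z) * x) * (norm (g x))\<^sup>2)" by simp
    also have "\<dots> \<le> integral {0..l} (\<lambda>x. (norm (u x z *v c))\<^sup>2)"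
    proof (rule integral_le)
      show "(\<lambda>x. exp (- (2 * Im z) * x) * (norm (g x))\<^sup>2) integrable_on {0..l}"
        by (intro integrable_continuous_real continuous_intros contg)
      show "(\<lambda>x. (norm (u x z *v c))\<^sup>2) integrable_on {0..l}"
        by (intro integrable_continuous_real continuous_intros solution_cont)
      fix x
      have "(norm (g x))\<^sup>2 = exp (2 * Im z * x) * (norm (lwr (u x z *v c)))\<^sup>2"
        by (simp add: g_def norm_cmult_vec norm_exp_eq_Re power_mult_distrib exp_double[symmetric] mult_ac)
      then have "exp (- (2 * Im z) * x) * (norm (g x))\<^sup>2 = (norm (lwr (u x z *v c)))\<^sup>2"
        by (simp add: exp_minus)
      also have "\<dots> \<le> (norm (u x z *v c))\<^sup>2" by (intro power_mono norm_lwr_le) auto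
      finally show "exp (- (2 * Im z) * x) * (norm (g x))\<^sup>2 \<le> (norm (u x z *v c))\<^sup>2" .
    qed
    also have "\<dots> \<le> B"
      unfolding B_def c_def w_def by (rule Weyl_integral_bound[OF _ z N]) (use l in auto)
    finally show ?thesis .
  qed
  have efL: "(\<lambda>x. e x *s f x) \<in> L2_on {0..}"
  proof (rule L2_on_halfline)
    show "continuous_on {0..} (\<lambda>x. e x *s f x)"
      by (intro continuous_on_cmult_vec conte contf)
    fix n
    have "(norm (e x *s f x))\<^sup>2 = exp (- (4 * Im z) * x) * (norm (f x))\<^sup>2" for x
      by (simp add: norm_cmult_vec ne power_mult_distrib exp_double[symmetric] mult.assoc)
    then show "integral {0..real n} (\<lambda>x. (norm (e x *s f x))\<^sup>2) \<le> B"
      using energy[of "real n"] B0 by (cases "n = 0") auto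
  qed
  have ePL: "(\<lambda>x. e x *s (\<Phi> x *v h)) \<in> L2_on {0..}"
  proof (rule L2_on_halfline)
    show "continuous_on {0..} (\<lambda>x. e x *s (\<Phi> x *v h))"
      by (intro continuous_on_cmult_vec conte contP)
    fix n
    have "(norm (e x *s (\<Phi> x *v h)))\<^sup>2 = exp (- (4 * Im z) * x) * (norm (\<Phi> x *v h))\<^sup>2" for x
      by (simp add: norm_cmult_vec ne power_mult_distrib exp_double[symmetric] mult.assoc)
    then show "integral {0..real n} (\<lambda>x. (norm (e x *s (\<Phi> x *v h)))\<^sup>2) \<le> (norm h)\<^sup>2 / (4 * Im z)"
      using Phi_weighted_integral_le[OF Phi _ less_imp_le[OF z], of "real n" h] by simp
  qed
  have ewL: "(\<lambda>x. e x *s w) \<in> L2_on {0..}"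
  proof -
    have "(\<lambda>x. exp (- (2 * Im z) * x) *\<^sub>R w) \<in> L2_on {0..}"
      by (rule L2_on_bounded_linear[OF bounded_linear_scaleR_left exp_L2_halfline]) (use Im_pos in simp)
    then have "integrable (lebesgue_on {0..}) (\<lambda>x. (norm (exp (- (2 * Im z) * x) *\<^sub>R w))\<^sup>2)"
      by (rule L2_onD)
    then have "integrable (lebesgue_on {0..}) (\<lambda>x. (norm (e x *s w))\<^sup>2)"
      by (simp add: norm_cmult_vec ne)
    moreover have "continuous_on {0..} (\<lambda>x. e x *s w)"
      by (intro continuous_on_cmult_vec conte continuous_intros)
    then have "(\<lambda>x. e x *s w) \<in> borel_measurable (lebesgue_on {0..})"
      by (intro continuous_imp_measurable_on_sets_lebesgue) auto
    ultimately show ?thesis by (simp add: L2_on_def)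
  qed
  \<comment> \<open>Since f = b - 2 \<i> z e' G, the difference e b - e f isolates G.\<close>
  have "(\<lambda>x. (e x *s (\<Phi> x *v h) + e x *s w) - e x *s f x) \<in> L2_on {0..}"
    by (intro L2_on_diff L2_on_add ePL ewL efL)
  moreover have "(e x *s (\<Phi> x *v h) + e x *s w) - e x *s f x = (2 * \<i> * z) *s G x" for x
  proof -
    have "e x *s f x = e x *s b x - (2 * \<i> * z) *s ((e x * e' x) *s G x)"
      by (simp add: f_def vec_eq_iff algebra_simps)
    then show ?thesis by (simp add: ee' b_def vector_add_ldistrib)
  qed
  ultimately have GL: "(\<lambda>x. (2 * \<i> * z) *s G x) \<in> L2_on {0..}" by simp
  define I where "I = (LINT x:{0..}|lebesgue. cscale (wave z x) (\<Phi> x))"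
  have iP: "set_integrable lebesgue {0..} (\<lambda>x. cscale (wave z x) (\<Phi> x))"
    using Phi_exp_integrable[OF Phi z] by (simp add: integrable_lebesgue_on_iff)
  have bl: "bounded_linear (\<lambda>A :: complex^'m1^'m2. A *v h)"
    by (rule bounded_bilinear.bounded_linear_left[OF bounded_bilinear_matrix_vector])
  have bl2: "bounded_linear (\<lambda>a. a *s w)"
    by (rule bounded_bilinear.bounded_linear_left[OF bounded_bilinear_cmult_vec])
  have iP1: "set_integrable lebesgue {0..} (\<lambda>x. e x *s (\<Phi> x *v h))"
    and IP1: "(LINT x:{0..}|lebesgue. e x *s (\<Phi> x *v h)) = I *v h"
    using integrable_bounded_linear[OF bl iP[unfolded set_integrable_def]]
      integral_bounded_linear[OF bl iP[unfolded set_integrable_def]]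
    by (simp_all add: set_integrable_def set_lebesgue_integral_def I_def matrix_vector_mult_scaleR cscale_vec e_eq)
  have iw: "set_integrable lebesgue {0..} (\<lambda>x. e x *s w)"
    and Iw: "(LINT x:{0..}|lebesgue. e x *s w) = (- (1 / (2 * \<i> * z))) *s w"
  proof -
    have s: "(r *\<^sub>R a) *s w = r *\<^sub>R (a *s w)" for r :: real and a
      by (simp add: vec_eq_iff)
    note i = lint_exp_halfline[OF Im_pos, unfolded e_eq set_integrable_def set_lebesgue_integral_def]
    show "set_integrable lebesgue {0..} (\<lambda>x. e x *s w)"
      using integrable_bounded_linear[OF bl2 i(1)] by (simp add: set_integrable_def s)
    show "(LINT x:{0..}|lebesgue. e x *s w) = (- (1 / (2 * \<i> * z))) *s w"
      using integral_bounded_linear[OF bl2 i(1)] by (simp add: set_lebesgue_integral_def s i(2))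
  qed
  have eb: "e x *s b x = e x *s (\<Phi> x *v h) + e x *s w" for x by (simp add: b_def vector_add_ldistrib)
  have ieb: "set_integrable lebesgue {0..} (\<lambda>x. e x *s b x)"
    and Ieb: "(LINT x:{0..}|lebesgue. e x *s b x) = I *v h - (1 / (2 * \<i> * z)) *s w"
    unfolding eb using set_integral_add[OF iP1 iw] by (simp_all add: IP1 Iw)
  have "((\<lambda>x. LINT t:{0..x}|lebesgue. e t *s b t) \<longlongrightarrow> (LINT x:{0..}|lebesgue. e x *s b x)) at_top"
    by (rule tendsto_set_lebesgue_integral_at_top[OF _ ieb]) auto
  moreover have "(LINT t:{0..x}|lebesgue. e t *s b t) = G x" for x
  proof -
    have "set_integrable lebesgue {0..x} (\<lambda>t. e t *s b t)"
      by (rule set_integrable_subset[OF ieb]) auto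
    then show ?thesis by (simp add: G_def set_lebesgue_integral_eq_integral)
  qed
  ultimately have "(G \<longlongrightarrow> I *v h - (1 / (2 * \<i> * z)) *s w) at_top" by (simp add: Ieb)
  then have "((\<lambda>x. (2 * \<i> * z) *s G x) \<longlongrightarrow> (2 * \<i> * z) *s (I *v h - (1 / (2 * \<i> * z)) *s w)) at_top"
    by (rule bounded_linear.tendsto[OF bounded_linear_cmult_vec])
  \<comment> \<open>The transform of the constant w is - w / (2 \<i> z), so vanishing of the limit
    reads 2 \<i> z I h = w.\<close>
  then have "(2 * \<i> * z) *s (I *v h - (1 / (2 * \<i> * z)) *s w) = 0"
    by (rule limit_square_integrable_eq_0[OF L2_onD(2)[OF GL]])
  then have "(2 * \<i> * z) *s (I *v h) - w = 0"
    using z0 by (simp add: vec_eq_iff algebra_simps)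
  then show "\<phi> z *v h = cscale (2 * \<i> * z) (LINT x:{0..}|lebesgue. cscale (wave z x) (\<Phi> x)) *v h"
    by (simp add: cscale_vec I_def w_def)
qed

end

section \<open>Fourier inversion\<close>

lemma tendsto_0_norm_less: "(f \<longlongrightarrow> 0) F \<Longrightarrow> 0 < e \<Longrightarrow> \<forall>\<^sub>F x in F. norm (f x) < e"
  by (drule (1) tendstoD) simp

text \<open>One integration by parts gains the factor 1/a.\<close>

lemma Riemann_Lebesgue_C1:
  fixes h :: "real \<Rightarrow> complex"
  assumes pq: "p \<le> q" and d: "\<And>s. s \<in> {p..q} \<Longrightarrow> (h has_vector_derivative h' s) (at s within {p..q})"
    and c: "continuous_on {p..q} h'"
  shows "((\<lambda>a. integral {p..q} (\<lambda>s. sin (a * s) *\<^sub>R h s)) \<longlongrightarrow> 0) at_top"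
proof -
  have dh: "has_ae_deriv p q h h'" by (rule has_ae_deriv_C1[OF d c])
  have ch: "continuous_on {p..q} h" by (rule has_ae_deriv_cont[OF dh])
  define K where "K = norm (h q) + norm (h p) + integral {p..q} (\<lambda>s. norm (h' s))"
  have bd: "norm (integral {p..q} (\<lambda>s. sin (a * s) *\<^sub>R h s)) \<le> K / a" if a: "a > 0" for a
  proof -
    have dc: "has_ae_deriv p q (\<lambda>s. - (cos (a * s) / a)) (\<lambda>s. sin (a * s))"
      using a by (intro has_ae_deriv_C1)
        (auto intro!: derivative_eq_intros continuous_intros simp: has_real_derivative_iff_has_vector_derivative[symmetric])
    have i: "((\<lambda>s. (- (cos (a * s) / a)) *\<^sub>R h' s + sin (a * s) *\<^sub>R h s) has_integral
       ((- (cos (a * q) / a)) *\<^sub>R h q - (- (cos (a * p) / a)) *\<^sub>R h p)) {p..q}"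
      by (rule has_ae_deriv_integral[OF has_ae_deriv_bilinear[OF bounded_bilinear_scaleR dc dh] order_refl pq order_refl])
    have ci: "(\<lambda>s. (- (cos (a * s) / a)) *\<^sub>R h' s) integrable_on {p..q}"
      and ni: "(\<lambda>s. norm (h' s) / a) integrable_on {p..q}"
      using a by (auto intro!: integrable_continuous_real continuous_intros c)
    have "integral {p..q} (\<lambda>s. sin (a * s) *\<^sub>R h s) =
       ((- (cos (a * q) / a)) *\<^sub>R h q - (- (cos (a * p) / a)) *\<^sub>R h p) - integral {p..q} (\<lambda>s. (- (cos (a * s) / a)) *\<^sub>R h' s)"
      using integral_unique[OF has_integral_diff[OF i integrable_integral[OF ci]]] by simp
    also have "norm \<dots> \<le> (norm (h q) / a + norm (h p) / a) + integral {p..q} (\<lambda>s. norm (h' s) / a)"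
    proof (intro order_trans[OF norm_triangle_ineq4] add_mono)
      have cl: "norm ((- (cos (a * s) / a)) *\<^sub>R w) \<le> norm w / a" for s and w :: complex
        using a mult_right_mono[OF abs_cos_le_one[of "a * s"], of "norm w"] by (simp add: divide_right_mono)
      show "norm ((- (cos (a * q) / a)) *\<^sub>R h q) \<le> norm (h q) / a"
           "norm ((- (cos (a * p) / a)) *\<^sub>R h p) \<le> norm (h p) / a" by (rule cl)+
      show "norm (integral {p..q} (\<lambda>s. (- (cos (a * s) / a)) *\<^sub>R h' s)) \<le> integral {p..q} (\<lambda>s. norm (h' s) / a)"
        by (rule integral_norm_bound_integral[OF ci ni cl])
    qed
    also have "\<dots> = K / a" by (simp add: K_def add_divide_distrib)
    finally show ?thesis .
  qed
  show ?thesis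
  proof (rule Lim_null_comparison)
    show "\<forall>\<^sub>F a in at_top. norm (integral {p..q} (\<lambda>s. sin (a * s) *\<^sub>R h s)) \<le> K / a"
      using eventually_gt_at_top[of 0] by eventually_elim (rule bd)
    show "((\<lambda>a. K / a) \<longlongrightarrow> 0) at_top" by real_asymp
  qed
qed

lemma Riemann_Lebesgue_continuous:
  fixes h :: "real \<Rightarrow> complex"
  assumes pq: "p \<le> q" and ch: "continuous_on {p..q} h"
  shows "((\<lambda>a. integral {p..q} (\<lambda>s. sin (a * s) *\<^sub>R h s)) \<longlongrightarrow> 0) at_top"
proof (rule tendstoI)
  fix e :: real assume e: "e > 0"
  define e1 where "e1 = e / (2 * (q - p + 1))"
  have e1: "e1 > 0" using e pq by (simp add: e1_def)
  obtain P where P: "polynomial_function P" and hP: "\<And>s. s \<in> {p..q} \<Longrightarrow> norm (h s - P s) < e1"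
    using Stone_Weierstrass_polynomial_function[OF compact_Icc ch e1] by auto
  obtain P' where P': "polynomial_function P'" "\<And>s. (P has_vector_derivative P' s) (at s)"
    using has_vector_derivative_polynomial_function[OF P] by blast
  have cP: "continuous_on {p..q} P" "continuous_on {p..q} P'"
    using P P' continuous_on_polymonial_function by blast+
  have "((\<lambda>a. integral {p..q} (\<lambda>s. sin (a * s) *\<^sub>R P s)) \<longlongrightarrow> 0) at_top"
    by (rule Riemann_Lebesgue_C1[OF pq has_vector_derivative_at_within[OF P'(2)] cP(2)])
  then have "\<forall>\<^sub>F a in at_top. norm (integral {p..q} (\<lambda>s. sin (a * s) *\<^sub>R P s)) < e / 2"
    by (rule tendsto_0_norm_less) (use e in simp)
  then show "\<forall>\<^sub>F a in at_top. dist (integral {p..q} (\<lambda>s. sin (a * s) *\<^sub>R h s)) 0 < e"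
  proof eventually_elim
    case (elim a)
    have i: "(\<lambda>s. sin (a * s) *\<^sub>R h s) integrable_on {p..q}" "(\<lambda>s. sin (a * s) *\<^sub>R P s) integrable_on {p..q}"
      by (intro integrable_continuous_real continuous_intros ch cP)+
    have "norm (integral {p..q} (\<lambda>s. sin (a * s) *\<^sub>R h s) - integral {p..q} (\<lambda>s. sin (a * s) *\<^sub>R P s))
       = norm (integral {p..q} (\<lambda>s. sin (a * s) *\<^sub>R (h s - P s)))"
      using integral_diff[OF i] by (simp add: scaleR_diff_right)
    also have "\<dots> \<le> integral {p..q} (\<lambda>s. e1)"
    proof (rule integral_norm_bound_integral)
      show "(\<lambda>s. sin (a * s) *\<^sub>R (h s - P s)) integrable_on {p..q}"
        by (intro integrable_continuous_real continuous_intros ch cP)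
      fix s assume s: "s \<in> {p..q}"
      have "norm (sin (a * s) *\<^sub>R (h s - P s)) \<le> 1 * norm (h s - P s)"
        unfolding norm_scaleR by (intro mult_right_mono) auto
      then show "norm (sin (a * s) *\<^sub>R (h s - P s)) \<le> e1" using hP[OF s] by simp
    qed auto
    also have "\<dots> = e1 * (q - p)" using pq by simp
    also have "\<dots> \<le> e / 2" using pq e by (simp add: e1_def field_simps)
    finally have "norm (integral {p..q} (\<lambda>s. sin (a * s) *\<^sub>R h s)) < e / 2 + e / 2"
      using elim norm_triangle_sub[of "integral {p..q} (\<lambda>s. sin (a * s) *\<^sub>R h s)" "integral {p..q} (\<lambda>s. sin (a * s) *\<^sub>R P s)"]
      by linarith
    then show ?case by simp
  qed
qed

text \<open>The quotients met below are continuous only on a half-open or unbounded set S. Off a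
  large compact interval their integral is small uniformly in a, because the sine is bounded by 1;
  on the interval the continuous case applies.\<close>

lemma Riemann_Lebesgue_exhaustion:
  fixes h :: "real \<Rightarrow> complex" and p q :: "nat \<Rightarrow> real"
  assumes int: "set_integrable lborel S h" and S: "S \<in> sets borel"
    and pq: "\<And>n. p n \<le> q n" and sub: "\<And>n. {p n..q n} \<subseteq> S" and c: "continuous_on S h"
    and ex: "\<And>s. s \<in> S \<Longrightarrow> \<forall>\<^sub>F n in sequentially. s \<in> {p n..q n}"
  shows "((\<lambda>a. LINT s:S|lborel. sin (a * s) *\<^sub>R h s) \<longlongrightarrow> 0) at_top"
proof (rule tendstoI)
  fix e :: real assume e: "e > 0"
  have hm: "(\<lambda>s. indicat_real S s *\<^sub>R h s) \<in> borel_measurable lborel"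
    using int by (simp add: set_integrable_def borel_measurable_integrable)
  have ni: "integrable lborel (\<lambda>s. indicator S s * norm (h s))"
    using integrable_norm[OF int[unfolded set_integrable_def]] by simp
  have "(\<lambda>n. \<integral>s. indicator (S - {p n..q n}) s * norm (h s) \<partial>lborel) \<longlonglongrightarrow> integral\<^sup>L lborel (\<lambda>s::real. 0)"
  proof (rule integral_dominated_convergence[where w = "\<lambda>s. indicator S s * norm (h s)"])
    show "integrable lborel (\<lambda>s. indicator S s * norm (h s))" by (rule ni)
    show "AE s in lborel. (\<lambda>n. indicator (S - {p n..q n}) s * norm (h s)) \<longlonglongrightarrow> 0"
    proof (rule AE_I2, rule tendsto_eventually)
      fix s show "\<forall>\<^sub>F n in sequentially. indicator (S - {p n..q n}) s * norm (h s) = 0"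
      proof (cases "s \<in> S")
        case True from ex[OF this] show ?thesis by eventually_elim simp
      qed simp
    qed
    show "(\<lambda>s. indicator (S - {p n..q n}) s * norm (h s)) \<in> borel_measurable lborel" for n
    proof -
      have "(\<lambda>s. indicator (- {p n..q n}) s * norm (indicat_real S s *\<^sub>R h s)) \<in> borel_measurable lborel"
        using hm by measurable
      then show ?thesis by (rule measurable_cong[THEN iffD1, rotated]) (auto simp: indicator_def)
    qed
  qed (auto simp: indicator_def)
  then have "\<forall>\<^sub>F n in sequentially. norm (\<integral>s. indicator (S - {p n..q n}) s * norm (h s) \<partial>lborel) < e / 2"
    using e by (intro tendsto_0_norm_less) auto
  then obtain n where n: "norm (\<integral>s. indicator (S - {p n..q n}) s * norm (h s) \<partial>lborel) < e / 2"
    using eventually_happens by fastforce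
  define I where "I = {p n..q n}"
  have intD: "set_integrable lborel (S - I) h" and intI: "set_integrable lborel I h"
    using S sub[of n] by (auto intro!: set_integrable_subset[OF int] simp: I_def)
  have s_int: "set_integrable lborel T (\<lambda>s. sin (a * s) *\<^sub>R h s)" if "set_integrable lborel T h" for T a
    unfolding set_integrable_def
  proof (rule Bochner_Integration.integrable_bound[OF that[unfolded set_integrable_def]])
    have "(\<lambda>s. sin (a * s) *\<^sub>R (indicat_real T s *\<^sub>R h s)) \<in> borel_measurable lborel"
      using borel_measurable_integrable[OF that[unfolded set_integrable_def]] by measurable
    then show "(\<lambda>s. indicat_real T s *\<^sub>R sin (a * s) *\<^sub>R h s) \<in> borel_measurable lborel"
      by (simp add: mult.commute)
    have "\<bar>sin (a * s)\<bar> * norm (h s) \<le> 1 * norm (h s)" for s by (intro mult_right_mono) auto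
    then show "AE s in lborel. norm (indicat_real T s *\<^sub>R sin (a * s) *\<^sub>R h s) \<le> norm (indicat_real T s *\<^sub>R h s)"
      by (intro AE_I2) (auto simp: indicator_def)
  qed
  have "((\<lambda>a. integral I (\<lambda>s. sin (a * s) *\<^sub>R h s)) \<longlongrightarrow> 0) at_top"
    unfolding I_def by (rule Riemann_Lebesgue_continuous[OF pq continuous_on_subset[OF c sub]])
  then have "\<forall>\<^sub>F a in at_top. norm (integral I (\<lambda>s. sin (a * s) *\<^sub>R h s)) < e / 2"
    by (rule tendsto_0_norm_less) (use e in simp)
  then show "\<forall>\<^sub>F a in at_top. dist (LINT s:S|lborel. sin (a * s) *\<^sub>R h s) 0 < e"
  proof eventually_elim
    case (elim a)
    have SI: "S = (S - I) \<union> I" using sub[of n] by (auto simp: I_def)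
    have "(LINT s:S|lborel. sin (a * s) *\<^sub>R h s) = (LINT s:(S - I) \<union> I|lborel. sin (a * s) *\<^sub>R h s)"
      using SI by simp
    also have "\<dots> = (LINT s:S - I|lborel. sin (a * s) *\<^sub>R h s) + (LINT s:I|lborel. sin (a * s) *\<^sub>R h s)"
      by (rule set_integral_Un) (auto intro: s_int intD intI)
    also have "(LINT s:I|lborel. sin (a * s) *\<^sub>R h s) = integral I (\<lambda>s. sin (a * s) *\<^sub>R h s)"
      using s_int[OF intI] by (rule set_borel_integral_eq_integral)
    finally have eq: "(LINT s:S|lborel. sin (a * s) *\<^sub>R h s) = (LINT s:S - I|lborel. sin (a * s) *\<^sub>R h s)
      + integral I (\<lambda>s. sin (a * s) *\<^sub>R h s)" .
    have "norm (LINT s:S - I|lborel. sin (a * s) *\<^sub>R h s) \<le> (\<integral>s. indicator (S - I) s * norm (h s) \<partial>lborel)"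
      unfolding set_lebesgue_integral_def
    proof (rule order_trans[OF integral_norm_bound integral_mono])
      show "integrable lborel (\<lambda>s. norm (indicat_real (S - I) s *\<^sub>R sin (a * s) *\<^sub>R h s))"
        using integrable_norm[OF s_int[OF intD, unfolded set_integrable_def]] .
      show "integrable lborel (\<lambda>s. indicator (S - I) s * norm (h s))"
        using integrable_norm[OF intD[unfolded set_integrable_def]] by simp
      have "\<bar>sin (a * s)\<bar> * norm (h s) \<le> 1 * norm (h s)" for s by (intro mult_right_mono) auto
      then show "norm (indicat_real (S - I) s *\<^sub>R sin (a * s) *\<^sub>R h s) \<le> indicator (S - I) s * norm (h s)" for s
        by (auto simp: indicator_def)
    qed
    also have "\<dots> < e / 2" using n by (simp add: I_def)
    finally show ?case unfolding eq using elim by (simp add: norm_add_less[of _ "e/2" _ "e/2", simplified])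
  qed
qed

text \<open>This is 2 sin(a s) / s, continued by 2 a at s = 0; it is the integral of exp(\<i> s
  \<xi>) over [-a, a].\<close>

definition dirichlet_kernel :: "real \<Rightarrow> real \<Rightarrow> real" where
  "dirichlet_kernel a s = 2 * a * sinc (a * s)"

lemma dirichlet_kernel_eq: "s \<noteq> 0 \<Longrightarrow> dirichlet_kernel a s = 2 * sin (a * s) / s"
  by (simp add: dirichlet_kernel_def)

lemma dirichlet_kernel_minus: "dirichlet_kernel a (- s) = dirichlet_kernel a s"
  by (simp add: dirichlet_kernel_def)

lemma dirichlet_kernel_measurable [measurable]: "dirichlet_kernel a \<in> borel_measurable borel"
  unfolding dirichlet_kernel_def[abs_def] by measurable

lemma dirichlet_kernel_bound: "0 \<le> a \<Longrightarrow> \<bar>dirichlet_kernel a s\<bar> \<le> 2 * a"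
proof -
  assume a: "0 \<le> a"
  have "\<bar>sinc (a * s)\<bar> \<le> 1"
    using abs_sin_x_le_abs_x[of "a * s"] by (auto simp: divide_le_eq_1)
  then show ?thesis using a by (auto simp: dirichlet_kernel_def abs_mult mult_left_le)
qed

lemma dirichlet_kernel_fourier:
  assumes "0 \<le> a"
  shows "(CLINT \<xi>:{-a..a}|lborel. exp (\<i> * of_real s * of_real \<xi>)) = of_real (dirichlet_kernel a s)"
proof -
  have c: "continuous_on {-a..a} (\<lambda>\<xi>. exp (\<i> * of_real s * of_real \<xi>))" by (intro continuous_intros)
  have "(CLINT \<xi>:{-a..a}|lborel. exp (\<i> * of_real s * of_real \<xi>)) = integral {-a..a} (\<lambda>\<xi>. exp (\<i> * of_real s * of_real \<xi>))"
    by (intro set_borel_integral_eq_integral borel_integrable_atLeastAtMost' c)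
  also have "\<dots> = of_real (dirichlet_kernel a s)"
  proof (cases "s = 0")
    case True then show ?thesis using assms by (simp add: dirichlet_kernel_def scaleR_conv_of_real)
  next
    case False
    have "((\<lambda>t. exp (t *\<^sub>R (\<i> * of_real s)) * (\<i> * of_real s)) has_integral
       (exp (a *\<^sub>R (\<i> * of_real s)) - exp ((- a) *\<^sub>R (\<i> * of_real s)))) {-a..a}"
      using exp_scaleR_has_vector_derivative_right[of "\<i> * of_real s"] assms
      by (intro fundamental_theorem_of_calculus) auto
    from integral_unique[OF has_integral_mult_left[OF this, of "1 / (\<i> * of_real s)"]] False
    have "integral {-a..a} (\<lambda>\<xi>. exp (\<i> * of_real s * of_real \<xi>))
       = (exp (a *\<^sub>R (\<i> * of_real s)) - exp ((- a) *\<^sub>R (\<i> * of_real s))) * (1 / (\<i> * of_real s))"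
      by (simp add: scaleR_conv_of_real mult_ac)
    also have "exp (a *\<^sub>R (\<i> * of_real s)) - exp ((- a) *\<^sub>R (\<i> * of_real s)) = 2 * \<i> * of_real (sin (a * s))"
    proof -
      have "a *\<^sub>R (\<i> * of_real s) = \<i> * of_real (a * s)" "(- a) *\<^sub>R (\<i> * of_real s) = \<i> * of_real (- (a * s))"
        by (simp_all add: scaleR_conv_of_real)
      then show ?thesis
        by (simp only: cis_conv_exp[symmetric]) (simp add: complex_eq_iff)
    qed
    finally show ?thesis using False by (simp add: dirichlet_kernel_eq)
  qed
  finally show ?thesis .
qed

lemma Si_has_integral: "(dirichlet_kernel a has_integral (2 * Si a)) {0..1}"
proof -
  have "((\<lambda>s. 2 * Si (a * s)) has_real_derivative dirichlet_kernel a s) (at s within {0..1})" for s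
    unfolding dirichlet_kernel_def
    by (auto intro!: derivative_eq_intros DERIV_chain2[OF DERIV_Si])
  then have "(dirichlet_kernel a has_integral (2 * Si (a * 1) - 2 * Si (a * 0))) {0..1}"
    by (intro fundamental_theorem_of_calculus) (auto simp: has_real_derivative_iff_has_vector_derivative[symmetric])
  moreover have "Si 0 = 0" by (simp add: Si_def zero_ereal_def)
  ultimately show ?thesis by simp
qed

lemma integrable_indicator_intervals:
  "integrable lborel (indicat_real {a..b})" "integrable lborel (indicat_real {a<..b})"
  for a b :: real
  by (rule integrable_real_indicator; cases "a \<le> b"; simp add: emeasure_lborel_Icc_eq)+

text \<open>Global continuity and integrability, with a Lipschitz condition at the points of [0, b]
  for shifts up to 1. This gives pointwise convergence with a uniform bound, hence convergence in
  the mean on [0, b] without the Plancherel theorem.\<close>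

locale fourier_function =
  fixes f :: "real \<Rightarrow> complex" and b L :: real
  assumes cont: "continuous_on UNIV f" and int: "integrable lborel f"
    and lip: "\<And>x s. 0 \<le> x \<Longrightarrow> x \<le> b \<Longrightarrow> \<bar>s\<bar> \<le> 1 \<Longrightarrow> norm (f (x + s) - f x) \<le> L * \<bar>s\<bar>"
begin

definition fhat :: "real \<Rightarrow> complex" where
  "fhat \<xi> = (\<integral>t. f t * exp (\<i> * of_real t * of_real \<xi>) \<partial>lborel)"

definition partial_integral :: "real \<Rightarrow> real \<Rightarrow> complex" where
  "partial_integral a x = (LINT \<xi>:{-a..a}|lborel. exp (- \<i> * of_real x * of_real \<xi>) * fhat \<xi>)"

lemma f_meas [measurable]: "f \<in> borel_measurable borel"
  using cont by (rule borel_measurable_continuous_onI)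

definition I0 :: real where "I0 = (\<integral>t. norm (f t) \<partial>lborel)"

lemma fhat_meas [measurable]: "fhat \<in> borel_measurable borel"
proof -
  have "fhat \<in> borel_measurable lborel"
    unfolding fhat_def by (rule lborel.borel_measurable_lebesgue_integral) measurable
  then show ?thesis by simp
qed

lemma partial_integral_meas [measurable]: "partial_integral a \<in> borel_measurable borel"
proof -
  have "partial_integral a \<in> borel_measurable lborel"
    unfolding partial_integral_def set_lebesgue_integral_def
    by (rule lborel.borel_measurable_lebesgue_integral) measurable
  then show ?thesis by simp
qed

lemma partial_integral_kernel:
  assumes a: "0 \<le> a"
  shows "partial_integral a x = (\<integral>s. dirichlet_kernel a s *\<^sub>R f (x + s) \<partial>lborel)"
proof -
  define F where "F \<xi> t = indicat_real {-a..a} \<xi> *\<^sub>R (exp (\<i> * of_real (t - x) * of_real \<xi>) * f t)" for \<xi> t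
  have "integrable (lborel \<Otimes>\<^sub>M lborel) (\<lambda>(\<xi>, t). F \<xi> t)"
  proof (rule Bochner_Integration.integrable_bound)
    show "integrable (lborel \<Otimes>\<^sub>M lborel) (\<lambda>(\<xi>, t). indicat_real {-a..a} \<xi> * norm (f t))"
    proof (rule lborel_pair.Fubini_integrable)
      show "(\<lambda>(\<xi>, t). indicat_real {-a..a} \<xi> * norm (f t)) \<in> borel_measurable (lborel \<Otimes>\<^sub>M lborel)" by measurable
      show "integrable lborel (\<lambda>\<xi>. \<integral>t. norm (case (\<xi>, t) of (\<xi>, t) \<Rightarrow> indicat_real {-a..a} \<xi> * norm (f t)) \<partial>lborel)"
        by (simp add: abs_mult integrable_indicator_intervals)
      show "AE \<xi> in lborel. integrable lborel (\<lambda>t. case (\<xi>, t) of (\<xi>, t) \<Rightarrow> indicat_real {-a..a} \<xi> * norm (f t))"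
        using integrable_norm[OF int] by simp
    qed
    show "(\<lambda>(\<xi>, t). F \<xi> t) \<in> borel_measurable (lborel \<Otimes>\<^sub>M lborel)" unfolding F_def by measurable
    have "norm (exp (\<i> * of_real (t - x) * of_real \<xi>)) = 1" for t \<xi>
      by (simp add: norm_exp_eq_Re)
    then show "AE z in lborel \<Otimes>\<^sub>M lborel. norm (case z of (\<xi>, t) \<Rightarrow> F \<xi> t)
       \<le> norm (case z of (\<xi>, t) \<Rightarrow> indicat_real {-a..a} \<xi> * norm (f t))"
      by (intro AE_I2) (auto simp: F_def norm_mult)
  qed
  from lborel_pair.Fubini_integral[OF this]
  have "(\<integral>t. (\<integral>\<xi>. F \<xi> t \<partial>lborel) \<partial>lborel) = (\<integral>\<xi>. (\<integral>t. F \<xi> t \<partial>lborel) \<partial>lborel)" .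
  moreover have "(\<integral>t. F \<xi> t \<partial>lborel) = indicat_real {-a..a} \<xi> *\<^sub>R (exp (- \<i> * of_real x * of_real \<xi>) * fhat \<xi>)" for \<xi>
  proof -
    have "F \<xi> t = indicat_real {-a..a} \<xi> *\<^sub>R (exp (- \<i> * of_real x * of_real \<xi>) * (f t * exp (\<i> * of_real t * of_real \<xi>)))" for t
      unfolding F_def by (simp add: exp_diff exp_minus divide_inverse algebra_simps)
    then show ?thesis unfolding fhat_def by simp
  qed
  moreover have "(\<integral>\<xi>. F \<xi> t \<partial>lborel) = dirichlet_kernel a (t - x) *\<^sub>R f t" for t
  proof -
    have "(\<integral>\<xi>. F \<xi> t \<partial>lborel) = (LINT \<xi>:{-a..a}|lborel. exp (\<i> * of_real (t - x) * of_real \<xi>)) * f t"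
      unfolding F_def set_lebesgue_integral_def by (simp flip: mult_scaleR_left)
    then show ?thesis unfolding dirichlet_kernel_fourier[OF a] by (simp add: scaleR_conv_of_real)
  qed
  ultimately have "partial_integral a x = (\<integral>t. dirichlet_kernel a (t - x) *\<^sub>R f t \<partial>lborel)"
    unfolding partial_integral_def set_lebesgue_integral_def by simp
  also have "\<dots> = (\<integral>s. dirichlet_kernel a s *\<^sub>R f (x + s) \<partial>lborel)"
    using lborel_integral_real_affine[of 1 "\<lambda>t. dirichlet_kernel a (t - x) *\<^sub>R f t" x] by simp
  finally show ?thesis .
qed

lemma int_shift: "integrable lborel (\<lambda>s. f (x + s))" "integrable lborel (\<lambda>s. f (x - s))"
  using lborel_integrable_real_affine[OF int, of 1 x] lborel_integrable_real_affine[OF int, of "-1" x] by simp_all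

lemma norm_shift: "(\<integral>s. norm (f (x + s)) \<partial>lborel) = I0" "(\<integral>s. norm (f (x - s)) \<partial>lborel) = I0"
  using lborel_integral_real_affine[of 1 "\<lambda>t. norm (f t)" x] lborel_integral_real_affine[of "-1" "\<lambda>t. norm (f t)" x]
  by (simp_all add: I0_def)

text \<open>Twice the even part of f about x. As the Dirichlet kernel is even, only s > 0 is left to
  integrate.\<close>

definition g :: "real \<Rightarrow> real \<Rightarrow> complex" where "g x s = f (x + s) + f (x - s)"

lemma g_int: "integrable lborel (g x)"
  unfolding g_def by (intro Bochner_Integration.integrable_add int_shift)

lemma g_cont: "continuous_on S (g x)"
  unfolding g_def by (intro continuous_intros continuous_on_compose2[OF cont]) auto

lemma g_meas [measurable]: "g x \<in> borel_measurable borel"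
  unfolding g_def by measurable

lemma kernel_int:
  assumes "0 \<le> a" "integrable lborel h"
  shows "integrable lborel (\<lambda>s. dirichlet_kernel a s *\<^sub>R (h s :: complex))"
proof (rule Bochner_Integration.integrable_bound)
  show "integrable lborel (\<lambda>s. (2 * a) *\<^sub>R h s)" using assms by simp
  have [measurable]: "h \<in> borel_measurable borel" using assms(2) borel_measurable_integrable by fastforce
  show "(\<lambda>s. dirichlet_kernel a s *\<^sub>R h s) \<in> borel_measurable lborel" by measurable
  show "AE s in lborel. norm (dirichlet_kernel a s *\<^sub>R h s) \<le> norm ((2 * a) *\<^sub>R h s)"
    using dirichlet_kernel_bound[OF assms(1)] assms(1) by (intro AE_I2) (auto intro!: mult_right_mono)
qed

text \<open>The split at s = 1 separates the range where the Lipschitz condition tames the factor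
  1/s from the one where 1/s is bounded and integrability of f suffices.\<close>

lemma partial_integral_halfline:
  assumes a: "0 \<le> a"
  shows "partial_integral a x = (LINT s:{0<..1}|lborel. dirichlet_kernel a s *\<^sub>R g x s)
     + (LINT s:{1<..}|lborel. dirichlet_kernel a s *\<^sub>R g x s)"
proof -
  define F where "F s = dirichlet_kernel a s *\<^sub>R f (x + s)" for s
  define F' where "F' s = dirichlet_kernel a s *\<^sub>R f (x - s)" for s
  have iF: "integrable lborel F" "integrable lborel F'"
    unfolding F_def F'_def by (intro kernel_int a int_shift)+
  have si: "set_integrable lborel S F" "set_integrable lborel S F'" if "S \<in> sets borel" for S
    using that iF by (auto simp: set_integrable_def intro!: integrable_mult_indicator)
  have "(\<integral>s. F s \<partial>lborel) = (LINT s:UNIV|lborel. F s)" by (simp add: set_lebesgue_integral_def)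
  also have "\<dots> = (LINT s:{0<..} \<union> {..0}|lborel. F s)" by (rule arg_cong[of _ _ "\<lambda>S. LINT s:S|lborel. F s"]) auto
  also have "\<dots> = (LINT s:{0<..}|lborel. F s) + (LINT s:{..0}|lborel. F s)"
    by (intro set_integral_Un si) auto
  also have "(LINT s:{..0}|lborel. F s) = (LINT s:{0..}|lborel. F' s)"
    unfolding set_lebesgue_integral_def
    using lborel_integral_real_affine[of "-1" "\<lambda>s. indicat_real {..0} s *\<^sub>R F s" 0]
    by (simp add: F_def F'_def dirichlet_kernel_minus indicator_def)
  also have "\<dots> = (LINT s:{0<..}|lborel. F' s)"
    unfolding set_lebesgue_integral_def
    by (rule integral_cong_AE) (use si[of "{0..}"] si[of "{0<..}"] AE_lborel_singleton[of 0] in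
       \<open>auto simp: set_integrable_def indicator_def dest: borel_measurable_integrable elim!: eventually_mono\<close>)
  also have "(LINT s:{0<..}|lborel. F s) + (LINT s:{0<..}|lborel. F' s) = (LINT s:{0<..}|lborel. dirichlet_kernel a s *\<^sub>R g x s)"
    using set_integral_add(2)[OF si(1) si(2), of "{0<..}"] by (simp add: F_def F'_def g_def scaleR_add_right)
  also have "\<dots> = (LINT s:{0<..1} \<union> {1<..}|lborel. dirichlet_kernel a s *\<^sub>R g x s)"
    by (rule arg_cong[of _ _ "\<lambda>S. LINT s:S|lborel. dirichlet_kernel a s *\<^sub>R g x s"]) auto
  also have "\<dots> = (LINT s:{0<..1}|lborel. dirichlet_kernel a s *\<^sub>R g x s)
     + (LINT s:{1<..}|lborel. dirichlet_kernel a s *\<^sub>R g x s)"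
  proof (rule set_integral_Un)
    show "set_integrable lborel {0<..1} (\<lambda>s. dirichlet_kernel a s *\<^sub>R g x s)"
      "set_integrable lborel {1<..} (\<lambda>s. dirichlet_kernel a s *\<^sub>R g x s)"
      unfolding set_integrable_def by (intro integrable_mult_indicator kernel_int a g_int; simp)+
  qed auto
  finally show ?thesis by (simp add: partial_integral_kernel[OF a] F_def)
qed

abbreviation "dirichlet_part x S a \<equiv> LINT s:S|lborel. dirichlet_kernel a s *\<^sub>R g x s"
abbreviation "sine_part h S a \<equiv> LINT s:S|lborel. sin (a * s) *\<^sub>R h s :: complex"
abbreviation "far_quotient x s \<equiv> (2 / s) *\<^sub>R g x s"

text \<open>Subtracting 2 f(x) from the even part leaves a quotient bounded by 4 L. The subtracted
  constant integrates to 4 Si(a) f(x), the source of the limit 2 pi f(x), as Si tends to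
  pi/2.\<close>

lemma near_part:
  assumes a: "0 \<le> a" and x: "0 \<le> x" "x \<le> b"
  defines "h \<equiv> \<lambda>s. (2 / s) *\<^sub>R (g x s - 2 * f x)"
  shows "dirichlet_part x {0<..1} a =
       sine_part h {0<..1} a + 4 * of_real (Si a) * f x"
    and "set_integrable lborel {0<..1} h" and "norm (sine_part h {0<..1} a) \<le> 4 * L"
proof -
  have hb: "norm (h s) \<le> 4 * L" if "s \<in> {0<..1}" for s
  proof -
    have "g x s - 2 * f x = (f (x + s) - f x) + (f (x + (- s)) - f x)" by (simp add: g_def)
    also have "norm \<dots> \<le> L * \<bar>s\<bar> + L * \<bar>- s\<bar>"
      by (intro order_trans[OF norm_triangle_ineq] add_mono lip x) (use that in auto)
    finally have "norm (g x s - 2 * f x) \<le> 2 * L * s" using that by simp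
    then have "(2 / s) * norm (g x s - 2 * f x) \<le> (2 / s) * (2 * L * s)"
      using that by (intro mult_left_mono) auto
    then show ?thesis using that by (simp add: h_def del: scaleR_right_diff_distrib)
  qed
  have "0 \<le> norm (h 1)" by simp
  also have "\<dots> \<le> 4 * L" by (rule hb) simp
  finally have L: "0 \<le> L" by simp
  have hm [measurable]: "h \<in> borel_measurable borel" unfolding h_def by measurable
  have ic: "set_integrable lborel {0<..1::real} (\<lambda>s. c :: real)" for c
    unfolding set_integrable_def
    by (rule integrable_scaleR_left) (rule integrable_indicator_intervals(2)[of 0 1])
  have si: "set_integrable lborel {0<..1} k" if "k \<in> borel_measurable borel" "\<And>s. s \<in> {0<..1} \<Longrightarrow> norm (k s) \<le> C" for k :: "real \<Rightarrow> complex" and C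
    unfolding set_integrable_def
  proof (rule Bochner_Integration.integrable_bound[OF ic[of C, unfolded set_integrable_def]])
    show "(\<lambda>s. indicat_real {0<..1} s *\<^sub>R k s) \<in> borel_measurable lborel" using that(1) by measurable
    show "AE s in lborel. norm (indicat_real {0<..1} s *\<^sub>R k s) \<le> norm (indicat_real {0<..1} s *\<^sub>R C)"
      using that(2) by (intro AE_I2) (force simp: indicator_def)
  qed
  show ih: "set_integrable lborel {0<..1} h" by (rule si[OF hm hb])
  have sb: "norm (sin (a * s) *\<^sub>R h s) \<le> 4 * L" if "s \<in> {0<..1}" for s
    using mult_mono[OF abs_sin_le_one hb[OF that], of "a * s"] by simp
  have ish: "set_integrable lborel {0<..1} (\<lambda>s. sin (a * s) *\<^sub>R h s)"
    by (rule si[OF _ sb]) measurable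
  have ik: "set_integrable lborel {0<..1} (\<lambda>s. dirichlet_kernel a s *\<^sub>R (2 * f x))"
  proof (rule si)
    show "norm (dirichlet_kernel a s *\<^sub>R (2 * f x)) \<le> 2 * a * norm (2 * f x)" for s
      unfolding norm_scaleR by (intro mult_right_mono dirichlet_kernel_bound[OF a] norm_ge_zero)
  qed measurable
  have "dirichlet_part x {0<..1} a =
     (LINT s:{0<..1}|lborel. sin (a * s) *\<^sub>R h s + dirichlet_kernel a s *\<^sub>R (2 * f x))"
    by (rule set_lebesgue_integral_cong) (auto simp: h_def dirichlet_kernel_eq scaleR_diff_right algebra_simps)
  also have "\<dots> = sine_part h {0<..1} a + (LINT s:{0<..1}|lborel. dirichlet_kernel a s *\<^sub>R (2 * f x))"
    by (rule set_integral_add(2)[OF ish ik])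
  also have "(LINT s:{0<..1}|lborel. dirichlet_kernel a s *\<^sub>R (2 * f x)) = 4 * of_real (Si a) * f x"
  proof -
    have "(LINT s:{0<..1}|lborel. dirichlet_kernel a s *\<^sub>R (2 * f x)) = integral {0<..1} (\<lambda>s. dirichlet_kernel a s *\<^sub>R (2 * f x))"
      by (rule set_borel_integral_eq_integral(2)[OF ik])
    also have "\<dots> = integral {0..1} (\<lambda>s. dirichlet_kernel a s *\<^sub>R (2 * f x))"
      by (rule integral_spike_set) (auto intro: negligible_subset[of "{0}"])
    also have "\<dots> = (2 * Si a) *\<^sub>R (2 * f x)"
      by (rule integral_unique, rule has_integral_scaleR_left, rule Si_has_integral)
    finally show ?thesis by (simp add: scaleR_conv_of_real)
  qed
  finally show "dirichlet_part x {0<..1} a =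
       sine_part h {0<..1} a + 4 * of_real (Si a) * f x" .
  have "norm (sine_part h {0<..1} a) \<le> (LINT s:{0<..1}|lborel. norm (sin (a * s) *\<^sub>R h s))"
    by (rule set_integral_norm_bound[OF ish])
  also have "\<dots> \<le> (LINT s:{0<..1::real}|lborel. 4 * L)"
    by (rule set_integral_mono[OF set_integrable_norm[OF ish] ic sb])
  also have "\<dots> = 4 * L" by (simp add: set_lebesgue_integral_def)
  finally show "norm (sine_part h {0<..1} a) \<le> 4 * L" .
qed

lemma far_part:
  assumes a: "0 \<le> a"
  shows "dirichlet_part x {1<..} a = sine_part (far_quotient x) {1<..} a"
    and "set_integrable lborel {1<..} (far_quotient x)"
    and "norm (sine_part (far_quotient x) {1<..} a) \<le> 4 * I0"
proof -
  show "dirichlet_part x {1<..} a = sine_part (far_quotient x) {1<..} a"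
    by (rule set_lebesgue_integral_cong) (auto simp: dirichlet_kernel_eq)
  have i2: "integrable lborel (\<lambda>s. 2 *\<^sub>R g x s)" using g_int by simp
  have b1: "norm (indicat_real {1<..} s *\<^sub>R c *\<^sub>R (far_quotient x s)) \<le> norm (2 *\<^sub>R g x s)" if "\<bar>c\<bar> \<le> 1" for s c
  proof (cases "s > 1")
    case True
    have "\<bar>c\<bar> * (2 / s) \<le> 1 * 2" using True that by (intro mult_mono) (auto simp: field_simps)
    from mult_right_mono[OF this norm_ge_zero[of "g x s"]] True show ?thesis by (simp add: abs_mult)
  qed simp
  show "set_integrable lborel {1<..} (far_quotient x)"
    unfolding set_integrable_def
    by (rule Bochner_Integration.integrable_bound[OF i2]) (use b1[of 1] in auto)
  have "norm (sine_part (far_quotient x) {1<..} a) \<le> (\<integral>s. norm (2 *\<^sub>R g x s) \<partial>lborel)"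
    unfolding set_lebesgue_integral_def
  proof (rule order_trans[OF integral_norm_bound integral_mono])
    have "integrable lborel (\<lambda>s. indicat_real {1<..} s *\<^sub>R sin (a * s) *\<^sub>R (far_quotient x s))"
      by (rule Bochner_Integration.integrable_bound[OF i2]) (use b1[OF abs_sin_le_one] in auto)
    then show "integrable lborel (\<lambda>s. norm (indicat_real {1<..} s *\<^sub>R sin (a * s) *\<^sub>R (far_quotient x s)))"
      by (rule integrable_norm)
    show "integrable lborel (\<lambda>s. norm (2 *\<^sub>R g x s))" using i2 by (rule integrable_norm)
  qed (rule b1[OF abs_sin_le_one])
  also have "\<dots> \<le> (\<integral>s. 2 * norm (f (x + s)) + 2 * norm (f (x - s)) \<partial>lborel)"
  proof (rule integral_mono)
    show "integrable lborel (\<lambda>s. norm (2 *\<^sub>R g x s))" using i2 by (rule integrable_norm)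
    show "integrable lborel (\<lambda>s. 2 * norm (f (x + s)) + 2 * norm (f (x - s)))"
      using int_shift by (intro Bochner_Integration.integrable_add integrable_mult_right integrable_norm)
    show "norm (2 *\<^sub>R g x s) \<le> 2 * norm (f (x + s)) + 2 * norm (f (x - s))" for s
      using norm_triangle_ineq[of "f (x + s)" "f (x - s)"] by (simp add: g_def)
  qed
  also have "\<dots> = 4 * I0"
    using int_shift by (simp add: Bochner_Integration.integral_add integrable_norm norm_shift)
  finally show "norm (sine_part (far_quotient x) {1<..} a) \<le> 4 * I0" .
qed

lemma partial_integral_tendsto:
  assumes x: "0 \<le> x" "x \<le> b"
  shows "((\<lambda>a. partial_integral a x) \<longlongrightarrow> 2 * pi * f x) at_top"
proof -
  define h where "h s = (2 / s) *\<^sub>R (g x s - 2 * f x)" for s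
  have n: "(sine_part h {0<..1} \<longlongrightarrow> 0) at_top"
  proof (rule Riemann_Lebesgue_exhaustion[where p = "\<lambda>n. inverse (real (Suc n))" and q = "\<lambda>n. 1"])
    show "set_integrable lborel {0<..1} h" unfolding h_def by (rule near_part(2)[OF order_refl x])
    show "continuous_on {0<..1} h" unfolding h_def by (intro continuous_intros g_cont) auto
    show "inverse (real (Suc n)) \<le> 1" for n by (simp add: field_simps)
    show "{inverse (real (Suc n))..1} \<subseteq> {0<..1}" for n
      using less_le_trans[of 0 "inverse (real (Suc n))"] by fastforce
    fix s :: real assume s: "s \<in> {0<..1}"
    then show "\<forall>\<^sub>F n in sequentially. s \<in> {inverse (real (Suc n))..1}"
      using order_tendstoD(2)[OF LIMSEQ_inverse_real_of_nat, of s] by (auto elim: eventually_mono)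
  qed simp
  have fr: "(sine_part (far_quotient x) {1<..} \<longlongrightarrow> 0) at_top"
  proof (rule Riemann_Lebesgue_exhaustion[where p = "\<lambda>n. 1 + inverse (real (Suc n))" and q = "\<lambda>n. 3 + real n"])
    show "set_integrable lborel {1<..} (far_quotient x)" by (rule far_part(2)[OF order_refl])
    show "continuous_on {1<..} (far_quotient x)" by (intro continuous_intros g_cont) auto
    show "1 + inverse (real (Suc n)) \<le> 3 + real n" for n by (simp add: field_simps)
    show "{1 + inverse (real (Suc n))..3 + real n} \<subseteq> {1<..}" for n
      using less_le_trans[of 1 "1 + inverse (real (Suc n))"] by fastforce
    fix s :: real assume s: "s \<in> {1<..}"
    then have "\<forall>\<^sub>F n in sequentially. inverse (real (Suc n)) < s - 1"
      using order_tendstoD(2)[OF LIMSEQ_inverse_real_of_nat, of "s - 1"] by simp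
    moreover have "\<forall>\<^sub>F n in sequentially. s \<le> real n"
      using filterlim_real_sequentially by (simp add: filterlim_at_top)
    ultimately show "\<forall>\<^sub>F n in sequentially. s \<in> {1 + inverse (real (Suc n))..3 + real n}"
      by eventually_elim auto
  qed simp
  have "((\<lambda>a. sine_part h {0<..1} a + 4 * of_real (Si a) * f x
      + sine_part (far_quotient x) {1<..} a) \<longlongrightarrow> 2 * pi * f x) at_top"
    using tendsto_add[OF tendsto_add[OF n tendsto_mult_right[OF tendsto_mult_left[OF tendsto_of_real[OF Si_at_top]]]] fr, of 4 "f x"] by simp
  then show ?thesis
  proof (rule Lim_transform_eventually)
    show "\<forall>\<^sub>F a in at_top. sine_part h {0<..1} a + 4 * of_real (Si a) * f x
      + sine_part (far_quotient x) {1<..} a = partial_integral a x"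
      using eventually_ge_at_top[of 0]
      by eventually_elim (simp add: partial_integral_halfline near_part(1)[OF _ x] far_part(1) h_def)
  qed
qed

text \<open>A bound uniform in a and x is the dominating function that upgrades pointwise
  convergence to convergence in the mean.\<close>

lemma partial_integral_bounded:
  obtains C where "\<And>a x. 0 \<le> a \<Longrightarrow> 0 \<le> x \<Longrightarrow> x \<le> b \<Longrightarrow> norm (partial_integral a x) \<le> C"
    "\<And>x. 0 \<le> x \<Longrightarrow> x \<le> b \<Longrightarrow> norm (f x) \<le> C"
proof -
  obtain B where B: "\<And>T. \<bar>Si T\<bar> \<le> B" using bounded_Si by blast
  obtain F where F: "\<And>x. x \<in> {0..b} \<Longrightarrow> norm (f x) \<le> F"
    using continuous_on_Icc_bounded[OF continuous_on_subset[OF cont subset_UNIV]] by blast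
  have "norm (partial_integral a x) \<le> 4 * L + 4 * B * F + 4 * I0" if a: "0 \<le> a" and x: "0 \<le> x" "x \<le> b" for a x
    unfolding partial_integral_halfline[OF a] near_part(1)[OF a x] far_part(1)[OF a]
  proof (intro order_trans[OF norm_triangle_ineq] add_mono near_part(3)[OF a x] far_part(3)[OF a])
    have "norm (4 * complex_of_real (Si a) * f x) = 4 * (\<bar>Si a\<bar> * norm (f x))" by (simp add: norm_mult)
    also have "\<dots> \<le> 4 * (B * F)" using B[of a] F[of x] x by (intro mult_left_mono mult_mono) auto
    finally show "norm (4 * complex_of_real (Si a) * f x) \<le> 4 * B * F" by simp
  qed
  then show ?thesis using F
    by (intro that[of "max F (4 * L + 4 * B * F + 4 * I0)"]) (auto intro: max.coboundedI1 max.coboundedI2)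
qed

theorem partial_integral_lim_in_mean:
  "lim_in_mean {0..b} partial_integral (\<lambda>x. 2 * pi * f x)"
proof -
  let ?D = "\<lambda>a x. partial_integral a x - 2 * pi * f x"
  obtain C where C: "\<And>a x. 0 \<le> a \<Longrightarrow> 0 \<le> x \<Longrightarrow> x \<le> b \<Longrightarrow> norm (partial_integral a x) \<le> C"
    "\<And>x. 0 \<le> x \<Longrightarrow> x \<le> b \<Longrightarrow> norm (f x) \<le> C"
    using partial_integral_bounded by blast
  have lm: "h \<in> borel_measurable (Leb b)" if "h \<in> borel_measurable borel" for h :: "real \<Rightarrow> complex"
    using that by (intro measurable_restrict_space1 measurable_completion) simp
  have F: "partial_integral a \<in> L2_on {0..b}" if "0 \<le> a" for a
    by (rule L2_on_bounded[where B = C]) (use C(1) that in \<open>auto intro!: lm AE_I2\<close>)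
  have G: "(\<lambda>x. 2 * pi * f x) \<in> L2_on {0..b}"
    by (rule L2_on_bounded[where B = "2 * pi * C"])
      (use C(2) in \<open>auto intro!: lm AE_I2 simp: norm_mult\<close>)
  interpret finite_measure "Leb b" by (rule finite_measure_lebesgue_on) simp
  \<comment> \<open>The bounds hold for nonnegative a. Replacing a by \<open>max a 0\<close> makes
    them available for every a and changes nothing eventually.\<close>
  have "((\<lambda>a. \<integral>x. (norm (?D (max a 0) x))\<^sup>2 \<partial>Leb b)
      \<longlongrightarrow> (\<integral>x. 0 \<partial>Leb b)) at_top"
  proof (rule integral_dominated_convergence_at_top[where w = "\<lambda>x. (C + 2 * pi * C)\<^sup>2"])
    have "((\<lambda>a. (norm (?D (max a 0) x))\<^sup>2) \<longlongrightarrow> 0) at_top" if "x \<in> {0..b}" for x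
    proof -
      have "((\<lambda>a. (norm (?D a x))\<^sup>2) \<longlongrightarrow> (norm (2 * pi * f x - 2 * pi * f x))\<^sup>2) at_top"
        using that by (intro tendsto_intros partial_integral_tendsto) auto
      then have "((\<lambda>a. (norm (?D a x))\<^sup>2) \<longlongrightarrow> 0) at_top" by simp
      then show ?thesis
        by (rule Lim_transform_eventually)
          (use eventually_ge_at_top[of 0] in \<open>eventually_elim, simp add: max_def\<close>)
    qed
    then show "AE x in Leb b. ((\<lambda>a. (norm (?D (max a 0) x))\<^sup>2) \<longlongrightarrow> 0) at_top"
      by (intro AE_I2) auto
    have "norm ((norm (?D (max a 0) x))\<^sup>2) \<le> (C + 2 * pi * C)\<^sup>2" if x: "x \<in> {0..b}" for a x
    proof -
      have "norm (?D (max a 0) x) \<le> norm (partial_integral (max a 0) x) + norm (2 * pi * f x)"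
        by (rule norm_triangle_ineq4)
      also have "\<dots> \<le> C + 2 * pi * C" using C(1)[of "max a 0" x] C(2)[of x] x by (simp add: norm_mult add_mono)
      finally show ?thesis by (simp add: power_mono)
    qed
    then show "\<forall>\<^sub>F a in at_top. AE x in Leb b. norm ((norm (?D (max a 0) x))\<^sup>2) \<le> (C + 2 * pi * C)\<^sup>2"
      by (intro always_eventually allI AE_I2) auto
    show "(\<lambda>x. (norm (?D (max a 0) x))\<^sup>2) \<in> borel_measurable (Leb b)" for a
    proof -
      have "?D (max a 0) \<in> borel_measurable (Leb b)"
        by (rule lm) measurable
      then show ?thesis by measurable
    qed
  qed auto
  then have "((\<lambda>a. \<integral>x. (norm (?D (max a 0) x))\<^sup>2 \<partial>Leb b) \<longlongrightarrow> 0) at_top" by simp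
  then have "((\<lambda>a. \<integral>x. (norm (?D a x))\<^sup>2 \<partial>Leb b) \<longlongrightarrow> 0) at_top"
    by (rule Lim_transform_eventually)
      (use eventually_ge_at_top[of 0] in \<open>eventually_elim, simp add: max_def\<close>)
  from tendsto_real_sqrt[OF this]
  have "((\<lambda>a. L2_norm_on {0..b} (?D a)) \<longlongrightarrow> 0) at_top"
    by (simp add: L2_norm_on_def)
  moreover have "\<forall>\<^sub>F a in at_top. partial_integral a \<in> L2_on {0..b}"
    using eventually_ge_at_top[of 0] by eventually_elim (rule F)
  ultimately show ?thesis using G by (simp add: lim_in_mean_def)
qed

end

section \<open>Inversion of the transform of \<Phi>1\<close>

lemma continuous_AE_le:
  fixes p q :: "real \<Rightarrow> real"
  assumes "0 < l" "continuous_on {0..l} p" "continuous_on {0..l} q"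
    and ae: "AE x in Leb l. p x \<le> q x" and x: "x \<in> {0..l}"
  shows "p x \<le> q x"
proof -
  define h where "h x = max (p x - q x) 0" for x
  have c: "continuous_on {0..l} h" unfolding h_def by (intro continuous_intros assms)
  have "integral\<^sup>L (Leb l) h = 0"
    by (rule integral_eq_zero_AE) (use ae in \<open>eventually_elim, simp add: h_def\<close>)
  then have "h x = 0"
    using integralL_eq_0_iff[OF c \<open>0 < l\<close>] x by (auto simp: h_def)
  then show ?thesis by (simp add: h_def)
qed

lemma lim_in_mean_cmult:
  fixes F :: "real \<Rightarrow> real \<Rightarrow> complex"
  assumes "lim_in_mean S F G"
  shows "lim_in_mean S (\<lambda>a x. c * F a x) (\<lambda>x. c * G x)"
proof -
  have L: "(\<lambda>x. c * h x) \<in> L2_on S" if "h \<in> L2_on S" for h :: "real \<Rightarrow> complex"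
    using that by (rule L2_on_bounded_linear[OF bounded_linear_mult_right])
  have e: "L2_norm_on S (\<lambda>x. c * F a x - c * G x) = cmod c * L2_norm_on S (\<lambda>x. F a x - G x)" for a
  proof -
    have "(norm (c * F a x - c * G x))\<^sup>2 = (cmod c)\<^sup>2 * (norm (F a x - G x))\<^sup>2" for x
      by (simp add: norm_mult power_mult_distrib flip: right_diff_distrib)
    then show ?thesis by (simp add: L2_norm_on_def real_sqrt_mult)
  qed
  have "((\<lambda>a. cmod c * L2_norm_on S (\<lambda>x. F a x - G x)) \<longlongrightarrow> cmod c * 0) at_top"
    using assms by (intro tendsto_intros) (simp add: lim_in_mean_def)
  then show ?thesis
    using assms L unfolding lim_in_mean_def e by (auto elim!: eventually_mono)
qed

lemma bounded_linear_entry: "bounded_linear (\<lambda>A :: complex^'q::finite^'p::finite. A $ i $ k)"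
  using bounded_linear_compose[OF bounded_linear_vec_nth bounded_linear_vec_nth] .

context dirac_similarity
begin

text \<open>E \<Phi> = \<gamma>1 holds almost everywhere, the integral part of E is O(x), and
  \<gamma>1 vanishes at 0; continuity carries the estimate to x = 0. The value matters for extending
  \<Phi> by zero to the negative axis and for writing \<Phi> as the primitive of its
  derivative.\<close>

lemma Phi_0: "\<Phi> 0 = 0"
proof (rule matrix_eq_vectorI)
  fix c :: "complex^'m1"
  obtain C0 where C0: "0 \<le> C0" "\<And>x t w. 0 \<le> t \<Longrightarrow> t \<le> x \<Longrightarrow> x \<le> l \<Longrightarrow> norm (k x t *v w) \<le> C0 * norm w"
    by (rule kernel_bound) blast
  obtain B where B: "0 \<le> B" "\<And>x. x \<in> {0..l} \<Longrightarrow> norm (\<Phi> x *v c) \<le> B"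
    using continuous_on_Icc_bounded[OF Phi_vec_cont] by blast
  have cg: "continuous_on {0..l} (\<lambda>x. \<gamma> x *v vjoin c 0)"
    by (intro continuous_on_matrix_vector gamma_cont continuous_intros)
  have ae: "AE x in Leb l. norm (\<Phi> x *v c) \<le> norm (\<gamma> x *v vjoin c 0) + (C0 * B) * x"
    using E_Phi[of c] AE_mem
  proof eventually_elim
    case (elim x)
    have "norm (LINT t:{0..x}|lebesgue. k x t *v (\<Phi> t *v c)) \<le> (C0 * B) * x"
      by (rule norm_lint_le) (use elim B C0 in \<open>auto intro!: order_trans[OF C0(2)] mult_left_mono\<close>)
    moreover have "\<Phi> x *v c = \<gamma> x *v vjoin c 0 - (LINT t:{0..x}|lebesgue. k x t *v (\<Phi> t *v c))"
      using elim(1) unfolding volterra_op_def by (simp add: algebra_simps)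
    ultimately show ?case using norm_triangle_ineq4[of "\<gamma> x *v vjoin c 0" "LINT t:{0..x}|lebesgue. k x t *v (\<Phi> t *v c)"]
      by simp
  qed
  have "norm (\<Phi> 0 *v c) \<le> norm (\<gamma> 0 *v vjoin c 0) + (C0 * B) * 0"
    by (rule continuous_AE_le[OF l_pos _ _ ae]) (use l_pos in \<open>auto intro!: continuous_intros Phi_vec_cont cg\<close>)
  then show "\<Phi> 0 *v c = 0 *v c" by (simp add: gamma_of_vec)
qed

end

context dirac_system
begin

text \<open>The substitution t = 2 x turns exp(2 \<i> x z) into a standard Fourier exponential and
  accounts for the factor 2. Since \<Phi> 0 = 0, the argument \<open>max t 0\<close> extends \<Phi>
  by zero to a continuous function that is still Lipschitz near [0, b].\<close>

lemma Phi_fourier_function: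
  fixes \<Phi> :: "real \<Rightarrow> complex^'m1^'m2" and i :: 'm2 and k :: 'm1 and b \<eta> \<xi> :: real
  assumes Phi: "is_Phi1 \<gamma> \<Phi>" and \<eta>: "M < \<eta>" and b: "0 < b"
  defines "f \<equiv> \<lambda>t. of_real (exp (- \<eta> * t)) * \<Phi> (max t 0 / 2) $ i $ k"
  shows "\<exists>L. fourier_function f b L"
    and "fourier_function.fhat f \<xi> =
      2 * (LINT x:{0..}|lebesgue. cscale (wave (Complex \<xi> \<eta>) x) (\<Phi> x)) $ i $ k"
proof -
  \<comment> \<open>One unit beyond b, because the Lipschitz condition compares points of [0, b]
    with points at distance up to 1.\<close>
  obtain kk R where "dirac_similarity M v u \<Phi> (b + 1) kk R" using similarity_exists[OF Phi, of "b + 1"] b by auto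
  then interpret S: dirac_similarity M v u \<Phi> "b + 1" kk R .
  have P0: "\<Phi> 0 = 0" by (rule S.Phi_0)
  have cPm: "continuous_on UNIV (\<lambda>t. \<Phi> (max t 0 * c) $ i $ k)" if "0 \<le> c" for c
  proof -
    have "continuous_on UNIV (\<lambda>t. \<Phi> (max t 0 * c))"
      by (rule continuous_on_compose2[OF Phi_cont_on[OF Phi]]) (use that in \<open>auto intro!: continuous_intros\<close>)
    then show ?thesis by (rule bounded_linear.continuous_on[OF bounded_linear_entry])
  qed
  have cf: "continuous_on UNIV f"
    unfolding f_def using cPm[of "1/2"] by (intro continuous_on_mult) (auto intro!: continuous_intros)
  define F where "F x = of_real (exp (- 2 * \<eta> * x)) * \<Phi> (max x 0) $ i $ k" for x
  have cF: "continuous_on UNIV F"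
    unfolding F_def using cPm[of 1] by (intro continuous_on_mult) (auto intro!: continuous_intros)
  define z where "z \<xi> = Complex \<xi> \<eta>" for \<xi>
  have z: "M < Im (z \<xi>)" for \<xi> using \<eta> by (simp add: z_def)
  have ent: "indicat_real {0..} x *\<^sub>R (cscale (wave (z \<xi>) x) (\<Phi> x) $ i $ k)
      = F x * wave (of_real \<xi>) x" for x \<xi>
  proof (cases "0 \<le> x")
    case True
    have "2 * \<i> * of_real x * z \<xi> = of_real (- 2 * \<eta> * x) + 2 * \<i> * of_real x * of_real \<xi>"
      by (simp add: z_def complex_eq_iff)
    then have "wave (z \<xi>) x = of_real (exp (- 2 * \<eta> * x)) * wave (of_real \<xi>) x"
      by (simp only: exp_add exp_of_real)
    then show ?thesis using True by (simp add: F_def cscale_def mult_ac)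
  next
    case False then show ?thesis by (simp add: F_def P0)
  qed
  have intz: "integrable lebesgue (\<lambda>x. F x * wave (of_real \<xi>) x)"
    and valz: "(\<integral>x. F x * wave (of_real \<xi>) x \<partial>lebesgue) =
       (LINT x:{0..}|lebesgue. cscale (wave (z \<xi>) x) (\<Phi> x)) $ i $ k" for \<xi>
  proof -
    have i: "integrable lebesgue (\<lambda>x. indicat_real {0..} x *\<^sub>R cscale (wave (z \<xi>) x) (\<Phi> x))"
      using Phi_exp_integrable[OF Phi z, of \<xi>] by (simp add: integrable_lebesgue_on_iff set_integrable_def)
    have e: "(indicat_real {0..} x *\<^sub>R cscale (wave (z \<xi>) x) (\<Phi> x)) $ i $ k =
      F x * wave (of_real \<xi>) x" for x
      unfolding ent[symmetric] by simp
    show "integrable lebesgue (\<lambda>x. F x * wave (of_real \<xi>) x)"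
      using integrable_bounded_linear[OF bounded_linear_entry[of i k] i] unfolding e .
    show "(\<integral>x. F x * wave (of_real \<xi>) x \<partial>lebesgue) =
       (LINT x:{0..}|lebesgue. cscale (wave (z \<xi>) x) (\<Phi> x)) $ i $ k"
      using integral_bounded_linear[OF bounded_linear_entry[of i k] i]
      unfolding e set_lebesgue_integral_def by simp
  qed
  have Fm: "F \<in> borel_measurable borel" using cF by (rule borel_measurable_continuous_onI)
  have iF: "integrable lborel F"
    using intz[of 0] Fm by (simp add: integrable_completion)
  have fF: "f t = F (0 + (1 / 2) * t)" for t
    by (cases "0 \<le> t") (simp_all add: f_def F_def P0)
  have intf: "integrable lborel f"
    using lborel_integrable_real_affine[OF iF, of "1/2" 0] unfolding fF[abs_def] by simp
  have "lip_on (- 1) (b + 1) f"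
    unfolding f_def
  proof (rule lip_on_bounded_bilinear[OF bounded_bilinear_mult])
    have "has_ae_deriv (- 1) (b + 1) (\<lambda>x. exp (- \<eta> * x)) (\<lambda>x. - \<eta> * exp (- \<eta> * x))"
      by (rule has_ae_deriv_C1)
        (auto intro!: derivative_eq_intros continuous_intros simp: has_real_derivative_iff_has_vector_derivative[symmetric])
    then show "lip_on (- 1) (b + 1) (\<lambda>x. complex_of_real (exp (- \<eta> * x)))"
      by (intro lip_on_bounded_linear[OF bounded_linear_of_real] has_ae_deriv_lip)
    have "lip_on 0 (b + 1) \<Phi>" by (rule has_ae_deriv_lip[OF S.Phi_deriv])
    then obtain L where L: "L \<ge> 0" "\<And>x y. x \<in> {0..b+1} \<Longrightarrow> y \<in> {0..b+1} \<Longrightarrow> norm (\<Phi> y - \<Phi> x) \<le> L * \<bar>y - x\<bar>"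
      by (rule lip_onE) blast
    have "norm (\<Phi> (max y 0 / 2) - \<Phi> (max x 0 / 2)) \<le> L * \<bar>y - x\<bar>" if "x \<in> {-1..b+1}" "y \<in> {-1..b+1}" for x y
    proof -
      have "norm (\<Phi> (max y 0 / 2) - \<Phi> (max x 0 / 2)) \<le> L * \<bar>max y 0 / 2 - max x 0 / 2\<bar>"
        using that b by (intro L(2)) auto
      also have "\<dots> \<le> L * \<bar>y - x\<bar>" using L(1) by (intro mult_left_mono) auto
      finally show ?thesis .
    qed
    then have "lip_on (- 1) (b + 1) (\<lambda>x. \<Phi> (max x 0 / 2))" unfolding lip_on_def by blast
    then show "lip_on (- 1) (b + 1) (\<lambda>x. \<Phi> (max x 0 / 2) $ i $ k)"
      by (rule lip_on_bounded_linear[OF bounded_linear_entry])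
  qed
  then obtain L where L: "L \<ge> 0" "\<And>x y. x \<in> {-1..b+1} \<Longrightarrow> y \<in> {-1..b+1} \<Longrightarrow> norm (f y - f x) \<le> L * \<bar>y - x\<bar>"
    by (rule lip_onE) blast
  have ff: "fourier_function f b L"
  proof
    fix x s :: real assume "0 \<le> x" "x \<le> b" "\<bar>s\<bar> \<le> 1"
    then show "norm (f (x + s) - f x) \<le> L * \<bar>s\<bar>" using L(2)[of x "x + s"] by (auto simp: abs_le_iff)
  qed (rule cf intf)+
  then show "\<exists>L. fourier_function f b L" by blast
  have "fourier_function.fhat f \<xi> = (\<integral>t. f t * exp (\<i> * of_real t * of_real \<xi>) \<partial>lborel)"
    by (rule fourier_function.fhat_def[OF ff])
  also have "\<dots> = \<bar>2\<bar> *\<^sub>R (\<integral>x. f (0 + 2 * x) * exp (\<i> * of_real (0 + 2 * x) * of_real \<xi>) \<partial>lborel)"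
    by (rule lborel_integral_real_affine) simp
  also have "\<dots> = 2 * (\<integral>x. F x * wave (of_real \<xi>) x \<partial>lborel)"
    by (simp add: fF scaleR_conv_of_real mult_ac)
  also have "(\<integral>x. F x * wave (of_real \<xi>) x \<partial>lborel) = (\<integral>x. F x * wave (of_real \<xi>) x \<partial>lebesgue)"
    by (rule integral_completion[symmetric]) (use Fm in measurable)
  finally show "fourier_function.fhat f \<xi> =
      2 * (LINT x:{0..}|lebesgue. cscale (wave (Complex \<xi> \<eta>) x) (\<Phi> x)) $ i $ k"
    unfolding valz z_def .
qed

theorem Phi_fourier_inversion:
  fixes \<Phi> :: "real \<Rightarrow> complex^'m1^'m2" and \<phi> :: "complex \<Rightarrow> complex^'m1^'m2"
  assumes Phi: "is_Phi1 \<gamma> \<Phi>" and W: "weyl_function M u \<phi>" and \<eta>: "M < \<eta>" and l: "0 < l"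
  shows "\<exists>G. (\<forall>i k. lim_in_mean {0..2 * l}
              (\<lambda>a x. LINT \<xi>:{- a..a}|lebesgue.
                 exp (- \<i> * x * \<xi>) * \<phi> (Complex \<xi> \<eta>) $ i $ k / (2 * \<i> * Complex \<xi> \<eta>))
              (\<lambda>x. G x $ i $ k)) \<and>
           (AE x in lebesgue_on {0..2 * l}. \<Phi> (x / 2) = (exp (x * \<eta>) / pi) *\<^sub>R G x)"
proof (intro exI conjI allI)
  \<comment> \<open>The recovery formula solved for G; with \<open>max\<close> its entries are
    multiples of f on the whole line.\<close>
  define G where "G x = (pi * exp (- \<eta> * x)) *\<^sub>R \<Phi> (max x 0 / 2)" for x
  show "AE x in lebesgue_on {0..2 * l}. \<Phi> (x / 2) = (exp (x * \<eta>) / pi) *\<^sub>R G x"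
    by (rule AE_I2) (simp add: G_def exp_minus mult.commute)
  fix i k
  define f where "f t = of_real (exp (- \<eta> * t)) * \<Phi> (max t 0 / 2) $ i $ k" for t
  have b: "0 < 2 * l" using l by simp
  obtain L where "fourier_function f (2 * l) L"
    using Phi_fourier_function(1)[OF Phi \<eta> b, of i k] unfolding f_def by blast
  then interpret fourier_function f "2 * l" L .
  \<comment> \<open>Dividing the Laplace representation by 2 \<i> z leaves half the Fourier
    transform of f; this half turns the limit 2 pi f into pi f.\<close>
  have fh: "\<phi> (Complex \<xi> \<eta>) $ i $ k / (2 * \<i> * Complex \<xi> \<eta>) = fhat \<xi> / 2" for \<xi>
  proof -
    define z where "z = Complex \<xi> \<eta>"
    have "z \<noteq> 0" using \<eta> M_pos by (auto simp: z_def complex_eq_iff)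
    have "\<phi> z = cscale (2 * \<i> * z) (LINT x:{0..}|lebesgue. cscale (wave z x) (\<Phi> x))"
      by (rule Weyl_representation[OF Phi W]) (use \<eta> in \<open>simp add: z_def\<close>)
    moreover have "fhat \<xi> = 2 * (LINT x:{0..}|lebesgue. cscale (wave z x) (\<Phi> x)) $ i $ k"
      using Phi_fourier_function(2)[OF Phi \<eta> b, of i k \<xi>] unfolding f_def z_def .
    ultimately have "\<phi> z $ i $ k = (2 * \<i> * z) * (fhat \<xi> / 2)" by (simp add: cscale_def)
    then show ?thesis using \<open>z \<noteq> 0\<close> by (simp add: z_def)
  qed
  have "(LINT \<xi>:{- a..a}|lebesgue. exp (- \<i> * x * \<xi>) * \<phi> (Complex \<xi> \<eta>) $ i $ k / (2 * \<i> * Complex \<xi> \<eta>)) = (1 / 2) * partial_integral a x"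
    for a x
  proof -
    have "exp (- \<i> * x * \<xi>) * \<phi> (Complex \<xi> \<eta>) $ i $ k / (2 * \<i> * Complex \<xi> \<eta>) = (1 / 2) * (exp (- \<i> * x * \<xi>) * fhat \<xi>)" for \<xi>
      unfolding times_divide_eq_right[symmetric] fh by simp
    then have "(LINT \<xi>:{- a..a}|lebesgue. exp (- \<i> * x * \<xi>) * \<phi> (Complex \<xi> \<eta>) $ i $ k / (2 * \<i> * Complex \<xi> \<eta>))
      = (LINT \<xi>:{- a..a}|lebesgue. (1 / 2) * (exp (- \<i> * x * \<xi>) * fhat \<xi>))" by (simp only:)
    also have "\<dots> = (1 / 2) * (LINT \<xi>:{- a..a}|lebesgue. exp (- \<i> * x * \<xi>) * fhat \<xi>)"
      by (rule set_integral_mult_right)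
    also have "(LINT \<xi>:{- a..a}|lebesgue. exp (- \<i> * x * \<xi>) * fhat \<xi>) = partial_integral a x"
      unfolding partial_integral_def set_lebesgue_integral_def
      by (rule integral_completion) measurable
    finally show ?thesis .
  qed
  note eq1 = this
  have eq2: "G x $ i $ k = (1 / 2) * (of_real (2 * pi) * f x)" for x
    by (simp add: G_def f_def scaleR_conv_of_real[where 'a = complex])
  show "lim_in_mean {0..2 * l}
              (\<lambda>a x. LINT \<xi>:{- a..a}|lebesgue.
                 exp (- \<i> * x * \<xi>) * \<phi> (Complex \<xi> \<eta>) $ i $ k / (2 * \<i> * Complex \<xi> \<eta>))
              (\<lambda>x. G x $ i $ k)"
    unfolding eq1 eq2 using lim_in_mean_cmult[OF partial_integral_lim_in_mean, of "1 / 2"] by simp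
qed

end

section \<open>Integral operators on an interval\<close>

lemma L2_on_inner_integrable:
  fixes f g :: "real \<Rightarrow> 'a::euclidean_space"
  assumes "f \<in> L2_on S" "g \<in> L2_on S"
  shows "integrable (lebesgue_on S) (\<lambda>x. f x \<bullet> g x)"
proof (rule Bochner_Integration.integrable_bound)
  note fg = L2_onD[OF assms(1)] L2_onD[OF assms(2)]
  show "integrable (lebesgue_on S) (\<lambda>x. (norm (f x))\<^sup>2 + (norm (g x))\<^sup>2)"
    using fg by (intro Bochner_Integration.integrable_add) auto
  show "(\<lambda>x. f x \<bullet> g x) \<in> borel_measurable (lebesgue_on S)"
    using fg by measurable
  have "\<bar>f x \<bullet> g x\<bar> \<le> (norm (f x))\<^sup>2 + (norm (g x))\<^sup>2" for x
  proof -
    have "\<bar>f x \<bullet> g x\<bar> \<le> norm (f x) * norm (g x)" by (rule Cauchy_Schwarz_ineq2)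
    also have "2 * (norm (f x) * norm (g x)) \<le> (norm (f x))\<^sup>2 + (norm (g x))\<^sup>2"
      using sum_squares_bound[of "norm (f x)" "norm (g x)"] by simp
    finally show ?thesis using mult_nonneg_nonneg[OF norm_ge_zero norm_ge_zero, of "f x" "g x"] by linarith
  qed
  then show "AE x in lebesgue_on S. norm (f x \<bullet> g x) \<le> norm ((norm (f x))\<^sup>2 + (norm (g x))\<^sup>2)"
    by (intro AE_I2) simp
qed

text \<open>The sets over which f integrates to 0 contain the half-lines, a generator stable under
  intersection, hence all Borel sets. Lebesgue sets differ from Borel sets by null sets, and a
  density that is zero on all sets vanishes almost everywhere.\<close>

lemma integral_zero_imp_AE_zero:
  fixes f :: "real \<Rightarrow> 'a::euclidean_space"
  assumes f: "integrable (Leb l) f"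
    and z: "\<And>x. x \<in> {0..l} \<Longrightarrow> integral {0..x} f = 0"
  shows "AE x in Leb l. f x = 0"
proof -
  define g where "g x = indicat_real {0..l} x *\<^sub>R f x" for x
  have g: "integrable lebesgue g"
    using f by (simp add: integrable_lebesgue_on_iff set_integrable_def g_def[abs_def])
  have gA: "set_integrable lebesgue A g" if "A \<in> sets lebesgue" for A
    unfolding set_integrable_def by (rule integrable_mult_indicator[OF that g])
  have half: "(LINT x:{..a}|lebesgue. g x) = 0" for a
  proof (cases "0 \<le> min a l")
    case True
    have "(LINT x:{..a}|lebesgue. g x) = (LINT x:{0..min a l}|lebesgue. f x)"
      unfolding set_lebesgue_integral_def g_def
      by (rule Bochner_Integration.integral_cong) (auto simp: indicator_def)
    also have "\<dots> = integral {0..min a l} f" by (rule lint_eq_integral(1)[OF f]) simp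
    finally show ?thesis using z True by simp
  next
    case False
    then have "indicat_real {..a} x *\<^sub>R g x = 0" for x by (auto simp: g_def indicator_def)
    then show ?thesis unfolding set_lebesgue_integral_def by (simp only: Bochner_Integration.integral_zero)
  qed
  have borel: "(LINT x:A|lebesgue. g x) = 0" if "A \<in> sets borel" for A
  proof -
    have "A \<in> sigma_sets UNIV (range (\<lambda>a::real. {..a}))"
      using that unfolding borel_eq_atMost by simp
    then show ?thesis
    proof (induction rule: sigma_sets_induct_disjoint[rotated 2, consumes 1, case_names basic empty compl union])
      case (basic A) then show ?case using half by auto
    next
      case empty then show ?case by (simp add: set_lebesgue_integral_def)
    next
      case (compl A)
      then have A: "A \<in> sets borel" by (simp add: borel_eq_atMost)
      then have "(LINT x:A \<union> (UNIV - A)|lebesgue. g x) = (LINT x:A|lebesgue. g x) + (LINT x:(UNIV - A)|lebesgue. g x)"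
        by (intro set_integral_Un gA) auto
      moreover have "(LINT x:UNIV|lebesgue. g x) = 0"
      proof -
        have "(LINT x:UNIV|lebesgue. g x) = (LINT x:{..l}|lebesgue. g x)"
          unfolding set_lebesgue_integral_def by (rule Bochner_Integration.integral_cong) (auto simp: g_def indicator_def)
        then show ?thesis using half by simp
      qed
      ultimately show ?case using compl by (simp add: Un_absorb1)
    next
      case (union A)
      then have "A i \<in> sets borel" for i by (auto simp: borel_eq_atMost)
      then have A: "A i \<in> sets lebesgue" for i by simp
      have "(LINT x:(\<Union>i. A i)|lebesgue. g x) = (\<Sum>i. (LINT x:(A i)|lebesgue. g x))"
        by (rule lebesgue_integral_countable_add)
          (use union(1) A in \<open>auto simp: disjoint_family_on_def intro!: gA\<close>)
      then show ?case using union by simp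
    next
      show "Int_stable (range (\<lambda>a::real. {..a}))" by (auto simp: Int_stable_def)
    qed auto
  qed
  interpret finite_measure "Leb l" by (rule finite_measure_lebesgue_on) simp
  show ?thesis
  proof (rule density_zero[OF f])
    fix A assume "A \<in> sets (Leb l)"
    then have A': "A \<in> sets lebesgue" "A \<subseteq> {0..l}" by (auto simp: sets_restrict_space)
    then obtain S N N' where A: "A = S \<union> N" "N \<subseteq> N'" "N' \<in> null_sets lborel" "S \<in> sets lborel"
      using sets_completionE by metis
    have "AE x in lebesgue. x \<in> A \<longleftrightarrow> x \<in> S"
    proof -
      have "AE x in lebesgue. x \<notin> N'" by (rule AE_not_in[OF null_sets_completionI[OF A(3)]])
      then show ?thesis by eventually_elim (use A in auto)
    qed
    then have "(LINT x:S|lebesgue. g x) = (LINT x:A|lebesgue. g x)"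
      by (rule set_integral_cong_set[rotated 2])
        (use gA[of A] gA[of S] A A' in \<open>auto simp: set_borel_measurable_def set_integrable_def\<close>)
    moreover have "(LINT x:A|Leb l. f x) = (LINT x:A|lebesgue. g x)"
      unfolding set_lebesgue_integral_def g_def
      by (subst integral_restrict_space) (auto intro!: Bochner_Integration.integral_cong simp: indicator_def)
    ultimately show "(LINT x:A|Leb l. f x) = 0" using borel A by simp
  qed
qed

section \<open>Operators with bounded Borel kernels\<close>

locale interval_operators =
  fixes l :: real
begin

abbreviation \<mu> where "\<mu> \<equiv> Leb l"

sublocale finite_measure \<mu> by (rule finite_measure_lebesgue_on) simp
sublocale pair_sigma_finite \<mu> \<mu> by unfold_locales

definition ip :: "(real \<Rightarrow> complex^'n::finite) \<Rightarrow> (real \<Rightarrow> complex^'n) \<Rightarrow> real" where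
  "ip f g = (\<integral>x. f x \<bullet> g x \<partial>\<mu>)"

abbreviation L2 :: "(real \<Rightarrow> complex^'n::finite) set" where "L2 \<equiv> L2_on {0..l}"

lemma L2_integrable: "f \<in> L2 \<Longrightarrow> integrable \<mu> f"
  by (rule L2_on_integrable) auto

lemma ip_add_left: "f \<in> L2 \<Longrightarrow> g \<in> L2 \<Longrightarrow> h \<in> L2 \<Longrightarrow> ip (\<lambda>x. f x + g x) h = ip f h + ip g h"
  by (simp add: ip_def inner_add_left L2_on_inner_integrable)

lemma ip_commute: "ip f g = ip g f"
  by (simp add: ip_def inner_commute)

lemma ip_add_right: "f \<in> L2 \<Longrightarrow> g \<in> L2 \<Longrightarrow> h \<in> L2 \<Longrightarrow> ip h (\<lambda>x. f x + g x) = ip h f + ip h g"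
  using ip_add_left[of f g h] by (simp add: ip_commute[of h])

lemma ip_scaleR_right: "ip f (\<lambda>x. c *\<^sub>R g x) = c * ip f g"
  by (simp add: ip_def)

lemma ip_diff_left: "f \<in> L2 \<Longrightarrow> g \<in> L2 \<Longrightarrow> h \<in> L2 \<Longrightarrow> ip (\<lambda>x. f x - g x) h = ip f h - ip g h"
  by (simp add: ip_def inner_diff_left L2_on_inner_integrable)

lemma L2_scaleR: "f \<in> L2 \<Longrightarrow> (\<lambda>x. c *\<^sub>R f x) \<in> L2"
  by (rule L2_on_bounded_linear[OF bounded_linear_scaleR_right])

lemma ip_cong:
  assumes "AE x in \<mu>. f x = f' x" "AE x in \<mu>. g x = g' x" "f \<in> L2" "g \<in> L2"
  shows "ip f g = ip f' g'"
proof -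
  have "f' \<in> L2" "g' \<in> L2" using assms by (auto intro: L2_on_cong_AE)
  then show ?thesis unfolding ip_def
    using assms by (intro integral_cong_AE borel_measurable_integrable L2_on_inner_integrable) auto
qed

lemma ip_eq_0:
  assumes "f \<in> L2" "ip f f = 0" shows "AE x in \<mu>. f x = 0"
proof -
  have "AE x in \<mu>. f x \<bullet> f x = 0"
    using assms integral_nonneg_eq_0_iff_AE[OF L2_on_inner_integrable[OF assms(1,1)]] by (simp add: ip_def)
  then show ?thesis by eventually_elim simp
qed

lemma ip_eq_AE:
  assumes "f \<in> L2" "g \<in> L2" "\<And>h. h \<in> L2 \<Longrightarrow> ip f h = ip g h"
  shows "AE x in \<mu>. f x = g x"
proof -
  have d: "(\<lambda>x. f x - g x) \<in> L2" using assms by (intro L2_on_diff)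
  then have "ip (\<lambda>x. f x - g x) (\<lambda>x. f x - g x) = 0"
    using assms by (simp add: ip_diff_left)
  from ip_eq_0[OF d this] show ?thesis by eventually_elim simp
qed

end

text \<open>Borel measurability on the whole plane and a global bound ensure that all sections and
  product kernels are measurable, so that adjoints and compositions stay in the class and Fubini
  always applies.\<close>

definition borel_kernel :: "(real \<Rightarrow> real \<Rightarrow> complex^'q::finite^'p::finite) \<Rightarrow> bool" where
  "borel_kernel \<kappa> \<longleftrightarrow> (\<lambda>p. \<kappa> (fst p) (snd p)) \<in> borel_measurable borel \<and> (\<exists>C. \<forall>x t. norm (\<kappa> x t) \<le> C)"

lemma borel_kernelI:
  assumes "(\<lambda>p. \<kappa> (fst p) (snd p)) \<in> borel_measurable borel" "\<And>x t. norm (\<kappa> x t) \<le> C"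
  shows "borel_kernel \<kappa>"
  using assms by (auto simp: borel_kernel_def)

lemma borel_kernel_section: "borel_kernel \<kappa> \<Longrightarrow> \<kappa> x \<in> borel_measurable borel"
proof -
  assume "borel_kernel \<kappa>"
  then have m: "(\<lambda>p. \<kappa> (fst p) (snd p)) \<in> borel_measurable borel" by (simp add: borel_kernel_def)
  have "(\<lambda>t. (x, t)) \<in> measurable borel borel"
    by (intro borel_measurable_continuous_onI continuous_intros)
  from measurable_compose[OF this m] show ?thesis by simp
qed

lemma borel_kernel_adjoint:
  assumes "borel_kernel \<kappa>" shows "borel_kernel (\<lambda>x t. cadj (\<kappa> t x))"
proof -
  from assms obtain C where m: "(\<lambda>p. \<kappa> (fst p) (snd p)) \<in> borel_measurable borel" and C: "\<And>x t. norm (\<kappa> x t) \<le> C"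
    by (auto simp: borel_kernel_def)
  have "(\<lambda>p. (snd p, fst p)) \<in> measurable (borel :: (real \<times> real) measure) (borel :: (real \<times> real) measure)"
    by (intro borel_measurable_continuous_onI continuous_intros)
  from measurable_compose[OF this m] have "(\<lambda>p. \<kappa> (snd p) (fst p)) \<in> borel_measurable borel" by simp
  moreover have "cadj \<in> borel_measurable (borel :: (complex^'a^'b) measure)"
    by (intro borel_measurable_continuous_onI linear_continuous_on bounded_linear_cadj)
  ultimately have "(\<lambda>p. cadj (\<kappa> (snd p) (fst p))) \<in> borel_measurable borel"
    by (rule measurable_compose)
  then show ?thesis by (rule borel_kernelI[where C = C]) (simp add: C)
qed

lemma borel_kernel_bound:
  assumes "borel_kernel \<kappa>"
  obtains C where "0 \<le> C" "\<And>x t w. norm (\<kappa> x t *v w) \<le> C * norm w"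
proof -
  obtain C where C: "\<And>x t. norm (\<kappa> x t) \<le> C" using assms by (auto simp: borel_kernel_def)
  show ?thesis
    by (rule that[of C]) (use C norm_ge_zero order_trans in blast, intro order_trans[OF norm_matrix_vector_le] mult_right_mono C norm_ge_zero)
qed

context interval_operators
begin

definition kop :: "(real \<Rightarrow> real \<Rightarrow> complex^'q::finite^'p::finite) \<Rightarrow> (real \<Rightarrow> complex^'q) \<Rightarrow> real \<Rightarrow> complex^'p" where
  "kop \<kappa> f x = (\<integral>t. \<kappa> x t *v f t \<partial>\<mu>)"

lemma measurable_pair_borel: "h \<in> borel_measurable borel \<Longrightarrow> h \<in> borel_measurable (\<mu> \<Otimes>\<^sub>M \<mu>)"
  for h :: "real \<times> real \<Rightarrow> 'b::topological_space"
proof -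
  assume h: "h \<in> borel_measurable borel"
  have i: "(\<lambda>x. x) \<in> measurable \<mu> borel"
    by (intro measurable_restrict_space1 measurable_completion) simp
  have "(\<lambda>p. (fst p, snd p)) \<in> measurable (\<mu> \<Otimes>\<^sub>M \<mu>) (borel \<Otimes>\<^sub>M borel)"
    by (intro measurable_Pair measurable_compose[OF measurable_fst i] measurable_compose[OF measurable_snd i])
  then show ?thesis using h by (simp add: borel_prod measurable_compose[where f = "\<lambda>p. p"])
qed

lemma kernel_measurable:
  assumes "borel_kernel \<kappa>"
  shows "(\<lambda>p. \<kappa> (fst p) (snd p)) \<in> borel_measurable (\<mu> \<Otimes>\<^sub>M \<mu>)"
    and "\<kappa> x \<in> borel_measurable \<mu>"
proof -
  show "(\<lambda>p. \<kappa> (fst p) (snd p)) \<in> borel_measurable (\<mu> \<Otimes>\<^sub>M \<mu>)"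
    using assms by (intro measurable_pair_borel) (simp add: borel_kernel_def)
  show "\<kappa> x \<in> borel_measurable \<mu>"
    using borel_kernel_section[OF assms] by (intro measurable_restrict_space1 measurable_completion) simp
qed

lemma measurable_matrix_vector:
  fixes A :: "'a \<Rightarrow> complex^'q::finite^'p::finite"
  assumes "A \<in> borel_measurable N" "f \<in> borel_measurable N"
  shows "(\<lambda>x. A x *v f x) \<in> borel_measurable N"
  by (rule borel_measurable_continuous_Pair[OF assms])
    (intro continuous_on_matrix_vector continuous_intros)

lemma bilinear_integrable:
  fixes h :: "'a::euclidean_space \<Rightarrow> 'b::euclidean_space \<Rightarrow> 'c::euclidean_space"
  assumes h: "bounded_bilinear h" and A: "continuous_on {0..l} A" and f: "integrable \<mu> f"
  shows "integrable \<mu> (\<lambda>t. h (A t) (f t))"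
proof -
  obtain B where B: "\<And>x. x \<in> {0..l} \<Longrightarrow> norm (A x) \<le> B" using continuous_on_Icc_bounded[OF A] by blast
  obtain K where K: "K \<ge> 0" "\<And>a b. norm (h a b) \<le> norm a * norm b * K"
    using bounded_bilinear.nonneg_bounded[OF h] by blast
  have Am: "A \<in> borel_measurable \<mu>" using A by (intro continuous_imp_measurable_on_sets_lebesgue) auto
  show ?thesis
  proof (rule Bochner_Integration.integrable_bound[OF integrable_mult_right[OF integrable_norm[OF f], of "B * K"]])
    show "(\<lambda>t. h (A t) (f t)) \<in> borel_measurable \<mu>"
      by (rule borel_measurable_continuous_Pair[OF Am borel_measurable_integrable[OF f]])
        (intro bounded_bilinear.continuous_on[OF h] continuous_intros)
    show "AE x in \<mu>. norm (h (A x) (f x)) \<le> norm (B * K * norm (f x))"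
      using AE_mem
    proof eventually_elim
      case (elim x)
      have "norm (h (A x) (f x)) \<le> norm (A x) * norm (f x) * K" by (rule K)
      also have "\<dots> \<le> B * norm (f x) * K" using B[OF elim] K(1) by (intro mult_right_mono) auto
      also have "\<dots> \<le> norm (B * K * norm (f x))" using abs_ge_self[of "B * K * norm (f x)"] by (simp add: mult_ac)
      finally show ?case .
    qed
  qed
qed

lemma kop_integrand:
  assumes \<kappa>: "borel_kernel \<kappa>" and f: "integrable \<mu> f"
  shows "integrable \<mu> (\<lambda>t. \<kappa> x t *v f t)"
proof -
  obtain C where C: "0 \<le> C" "\<And>x t w. norm (\<kappa> x t *v w) \<le> C * norm w"
    by (rule borel_kernel_bound[OF \<kappa>]) blast
  show ?thesis
    by (rule Bochner_Integration.integrable_bound[OF integrable_mult_right[OF integrable_norm[OF f], of C]])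
      (use C f in \<open>auto intro!: AE_I2 measurable_matrix_vector kernel_measurable \<kappa>\<close>)
qed

lemma kop_bound:
  assumes \<kappa>: "borel_kernel \<kappa>"
  shows "\<exists>C\<ge>0. \<forall>f. integrable \<mu> f \<longrightarrow> (\<forall>x. norm (kop \<kappa> f x) \<le> C * (\<integral>t. norm (f t) \<partial>\<mu>))"
proof -
  obtain C where C: "0 \<le> C" "\<And>x t w. norm (\<kappa> x t *v w) \<le> C * norm w"
    by (rule borel_kernel_bound[OF \<kappa>]) blast
  have "norm (kop \<kappa> f x) \<le> C * (\<integral>t. norm (f t) \<partial>\<mu>)" if f: "integrable \<mu> f" for f x
  proof -
    have "norm (kop \<kappa> f x) \<le> (\<integral>t. norm (\<kappa> x t *v f t) \<partial>\<mu>)"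
      unfolding kop_def by (rule integral_norm_bound)
    also have "\<dots> \<le> (\<integral>t. C * norm (f t) \<partial>\<mu>)"
      using C f by (intro integral_mono integrable_norm kop_integrand[OF \<kappa>] integrable_mult_right) auto
    finally show ?thesis by simp
  qed
  with C show ?thesis by blast
qed

lemma pair_integrable_bound:
  fixes h :: "real \<times> real \<Rightarrow> 'b::{banach, second_countable_topology}" and a b :: "real \<Rightarrow> real"
  assumes h: "h \<in> borel_measurable (\<mu> \<Otimes>\<^sub>M \<mu>)" and a: "integrable \<mu> a" and b: "integrable \<mu> b"
    and le: "\<And>x t. norm (h (x, t)) \<le> a x * b t"
  shows "integrable (\<mu> \<Otimes>\<^sub>M \<mu>) h"
proof (rule Bochner_Integration.integrable_bound[OF _ h])
  have [measurable]: "a \<in> borel_measurable \<mu>" "b \<in> borel_measurable \<mu>" using a b by auto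
  show "integrable (\<mu> \<Otimes>\<^sub>M \<mu>) (\<lambda>p. a (fst p) * b (snd p))"
  proof (rule Fubini_integrable)
    have "(\<lambda>x. \<integral>y. norm (a (fst (x, y)) * b (snd (x, y))) \<partial>\<mu>) = (\<lambda>x. \<bar>a x\<bar> * (\<integral>y. \<bar>b y\<bar> \<partial>\<mu>))"
      by (simp add: abs_mult)
    then show "integrable \<mu> (\<lambda>x. \<integral>y. norm (a (fst (x, y)) * b (snd (x, y))) \<partial>\<mu>)"
      using a by simp
  qed (use b in auto)
  show "AE p in \<mu> \<Otimes>\<^sub>M \<mu>. norm (h p) \<le> norm (a (fst p) * b (snd p))"
  proof (rule AE_I2)
    fix p :: "real \<times> real"
    show "norm (h p) \<le> norm (a (fst p) * b (snd p))"
      using le[of "fst p" "snd p"] abs_ge_self[of "a (fst p) * b (snd p)"] by simp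
  qed
qed

lemma kop_measurable:
  assumes \<kappa>: "borel_kernel \<kappa>" and f: "integrable \<mu> f"
  shows "kop \<kappa> f \<in> borel_measurable \<mu>"
proof -
  have [measurable]: "f \<in> borel_measurable \<mu>" using f by auto
  have "(\<lambda>p. \<kappa> (fst p) (snd p) *v f (snd p)) \<in> borel_measurable (\<mu> \<Otimes>\<^sub>M \<mu>)"
    by (intro measurable_matrix_vector kernel_measurable \<kappa>) measurable
  then have "case_prod (\<lambda>x t. \<kappa> x t *v f t) \<in> borel_measurable (\<mu> \<Otimes>\<^sub>M \<mu>)"
    by (simp add: case_prod_beta')
  then show ?thesis unfolding kop_def[abs_def] by (intro sigma_finite_measure.borel_measurable_lebesgue_integral) unfold_locales
qed

lemma kop_L2:
  assumes \<kappa>: "borel_kernel \<kappa>" and f: "integrable \<mu> f"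
  shows "kop \<kappa> f \<in> L2"
proof -
  obtain C where "\<And>x. norm (kop \<kappa> f x) \<le> C * (\<integral>t. norm (f t) \<partial>\<mu>)"
    using kop_bound[OF \<kappa>] f by blast
  then show ?thesis
    by (intro L2_on_bounded[where B = "C * (\<integral>t. norm (f t) \<partial>\<mu>)"] kop_measurable assms) auto
qed

lemma kop_adjoint:
  assumes \<kappa>: "borel_kernel \<kappa>" and f: "integrable \<mu> f" and g: "integrable \<mu> g"
  shows "ip (kop \<kappa> f) g = ip f (kop (\<lambda>x t. cadj (\<kappa> t x)) g)"
proof -
  have [measurable]: "f \<in> borel_measurable \<mu>" "g \<in> borel_measurable \<mu>" using f g by auto
  obtain C where C: "0 \<le> C" "\<And>x t w. norm (\<kappa> x t *v w) \<le> C * norm w"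
    by (rule borel_kernel_bound[OF \<kappa>]) blast
  have m: "(\<lambda>p. (\<kappa> (fst p) (snd p) *v f (snd p)) \<bullet> g (fst p)) \<in> borel_measurable (\<mu> \<Otimes>\<^sub>M \<mu>)"
    by (intro borel_measurable_inner measurable_matrix_vector kernel_measurable \<kappa>) measurable
  have "integrable (\<mu> \<Otimes>\<^sub>M \<mu>) (\<lambda>p. (\<kappa> (fst p) (snd p) *v f (snd p)) \<bullet> g (fst p))"
  proof (rule pair_integrable_bound[OF m integrable_norm[OF g] integrable_mult_right[OF integrable_norm[OF f], of C]])
    fix x t
    have "\<bar>(\<kappa> x t *v f t) \<bullet> g x\<bar> \<le> norm (\<kappa> x t *v f t) * norm (g x)" by (rule Cauchy_Schwarz_ineq2)
    also have "\<dots> \<le> (C * norm (f t)) * norm (g x)" using C by (intro mult_right_mono) auto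
    finally show "norm ((\<kappa> (fst (x, t)) (snd (x, t)) *v f (snd (x, t))) \<bullet> g (fst (x, t))) \<le> norm (g x) * (C * norm (f t))"
      by (simp add: mult_ac)
  qed
  then have i: "integrable (\<mu> \<Otimes>\<^sub>M \<mu>) (case_prod (\<lambda>x t. (\<kappa> x t *v f t) \<bullet> g x))" by (simp add: case_prod_beta')
  have "ip (kop \<kappa> f) g = (\<integral>x. (\<integral>t. (\<kappa> x t *v f t) \<bullet> g x \<partial>\<mu>) \<partial>\<mu>)"
    unfolding ip_def kop_def by (simp add: kop_integrand[OF \<kappa> f])
  also have "\<dots> = (\<integral>t. (\<integral>x. (\<kappa> x t *v f t) \<bullet> g x \<partial>\<mu>) \<partial>\<mu>)"
    by (rule Fubini_integral[OF i, symmetric])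
  also have "\<dots> = ip f (kop (\<lambda>x t. cadj (\<kappa> t x)) g)"
    unfolding ip_def kop_def inner_matrix_cadj
    by (simp add: kop_integrand[OF borel_kernel_adjoint[OF \<kappa>] g])
  finally show ?thesis .
qed

lemma measurable_matrix_matrix:
  fixes A :: "'a \<Rightarrow> complex^'q::finite^'p::finite" and B :: "'a \<Rightarrow> complex^'r::finite^'q::finite"
  assumes "A \<in> borel_measurable N" "B \<in> borel_measurable N"
  shows "(\<lambda>x. A x ** B x) \<in> borel_measurable N"
  by (rule borel_measurable_continuous_Pair[OF assms])
    (intro continuous_on_matrix_matrix continuous_intros)

lemma kernel_product_integrable:
  fixes \<kappa> :: "real \<Rightarrow> real \<Rightarrow> complex^'b::finite^'a::finite" and \<rho> :: "real \<Rightarrow> real \<Rightarrow> complex^'c::finite^'b"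
  assumes \<kappa>: "borel_kernel \<kappa>" and \<rho>: "borel_kernel \<rho>"
  shows "integrable \<mu> (\<lambda>s. \<kappa> x s ** \<rho> s t)"
proof -
  obtain B where B: "\<And>x t. norm (\<kappa> x t) \<le> B" using \<kappa> by (auto simp: borel_kernel_def)
  obtain B' where B': "\<And>x t. norm (\<rho> x t) \<le> B'" using \<rho> by (auto simp: borel_kernel_def)
  have "0 \<le> B" using B[of 0 0] norm_ge_zero order_trans by blast
  then have bd: "norm (\<kappa> x s ** \<rho> s t) \<le> B * B'" for s
    by (intro order_trans[OF norm_matrix_matrix_le] mult_mono B B') auto
  have "(\<lambda>s. (s, t)) \<in> measurable borel borel"
    by (intro borel_measurable_continuous_onI continuous_intros)
  moreover have "(\<lambda>p. \<rho> (fst p) (snd p)) \<in> borel_measurable borel"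
    using \<rho> by (simp add: borel_kernel_def)
  ultimately have "(\<lambda>s. \<rho> (fst (s, t)) (snd (s, t))) \<in> borel_measurable borel"
    by (rule measurable_compose)
  then have "(\<lambda>s. \<rho> s t) \<in> borel_measurable \<mu>"
    by (intro measurable_restrict_space1 measurable_completion) simp
  then have "(\<lambda>s. \<kappa> x s ** \<rho> s t) \<in> borel_measurable \<mu>"
    by (rule measurable_matrix_matrix[OF kernel_measurable(2)[OF \<kappa>]])
  then show ?thesis by (intro integrable_const_bound[where B = "B * B'"] AE_I2 bd)
qed

lemma kop_compose:
  fixes \<kappa> :: "real \<Rightarrow> real \<Rightarrow> complex^'b::finite^'a::finite" and \<rho> :: "real \<Rightarrow> real \<Rightarrow> complex^'c::finite^'b"
  assumes \<kappa>: "borel_kernel \<kappa>" and \<rho>: "borel_kernel \<rho>" and f: "integrable \<mu> f"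
  shows "kop \<kappa> (kop \<rho> f) x = kop (\<lambda>x t. \<integral>s. \<kappa> x s ** \<rho> s t \<partial>\<mu>) f x"
proof -
  have [measurable]: "f \<in> borel_measurable \<mu>" using f by auto
  obtain C where C: "0 \<le> C" "\<And>x t w. norm (\<kappa> x t *v w) \<le> C * norm w"
    by (rule borel_kernel_bound[OF \<kappa>]) blast
  obtain C' where C': "0 \<le> C'" "\<And>x t w. norm (\<rho> x t *v w) \<le> C' * norm w"
    by (rule borel_kernel_bound[OF \<rho>]) blast
  have mk: "(\<lambda>p. \<kappa> x (fst p)) \<in> borel_measurable (\<mu> \<Otimes>\<^sub>M \<mu>)"
    by (rule measurable_compose[OF measurable_fst kernel_measurable(2)[OF \<kappa>]])
  have m: "(\<lambda>p. \<kappa> x (fst p) *v (\<rho> (fst p) (snd p) *v f (snd p))) \<in> borel_measurable (\<mu> \<Otimes>\<^sub>M \<mu>)"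
    by (intro measurable_matrix_vector mk kernel_measurable(1)[OF \<rho>]) measurable
  have "integrable (\<mu> \<Otimes>\<^sub>M \<mu>) (\<lambda>p. \<kappa> x (fst p) *v (\<rho> (fst p) (snd p) *v f (snd p)))"
  proof (rule pair_integrable_bound[OF m _ integrable_norm[OF f], of "\<lambda>_. C * C'"])
    fix s t
    have "norm (\<kappa> x s *v (\<rho> s t *v f t)) \<le> C * norm (\<rho> s t *v f t)" by (rule C)
    also have "\<dots> \<le> C * (C' * norm (f t))" using C' C by (intro mult_left_mono) auto
    finally show "norm (\<kappa> x (fst (s, t)) *v (\<rho> (fst (s, t)) (snd (s, t)) *v f (snd (s, t)))) \<le> C * C' * norm (f t)"
      by (simp add: mult_ac)
  qed simp
  then have i: "integrable (\<mu> \<Otimes>\<^sub>M \<mu>) (case_prod (\<lambda>s t. \<kappa> x s *v (\<rho> s t *v f t)))" by (simp add: case_prod_beta')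
  note int = kernel_product_integrable[OF \<kappa> \<rho>]
  have "kop \<kappa> (kop \<rho> f) x = (\<integral>s. (\<integral>t. \<kappa> x s *v (\<rho> s t *v f t) \<partial>\<mu>) \<partial>\<mu>)"
    unfolding kop_def
    by (simp add: integral_bounded_linear[OF bounded_linear_matrix_vector kop_integrand[OF \<rho> f], symmetric])
  also have "\<dots> = (\<integral>t. (\<integral>s. \<kappa> x s *v (\<rho> s t *v f t) \<partial>\<mu>) \<partial>\<mu>)"
    by (rule Fubini_integral[OF i, symmetric])
  also have "\<dots> = (\<integral>t. (\<integral>s. \<kappa> x s ** \<rho> s t \<partial>\<mu>) *v f t \<partial>\<mu>)"
    unfolding matrix_vector_mul_assoc
    by (simp add: integral_bounded_linear[OF bounded_bilinear.bounded_linear_left[OF bounded_bilinear_matrix_vector] int])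
  finally show ?thesis by (simp add: kop_def)
qed

lemma borel_kernel_compose:
  fixes \<kappa> :: "real \<Rightarrow> real \<Rightarrow> complex^'b::finite^'a::finite" and \<rho> :: "real \<Rightarrow> real \<Rightarrow> complex^'c::finite^'b"
  assumes \<kappa>: "borel_kernel \<kappa>" and \<rho>: "borel_kernel \<rho>"
  shows "borel_kernel (\<lambda>x t. \<integral>s. \<kappa> x s ** \<rho> s t \<partial>\<mu>)"
proof -
  obtain B where B: "\<And>x t. norm (\<kappa> x t) \<le> B" using \<kappa> by (auto simp: borel_kernel_def)
  obtain B' where B': "\<And>x t. norm (\<rho> x t) \<le> B'" using \<rho> by (auto simp: borel_kernel_def)
  have "0 \<le> B" using B[of 0 0] norm_ge_zero order_trans by blast
  have i: "(\<lambda>x. x) \<in> measurable \<mu> borel" by (intro measurable_restrict_space1 measurable_completion) simp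
  have m: "(\<lambda>q. h (f q) (g q)) \<in> borel_measurable (borel \<Otimes>\<^sub>M \<mu>)"
    if "borel_kernel h" "f \<in> measurable (borel \<Otimes>\<^sub>M \<mu>) borel" "g \<in> measurable (borel \<Otimes>\<^sub>M \<mu>) borel"
    for f g :: "(real \<times> real) \<times> real \<Rightarrow> real" and h :: "real \<Rightarrow> real \<Rightarrow> complex^'d::finite^'e::finite"
  proof -
    have "(\<lambda>q. (f q, g q)) \<in> measurable (borel \<Otimes>\<^sub>M \<mu>) borel" using that(2,3) by (rule borel_measurable_Pair)
    from measurable_compose[OF this, of "\<lambda>p. h (fst p) (snd p)" borel] that(1) show ?thesis by (simp add: borel_kernel_def)
  qed
  have c: "(\<lambda>q. fst (fst q)) \<in> measurable ((borel :: (real \<times> real) measure) \<Otimes>\<^sub>M \<mu>) (borel :: real measure)"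
    "(\<lambda>q. snd (fst q)) \<in> measurable ((borel :: (real \<times> real) measure) \<Otimes>\<^sub>M \<mu>) (borel :: real measure)"
    "snd \<in> borel_measurable ((borel :: (real \<times> real) measure) \<Otimes>\<^sub>M \<mu>)"
    by (rule measurable_compose[OF measurable_fst], intro borel_measurable_continuous_onI continuous_intros)+
      (rule measurable_compose[OF measurable_snd i])
  have "(\<lambda>q. \<kappa> (fst (fst q)) (snd q) ** \<rho> (snd q) (snd (fst q))) \<in> borel_measurable (borel \<Otimes>\<^sub>M \<mu>)"
    by (intro measurable_matrix_matrix m \<kappa> \<rho> c)
  then have "(\<lambda>p. \<integral>s. \<kappa> (fst p) s ** \<rho> s (snd p) \<partial>\<mu>) \<in> borel_measurable borel"
    by (intro sigma_finite_measure.borel_measurable_lebesgue_integral) (unfold_locales, simp add: case_prod_beta')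
  moreover have "norm (\<integral>s. \<kappa> x s ** \<rho> s t \<partial>\<mu>) \<le> (\<integral>s. B * B' \<partial>\<mu>)" for x t
    using \<open>0 \<le> B\<close> by (intro order_trans[OF integral_norm_bound] integral_mono integrable_norm kernel_product_integrable[OF \<kappa> \<rho>]
      order_trans[OF norm_matrix_matrix_le] mult_mono B B') auto
  ultimately show ?thesis by (rule borel_kernelI)
qed

lemma kop_add: "borel_kernel \<kappa> \<Longrightarrow> integrable \<mu> f \<Longrightarrow> integrable \<mu> g \<Longrightarrow>
    kop \<kappa> (\<lambda>x. f x + g x) x = kop \<kappa> f x + kop \<kappa> g x"
  unfolding kop_def by (simp add: matrix_vector_right_distrib kop_integrand)

lemma kop_cmult: "borel_kernel \<kappa> \<Longrightarrow> integrable \<mu> f \<Longrightarrow> kop \<kappa> (\<lambda>x. c *s f x) x = c *s kop \<kappa> f x"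
  unfolding kop_def matrix_vec_cmult
  by (rule integral_bounded_linear[OF bounded_linear_cmult_vec kop_integrand])

lemma kop_scaleR: "borel_kernel \<kappa> \<Longrightarrow> integrable \<mu> f \<Longrightarrow> kop \<kappa> (\<lambda>x. c *\<^sub>R f x) x = c *\<^sub>R kop \<kappa> f x"
  unfolding kop_def matrix_vector_mult_scaleR_right by simp

lemma kop_cong:
  assumes "AE x in \<mu>. f x = g x" "borel_kernel \<kappa>" "integrable \<mu> f" "integrable \<mu> g"
  shows "kop \<kappa> f x = kop \<kappa> g x"
  unfolding kop_def
  by (rule integral_cong_AE) (use assms kop_integrand in \<open>auto elim!: eventually_mono intro: borel_measurable_integrable\<close>)

text \<open>For N the L2 norm, the pointwise inequality n \<le> n^2 / N + N integrates to N (1 + l);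
  it serves in place of Cauchy-Schwarz.\<close>

lemma norm_integral_L2:
  assumes f: "f \<in> L2" and l: "0 \<le> l"
  shows "(\<integral>t. norm (f t) \<partial>\<mu>) \<le> (1 + l) * L2_norm_on {0..l} f"
proof -
  define N where "N = L2_norm_on {0..l} f"
  have "0 \<le> N" by (simp add: N_def L2_norm_on_def)
  have N2: "(\<integral>t. (norm (f t))\<^sup>2 \<partial>\<mu>) = N\<^sup>2" using L2_onD(2)[OF f]
    by (simp add: N_def L2_norm_on_def)
  show ?thesis
  proof (cases "N = 0")
    case True
    then have "ip f f = 0" using N2 by (simp add: ip_def power2_norm_eq_inner)
    then have "AE x in \<mu>. norm (f x) = 0" using ip_eq_0[OF f] by simp
    then have "(\<integral>t. norm (f t) \<partial>\<mu>) = 0" by (rule integral_eq_zero_AE)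
    then show ?thesis using True by (simp add: N_def)
  next
    case False
    then have "0 < N" using \<open>0 \<le> N\<close> by simp
    have "(\<integral>t. norm (f t) \<partial>\<mu>) \<le> (\<integral>t. (norm (f t))\<^sup>2 / N + N \<partial>\<mu>)"
    proof (intro integral_mono integrable_norm L2_integrable[OF f] Bochner_Integration.integrable_add)
      show "norm (f t) \<le> (norm (f t))\<^sup>2 / N + N" for t
      proof -
        have "2 * (N * norm (f t)) \<le> (norm (f t))\<^sup>2 + N\<^sup>2" "0 \<le> N * norm (f t)"
          using sum_squares_bound[of "norm (f t)" N] \<open>0 \<le> N\<close> by (simp_all add: mult_ac)
        then have "N * norm (f t) \<le> (norm (f t))\<^sup>2 + N\<^sup>2" by linarith
        then show ?thesis using \<open>0 < N\<close> by (simp add: field_simps power2_eq_square)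
      qed
    qed (use L2_onD(2)[OF f] in auto)
    also have "\<dots> = N\<^sup>2 / N + N * l"
      using L2_onD(2)[OF f] l N2 by (simp add: measure_restrict_space)
    finally show ?thesis using \<open>0 < N\<close> by (simp add: N_def[symmetric] power2_eq_square algebra_simps)
  qed
qed

lemma kop_L2_norm:
  assumes \<kappa>: "borel_kernel \<kappa>" and l: "0 \<le> l"
  shows "\<exists>C\<ge>0. \<forall>f\<in>L2. L2_norm_on {0..l} (kop \<kappa> f) \<le> C * L2_norm_on {0..l} f"
proof -
  obtain C where C: "0 \<le> C" "\<And>f x. integrable \<mu> f \<Longrightarrow> norm (kop \<kappa> f x) \<le> C * (\<integral>t. norm (f t) \<partial>\<mu>)"
    using kop_bound[OF \<kappa>] by blast
  have "L2_norm_on {0..l} (kop \<kappa> f) \<le> sqrt l * (C * (1 + l)) * L2_norm_on {0..l} f" if f: "f \<in> L2" for f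
  proof -
    define B where "B = C * ((1 + l) * L2_norm_on {0..l} f)"
    have B: "norm (kop \<kappa> f x) \<le> B" for x
      using C(2)[OF L2_integrable[OF f], of x] mult_left_mono[OF norm_integral_L2[OF f l] C(1)] unfolding B_def by linarith
    have "0 \<le> B" using B[of 0] norm_ge_zero order_trans by blast
    have "(\<integral>x. (norm (kop \<kappa> f x))\<^sup>2 \<partial>\<mu>) \<le> (\<integral>x. B\<^sup>2 \<partial>\<mu>)"
      using kop_L2[OF \<kappa> L2_integrable[OF f]] B \<open>0 \<le> B\<close>
      by (intro integral_mono) (auto dest: L2_onD(2) intro!: power_mono)
    also have "\<dots> = l * B\<^sup>2" using l by (simp add: measure_restrict_space)
    finally have "L2_norm_on {0..l} (kop \<kappa> f) \<le> sqrt (l * B\<^sup>2)"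
      unfolding L2_norm_on_def by (rule real_sqrt_le_mono)
    also have "\<dots> = sqrt l * B" using \<open>0 \<le> B\<close> by (simp add: real_sqrt_mult)
    finally show ?thesis by (simp add: B_def mult_ac)
  qed
  then show ?thesis using C l by (intro exI[of _ "sqrt l * (C * (1 + l))"]) auto
qed

text \<open>The constant 2 comes from bounding a squared sum by twice the squares; any constant
  serves for boundedness of operators.\<close>

lemma L2_norm_triangle:
  assumes f: "f \<in> L2" and g: "g \<in> L2"
  shows "L2_norm_on {0..l} (\<lambda>x. f x + g x) \<le> 2 * (L2_norm_on {0..l} f + L2_norm_on {0..l} g)"
proof -
  define a b where "a = L2_norm_on {0..l} f" and "b = L2_norm_on {0..l} g"
  have ab: "0 \<le> a" "0 \<le> b" by (simp_all add: a_def b_def L2_norm_on_def)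
  have "(\<integral>x. (norm (f x + g x))\<^sup>2 \<partial>\<mu>) \<le> (\<integral>x. 2 * (norm (f x))\<^sup>2 + 2 * (norm (g x))\<^sup>2 \<partial>\<mu>)"
    using L2_onD(2)[OF f] L2_onD(2)[OF g] L2_onD(2)[OF L2_on_add[OF f g]] by (intro integral_mono norm_add_sq_le) auto
  also have "\<dots> = 2 * a\<^sup>2 + 2 * b\<^sup>2"
    using L2_onD(2)[OF f] L2_onD(2)[OF g] by (simp add: a_def b_def L2_norm_on_def)
  also have "\<dots> \<le> (2 * (a + b))\<^sup>2"
    using ab mult_nonneg_nonneg[OF ab] by (simp add: power2_eq_square algebra_simps)
  finally have "L2_norm_on {0..l} (\<lambda>x. f x + g x) \<le> sqrt ((2 * (a + b))\<^sup>2)"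
    unfolding L2_norm_on_def by (rule real_sqrt_le_mono)
  then show ?thesis using ab by (simp add: a_def b_def)
qed

lemma L2_bounded_op_id_plus_kop:
  assumes \<kappa>: "borel_kernel \<kappa>" and l: "0 \<le> l"
  shows "L2_bounded_op l (\<lambda>f x. f x + kop \<kappa> f x)"
proof -
  obtain C where C: "0 \<le> C" "\<And>f. f \<in> L2 \<Longrightarrow> L2_norm_on {0..l} (kop \<kappa> f) \<le> C * L2_norm_on {0..l} f"
    using kop_L2_norm[OF \<kappa> l] by blast
  have "L2_norm_on {0..l} (\<lambda>x. f x + kop \<kappa> f x) \<le> 2 * (1 + C) * L2_norm_on {0..l} f" if "f \<in> L2" for f
    using L2_norm_triangle[OF that kop_L2[OF \<kappa> L2_integrable[OF that]]] C(2)[OF that] by (simp add: algebra_simps)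
  then show ?thesis
    unfolding L2_bounded_op_def
    by (auto intro!: L2_on_add kop_L2 \<kappa> L2_integrable AE_I2 simp: kop_add[OF \<kappa>] kop_cmult[OF \<kappa>] L2_integrable vector_add_ldistrib)
qed

end

lemma L2_bounded_op_compose:
  fixes T U :: "'n::finite oper"
  assumes T: "L2_bounded_op l T" and U: "L2_bounded_op l U"
  shows "L2_bounded_op l (\<lambda>f. T (U f))"
proof -
  obtain C where C: "\<And>f. f \<in> L2_on {0..l} \<Longrightarrow> L2_norm_on {0..l} (T f) \<le> C * L2_norm_on {0..l} f"
    using T unfolding L2_bounded_op_def by blast
  obtain D where D: "\<And>f. f \<in> L2_on {0..l} \<Longrightarrow> L2_norm_on {0..l} (U f) \<le> D * L2_norm_on {0..l} f"
    using U unfolding L2_bounded_op_def by blast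
  note TL = L2_bounded_op_L2[OF T] and UL = L2_bounded_op_L2[OF U]
  show ?thesis
    unfolding L2_bounded_op_def
  proof (intro conjI ballI allI exI[of _ "\<bar>C\<bar> * D"])
    fix f g :: "real \<Rightarrow> complex^'n" and c assume f: "f \<in> L2_on {0..l}" and g: "g \<in> L2_on {0..l}"
    have "AE x in Leb l. T (U (\<lambda>t. f t + g t)) x = T (\<lambda>t. U f t + U g t) x"
      by (rule L2_bounded_op_cong[OF T UL[OF L2_on_add[OF f g]] L2_on_add[OF UL[OF f] UL[OF g]] L2_bounded_op_add[OF U f g]])
    with L2_bounded_op_add[OF T UL[OF f] UL[OF g]]
    show "AE x in Leb l. T (U (\<lambda>t. f t + g t)) x = T (U f) x + T (U g) x"
      by eventually_elim simp
    have "AE x in Leb l. T (U (\<lambda>t. c *s f t)) x = T (\<lambda>t. c *s U f t) x"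
      by (rule L2_bounded_op_cong[OF T UL[OF L2_on_cmult[OF f]] L2_on_cmult[OF UL[OF f]] L2_bounded_op_cmult[OF U f]])
    with L2_bounded_op_cmult[OF T UL[OF f]]
    show "AE x in Leb l. T (U (\<lambda>t. c *s f t)) x = c *s T (U f) x"
      by eventually_elim simp
  next
    fix f :: "real \<Rightarrow> complex^'n" assume f: "f \<in> L2_on {0..l}"
    show "T (U f) \<in> L2_on {0..l}" by (intro TL UL f)
    have "0 \<le> L2_norm_on {0..l} (U f)" by (simp add: L2_norm_on_def)
    have "L2_norm_on {0..l} (T (U f)) \<le> C * L2_norm_on {0..l} (U f)" by (rule C[OF UL[OF f]])
    also have "\<dots> \<le> \<bar>C\<bar> * L2_norm_on {0..l} (U f)" using \<open>0 \<le> L2_norm_on {0..l} (U f)\<close> by (intro mult_right_mono) auto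
    also have "\<dots> \<le> \<bar>C\<bar> * (D * L2_norm_on {0..l} f)" by (intro mult_left_mono D f) auto
    finally show "L2_norm_on {0..l} (T (U f)) \<le> \<bar>C\<bar> * D * L2_norm_on {0..l} f" by (simp add: mult_ac)
  qed
qed

section \<open>Volterra kernels and convolutions\<close>

context interval_operators
begin

text \<open>Volterra kernels are cut off to the triangle 0 \<le> t \<le> x \<le> l, so that they
  become ordinary kernels on the square; \<open>up\<close> is the kernel of the adjoint, integrating
  over [x, l].\<close>

definition low :: "(real \<Rightarrow> real \<Rightarrow> complex^'q::finite^'p::finite) \<Rightarrow> real \<Rightarrow> real \<Rightarrow> complex^'q^'p" where
  "low h x t = (if 0 \<le> t \<and> t \<le> x \<and> x \<le> l then h x t else 0)"

definition up :: "(real \<Rightarrow> real \<Rightarrow> complex^'q::finite^'p::finite) \<Rightarrow> real \<Rightarrow> real \<Rightarrow> complex^'p^'q" where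
  "up h x t = cadj (low h t x)"

lemma triangle_compact: "compact {p :: real \<times> real. 0 \<le> snd p \<and> snd p \<le> fst p \<and> fst p \<le> l}"
proof -
  have "{p :: real \<times> real. 0 \<le> snd p \<and> snd p \<le> fst p \<and> fst p \<le> l} \<subseteq> {0..l} \<times> {0..l}" by auto
  moreover have "compact ({0..l} \<times> {0..l})" by (intro compact_Times) auto
  moreover have "closed {p :: real \<times> real. 0 \<le> snd p \<and> snd p \<le> fst p \<and> fst p \<le> l}"
    by (intro closed_Collect_conj closed_Collect_le continuous_intros)
  ultimately show ?thesis
    using bounded_subset[OF compact_imp_bounded] unfolding compact_eq_bounded_closed[where S = "Collect _"] by blast
qed

lemma borel_kernel_low:
  assumes "continuous_on {p. 0 \<le> snd p \<and> snd p \<le> fst p \<and> fst p \<le> l} (\<lambda>p. h (fst p) (snd p))"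
  shows "borel_kernel (low h)"
proof -
  define \<Delta> where "\<Delta> = {p :: real \<times> real. 0 \<le> snd p \<and> snd p \<le> fst p \<and> fst p \<le> l}"
  have "compact ((\<lambda>p. h (fst p) (snd p)) ` \<Delta>)"
    using assms triangle_compact unfolding \<Delta>_def by (rule compact_continuous_image)
  then have "bounded ((\<lambda>p. h (fst p) (snd p)) ` \<Delta>)" by (rule compact_imp_bounded)
  then obtain C where C: "\<And>p. p \<in> \<Delta> \<Longrightarrow> norm (h (fst p) (snd p)) \<le> C"
    unfolding bounded_iff by blast
  show ?thesis
  proof (rule borel_kernelI[where C = "max C 0"])
    have "(\<lambda>p. indicator \<Delta> p *\<^sub>R h (fst p) (snd p)) \<in> borel_measurable borel"
      using assms triangle_compact unfolding \<Delta>_def[symmetric]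
      by (intro borel_measurable_continuous_on_indicator borel_compact)
    moreover have "(\<lambda>p. low h (fst p) (snd p)) = (\<lambda>p. indicator \<Delta> p *\<^sub>R h (fst p) (snd p))"
      by (auto simp: low_def \<Delta>_def indicator_def)
    ultimately show "(\<lambda>p. low h (fst p) (snd p)) \<in> borel_measurable borel" by simp
    show "norm (low h x t) \<le> max C 0" for x t
      using C[of "(x, t)"] by (auto simp: low_def \<Delta>_def)
  qed
qed

lemma borel_kernel_convolution:
  fixes D :: "real \<Rightarrow> complex^'q::finite^'p::finite"
  assumes D: "D \<in> borel_measurable borel" "\<And>x. norm (D x) \<le> C"
  shows "borel_kernel (low (\<lambda>x t. D (x - t)))"
proof (rule borel_kernelI[where C = "max C 0"])
  define \<Delta> where "\<Delta> = {p :: real \<times> real. 0 \<le> snd p \<and> snd p \<le> fst p \<and> fst p \<le> l}"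
  have "\<Delta> \<in> sets borel" unfolding \<Delta>_def by (rule borel_compact[OF triangle_compact])
  moreover have "(\<lambda>p. D (fst p - snd p)) \<in> borel_measurable (borel :: (real \<times> real) measure)"
    by (rule measurable_compose[OF _ D(1)]) (intro borel_measurable_continuous_onI continuous_intros)
  ultimately have "(\<lambda>p. indicator \<Delta> p *\<^sub>R D (fst p - snd p)) \<in> borel_measurable borel"
    by (intro borel_measurable_scaleR borel_measurable_indicator)
  moreover have "(\<lambda>p. low (\<lambda>x t. D (x - t)) (fst p) (snd p)) = (\<lambda>p. indicator \<Delta> p *\<^sub>R D (fst p - snd p))"
    by (auto simp: low_def \<Delta>_def indicator_def)
  ultimately show "(\<lambda>p. low (\<lambda>x t. D (x - t)) (fst p) (snd p)) \<in> borel_measurable borel" by simp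
  show "norm (low (\<lambda>x t. D (x - t)) x t) \<le> max C 0" for x t
    using D(2)[of "x - t"] by (auto simp: low_def)
qed

lemma borel_kernel_up: "borel_kernel (low h) \<Longrightarrow> borel_kernel (up h)"
  unfolding up_def[abs_def] by (rule borel_kernel_adjoint)

lemma kop_low_up: "borel_kernel (low h) \<Longrightarrow> integrable \<mu> f \<Longrightarrow> integrable \<mu> g \<Longrightarrow>
    ip (kop (low h) f) g = ip f (kop (up h) g)"
  unfolding up_def[abs_def] by (rule kop_adjoint)

lemma kop_low:
  assumes "x \<in> {0..l}" shows "kop (low h) f x = (LINT t:{0..x}|lebesgue. h x t *v f t)"
  unfolding kop_def set_lebesgue_integral_def
  by (subst integral_restrict_space)
    (use assms in \<open>auto intro!: Bochner_Integration.integral_cong simp: indicator_def low_def\<close>)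

lemma kop_up:
  assumes "x \<in> {0..l}" shows "kop (up h) f x = (LINT t:{x..l}|lebesgue. cadj (h t x) *v f t)"
  unfolding kop_def set_lebesgue_integral_def
  by (subst integral_restrict_space)
    (use assms in \<open>auto intro!: Bochner_Integration.integral_cong simp: indicator_def low_def up_def\<close>)

lemma low_product:
  "(\<integral>s. low a x s ** low b s t \<partial>\<mu>) = low (\<lambda>x t. LINT s:{t..x}|lebesgue. a x s ** b s t) x t"
proof -
  have "(\<integral>s. low a x s ** low b s t \<partial>\<mu>) = (\<integral>s. indicat_real {0..l} s *\<^sub>R (low a x s ** low b s t) \<partial>lebesgue)"
    by (subst integral_restrict_space) auto
  also have "\<dots> = low (\<lambda>x t. LINT s:{t..x}|lebesgue. a x s ** b s t) x t"
  proof (cases "0 \<le> t \<and> t \<le> x \<and> x \<le> l")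
    case True
    then show ?thesis unfolding set_lebesgue_integral_def low_def
      by (auto intro!: Bochner_Integration.integral_cong simp: indicator_def)
  next
    case False
    then have "indicat_real {0..l} s *\<^sub>R (low a x s ** low b s t) = 0" for s by (auto simp: low_def)
    then have "(\<integral>s. indicat_real {0..l} s *\<^sub>R (low a x s ** low b s t) \<partial>lebesgue) = 0" by (simp only: Bochner_Integration.integral_zero)
    then show ?thesis using False by (auto simp: low_def[of _ x t])
  qed
  finally show ?thesis .
qed

text \<open>Adjoints of Volterra operators compose in the reverse order, which exchanges a and b in
  the kernel.\<close>

lemma kop_up_compose:
  assumes a: "borel_kernel (low a)" and b: "borel_kernel (low b)" and f: "integrable \<mu> f"
  shows "kop (up a) (kop (up b) f) x = kop (up (\<lambda>x t. LINT s:{t..x}|lebesgue. b x s ** a s t)) f x"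
proof -
  have "(\<integral>s. up a x s ** up b s t \<partial>\<mu>) = up (\<lambda>x t. LINT s:{t..x}|lebesgue. b x s ** a s t) x t" for x t
  proof -
    have "(\<integral>s. up a x s ** up b s t \<partial>\<mu>) = (\<integral>s. cadj (low b t s ** low a s x) \<partial>\<mu>)"
      by (simp add: up_def cadj_mult)
    also have "\<dots> = cadj (\<integral>s. low b t s ** low a s x \<partial>\<mu>)"
      by (rule integral_bounded_linear[OF bounded_linear_cadj kernel_product_integrable[OF b a]])
    finally show ?thesis by (simp add: low_product up_def)
  qed
  then show ?thesis unfolding kop_compose[OF borel_kernel_up[OF a] borel_kernel_up[OF b] f] by simp
qed

abbreviation "unit_kernel \<equiv> (\<lambda>x t. mat 1 :: complex^'n::finite^'n)"

lemma borel_kernel_unit: "borel_kernel (low unit_kernel)"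
  by (rule borel_kernel_low) (rule continuous_on_const)

lemma kop_unit:
  assumes "integrable \<mu> f" "x \<in> {0..l}"
  shows "kop (low unit_kernel) f x = integral {0..x} f"
    "kop (low unit_kernel) f x + kop (up unit_kernel) f x = (\<integral>t. f t \<partial>\<mu>)"
proof -
  show 1: "kop (low unit_kernel) f x = integral {0..x} f"
    using lint_eq_integral(1)[OF assms(1), of x] assms(2) by (simp add: kop_low)
  have f: "set_integrable lebesgue {0..l} f" using assms by (simp add: integrable_lebesgue_on_iff)
  then have "kop (up unit_kernel) f x = integral {x..l} f"
    unfolding kop_up[OF assms(2)]
    using set_lebesgue_integral_eq_integral(2)[OF set_integrable_subset[OF f, of "{x..l}"]] assms(2) by simp
  moreover have "integral {0..x} f + integral {x..l} f = integral {0..l} f"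
    using assms lint_eq_integral(2)[OF assms(1), of l]
    by (intro Henstock_Kurzweil_Integration.integral_combine) auto
  moreover have "(\<integral>t. f t \<partial>\<mu>) = integral {0..l} f"
    using lint_eq_integral(1)[OF assms(1), of l] by (simp add: set_lebesgue_integral_def integral_restrict_space)
  ultimately show "kop (low unit_kernel) f x + kop (up unit_kernel) f x = (\<integral>t. f t \<partial>\<mu>)" using 1 by simp
qed

lemma ip_const: "f \<in> L2 \<Longrightarrow> ip (\<lambda>x. c) f = c \<bullet> (\<integral>x. f x \<partial>\<mu>)"
  unfolding ip_def using L2_integrable by (intro integral_inner_right) auto

text \<open>Integration from the left plus integration from the right is the full integral. So the
  integration operator plus its adjoint has values in the constants, which is the displacement
  structure used for S.\<close>

lemma ip_unit:
  assumes f: "f \<in> L2" and g: "g \<in> L2"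
  shows "ip (kop (up unit_kernel) f) g + ip f (kop (up unit_kernel) g) = (\<integral>x. f x \<partial>\<mu>) \<bullet> (\<integral>x. g x \<partial>\<mu>)"
proof -
  note i = L2_integrable[OF f] L2_integrable[OF g]
  have "ip (kop (up unit_kernel) f) g + ip f (kop (up unit_kernel) g)
     = ip (kop (up unit_kernel) f) g + ip (kop (low unit_kernel) f) g"
    using i by (simp add: kop_low_up[OF borel_kernel_unit])
  also have "\<dots> = ip (\<lambda>x. kop (up unit_kernel) f x + kop (low unit_kernel) f x) g"
    using i g by (intro ip_add_left[symmetric] kop_L2 borel_kernel_unit borel_kernel_up)
  also have "\<dots> = ip (\<lambda>x. \<integral>x. f x \<partial>\<mu>) g"
    unfolding ip_def by (rule Bochner_Integration.integral_cong) (use kop_unit(2)[OF i(1)] in \<open>auto simp: add.commute\<close>)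
  finally show ?thesis using g by (simp add: ip_const)
qed

abbreviation "poly_kernel p \<equiv> (\<lambda>x t. p (x - t) *\<^sub>R (mat 1 :: complex^'n::finite^'n))"

lemma borel_kernel_poly:
  assumes "continuous_on UNIV p" shows "borel_kernel (low (poly_kernel p))"
proof (rule borel_kernel_low)
  have "continuous_on UNIV (\<lambda>q :: real \<times> real. p (fst q - snd q))"
    by (rule continuous_on_compose2[OF assms]) (auto intro!: continuous_intros)
  then show "continuous_on {q :: real \<times> real. 0 \<le> snd q \<and> snd q \<le> fst q \<and> fst q \<le> l} (\<lambda>q. p (fst q - snd q) *\<^sub>R (mat 1 :: complex^'n^'n))"
    by (intro continuous_on_scaleR continuous_on_const) (rule continuous_on_subset, auto)
qed

lemma lint_power:
  fixes t x :: real assumes "t \<le> x"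
  shows "(LINT s:{t..x}|lebesgue. (s - t) ^ n) = (x - t) ^ Suc n / Suc n"
    "(LINT s:{t..x}|lebesgue. (x - s) ^ n) = (x - t) ^ Suc n / Suc n"
proof -
  have 1: "((\<lambda>s. (s - t) ^ n) has_integral (x - t) ^ Suc n / Suc n - (t - t) ^ Suc n / Suc n) {t..x}"
    by (rule fundamental_theorem_of_calculus[OF assms])
      (auto intro!: derivative_eq_intros simp: has_real_derivative_iff_has_vector_derivative[symmetric] simp del: power_Suc)
  have 2: "((\<lambda>s. (x - s) ^ n) has_integral - ((x - x) ^ Suc n / Suc n) - (- ((x - t) ^ Suc n / Suc n))) {t..x}"
    by (rule fundamental_theorem_of_calculus[OF assms])
      (auto intro!: derivative_eq_intros simp: has_real_derivative_iff_has_vector_derivative[symmetric] simp del: power_Suc)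
  have c: "(\<lambda>s. (s - t) ^ n) absolutely_integrable_on {t..x}" "(\<lambda>s. (x - s) ^ n) absolutely_integrable_on {t..x}"
    by (intro absolutely_integrable_continuous_real continuous_intros)+
  show "(LINT s:{t..x}|lebesgue. (s - t) ^ n) = (x - t) ^ Suc n / Suc n"
    "(LINT s:{t..x}|lebesgue. (x - s) ^ n) = (x - t) ^ Suc n / Suc n"
    unfolding set_lebesgue_integral_eq_integral(2)[OF c(1)] set_lebesgue_integral_eq_integral(2)[OF c(2)]
    using integral_unique[OF 1] integral_unique[OF 2] by simp_all
qed

lemma low_cong: "(\<And>x t. 0 \<le> t \<Longrightarrow> t \<le> x \<Longrightarrow> x \<le> l \<Longrightarrow> h x t = h' x t) \<Longrightarrow> low h = low h'"
  by (auto simp: low_def intro!: ext)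

lemma up_cong: "(\<And>x t. 0 \<le> t \<Longrightarrow> t \<le> x \<Longrightarrow> x \<le> l \<Longrightarrow> h x t = h' x t) \<Longrightarrow> up h = up h'"
  unfolding up_def[abs_def] using low_cong[of h h'] by metis

lemma kop_up_scaleR: "kop (up (\<lambda>x t. c *\<^sub>R h x t)) f x = c *\<^sub>R kop (up h) f x"
proof -
  have "up (\<lambda>x t. c *\<^sub>R h x t) x t *v y = c *\<^sub>R (up h x t *v y)" for x t y
    by (simp add: up_def low_def linear_scale[OF linear_cadj] matrix_vector_mult_scaleR)
  then show ?thesis by (simp add: kop_def)
qed

text \<open>Integrating a power raises the degree and divides by the new one. Hence the (n+1)st
  power of the upper integration operator has kernel s^n / n!.\<close>

lemma unit_poly_compose:
  assumes f: "integrable \<mu> (f :: real \<Rightarrow> complex^'n::finite)"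
  shows "kop (up unit_kernel) (kop (up (poly_kernel (\<lambda>s. s ^ n))) f) x
       = (1 / Suc n) *\<^sub>R kop (up (poly_kernel (\<lambda>s. s ^ Suc n))) f x"
    "kop (up (poly_kernel (\<lambda>s. s ^ n))) (kop (up unit_kernel) f) x
       = (1 / Suc n) *\<^sub>R kop (up (poly_kernel (\<lambda>s. s ^ Suc n))) f x"
proof -
  have p: "borel_kernel (low (poly_kernel (\<lambda>s. s ^ n)))"
    by (intro borel_kernel_poly continuous_intros)
  have lint_scaleR: "(LINT s:{t..x}|lebesgue. q s *\<^sub>R A) = (LINT s:{t..x}|lebesgue. q s) *\<^sub>R A"
    if "continuous_on {t..x} q" for q :: "real \<Rightarrow> real" and t x and A :: "complex^'n^'n"
  proof -
    have "integrable lebesgue (\<lambda>s. indicat_real {t..x} s *\<^sub>R q s)"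
      using absolutely_integrable_continuous_real[OF that] by (simp add: set_integrable_def)
    from integral_scaleR_left[OF this, of A] show ?thesis by (simp add: set_lebesgue_integral_def)
  qed
  have e: "up (\<lambda>x t. LINT s:{t..x}|lebesgue. poly_kernel (\<lambda>s. s ^ n) x s ** unit_kernel s t) =
     up (\<lambda>x t. (1 / Suc n) *\<^sub>R (poly_kernel (\<lambda>s. s ^ Suc n) x t :: complex^'n^'n))"
   "up (\<lambda>x t. LINT s:{t..x}|lebesgue. unit_kernel x s ** poly_kernel (\<lambda>s. s ^ n) s t) =
     up (\<lambda>x t. (1 / Suc n) *\<^sub>R (poly_kernel (\<lambda>s. s ^ Suc n) x t :: complex^'n^'n))"
    by (rule up_cong, simp add: lint_power lint_scaleR continuous_intros del: power_Suc)+
  show "kop (up unit_kernel) (kop (up (poly_kernel (\<lambda>s. s ^ n))) f) x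
       = (1 / Suc n) *\<^sub>R kop (up (poly_kernel (\<lambda>s. s ^ Suc n))) f x"
    unfolding kop_up_compose[OF borel_kernel_unit p f] e kop_up_scaleR ..
  show "kop (up (poly_kernel (\<lambda>s. s ^ n))) (kop (up unit_kernel) f) x
       = (1 / Suc n) *\<^sub>R kop (up (poly_kernel (\<lambda>s. s ^ Suc n))) f x"
    unfolding kop_up_compose[OF p borel_kernel_unit f] e kop_up_scaleR ..
qed

lemma lint_reflect:
  fixes D :: "real \<Rightarrow> 'a::euclidean_space"
  assumes D: "D \<in> borel_measurable borel"
  shows "(LINT s:{t..x}|lebesgue. D (s - t)) = (LINT s:{t..x}|lebesgue. D (x - s))"
proof -
  have m: "(\<lambda>s. indicat_real {t..x} s *\<^sub>R D (s - t)) \<in> borel_measurable borel"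
    "(\<lambda>s. indicat_real {t..x} s *\<^sub>R D (x - s)) \<in> borel_measurable borel"
    using D by measurable
  have "(LINT s:{t..x}|lebesgue. D (s - t)) = (\<integral>s. indicat_real {t..x} s *\<^sub>R D (s - t) \<partial>lborel)"
    unfolding set_lebesgue_integral_def by (rule integral_completion) (use m in simp)
  also have "\<dots> = \<bar>-1\<bar> *\<^sub>R (\<integral>s. indicat_real {t..x} ((x + t) + (-1) * s) *\<^sub>R D ((x + t) + (-1) * s - t) \<partial>lborel)"
    by (rule lborel_integral_real_affine) simp
  also have "\<dots> = (\<integral>s. indicat_real {t..x} s *\<^sub>R D (x - s) \<partial>lborel)"
    by (auto intro!: Bochner_Integration.integral_cong simp: indicator_def algebra_simps)
  also have "\<dots> = (LINT s:{t..x}|lebesgue. D (x - s))"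
    unfolding set_lebesgue_integral_def by (rule integral_completion[symmetric]) (use m in simp)
  finally show ?thesis .
qed

text \<open>Convolution operators commute with integration: the reflection s to x + t - s exchanges
  the two orders of composition.\<close>

lemma convolution_commute:
  fixes D :: "real \<Rightarrow> complex^'q::finite^'p::finite"
  assumes D: "D \<in> borel_measurable borel" "\<And>x. norm (D x) \<le> C" and f: "integrable \<mu> f"
  shows "kop (up (\<lambda>x t. D (x - t))) (kop (up unit_kernel) f) x = kop (up unit_kernel) (kop (up (\<lambda>x t. D (x - t))) f) x"
  by (simp add: kop_up_compose borel_kernel_convolution[OF D] borel_kernel_unit f lint_reflect[OF D(1)])

end

section \<open>Borel representatives of the kernel and of the derivative\<close>

lemma completion_borel_version:
  fixes g :: "'a \<Rightarrow> 'b::euclidean_space"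
  assumes "g \<in> borel_measurable (completion N)"
  shows "\<exists>g'\<in>borel_measurable N. AE x in N. g x = g' x"
proof -
  have "\<forall>b. \<exists>g'. g' \<in> borel_measurable N \<and> (AE x in N. g x \<bullet> b = g' x)"
  proof
    fix b
    have "(\<lambda>x. g x \<bullet> b) \<in> borel_measurable (completion N)" using assms by simp
    then show "\<exists>g'. g' \<in> borel_measurable N \<and> (AE x in N. g x \<bullet> b = g' x)"
      using completion_ex_borel_measurable_real by blast
  qed
  then obtain h where h: "\<And>b. h b \<in> borel_measurable N" "\<And>b. AE x in N. g x \<bullet> b = h b x" by metis
  have "AE x in N. \<forall>b\<in>Basis. g x \<bullet> b = h b x"
    by (rule AE_finite_allI) (use h in auto)
  then have "AE x in N. g x = (\<Sum>b\<in>Basis. h b x *\<^sub>R b)"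
    by eventually_elim (metis (no_types, lifting) euclidean_representation sum.cong)
  then show ?thesis
    using h by (intro bexI[of _ "\<lambda>x. \<Sum>b\<in>Basis. h b x *\<^sub>R b"]) auto
qed

context dirac_similarity
begin

sublocale interval_operators l .

text \<open>The kernel of E is only Lebesgue measurable on a triangle in the plane. A Borel version
  differs from it on a planar null set, so almost every section agrees almost everywhere and E is
  unchanged up to null sets.\<close>

lemma kernel_representative:
  obtains \<kappa> where "borel_kernel \<kappa>" "\<And>f. f \<in> L2 \<Longrightarrow> AE x in \<mu>. E f x = f x + kop \<kappa> f x"
proof -
  define \<Delta> where "\<Delta> = {p :: real \<times> real. 0 \<le> snd p \<and> snd p \<le> fst p \<and> fst p \<le> l}"
  have D': "\<Delta> = {(x, t). 0 \<le> t \<and> t \<le> x \<and> x \<le> l}" by (auto simp: \<Delta>_def)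
  have \<Delta>: "\<Delta> \<in> sets borel" unfolding \<Delta>_def by (rule borel_compact[OF triangle_compact])
  obtain C where C: "\<And>x t. 0 \<le> t \<Longrightarrow> t \<le> x \<Longrightarrow> x \<le> l \<Longrightarrow> norm (k x t) \<le> C"
    and m: "(\<lambda>(x, t). k x t) \<in> borel_measurable (lebesgue_on \<Delta>)"
    using kernel unfolding bounded_kernel_def D' by blast
  define h where "h p = indicat_real \<Delta> p *\<^sub>R k (fst p) (snd p)" for p
  have "h \<in> borel_measurable lebesgue"
    using m \<Delta> by (subst (asm) borel_measurable_restrict_space_iff) (auto simp: h_def[abs_def] case_prod_beta')
  then obtain g where g: "g \<in> borel_measurable lborel" "AE p in lborel. h p = g p"
    using completion_borel_version by blast
  \<comment> \<open>Truncation at the bound C restores boundedness everywhere; it alters the Borel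
    version only on a null subset of the triangle.\<close>
  define \<kappa> where "\<kappa> x t = (\<lambda>p. if p \<in> \<Delta> \<and> norm (g p) \<le> C then g p else 0) (x, t)" for x t
  have [measurable]: "g \<in> borel_measurable borel" "\<Delta> \<in> sets borel" using g \<Delta> by auto
  have "(\<lambda>p. if p \<in> \<Delta> \<and> norm (g p) \<le> C then g p else 0) \<in> borel_measurable borel" by measurable
  then have \<kappa>: "borel_kernel \<kappa>"
    by (intro borel_kernelI[where C = "max C 0"]) (auto simp: \<kappa>_def le_max_iff_disj cong: if_cong)
  have "AE p in lborel. h p = \<kappa> (fst p) (snd p)"
    using g(2)
  proof eventually_elim
    case (elim p)
    show ?case
    proof (cases "p \<in> \<Delta>")
      case True
      then have "norm (g p) \<le> C" using elim C[of "snd p" "fst p"] by (auto simp: h_def \<Delta>_def)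
      then show ?thesis using elim True by (simp add: \<kappa>_def)
    qed (simp add: h_def \<kappa>_def)
  qed
  then have "AE p in lborel \<Otimes>\<^sub>M lborel. h p = \<kappa> (fst p) (snd p)" by (simp only: lborel_prod)
  then have "AE x in lborel. AE t in lborel. h (x, t) = \<kappa> x t"
    using lborel_pair.AE_pair by fastforce
  then have ae: "AE x in \<mu>. AE t in \<mu>. h (x, t) = \<kappa> x t"
    by (auto simp: AE_restrict_space_iff AE_completion elim!: eventually_mono intro: AE_completion)
  show ?thesis
  proof (rule that[OF \<kappa>])
    fix f :: "real \<Rightarrow> complex^'m2" assume f: "f \<in> L2"
    show "AE x in \<mu>. E f x = f x + kop \<kappa> f x"
      using ae AE_mem
    proof eventually_elim
      case (elim x)
      have i: "integrable \<mu> (\<lambda>t. \<kappa> x t *v f t)" by (rule kop_integrand[OF \<kappa> L2_integrable[OF f]])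
      have ae: "AE t in \<mu>. \<kappa> x t *v f t = h (x, t) *v f t" using elim(1) by eventually_elim simp
      have "(LINT t:{0..x}|lebesgue. k x t *v f t) = (\<integral>t. h (x, t) *v f t \<partial>\<mu>)"
        unfolding set_lebesgue_integral_def
        by (subst integral_restrict_space)
          (use elim(2) in \<open>auto intro!: Bochner_Integration.integral_cong simp: h_def \<Delta>_def indicator_def\<close>)
      also have "\<dots> = kop \<kappa> f x" unfolding kop_def
        using borel_measurable_lebesgue_on_AE[OF borel_measurable_integrable[OF i] ae] i ae
        by (intro integral_cong_AE) (auto elim: eventually_mono)
      finally show ?case by (simp add: volterra_op_def)
    qed
  qed
qed

text \<open>Convolution kernels need the derivative of \<Phi> as a bounded Borel function on the
  line. It must match both the derivative within the interval, which the calculus uses, and the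
  two-sided one in \<open>s_kernel\<close>.\<close>

lemma derivative_representative:
  obtains D C where "D \<in> borel_measurable borel" "\<And>x. norm (D x) \<le> C"
    "AE x in \<mu>. D x = vector_derivative \<Phi> (at x within {0..l})"
    "AE x in \<mu>. D x = vector_derivative \<Phi> (at x)"
    "has_ae_deriv 0 l \<Phi> D"
proof -
  define d where "d x = vector_derivative \<Phi> (at x within {0..l})" for x
  obtain C where "AE x in \<mu>. \<exists>D. (\<Phi> has_vector_derivative D) (at x within {0..l}) \<and> norm D \<le> C"
    using Phi_bd unfolding boundedly_diff_def by blast
  then have C: "AE x in \<mu>. norm (d x) \<le> C"
    using AE_mem
  proof eventually_elim
    case (elim x)
    then obtain D where D: "(\<Phi> has_vector_derivative D) (at x within cbox 0 l)" "norm D \<le> C" by auto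
    then have "d x = D" using vector_derivative_within_cbox[of 0 l x \<Phi> D] l_pos elim(2) by (simp add: d_def)
    then show ?case using D by simp
  qed
  have "(d has_integral \<Phi> l - \<Phi> 0) {0..l}"
    unfolding d_def using l_pos by (intro has_ae_deriv_integral[OF Phi_deriv]) auto
  then have "(\<lambda>x. indicat_real {0..l} x *\<^sub>R d x) \<in> borel_measurable lebesgue"
    by (rule has_integral_implies_lebesgue_measurable)
  then obtain g where g: "g \<in> borel_measurable lborel" "AE x in lborel. indicat_real {0..l} x *\<^sub>R d x = g x"
    using completion_borel_version by blast
  define D where "D x = (if norm (g x) \<le> C then g x else 0)" for x
  have "AE x in lebesgue. indicat_real {0..l} x *\<^sub>R d x = g x" using g(2) by (rule AE_completion)
  then have "AE x in \<mu>. g x = d x" by (auto simp: AE_restrict_space_iff elim!: eventually_mono)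
  with C have Dd: "AE x in \<mu>. D x = d x" by eventually_elim (simp add: D_def)
  show ?thesis
  proof (rule that)
    show "D \<in> borel_measurable borel" unfolding D_def using g(1) by measurable
    show "norm (D x) \<le> max C 0" for x by (simp add: D_def le_max_iff_disj)
    show 1: "AE x in \<mu>. D x = vector_derivative \<Phi> (at x within {0..l})" using Dd by (simp add: d_def)
    \<comment> \<open>Away from the endpoints the derivative within the interval and the two-sided
      derivative coincide.\<close>
    have "AE x in lebesgue. x \<noteq> 0 \<and> x \<noteq> l"
      using AE_completion[OF AE_lborel_singleton[of 0]] AE_completion[OF AE_lborel_singleton[of l]]
      by eventually_elim simp
    then have "AE x in \<mu>. x \<noteq> 0 \<and> x \<noteq> l"
      by (subst AE_restrict_space_iff) (auto elim: eventually_mono)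
    then show "AE x in \<mu>. D x = vector_derivative \<Phi> (at x)"
      using Dd AE_mem
    proof eventually_elim
      case (elim x)
      then have "at x within {0..l} = at x" by (intro at_within_interior) (auto simp: interior_atLeastAtMost_real)
      then show ?case using elim by (simp add: d_def)
    qed
    show "has_ae_deriv 0 l \<Phi> D" by (rule has_ae_deriv_cong[OF Phi_deriv]) (use 1 in \<open>eventually_elim, simp\<close>)
  qed
qed

end

section \<open>Recovery of \<open>\<beta>\<close>\<close>

locale dirac_kernels = dirac_similarity M v u \<Phi> l k R
  for M v and u :: "real \<Rightarrow> complex \<Rightarrow> complex^('m1::finite + 'm2::finite)^('m1 + 'm2)"
    and \<Phi> :: "real \<Rightarrow> complex^'m1^'m2" and l k R +
  fixes \<kappa> :: "real \<Rightarrow> real \<Rightarrow> complex^'m2^'m2" and D :: "real \<Rightarrow> complex^'m1^'m2" and C :: real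
  assumes \<kappa>: "borel_kernel \<kappa>" and E_kop: "\<And>f. f \<in> L2 \<Longrightarrow> AE x in \<mu>. E f x = f x + kop \<kappa> f x"
    and D_meas: "D \<in> borel_measurable borel" and D_bound: "\<And>x. norm (D x) \<le> C"
    and D_deriv: "has_ae_deriv 0 l \<Phi> D"
    and Phi_0: "\<Phi> 0 = 0"
begin

text \<open>These are \<i> A, its adjoint up to the factor, and convolution with \<Phi>1' with its
  adjoint; \<open>Ns\<close> is \<i> K and \<open>N\<close> its adjoint. Dropping \<i> keeps
  everything compatible with the real inner product: \<open>J\<close>, \<open>Ts\<close> and
  \<open>N\<close> are the real adjoints of \<open>I0\<close>, \<open>T\<close> and
  \<open>Ns\<close>.\<close>

abbreviation "I0 \<equiv> kop (low unit_kernel)"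
abbreviation "J \<equiv> kop (up unit_kernel)"
abbreviation "T \<equiv> kop (low (\<lambda>x t. D (x - t)))"
abbreviation "Ts \<equiv> kop (up (\<lambda>x t. D (x - t)))"
abbreviation "N \<equiv> kop (up (\<lambda>x t. \<gamma> x ** cadj (\<gamma> t)))"
abbreviation "Ns \<equiv> kop (low (\<lambda>x t. \<gamma> x ** cadj (\<gamma> t)))"

definition Es :: "(real \<Rightarrow> complex^'m2) \<Rightarrow> real \<Rightarrow> complex^'m2" where
  "Es f x = f x + kop (\<lambda>x t. cadj (\<kappa> t x)) f x"

text \<open>The kernel s(x,t) is that of T composed with its adjoint. The factorized form makes S
  symmetric at once and gives the squares used in the form below.\<close>

definition S :: "(real \<Rightarrow> complex^'m2) \<Rightarrow> real \<Rightarrow> complex^'m2" where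
  "S f x = f x + T (Ts f) x"

lemma E_L2: "f \<in> L2 \<Longrightarrow> E f \<in> L2" and R_L2: "f \<in> L2 \<Longrightarrow> R f \<in> L2"
  using E_bdd R_bdd by (auto intro: L2_bounded_op_L2)

lemma Es_L2: "f \<in> L2 \<Longrightarrow> Es f \<in> L2"
  unfolding Es_def[abs_def] by (intro L2_on_add kop_L2 borel_kernel_adjoint \<kappa> L2_integrable)

lemma kernels: "borel_kernel (low (\<lambda>x t. D (x - t)))" "borel_kernel (low (\<lambda>x t. \<gamma> x ** cadj (\<gamma> t)))"
  "borel_kernel (up (\<lambda>x t. D (x - t)))" "borel_kernel (up (\<lambda>x t. \<gamma> x ** cadj (\<gamma> t)))"
  "borel_kernel (low unit_kernel)" "borel_kernel (up unit_kernel)"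
proof -
  show 1: "borel_kernel (low (\<lambda>x t. D (x - t)))" by (rule borel_kernel_convolution[OF D_meas D_bound])
  have g: "continuous_on {p. 0 \<le> snd p \<and> snd p \<le> fst p \<and> fst p \<le> l} (\<lambda>p. \<gamma> (fst p))"
     "continuous_on {p. 0 \<le> snd p \<and> snd p \<le> fst p \<and> fst p \<le> l} (\<lambda>p. \<gamma> (snd p))"
    by (rule continuous_on_compose2[OF gamma_cont[of l]], auto intro!: continuous_intros)+
  show 2: "borel_kernel (low (\<lambda>x t. \<gamma> x ** cadj (\<gamma> t)))"
    by (intro borel_kernel_low continuous_on_matrix_matrix g
      continuous_on_cadj)
  show "borel_kernel (up (\<lambda>x t. D (x - t)))" "borel_kernel (up (\<lambda>x t. \<gamma> x ** cadj (\<gamma> t)))"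
    by (rule borel_kernel_up[OF 1], rule borel_kernel_up[OF 2])
  show "borel_kernel (low unit_kernel)" "borel_kernel (up unit_kernel)"
    by (intro borel_kernel_unit borel_kernel_up)+
qed

lemma kop_L2': "borel_kernel \<rho> \<Longrightarrow> f \<in> L2 \<Longrightarrow> kop \<rho> f \<in> L2"
  by (intro kop_L2 L2_integrable)

lemmas L2_intros = E_L2 R_L2 Es_L2 kernels kop_L2' L2_on_add L2_on_diff L2_scaleR

lemma S_L2: "f \<in> L2 \<Longrightarrow> S f \<in> L2"
  unfolding S_def[abs_def] by (intro L2_intros)

lemma E_adjoint:
  assumes f: "f \<in> L2" and g: "g \<in> L2"
  shows "ip (E f) g = ip f (Es g)"
proof -
  have "ip (E f) g = ip (\<lambda>x. f x + kop \<kappa> f x) g"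
    by (rule ip_cong[OF E_kop]) (use f g E_L2 in auto)
  also have "\<dots> = ip f g + ip f (kop (\<lambda>x t. cadj (\<kappa> t x)) g)"
    using f g by (simp add: ip_add_left kop_L2' \<kappa> kop_adjoint L2_integrable)
  also have "\<dots> = ip f (Es g)"
    unfolding Es_def[abs_def] using f g by (simp add: ip_add_right kop_L2' \<kappa> borel_kernel_adjoint)
  finally show ?thesis .
qed

lemma S_adjoint:
  assumes f: "f \<in> L2" and g: "g \<in> L2"
  shows "ip (S f) g = ip f g + ip (Ts f) (Ts g)" "ip (S f) g = ip f (S g)"
proof -
  have *: "ip (S f) g = ip f g + ip (Ts f) (Ts g)" if f: "f \<in> L2" and g: "g \<in> L2" for f g
    unfolding S_def[abs_def] using f g
    by (simp add: ip_add_left L2_intros kop_low_up[OF kernels(1)] L2_integrable)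
  show "ip (S f) g = ip f g + ip (Ts f) (Ts g)" by (rule *[OF f g])
  show "ip (S f) g = ip f (S g)"
    unfolding *[OF f g] ip_commute[of f "S g"] *[OF g f] by (simp add: ip_commute)
qed

lemma gamma_adj_integrable: "w \<in> L2 \<Longrightarrow> integrable \<mu> (\<lambda>t. cadj (\<gamma> t) *v w t)"
  by (intro bilinear_integrable[OF bounded_bilinear_matrix_vector] continuous_on_cadj gamma_cont L2_integrable)

lemma gamma_vec_cont: "continuous_on {0..l} (\<lambda>x. \<gamma> x *v c)"
  by (intro continuous_on_matrix_vector gamma_cont continuous_intros)

lemma N_unit:
  assumes w: "w \<in> L2" and x: "x \<in> {0..l}"
  shows "Ns w x = \<gamma> x *v I0 (\<lambda>t. cadj (\<gamma> t) *v w t) x" "N w x = \<gamma> x *v J (\<lambda>t. cadj (\<gamma> t) *v w t) x"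
proof -
  note i = kop_integrand[OF kernels(5) gamma_adj_integrable[OF w], of x] kop_integrand[OF kernels(6) gamma_adj_integrable[OF w], of x]
  have low: "low (\<lambda>x t. \<gamma> x ** cadj (\<gamma> t)) x t *v w t = \<gamma> x *v (low unit_kernel x t *v (cadj (\<gamma> t) *v w t))" for t
    by (simp add: low_def matrix_vector_mul_assoc[symmetric])
  show "Ns w x = \<gamma> x *v I0 (\<lambda>t. cadj (\<gamma> t) *v w t) x"
    unfolding kop_def low by (rule integral_bounded_linear[OF bounded_linear_matrix_vector i(1)])
  have up: "up (\<lambda>x t. \<gamma> x ** cadj (\<gamma> t)) x t *v w t = \<gamma> x *v (up unit_kernel x t *v (cadj (\<gamma> t) *v w t))" for t
    by (simp add: low_def up_def cadj_mult matrix_vector_mul_assoc[symmetric])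
  show "N w x = \<gamma> x *v J (\<lambda>t. cadj (\<gamma> t) *v w t) x"
    unfolding kop_def up by (rule integral_bounded_linear[OF bounded_linear_matrix_vector i(2)])
qed

text \<open>The counterpart of \<open>ip_unit\<close>: the sum of \<open>N\<close> and
  \<open>Ns\<close> sends w to \<gamma>(x) times the constant vector obtained by integrating w
  against the adjoint of \<gamma>.\<close>

lemma N_ip:
  assumes w: "w \<in> L2" and w': "w' \<in> L2"
  shows "ip (N w) w' + ip w (N w') = (\<integral>x. cadj (\<gamma> x) *v w x \<partial>\<mu>) \<bullet> (\<integral>x. cadj (\<gamma> x) *v w' x \<partial>\<mu>)"
proof -
  define y where "y = (\<integral>x. cadj (\<gamma> x) *v w x \<partial>\<mu>)"
  have "ip (N w) w' + ip w (N w') = ip (N w) w' + ip (Ns w) w'"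
    using w w' by (simp add: kop_low_up[OF kernels(2)] L2_integrable)
  also have "\<dots> = ip (\<lambda>x. N w x + Ns w x) w'"
    using w w' by (intro ip_add_left[symmetric] L2_intros)
  also have "\<dots> = (\<integral>x. y \<bullet> (cadj (\<gamma> x) *v w' x) \<partial>\<mu>)"
    unfolding ip_def
  proof (rule Bochner_Integration.integral_cong[OF refl])
    fix x assume "x \<in> space \<mu>"
    then have x: "x \<in> {0..l}" by simp
    have "N w x + Ns w x = \<gamma> x *v y"
      unfolding N_unit[OF w x] y_def kop_unit(2)[OF gamma_adj_integrable[OF w] x, symmetric]
      by (simp add: matrix_vector_right_distrib)
    then show "(N w x + Ns w x) \<bullet> w' x = y \<bullet> (cadj (\<gamma> x) *v w' x)" by (simp add: inner_matrix_cadj)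
  qed
  also have "\<dots> = y \<bullet> (\<integral>x. cadj (\<gamma> x) *v w' x \<partial>\<mu>)"
    by (rule integral_inner_right) (use gamma_adj_integrable[OF w'] in auto)
  finally show ?thesis by (simp add: y_def)
qed

text \<open>Convolving a constant integrates the derivative of \<Phi>, and \<Phi> 0 = 0. So \<Phi>
  itself is the image of the constants under T.\<close>

lemma T_const:
  assumes "x \<in> {0..l}" shows "T (\<lambda>t. c) x = \<Phi> x *v c"
proof -
  have 1: "(D has_integral \<Phi> x) {0..x}"
    using has_ae_deriv_integral[OF D_deriv, of 0 x] assms by (simp add: Phi_0)
  have Dc: "(\<lambda>t. D t *v c) \<in> borel_measurable borel"
    using D_meas by (intro measurable_matrix_vector) auto
  have "integrable \<mu> D"
    by (rule integrable_const_bound[where B = C])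
      (use D_bound D_meas in \<open>auto intro!: measurable_restrict_space1 measurable_completion\<close>)
  then have i: "integrable \<mu> (\<lambda>t. D t *v c)"
    by (rule integrable_bounded_linear[OF bounded_bilinear.bounded_linear_left[OF bounded_bilinear_matrix_vector]])
  have "T (\<lambda>t. c) x = (LINT t:{0..x}|lebesgue. D (t - 0) *v c)"
    unfolding kop_low[OF assms] lint_reflect[OF Dc] ..
  also have "\<dots> = integral {0..x} (\<lambda>t. D t *v c)"
    using lint_eq_integral(1)[OF i, of x] assms by simp
  also have "\<dots> = \<Phi> x *v c"
    using has_integral_linear[OF 1 bounded_bilinear.bounded_linear_left[OF bounded_bilinear_matrix_vector, of c]]
    by (simp add: o_def integral_unique)
  finally show ?thesis .
qed

lemma Ns_E:
  assumes f: "f \<in> L2" shows "AE x in \<mu>. Ns (E f) x = E (I0 f) x"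
proof -
  have K: "K_op \<gamma> g x = (- \<i>) *s Ns g x" if "g \<in> L2" "x \<in> {0..l}" for g x
    unfolding K_op_def N_unit(1)[OF that] unfolding kop_low[OF that(2)] by simp
  have A: "A_op g x = (- \<i>) *s I0 g x" if "g \<in> L2" "x \<in> {0..l}" for g x
    using that by (simp add: A_op_eq kop_unit(1) L2_integrable)
  have RE: "R (E f) \<in> L2" and I: "I0 f \<in> L2" using f by (auto intro!: L2_intros)
  have "AE x in \<mu>. A_op (R (E f)) x = (- \<i>) *s I0 f x"
    using AE_mem
  proof eventually_elim
    case (elim x)
    have "I0 (R (E f)) x = I0 f x"
      by (rule kop_cong[OF R_E[OF f]]) (use RE f kernels in \<open>auto intro: L2_integrable\<close>)
    then show ?case using A[OF RE elim] by simp
  qed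
  then have 1: "AE x in \<mu>. E (A_op (R (E f))) x = E (\<lambda>x. (- \<i>) *s I0 f x) x"
    by (rule L2_bounded_op_cong[OF E_bdd A_op_L2[OF RE] L2_on_cmult[OF I]])
  show ?thesis
    using 1 L2_bounded_op_cmult[OF E_bdd I, of "- \<i>"] intertwine[OF E_L2[OF f]] AE_mem
  proof eventually_elim
    case (elim x)
    then have "(- \<i>) *s Ns (E f) x = (- \<i>) *s E (I0 f) x" using K[OF E_L2[OF f], of x] by simp
    then have "\<i> *s ((- \<i>) *s Ns (E f) x) = \<i> *s ((- \<i>) *s E (I0 f) x)" by simp
    then show ?case by (simp add: vector_smult_assoc)
  qed
qed

text \<open>The adjoint form of the similarity K E = E A, obtained by testing with all h.\<close>

lemma Es_N:
  assumes w: "w \<in> L2" shows "AE x in \<mu>. Es (N w) x = J (Es w) x"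
proof (rule ip_eq_AE)
  fix h :: "real \<Rightarrow> complex^'m2" assume h: "h \<in> L2"
  have "ip (Es (N w)) h = ip (E h) (N w)"
    using E_adjoint[OF h, of "N w"] w by (simp add: L2_intros ip_commute)
  also have "\<dots> = ip (Ns (E h)) w"
    using kop_low_up[OF kernels(2), of "E h" w] h w by (simp add: L2_intros L2_integrable)
  also have "\<dots> = ip (E (I0 h)) w"
    by (rule ip_cong[OF Ns_E[OF h]]) (use h w in \<open>auto intro!: L2_intros\<close>)
  also have "\<dots> = ip (I0 h) (Es w)" by (rule E_adjoint) (use h w in \<open>auto intro!: L2_intros\<close>)
  also have "\<dots> = ip (J (Es w)) h"
    using kop_low_up[OF kernels(5), of h "Es w"] h w by (simp add: L2_intros L2_integrable ip_commute)
  finally show "ip (Es (N w)) h = ip (J (Es w)) h" .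
qed (use w in \<open>auto intro!: L2_intros\<close>)

text \<open>Since \<gamma> c is the image under E of T applied to the upper part of c plus the lower
  part of c, moving E and T to the other side of the inner product expresses the rank part of
  \<open>N_ip\<close> through those of \<open>ip_unit\<close>.\<close>

lemma integral_Es:
  assumes w: "w \<in> L2"
  shows "(\<integral>x. cadj (\<gamma> x) *v w x \<partial>\<mu>) = vjoin (\<integral>x. Ts (Es w) x \<partial>\<mu>) (\<integral>x. Es w x \<partial>\<mu>)"
proof (rule vec_eq_inner)
  fix c :: "complex^('m1 + 'm2)"
  have P: "(\<lambda>x. \<Phi> x *v a) \<in> L2" for a
    by (intro L2_on_continuous Phi_vec_cont)
  have cL: "(\<lambda>x. a) \<in> L2" for a :: "complex^'m2" by (intro L2_on_continuous continuous_intros)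
  have cL1: "(\<lambda>x. a) \<in> L2" for a :: "complex^'m1" by (intro L2_on_continuous continuous_intros)
  have gL: "(\<lambda>x. \<gamma> x *v c) \<in> L2" by (intro L2_on_continuous gamma_vec_cont)
  note wE = Es_L2[OF w]
  have "AE x in \<mu>. \<gamma> x *v c = E (\<lambda>t. \<Phi> t *v upr c + lwr c) x"
    using L2_bounded_op_add[OF E_bdd P[of "upr c"] cL[of "lwr c"]] E_Phi[of "upr c"] E_const[of "lwr c"]
  proof eventually_elim
    case (elim x)
    have "\<gamma> x *v vjoin (upr c) 0 + \<gamma> x *v vjoin 0 (lwr c) = \<gamma> x *v c"
      by (simp add: matrix_vector_right_distrib[symmetric] vjoin_add)
    then show ?case using elim by simp
  qed
  then have "ip (\<lambda>x. \<gamma> x *v c) w = ip (E (\<lambda>t. \<Phi> t *v upr c + lwr c)) w"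
    by (rule ip_cong) (use w gL in auto)
  also have "\<dots> = ip (\<lambda>t. \<Phi> t *v upr c + lwr c) (Es w)"
    by (rule E_adjoint[OF L2_on_add[OF P cL] w])
  also have "\<dots> = ip (\<lambda>t. \<Phi> t *v upr c) (Es w) + lwr c \<bullet> (\<integral>x. Es w x \<partial>\<mu>)"
    using wE P cL by (simp add: ip_add_left ip_const)
  also have "ip (\<lambda>t. \<Phi> t *v upr c) (Es w) = ip (T (\<lambda>t. upr c)) (Es w)"
    unfolding ip_def by (rule Bochner_Integration.integral_cong) (auto simp: T_const)
  also have "\<dots> = upr c \<bullet> (\<integral>x. Ts (Es w) x \<partial>\<mu>)"
    using kop_low_up[OF kernels(1) L2_integrable[OF cL1] L2_integrable[OF wE], of "upr c"] wE
    by (simp add: ip_const L2_intros)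
  finally have e: "ip (\<lambda>x. \<gamma> x *v c) w = upr c \<bullet> (\<integral>x. Ts (Es w) x \<partial>\<mu>) + lwr c \<bullet> (\<integral>x. Es w x \<partial>\<mu>)" .
  have "(\<integral>x. cadj (\<gamma> x) *v w x \<partial>\<mu>) \<bullet> c = (\<integral>x. (cadj (\<gamma> x) *v w x) \<bullet> c \<partial>\<mu>)"
    by (rule integral_inner_left[symmetric]) (use gamma_adj_integrable[OF w] in auto)
  also have "\<dots> = ip (\<lambda>x. \<gamma> x *v c) w"
  proof -
    have "(cadj (\<gamma> x) *v w x) \<bullet> c = (\<gamma> x *v c) \<bullet> w x" for x
      using inner_matrix_cadj[of "\<gamma> x" c "w x"] by (simp add: inner_commute)
    then show ?thesis by (simp add: ip_def)
  qed
  finally show "(\<integral>x. cadj (\<gamma> x) *v w x \<partial>\<mu>) \<bullet> c = vjoin (\<integral>x. Ts (Es w) x \<partial>\<mu>) (\<integral>x. Es w x \<partial>\<mu>) \<bullet> c"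
    by (simp add: e inner_blocks inner_commute)
qed

text \<open>The defect of the relation that composing S with the adjoint of E gives the inverse of
  E; the aim is to show that it vanishes.\<close>

definition Z :: "(real \<Rightarrow> complex^'m2) \<Rightarrow> real \<Rightarrow> complex^'m2" where
  "Z w x = S (Es w) x - R w x"

text \<open>
  \<open>b w w' = \<langle>S E\<^sup>* w, E\<^sup>* w'\<rangle> - \<langle>w, w'\<rangle>\<close>. The displacement identity for \<open>S\<close> and the identity for
  \<open>N + Ns\<close> have the same finite rank part, so it cancels and \<open>N\<close> is skew with respect to \<open>b\<close>.
\<close>

definition b :: "(real \<Rightarrow> complex^'m2) \<Rightarrow> (real \<Rightarrow> complex^'m2) \<Rightarrow> real" where
  "b w w' = ip (Z w) (Es w')"

lemma Z_L2: "w \<in> L2 \<Longrightarrow> Z w \<in> L2"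
  unfolding Z_def[abs_def] by (intro L2_intros S_L2)

lemma b_eq:
  assumes w: "w \<in> L2" and w': "w' \<in> L2"
  shows "b w w' = ip (Es w) (Es w') + ip (Ts (Es w)) (Ts (Es w')) - ip w w'"
proof -
  have "b w w' = ip (S (Es w)) (Es w') - ip (R w) (Es w')"
    unfolding b_def Z_def[abs_def] by (intro ip_diff_left L2_intros S_L2 w w')
  also have "ip (R w) (Es w') = ip (E (R w)) w'"
    by (rule E_adjoint[symmetric]) (use w w' R_L2 in auto)
  also have "\<dots> = ip w w'"
    by (rule ip_cong[OF E_R[OF w]]) (use w w' in \<open>auto intro!: L2_intros\<close>)
  finally show ?thesis using w w' by (simp add: S_adjoint(1) Es_L2)
qed

lemma b_skew:
  assumes w: "w \<in> L2" and w': "w' \<in> L2"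
  shows "b (N w) w' = - b w (N w')"
proof -
  define h h' where "h = Es w" and "h' = Es w'"
  have L: "h \<in> L2" "h' \<in> L2" "Ts h \<in> L2" "Ts h' \<in> L2" using w w' by (auto simp: h_def h'_def intro!: L2_intros)
  have TJ: "Ts (J g) x = J (Ts g) x" if "g \<in> L2" for g x
    by (rule convolution_commute[OF D_meas D_bound L2_integrable[OF that]])
  have TE: "Ts (Es (N g)) x = J (Ts (Es g)) x" if g: "g \<in> L2" for g x
  proof -
    have "Ts (Es (N g)) x = Ts (J (Es g)) x"
      by (rule kop_cong[OF Es_N[OF g] kernels(3)]) (use g in \<open>auto intro!: L2_integrable L2_intros\<close>)
    then show ?thesis using TJ[OF Es_L2[OF g]] by simp
  qed
  have 1: "b (N w) w' = ip (J h) h' + ip (J (Ts h)) (Ts h') - ip (N w) w'"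
  proof -
    have "ip (Es (N w)) (Es w') = ip (J h) h'"
      by (rule ip_cong) (use Es_N[OF w] w w' in \<open>auto simp: h_def h'_def intro!: L2_intros\<close>)
    then show ?thesis using w w' TE[OF w] by (simp add: b_eq L2_intros h_def h'_def ip_def)
  qed
  have 2: "b w (N w') = ip h (J h') + ip (Ts h) (J (Ts h')) - ip w (N w')"
  proof -
    have "ip (Es w) (Es (N w')) = ip h (J h')"
      by (rule ip_cong) (use Es_N[OF w'] w w' in \<open>auto simp: h_def h'_def intro!: L2_intros\<close>)
    then show ?thesis using w w' TE[OF w'] by (simp add: b_eq L2_intros h_def h'_def ip_def)
  qed
  \<comment> \<open>The two \<open>ip_unit\<close> identities, for h and for \<open>Ts h\<close>,
    produce the inner products of the two blocks of the vector in \<open>N_ip\<close>.\<close>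
  have "b (N w) w' + b w (N w') = 0"
    unfolding 1 2
    using ip_unit[OF L(1,2)] ip_unit[OF L(3,4)] N_ip[OF w w']
    by (simp add: integral_Es w w' inner_blocks h_def h'_def)
  then show ?thesis by simp
qed

end

section \<open>Vanishing of the defect\<close>

context dirac_kernels
begin

text \<open>Sends f to the integral of p(t - x) f(t) over t in [x, l]. Only the values of p on
  [0, l] enter, which is what lets the two sides of a transfer decouple.\<close>

definition Cp :: "(real \<Rightarrow> real) \<Rightarrow> (real \<Rightarrow> complex^'n::finite) \<Rightarrow> real \<Rightarrow> complex^'n" where
  "Cp p = kop (up (poly_kernel p))"

lemma Es_add: "f \<in> L2 \<Longrightarrow> g \<in> L2 \<Longrightarrow> Es (\<lambda>x. f x + g x) x = Es f x + Es g x"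
  by (simp add: Es_def kop_add borel_kernel_adjoint \<kappa> L2_integrable algebra_simps)

lemma Es_scaleR: "f \<in> L2 \<Longrightarrow> Es (\<lambda>x. c *\<^sub>R f x) x = c *\<^sub>R Es f x"
  by (simp add: Es_def kop_scaleR borel_kernel_adjoint \<kappa> L2_integrable algebra_simps)

lemma b_sym: "w \<in> L2 \<Longrightarrow> w' \<in> L2 \<Longrightarrow> b w w' = b w' w"
  by (simp add: b_eq ip_commute)

lemma b_add_right: "w \<in> L2 \<Longrightarrow> f \<in> L2 \<Longrightarrow> g \<in> L2 \<Longrightarrow> b w (\<lambda>x. f x + g x) = b w f + b w g"
proof -
  assume a: "w \<in> L2" "f \<in> L2" "g \<in> L2"
  have "Es (\<lambda>x. f x + g x) = (\<lambda>x. Es f x + Es g x)" by (intro ext Es_add a)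
  then show ?thesis by (simp add: b_def ip_add_right Z_L2 Es_L2 a)
qed

lemma b_scaleR_right: "w \<in> L2 \<Longrightarrow> f \<in> L2 \<Longrightarrow> b w (\<lambda>x. c *\<^sub>R f x) = c * b w f"
proof -
  assume a: "w \<in> L2" "f \<in> L2"
  have "Es (\<lambda>x. c *\<^sub>R f x) = (\<lambda>x. c *\<^sub>R Es f x)" by (intro ext Es_scaleR a)
  then show ?thesis by (simp add: b_def ip_scaleR_right)
qed

lemma b_add_left: "w \<in> L2 \<Longrightarrow> f \<in> L2 \<Longrightarrow> g \<in> L2 \<Longrightarrow> b (\<lambda>x. f x + g x) w = b f w + b g w"
  by (simp add: b_sym[of _ w] b_add_right L2_on_add)

lemma b_scaleR_left: "w \<in> L2 \<Longrightarrow> f \<in> L2 \<Longrightarrow> b (\<lambda>x. c *\<^sub>R f x) w = c * b f w"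
  by (simp add: b_sym[of _ w] b_scaleR_right L2_scaleR)

lemma Cp_L2: "continuous_on UNIV p \<Longrightarrow> f \<in> L2 \<Longrightarrow> Cp p f \<in> L2"
  unfolding Cp_def by (intro kop_L2' borel_kernel_up borel_kernel_poly)

lemma Cp_add:
  fixes f :: "real \<Rightarrow> complex^'n::finite"
  assumes "continuous_on UNIV p" "continuous_on UNIV q" and f: "f \<in> L2"
  shows "Cp (\<lambda>s. p s + q s) f x = Cp p f x + Cp q f x"
proof -
  have "up (poly_kernel (\<lambda>s. p s + q s)) x t *v f t = up (poly_kernel p) x t *v f t + up (poly_kernel q) x t *v f t" for t
    by (simp add: up_def low_def scaleR_add_left cadj_add matrix_vector_mult_add_rdistrib)
  then show ?thesis unfolding Cp_def kop_def
    by (simp add: kop_integrand[OF borel_kernel_up[OF borel_kernel_poly[OF assms(1)]] L2_integrable[OF f]]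
      kop_integrand[OF borel_kernel_up[OF borel_kernel_poly[OF assms(2)]] L2_integrable[OF f]])
qed

lemma Cp_scaleR: "Cp (\<lambda>s. c * p s) f x = c *\<^sub>R Cp p f x"
  using kop_up_scaleR[of c "poly_kernel p" f x] by (simp add: Cp_def)

lemma unit_Cp:
  fixes f :: "real \<Rightarrow> complex^'n::finite"
  assumes f: "integrable \<mu> f"
  shows "J (Cp (\<lambda>s. s ^ n) f) x = (1 / Suc n) *\<^sub>R Cp (\<lambda>s. s ^ Suc n) f x"
    "Cp (\<lambda>s. s ^ n) (J f) x = (1 / Suc n) *\<^sub>R Cp (\<lambda>s. s ^ Suc n) f x"
    "Cp (\<lambda>s. s ^ 0) f x = J f x"
  unfolding Cp_def using unit_poly_compose[OF f] by simp_all

text \<open>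
  \<open>w1\<close> and \<open>w2\<close> are obtained from \<open>w\<close> and \<open>w'\<close> by applying a polynomial in \<open>N\<close>, respectively
  in \<open>-N\<close>; the operator \<open>Es\<close> turns \<open>N\<close> into \<open>J\<close>, and the powers of \<open>J\<close> have polynomial kernels.
\<close>

definition transfers :: "(real \<Rightarrow> real) \<Rightarrow> bool" where
  "transfers p \<longleftrightarrow> (\<forall>w\<in>L2. \<forall>w'\<in>L2. \<exists>w1\<in>L2. \<exists>w2\<in>L2.
     (AE x in \<mu>. Es w1 x = Cp p (Es w) x) \<and> (AE x in \<mu>. Es w2 x = Cp (\<lambda>s. p (- s)) (Es w') x) \<and>
     b w1 w' = - b w w2)"

lemma transfers_add:
  assumes "transfers p" "transfers q" and c: "continuous_on UNIV p" "continuous_on UNIV q"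
  shows "transfers (\<lambda>s. p s + q s)"
  unfolding transfers_def
proof (intro ballI)
  fix w w' :: "real \<Rightarrow> complex^'m2" assume w: "w \<in> L2" "w' \<in> L2"
  obtain a1 a2 where a: "a1 \<in> L2" "a2 \<in> L2" "AE x in \<mu>. Es a1 x = Cp p (Es w) x"
    "AE x in \<mu>. Es a2 x = Cp (\<lambda>s. p (- s)) (Es w') x" "b a1 w' = - b w a2"
    using assms(1) w unfolding transfers_def by blast
  obtain b1 b2 where b: "b1 \<in> L2" "b2 \<in> L2" "AE x in \<mu>. Es b1 x = Cp q (Es w) x"
    "AE x in \<mu>. Es b2 x = Cp (\<lambda>s. q (- s)) (Es w') x" "b b1 w' = - b w b2"
    using assms(2) w unfolding transfers_def by blast
  have c': "continuous_on UNIV (\<lambda>s. p (- s))" "continuous_on UNIV (\<lambda>s. q (- s))"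
    by (rule continuous_on_compose2[OF c(1)] continuous_on_compose2[OF c(2)], auto intro!: continuous_intros)+
  show "\<exists>w1\<in>L2. \<exists>w2\<in>L2.
     (AE x in \<mu>. Es w1 x = Cp (\<lambda>s. p s + q s) (Es w) x) \<and> (AE x in \<mu>. Es w2 x = Cp (\<lambda>s. p (- s) + q (- s)) (Es w') x) \<and>
     b w1 w' = - b w w2"
  proof (intro bexI conjI)
    show "AE x in \<mu>. Es (\<lambda>x. a1 x + b1 x) x = Cp (\<lambda>s. p s + q s) (Es w) x"
      using a(3) b(3) by eventually_elim (simp add: Es_add a b Cp_add c Es_L2 w)
    show "AE x in \<mu>. Es (\<lambda>x. a2 x + b2 x) x = Cp (\<lambda>s. p (- s) + q (- s)) (Es w') x"
      using a(4) b(4) by eventually_elim (simp add: Es_add a b Cp_add c' Es_L2 w)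
    show "b (\<lambda>x. a1 x + b1 x) w' = - b w (\<lambda>x. a2 x + b2 x)"
      using a b w by (simp add: b_add_left b_add_right)
  qed (use a b in \<open>auto intro: L2_on_add\<close>)
qed

lemma transfers_scale:
  assumes "transfers p" shows "transfers (\<lambda>s. c * p s)"
  unfolding transfers_def
proof (intro ballI)
  fix w w' :: "real \<Rightarrow> complex^'m2" assume w: "w \<in> L2" "w' \<in> L2"
  obtain a1 a2 where a: "a1 \<in> L2" "a2 \<in> L2" "AE x in \<mu>. Es a1 x = Cp p (Es w) x"
    "AE x in \<mu>. Es a2 x = Cp (\<lambda>s. p (- s)) (Es w') x" "b a1 w' = - b w a2"
    using assms(1) w unfolding transfers_def by blast
  show "\<exists>w1\<in>L2. \<exists>w2\<in>L2.
     (AE x in \<mu>. Es w1 x = Cp (\<lambda>s. c * p s) (Es w) x) \<and> (AE x in \<mu>. Es w2 x = Cp (\<lambda>s. c * p (- s)) (Es w') x) \<and>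
     b w1 w' = - b w w2"
  proof (intro bexI conjI)
    show "AE x in \<mu>. Es (\<lambda>x. c *\<^sub>R a1 x) x = Cp (\<lambda>s. c * p s) (Es w) x"
      using a(3) by eventually_elim (simp only: Es_scaleR a Cp_scaleR)
    show "AE x in \<mu>. Es (\<lambda>x. c *\<^sub>R a2 x) x = Cp (\<lambda>s. c * p (- s)) (Es w') x"
      using a(4) by eventually_elim (simp only: Es_scaleR a Cp_scaleR)
    show "b (\<lambda>x. c *\<^sub>R a1 x) w' = - b w (\<lambda>x. c *\<^sub>R a2 x)"
      using a w by (simp add: b_scaleR_left b_scaleR_right)
  qed (use a in \<open>auto intro: L2_scaleR\<close>)
qed

text \<open>The power s^n stands for n! times the (n+1)st power of N, as convolution with 1 is
  already one integration. The induction step moves one more N across and enlarges w' to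
  \<open>N w'\<close>. Moving n + 1 factors gives (-1)^(n+1), which is the sign of (-s)^n together
  with the minus in \<open>transfers\<close>; the factor n + 1 undoes the division caused by
  integrating.\<close>

lemma transfers_power: "transfers (\<lambda>s. s ^ n)"
proof (induction n)
  case 0
  show ?case unfolding transfers_def
  proof (intro ballI)
    fix w w' :: "real \<Rightarrow> complex^'m2" assume w: "w \<in> L2" "w' \<in> L2"
    have "AE x in \<mu>. Es (N w) x = Cp (\<lambda>s. s ^ 0) (Es w) x" "AE x in \<mu>. Es (N w') x = Cp (\<lambda>s. (- s) ^ 0) (Es w') x"
      using Es_N[OF w(1)] Es_N[OF w(2)] by (simp_all add: unit_Cp(3)[OF L2_integrable[OF Es_L2]] w power_0[symmetric] del: power_0)
    moreover have "N w \<in> L2" "N w' \<in> L2" using w by (auto intro!: L2_intros)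
    ultimately show "\<exists>w1\<in>L2. \<exists>w2\<in>L2. (AE x in \<mu>. Es w1 x = Cp (\<lambda>s. s ^ 0) (Es w) x) \<and>
        (AE x in \<mu>. Es w2 x = Cp (\<lambda>s. (- s) ^ 0) (Es w') x) \<and> b w1 w' = - b w w2"
      using b_skew[OF w] by blast
  qed
next
  case (Suc n)
  show ?case unfolding transfers_def
  proof (intro ballI)
    fix w w' :: "real \<Rightarrow> complex^'m2" assume w: "w \<in> L2" "w' \<in> L2"
    have Nw: "N w' \<in> L2" using w by (auto intro!: L2_intros)
    obtain a1 a2 where a: "a1 \<in> L2" "a2 \<in> L2" "AE x in \<mu>. Es a1 x = Cp (\<lambda>s. s ^ n) (Es w) x"
      "AE x in \<mu>. Es a2 x = Cp (\<lambda>s. (- s) ^ n) (Es (N w')) x" "b a1 (N w') = - b w a2"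
      using Suc w Nw unfolding transfers_def by blast
    have Na: "N a1 \<in> L2" using a by (auto intro!: L2_intros)
    have pk: "borel_kernel (up (poly_kernel (\<lambda>s. s ^ n)))" by (intro borel_kernel_up borel_kernel_poly continuous_intros)
    have sign: "Cp (\<lambda>s. (- s) ^ m) f x = (- 1) ^ m *\<^sub>R Cp (\<lambda>s. s ^ m) f x" for m x and f :: "real \<Rightarrow> complex^'m2"
      using Cp_scaleR[of "(- 1) ^ m" "\<lambda>s. s ^ m" f x] by (simp add: power_mult_distrib[symmetric])
    show "\<exists>w1\<in>L2. \<exists>w2\<in>L2. (AE x in \<mu>. Es w1 x = Cp (\<lambda>s. s ^ Suc n) (Es w) x) \<and>
        (AE x in \<mu>. Es w2 x = Cp (\<lambda>s. (- s) ^ Suc n) (Es w') x) \<and> b w1 w' = - b w w2"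
    proof (intro bexI conjI)
      show "AE x in \<mu>. Es (\<lambda>x. real (Suc n) *\<^sub>R N a1 x) x = Cp (\<lambda>s. s ^ Suc n) (Es w) x"
        using Es_N[OF a(1)]
      proof eventually_elim
        case (elim x)
        have "J (Es a1) x = J (Cp (\<lambda>s. s ^ n) (Es w)) x"
          by (rule kop_cong[OF a(3) kernels(6)]) (use a w pk in \<open>auto intro!: L2_integrable Cp_L2 Es_L2 continuous_intros\<close>)
        also have "\<dots> = (1 / Suc n) *\<^sub>R Cp (\<lambda>s. s ^ Suc n) (Es w) x"
          by (rule unit_Cp(1)) (use w in \<open>auto intro!: L2_integrable Es_L2\<close>)
        finally show ?case using elim by (simp add: Es_scaleR[OF Na] del: power_Suc)
      qed
      show "AE x in \<mu>. Es (\<lambda>x. (- real (Suc n)) *\<^sub>R a2 x) x = Cp (\<lambda>s. (- s) ^ Suc n) (Es w') x"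
        using a(4)
      proof eventually_elim
        case (elim x)
        have "Cp (\<lambda>s. s ^ n) (Es (N w')) x = Cp (\<lambda>s. s ^ n) (J (Es w')) x"
          unfolding Cp_def by (rule kop_cong[OF Es_N[OF w(2)] pk]) (use Nw w in \<open>auto intro!: L2_integrable kop_L2' Es_L2 kernels\<close>)
        also have "\<dots> = (1 / Suc n) *\<^sub>R Cp (\<lambda>s. s ^ Suc n) (Es w') x"
          by (rule unit_Cp(2)) (use w in \<open>auto intro!: L2_integrable Es_L2\<close>)
        finally show ?case using elim unfolding Es_scaleR[OF a(2)] sign by (simp del: power_Suc) (simp add: field_simps)
      qed
      show "b (\<lambda>x. real (Suc n) *\<^sub>R N a1 x) w' = - b w (\<lambda>x. (- real (Suc n)) *\<^sub>R a2 x)"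
        unfolding b_scaleR_right[OF w(1) a(2)] b_scaleR_left[OF w(2) Na] b_skew[OF a(1) w(2)] a(5) by (simp add: algebra_simps)
    qed (use Na a in \<open>auto intro: L2_scaleR\<close>)
  qed
qed

lemma transfers_polynomial: "transfers (\<lambda>s. \<Sum>i\<le>n. a i * s ^ i)"
proof (induction n)
  case 0 show ?case using transfers_scale[OF transfers_power, of "a 0" 0] by simp
next
  case (Suc n)
  have "continuous_on UNIV (\<lambda>s. \<Sum>i\<le>n. a i * s ^ i)" "continuous_on UNIV (\<lambda>s. a (Suc n) * s ^ Suc n)"
    by (intro continuous_intros)+
  from transfers_add[OF Suc transfers_scale[OF transfers_power] this] show ?case by simp
qed

lemma ip_Cp_le:
  assumes p: "continuous_on UNIV p" and \<epsilon>: "\<And>s. 0 \<le> s \<Longrightarrow> s \<le> l \<Longrightarrow> \<bar>p s\<bar> \<le> \<epsilon>"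
    and f: "f \<in> L2" and g: "g \<in> (L2 :: (real \<Rightarrow> complex^'n::finite) set)"
  shows "\<bar>ip g (Cp p f)\<bar> \<le> \<epsilon> * ((\<integral>t. norm (f t) \<partial>\<mu>) * (\<integral>t. norm (g t) \<partial>\<mu>))"
proof -
  have "0 \<le> \<bar>p 0\<bar>" by simp
  also have "\<dots> \<le> \<epsilon>" using \<epsilon>[of 0] l_pos by simp
  finally have "0 \<le> \<epsilon>" .
  have bd: "norm (Cp p f x) \<le> \<epsilon> * (\<integral>t. norm (f t) \<partial>\<mu>)" for x
  proof -
    have i: "integrable \<mu> (\<lambda>t. up (poly_kernel p) x t *v f t)"
      by (intro kop_integrand borel_kernel_up borel_kernel_poly p L2_integrable f)
    have "norm (Cp p f x) \<le> (\<integral>t. norm (up (poly_kernel p) x t *v f t) \<partial>\<mu>)"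
      unfolding Cp_def kop_def by (rule integral_norm_bound)
    also have "\<dots> \<le> (\<integral>t. \<epsilon> * norm (f t) \<partial>\<mu>)"
    proof (intro integral_mono integrable_norm i integrable_mult_right L2_integrable f)
      fix t
      show "norm (up (poly_kernel p) x t *v f t) \<le> \<epsilon> * norm (f t)"
        using \<epsilon>[of "t - x"] \<open>0 \<le> \<epsilon>\<close>
        by (auto simp: up_def low_def linear_scale[OF linear_cadj] matrix_vector_mult_scaleR intro!: mult_right_mono)
    qed
    finally show ?thesis by simp
  qed
  have C: "Cp p f \<in> L2" by (intro Cp_L2 p f)
  have "\<bar>ip g (Cp p f)\<bar> \<le> (\<integral>x. norm (g x \<bullet> Cp p f x) \<partial>\<mu>)"
    unfolding ip_def using integral_norm_bound[of \<mu> "\<lambda>x. g x \<bullet> Cp p f x"] by simp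
  also have "\<dots> \<le> (\<integral>x. norm (g x) * (\<epsilon> * (\<integral>t. norm (f t) \<partial>\<mu>)) \<partial>\<mu>)"
  proof (intro integral_mono integrable_norm L2_on_inner_integrable g C integrable_mult_left L2_integrable)
    fix x show "norm (g x \<bullet> Cp p f x) \<le> norm (g x) * (\<epsilon> * (\<integral>t. norm (f t) \<partial>\<mu>))"
      using Cauchy_Schwarz_ineq2[of "g x" "Cp p f x"] mult_left_mono[OF bd[of x] norm_ge_zero[of "g x"]] by simp
  qed
  finally show ?thesis by (simp add: mult_ac)
qed

text \<open>The function max (- s) 0 vanishes on [0, l], while its reflection is s there, the kernel
  of two integrations. Transferring a polynomial \<epsilon>-close to it leaves an error of order
  \<epsilon> on one side and the inner product in question, up to \<epsilon>, on the other. A jump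
  at 0 could not be approximated uniformly, hence two integrations instead of one.\<close>

lemma Z_JJ:
  assumes w: "w \<in> L2" and w': "w' \<in> L2"
  shows "ip (Z w) (J (J (Es w'))) = 0"
proof -
  define c where "c = (\<integral>t. norm (Es w t) \<partial>\<mu>) * (\<integral>t. norm (Z w' t) \<partial>\<mu>) + (\<integral>t. norm (Es w' t) \<partial>\<mu>) * (\<integral>t. norm (Z w t) \<partial>\<mu>)"
  note L = Es_L2[OF w] Es_L2[OF w'] Z_L2[OF w] Z_L2[OF w']
  have JJ: "J (J (Es w')) = Cp (\<lambda>s. s) (Es w')"
    using unit_Cp(1)[OF L2_integrable[OF L(2)], of 0] unfolding Cp_def by (intro ext) simp
  have "\<bar>ip (Z w) (Cp (\<lambda>s. s) (Es w'))\<bar> \<le> \<epsilon> * c" if \<epsilon>: "0 < \<epsilon>" for \<epsilon>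
  proof -
    obtain p where p: "real_polynomial_function p" and pe: "\<And>s. s \<in> {- l..l} \<Longrightarrow> \<bar>max (- s) 0 - p s\<bar> < \<epsilon>"
    proof (rule Stone_Weierstrass_real_polynomial_function[of "{- l..l}" "\<lambda>s. max (- s) 0" \<epsilon>])
      show "continuous_on {- l..l} (\<lambda>s. max (- s) (0::real))" by (intro continuous_intros)
    qed (use that \<epsilon> in auto)
    obtain a n where p_eq: "p = (\<lambda>s. \<Sum>i\<le>n. a i * s ^ i)" using p unfolding real_polynomial_function_iff_sum by blast
    have pc: "continuous_on UNIV p" "continuous_on UNIV (\<lambda>s. p (- s))" "continuous_on UNIV (\<lambda>s. s - p (- s))"
      unfolding p_eq by (intro continuous_intros)+
    have "transfers p" unfolding p_eq by (rule transfers_polynomial)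
    then obtain w1 w2 where t: "w1 \<in> L2" "w2 \<in> L2" "AE x in \<mu>. Es w1 x = Cp p (Es w) x"
      "AE x in \<mu>. Es w2 x = Cp (\<lambda>s. p (- s)) (Es w') x" "b w1 w' = - b w w2"
      using w w' unfolding transfers_def by blast
    have b1: "b w1 w' = ip (Z w') (Cp p (Es w))"
      unfolding b_sym[OF t(1) w'] unfolding b_def by (rule ip_cong) (use t L in \<open>auto intro: Es_L2\<close>)
    have b2: "b w w2 = ip (Z w) (Cp (\<lambda>s. p (- s)) (Es w'))"
      unfolding b_def by (rule ip_cong) (use t L in \<open>auto intro: Es_L2\<close>)
    have "ip (Z w) (Cp (\<lambda>s. s) (Es w')) = ip (Z w) (\<lambda>x. Cp (\<lambda>s. p (- s)) (Es w') x + Cp (\<lambda>s. s - p (- s)) (Es w') x)"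
      using Cp_add[OF pc(2,3) L(2)] by (simp flip: Cp_add[OF pc(2,3) L(2)])
    also have "\<dots> = b w w2 + ip (Z w) (Cp (\<lambda>s. s - p (- s)) (Es w'))"
      unfolding b2 by (intro ip_add_right Cp_L2 pc L)
    also have "b w w2 = - ip (Z w') (Cp p (Es w))" using t(5) b1 by simp
    finally have e: "ip (Z w) (Cp (\<lambda>s. s) (Es w')) = ip (Z w) (Cp (\<lambda>s. s - p (- s)) (Es w')) - ip (Z w') (Cp p (Es w))" by simp
    have "\<bar>p s\<bar> \<le> \<epsilon>" "\<bar>s - p (- s)\<bar> \<le> \<epsilon>" if "0 \<le> s" "s \<le> l" for s
      using pe[of s] pe[of "- s"] that by auto
    then have "\<bar>ip (Z w') (Cp p (Es w))\<bar> \<le> \<epsilon> * ((\<integral>t. norm (Es w t) \<partial>\<mu>) * (\<integral>t. norm (Z w' t) \<partial>\<mu>))"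
      "\<bar>ip (Z w) (Cp (\<lambda>s. s - p (- s)) (Es w'))\<bar> \<le> \<epsilon> * ((\<integral>t. norm (Es w' t) \<partial>\<mu>) * (\<integral>t. norm (Z w t) \<partial>\<mu>))"
      by (intro ip_Cp_le pc L; auto)+
    then show ?thesis unfolding e c_def by (simp add: distrib_left)
  qed
  note le = this
  have "\<bar>ip (Z w) (Cp (\<lambda>s. s) (Es w'))\<bar> \<le> 0" (is "?X \<le> 0")
  proof (rule ccontr)
    assume "\<not> ?thesis"
    then have X: "0 < ?X" by simp
    then have "0 < c" using le[of 1] by simp
    \<comment> \<open>The choice of \<epsilon> makes the bound half of the quantity itself, which is
      impossible for a positive one.\<close>
    then have "?X \<le> ?X / (2 * c) * c" using X by (intro le) simp
    then show False using X \<open>0 < c\<close> by simp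
  qed
  then show ?thesis by (simp add: JJ)
qed

lemma I0_injective:
  assumes g: "g \<in> (L2 :: (real \<Rightarrow> complex^'n::finite) set)" and z: "AE x in \<mu>. I0 g x = 0"
  shows "AE x in \<mu>. g x = 0"
proof (rule integral_zero_imp_AE_zero[OF L2_integrable[OF g]])
  have c: "continuous_on {0..l} (\<lambda>x. integral {0..x} g)"
    by (rule indefinite_integral_continuous_1) (rule lint_eq_integral(2)[OF L2_integrable[OF g]], simp)
  have ae: "AE x in \<mu>. norm (integral {0..x} g) \<le> 0"
    using z AE_mem by eventually_elim (simp add: kop_unit(1)[OF L2_integrable[OF g]])
  show "integral {0..x} g = 0" if "x \<in> {0..l}" for x
    using continuous_AE_le[OF l_pos continuous_on_norm[OF c] continuous_on_const ae that] by simp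
qed

lemma E_injective:
  assumes f: "f \<in> L2" and z: "AE x in \<mu>. E f x = 0"
  shows "AE x in \<mu>. f x = 0"
proof -
  have 0: "(\<lambda>x. 0) \<in> (L2 :: (real \<Rightarrow> complex^'m2) set)" by (intro L2_on_continuous continuous_intros)
  have "AE x in \<mu>. R (E f) x = R (\<lambda>x. 0) x"
    by (rule L2_bounded_op_cong[OF R_bdd E_L2[OF f] 0 z])
  moreover have "AE x in \<mu>. R (\<lambda>x. 0) x = 0" using L2_bounded_op_cmult[OF R_bdd 0, of 0] by simp
  ultimately show ?thesis using R_E[OF f] by eventually_elim simp
qed

text \<open>The similarity turns \<open>Ns\<close> into integration, which is injective.\<close>

lemma Ns_injective:
  assumes g: "g \<in> L2" and z: "AE x in \<mu>. Ns g x = 0"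
  shows "AE x in \<mu>. g x = 0"
proof -
  have Rg: "R g \<in> L2" by (rule R_L2[OF g])
  have "AE x in \<mu>. E (I0 (R g)) x = 0"
    using Ns_E[OF Rg] z
  proof eventually_elim
    case (elim x)
    have "Ns (E (R g)) x = Ns g x"
      by (rule kop_cong[OF E_R[OF g] kernels(2)]) (use g Rg in \<open>auto intro!: L2_integrable E_L2\<close>)
    then show ?case using elim by simp
  qed
  then have "AE x in \<mu>. I0 (R g) x = 0"
    by (rule E_injective[rotated]) (use Rg in \<open>auto intro!: L2_intros\<close>)
  then have "AE x in \<mu>. R g x = 0" by (rule I0_injective[OF Rg])
  then have 1: "AE x in \<mu>. E (R g) x = E (\<lambda>x. 0) x"
    by (intro L2_bounded_op_cong[OF E_bdd Rg]) (auto intro!: L2_on_continuous continuous_intros)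
  have "AE x in \<mu>. E (\<lambda>x. 0) x = 0"
    by (rule AE_I2) (simp add: volterra_op_def)
  with 1 E_R[OF g] show ?thesis by eventually_elim simp
qed

text \<open>Moving the two integrations and E back by adjunction, \<open>Z_JJ\<close> says that E
  applied to the second primitive of the defect is orthogonal to everything. Injectivity of E and of
  integration, used twice, removes them again.\<close>

lemma S_Es:
  assumes w: "w \<in> L2" shows "AE x in \<mu>. S (Es w) x = R w x"
proof -
  define y where "y = I0 (I0 (Z w))"
  have y: "y \<in> L2" unfolding y_def by (intro L2_intros Z_L2 w)
  have "ip (E y) h = 0" if h: "h \<in> L2" for h
  proof -
    have "ip (E y) h = ip y (Es h)" by (rule E_adjoint[OF y h])
    also have "\<dots> = ip (Z w) (J (J (Es h)))"
      unfolding y_def using w h by (simp add: kop_low_up[OF kernels(5)] L2_integrable L2_intros Z_L2)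
    also have "\<dots> = 0" by (rule Z_JJ[OF w h])
    finally show ?thesis .
  qed
  then have "AE x in \<mu>. E y x = 0" using ip_eq_0[OF E_L2[OF y]] E_L2[OF y] by blast
  then have "AE x in \<mu>. y x = 0" by (rule E_injective[OF y])
  then have "AE x in \<mu>. I0 (Z w) x = 0"
    unfolding y_def by (rule I0_injective[rotated]) (intro L2_intros Z_L2 w)
  then have "AE x in \<mu>. Z w x = 0" by (rule I0_injective[OF Z_L2[OF w]])
  then show ?thesis by eventually_elim (simp add: Z_def)
qed

text \<open>The first identity is \<open>S_Es\<close> with w = E f. The second is its adjoint,
  because S and the composition of E with its adjoint are both symmetric.\<close>

lemma S_inverse:
  assumes f: "f \<in> L2"
  shows "AE x in \<mu>. S (Es (E f)) x = f x" "AE x in \<mu>. Es (E (S f)) x = f x"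
proof -
  have 1: "AE x in \<mu>. S (Es (E f)) x = f x" if f: "f \<in> L2" for f
    using S_Es[OF E_L2[OF f]] R_E[OF f] by eventually_elim simp
  show "AE x in \<mu>. S (Es (E f)) x = f x" by (rule 1[OF f])
  show "AE x in \<mu>. Es (E (S f)) x = f x"
  proof (rule ip_eq_AE)
    fix g :: "real \<Rightarrow> complex^'m2" assume g: "g \<in> L2"
    note L = S_L2[OF f] E_L2[OF S_L2[OF f]] E_L2[OF g] Es_L2[OF E_L2[OF g]]
    have "ip (Es (E (S f))) g = ip (E (S f)) (E g)"
      using E_adjoint[OF g L(2)] by (simp add: ip_commute)
    also have "\<dots> = ip (S f) (Es (E g))" by (rule E_adjoint[OF L(1,3)])
    also have "\<dots> = ip f (S (Es (E g)))" by (rule S_adjoint(2)[OF f L(4)])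
    also have "\<dots> = ip f g" by (rule ip_cong) (use 1[OF g] f L in \<open>auto intro: S_L2\<close>)
    finally show "ip (Es (E (S f))) g = ip f g" .
  qed (use f in \<open>auto intro!: L2_intros S_L2\<close>)
qed

end

section \<open>The inverse of the truncated operator and the formula for \<beta>\<close>

lemma L2_bounded_op_transfer:
  fixes T U :: "'n::finite oper"
  assumes T: "L2_bounded_op l T" and eq: "\<And>f. f \<in> L2_on {0..l} \<Longrightarrow> AE x in Leb l. T f x = U f x"
  shows "L2_bounded_op l U"
proof -
  obtain C where C: "\<And>f. f \<in> L2_on {0..l} \<Longrightarrow> L2_norm_on {0..l} (T f) \<le> C * L2_norm_on {0..l} f"
    using T unfolding L2_bounded_op_def by blast
  have L: "U f \<in> L2_on {0..l}" if "f \<in> L2_on {0..l}" for f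
    by (rule L2_on_cong_AE[OF L2_bounded_op_L2[OF T that] eq[OF that]]) simp
  have n: "L2_norm_on {0..l} (U f) = L2_norm_on {0..l} (T f)" if f: "f \<in> L2_on {0..l}" for f
    unfolding L2_norm_on_def
    using L2_onD(2)[OF L[OF f]] L2_onD(2)[OF L2_bounded_op_L2[OF T f]] eq[OF f]
    by (auto intro!: arg_cong[where f = sqrt] integral_cong_AE elim: eventually_mono)
  show ?thesis
    unfolding L2_bounded_op_def
  proof (intro conjI ballI allI exI[of _ C])
    fix f g :: "real \<Rightarrow> complex^'n" and c assume f: "f \<in> L2_on {0..l}" and g: "g \<in> L2_on {0..l}"
    show "AE x in Leb l. U (\<lambda>t. f t + g t) x = U f x + U g x"
      using L2_bounded_op_add[OF T f g] eq[OF L2_on_add[OF f g]] eq[OF f] eq[OF g] by eventually_elim simp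
    show "AE x in Leb l. U (\<lambda>t. c *s f t) x = c *s U f x"
      using L2_bounded_op_cmult[OF T f, of c] eq[OF L2_on_cmult[OF f, of c]] eq[OF f] by eventually_elim simp
  next
    fix f :: "real \<Rightarrow> complex^'n" assume f: "f \<in> L2_on {0..l}"
    show "U f \<in> L2_on {0..l}" by (rule L[OF f])
    show "L2_norm_on {0..l} (U f) \<le> C * L2_norm_on {0..l} f" unfolding n[OF f] by (rule C[OF f])
  qed
qed

text \<open>A reflection maps null sets to null sets. It is needed because \<open>s_kernel\<close>
  evaluates the derivative at x - \<zeta> and t - \<zeta>.\<close>

lemma AE_lebesgue_reflect:
  assumes "AE y in lebesgue. P y" shows "AE x in lebesgue. P (a - x :: real)"
proof -
  have "negligible {y. \<not> P y}"
    using assms by (simp add: eventually_ae_filter_negligible) (meson negligible_subset)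
  then have "negligible ((\<lambda>y. a - y) ` {y. \<not> P y})"
    by (rule negligible_differentiable_image_negligible[OF order_refl]) (intro derivative_intros)
  moreover have "{x. \<not> P (a - x)} \<subseteq> (\<lambda>y. a - y) ` {y. \<not> P y}"
    by (auto intro: image_eqI[of _ _ "a - _"])
  ultimately have "negligible {x. \<not> P (a - x)}" by (rule negligible_subset)
  then show ?thesis
    by (auto simp: eventually_ae_filter_negligible)
qed

context dirac_kernels
begin

lemma S_bounded: "L2_bounded_op l S"
proof -
  define \<sigma> where "\<sigma> x t = (\<integral>s. low (\<lambda>x t. D (x - t)) x s ** up (\<lambda>x t. D (x - t)) s t \<partial>\<mu>)" for x t
  have "L2_bounded_op l (\<lambda>f x. f x + kop \<sigma> f x)"
    unfolding \<sigma>_def by (rule L2_bounded_op_id_plus_kop[OF borel_kernel_compose[OF kernels(1,3)]]) (use l_pos in simp)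
  then show ?thesis
    by (rule L2_bounded_op_transfer) (simp add: S_def \<sigma>_def[abs_def] kop_compose kernels L2_integrable)
qed

lemma EsE_bounded: "L2_bounded_op l (\<lambda>f. Es (E f))"
proof (rule L2_bounded_op_compose[OF _ E_bdd])
  show "L2_bounded_op l Es"
    using L2_bounded_op_id_plus_kop[OF borel_kernel_adjoint[OF \<kappa>]] l_pos unfolding Es_def[abs_def] by simp
qed

lemma cadj_measurable: "cadj \<in> borel_measurable borel"
  by (intro borel_measurable_continuous_onI linear_continuous_on bounded_linear_cadj)

text \<open>For fixed x and t, replacing the Borel representative by the actual derivative changes
  the integrand only on a null set of \<zeta>, so the kernels agree at every point of the
  square.\<close>

lemma S_kernel:
  assumes D_eq: "AE x in \<mu>. D x = vector_derivative \<Phi> (at x)"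
    and x: "x \<in> {0..l}" and f: "f \<in> L2"
  shows "T (Ts f) x = (LINT t:{0..l}|lebesgue. s_kernel \<Phi> x t *v f t)"
proof -
  have "(\<integral>s. low (\<lambda>x t. D (x - t)) x s ** up (\<lambda>x t. D (x - t)) s t \<partial>\<mu>) = s_kernel \<Phi> x t" if t: "t \<in> {0..l}" for t
  proof -
    have "AE y in lebesgue. y \<in> {0..l} \<longrightarrow> D y = vector_derivative \<Phi> (at y)"
      using D_eq by (subst (asm) AE_restrict_space_iff) auto
    then have r: "AE s in lebesgue. (y - s) \<in> {0..l} \<longrightarrow> D (y - s) = vector_derivative \<Phi> (at (y - s))" for y
      by (rule AE_lebesgue_reflect)
    have ae: "AE s in lebesgue. indicat_real {0..min x t} s *\<^sub>R (D (x - s) ** cadj (D (t - s))) =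
        indicat_real {0..min x t} s *\<^sub>R (vector_derivative \<Phi> (at (x - s)) ** cadj (vector_derivative \<Phi> (at (t - s))))"
      using r[of x] r[of t] by eventually_elim (use x t in \<open>auto simp: indicator_def\<close>)
    have "(\<lambda>s. indicat_real {0..min x t} s *\<^sub>R (D (x - s) ** cadj (D (t - s)))) \<in> borel_measurable borel"
      by (intro borel_measurable_scaleR borel_measurable_indicator measurable_matrix_matrix
        measurable_compose[OF _ D_meas] measurable_compose[OF _ cadj_measurable]) measurable
    then have m: "(\<lambda>s. indicat_real {0..min x t} s *\<^sub>R (D (x - s) ** cadj (D (t - s)))) \<in> borel_measurable lebesgue"
      by (intro measurable_completion) simp
    have m': "(\<lambda>s. indicat_real {0..min x t} s *\<^sub>R (vector_derivative \<Phi> (at (x - s)) ** cadj (vector_derivative \<Phi> (at (t - s))))) \<in> borel_measurable lebesgue"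
      by (rule borel_measurable_lebesgue_on_AE[where S = UNIV, unfolded lebesgue_on_UNIV_eq, OF m ae]) simp
    have "(\<integral>s. low (\<lambda>x t. D (x - t)) x s ** up (\<lambda>x t. D (x - t)) s t \<partial>\<mu>) =
       (\<integral>s. indicat_real {0..min x t} s *\<^sub>R (D (x - s) ** cadj (D (t - s))) \<partial>lebesgue)"
      by (subst integral_restrict_space)
        (use x t in \<open>auto intro!: Bochner_Integration.integral_cong simp: low_def up_def indicator_def\<close>)
    also have "\<dots> = s_kernel \<Phi> x t"
      unfolding s_kernel_def set_lebesgue_integral_def by (rule integral_cong_AE[OF m m' ae])
    finally show ?thesis .
  qed
  then show ?thesis
    unfolding kop_compose[OF kernels(1,3) L2_integrable[OF f]]
    unfolding kop_def set_lebesgue_integral_def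
    by (subst integral_restrict_space) (auto intro!: Bochner_Integration.integral_cong simp: indicator_def)
qed

text \<open>The kernel s(x,t) does not involve the interval length, so truncating the operator of
  [0, L] gives the operator of [0, l]. Its inverse can thus be built from the E of the short
  interval.\<close>

lemma S_sub_eq:
  assumes D_eq: "AE x in \<mu>. D x = vector_derivative \<Phi> (at x)" and f: "f \<in> L2" and L: "l \<le> L"
  shows "AE x in \<mu>. S f x = S_sub L \<Phi> l f x"
  using AE_mem
proof eventually_elim
  case (elim x)
  have "(LINT t:{0..L}|lebesgue. s_kernel \<Phi> x t *v cut l f t) = (LINT t:{0..l}|lebesgue. s_kernel \<Phi> x t *v f t)"
    unfolding set_lebesgue_integral_def
    by (rule Bochner_Integration.integral_cong) (use L in \<open>auto simp: cut_def indicator_def\<close>)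
  then show ?case
    using S_kernel[OF D_eq elim f] elim by (simp add: S_def S_sub_def S_op_def cut_def[of l "S_op _ _ _"] cut_def[of l f x])
qed

lemma S_sub_inverse:
  assumes D_eq: "AE x in \<mu>. D x = vector_derivative \<Phi> (at x)" and L: "l \<le> L"
  shows "L2_inverse l (S_sub L \<Phi> l) (\<lambda>f. Es (E f))"
  unfolding L2_inverse_def
proof (intro conjI ballI)
  note eq = S_sub_eq[OF D_eq _ L]
  show b: "L2_bounded_op l (S_sub L \<Phi> l)" by (rule L2_bounded_op_transfer[OF S_bounded eq])
  show "L2_bounded_op l (\<lambda>f. Es (E f))" by (rule EsE_bounded)
  fix f :: "real \<Rightarrow> complex^'m2" assume f: "f \<in> L2"
  have "Es (E f) \<in> L2" using f by (intro L2_intros)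
  from eq[OF this] S_inverse(1)[OF f]
  show "AE x in \<mu>. S_sub L \<Phi> l (Es (E f)) x = f x" by eventually_elim simp
  have "AE x in \<mu>. Es (E (S f)) x = Es (E (S_sub L \<Phi> l f)) x"
    by (rule L2_bounded_op_cong[OF EsE_bounded S_L2[OF f] L2_bounded_op_L2[OF b f] eq[OF f]])
  with S_inverse(2)[OF f] show "AE x in \<mu>. Es (E (S_sub L \<Phi> l f)) x = f x" by eventually_elim simp
qed

lemma beta_gamma_adj:
  assumes "0 \<le> x" shows "\<beta> x *v (cadj (\<gamma> x) *v y) = 0"
proof -
  have "cadj (\<gamma> x) *v y = cadj (u x 0) *v vjoin 0 y"
  proof (rule vec_eq_inner)
    fix d
    have "(cadj (\<gamma> x) *v y) \<bullet> d = y \<bullet> (\<gamma> x *v d)" using inner_matrix_cadj[of "cadj (\<gamma> x)" y d] by simp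
    also have "\<dots> = vjoin 0 y \<bullet> (u x 0 *v d)" by (simp add: gamma_of_vec inner_blocks)
    also have "\<dots> = (cadj (u x 0) *v vjoin 0 y) \<bullet> d" using inner_matrix_cadj[of "cadj (u x 0)" "vjoin 0 y" d] by simp
    finally show "(cadj (\<gamma> x) *v y) \<bullet> d = (cadj (u x 0) *v vjoin 0 y) \<bullet> d" .
  qed
  moreover have "u x 0 *v (cadj (u x 0) *v w) = w" for w
    using u_inverse(2)[OF assms, of 0] by (simp add: matrix_vector_mul_assoc)
  ultimately show ?thesis by (simp add: beta_of_vec)
qed

lemma v_adj_L2: "(\<lambda>x. cadj (v x) *v c) \<in> L2"
proof (rule L2_on_bounded)
  have "v \<in> borel_measurable \<mu>" by (rule measurable_restrict_mono[OF v_meas]) auto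
  then have "(\<lambda>x. cadj (v x)) \<in> borel_measurable \<mu>" by (rule measurable_compose[OF _ cadj_measurable])
  then show "(\<lambda>x. cadj (v x) *v c) \<in> borel_measurable \<mu>" by (intro measurable_matrix_vector) auto
  show "AE x in \<mu>. norm (cadj (v x) *v c) \<le> M * norm c"
    using AE_mem by eventually_elim (simp add: norm_v_adj_vec)
qed simp

lemma beta_difference:
  assumes x: "x \<in> {0..l}"
  shows "((\<lambda>t. c \<bullet> (v t *v (\<gamma> t *v d))) has_integral (c \<bullet> (\<beta> x *v d) - c \<bullet> (\<beta> 0 *v d))) {0..x}"
proof -
  have "((\<lambda>t. upr (rhs 0 t (u t 0 *v d))) has_integral (upr (u x 0 *v d) - upr (u 0 0 *v d))) {0..x}"
    by (rule has_ae_deriv_integral[OF upr_deriv[of x]]) (use x in auto)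
  then have "((\<lambda>t. v t *v (\<gamma> t *v d)) has_integral (\<beta> x *v d - \<beta> 0 *v d)) {0..x}"
    by (simp add: beta_of_vec gamma_of_vec)
  from has_integral_linear[OF this bounded_linear_inner_right[of c]] show ?thesis
    by (simp add: o_def inner_diff_right)
qed

text \<open>As \<beta>' = v \<gamma>, the inner integral is the adjoint of \<beta>(x) - \<beta>(0)
  applied to c. Multiplication by \<gamma>(x) kills the part with \<beta>(x) by orthogonality and
  leaves the initial value.\<close>

lemma Ns_v:
  assumes x: "x \<in> {0..l}" shows "Ns (\<lambda>t. cadj (v t) *v c) x = - (\<gamma> x *v vjoin c 0)"
proof (rule vec_eq_inner)
  fix y
  define d where "d = cadj (\<gamma> x) *v y"
  define f where "f t = cadj (\<gamma> t) *v (cadj (v t) *v c)" for t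
  have f: "integrable \<mu> f" unfolding f_def by (rule gamma_adj_integrable[OF v_adj_L2])
  have "(\<gamma> x *v w) \<bullet> y = w \<bullet> d" for w by (simp add: d_def inner_matrix_cadj)
  then have "Ns (\<lambda>t. cadj (v t) *v c) x \<bullet> y = integral {0..x} f \<bullet> d"
    unfolding N_unit(1)[OF v_adj_L2 x] f_def[symmetric] kop_unit(1)[OF f x] .
  also have "\<dots> = integral {0..x} (\<lambda>t. f t \<bullet> d)"
    using integral_linear[OF lint_eq_integral(2)[OF f, of x] bounded_linear_inner_left[of d]] x by (simp add: o_def)
  also have "(\<lambda>t. f t \<bullet> d) = (\<lambda>t. c \<bullet> (v t *v (\<gamma> t *v d)))"
    by (simp add: f_def inner_matrix_cadj)
  also have "integral {0..x} \<dots> = c \<bullet> (\<beta> x *v d) - c \<bullet> (\<beta> 0 *v d)"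
    by (rule integral_unique[OF beta_difference[OF x]])
  also have "\<beta> x *v d = 0" unfolding d_def by (rule beta_gamma_adj) (use x in simp)
  also have "\<beta> 0 *v d = upr d" by (simp add: beta_of_vec)
  also have "c \<bullet> upr d = (\<gamma> x *v vjoin c 0) \<bullet> y" by (simp add: d_def inner_matrix_cadj inner_blocks)
  finally show "Ns (\<lambda>t. cadj (v t) *v c) x \<bullet> y = - (\<gamma> x *v vjoin c 0) \<bullet> y" by simp
qed

lemma D_L2: "(\<lambda>t. D t *v c) \<in> L2"
proof -
  have "D \<in> L2_on {0..l}"
    by (rule L2_on_bounded[where B = C]) (use D_meas D_bound in \<open>auto intro!: measurable_restrict_space1 measurable_completion\<close>)
  then show ?thesis
    by (rule L2_on_bounded_linear[OF bounded_bilinear.bounded_linear_left[OF bounded_bilinear_matrix_vector]])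
qed

text \<open>The primitive of the derivative is \<Phi>, and E \<Phi> = \<gamma>1. Through the
  similarity, \<open>Ns\<close> maps E D c to \<gamma>1 c, and by \<open>Ns_v\<close> it maps the
  adjoint of v applied to c to the negative of this; \<open>Ns\<close> is injective.\<close>

lemma E_D: "AE x in \<mu>. E (\<lambda>t. D t *v c) x = - (cadj (v x) *v c)"
proof -
  define f where "f = (\<lambda>t. D t *v c)"
  have f: "f \<in> L2" unfolding f_def by (rule D_L2)
  have P: "(\<lambda>x. \<Phi> x *v c) \<in> L2"
    by (intro L2_on_continuous Phi_vec_cont)
  have "AE x in \<mu>. I0 f x = \<Phi> x *v c"
    using AE_mem
  proof eventually_elim
    case (elim x)
    have "(D has_integral \<Phi> x) {0..x}"
      using has_ae_deriv_integral[OF D_deriv, of 0 x] elim by (simp add: Phi_0)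
    from has_integral_linear[OF this bounded_bilinear.bounded_linear_left[OF bounded_bilinear_matrix_vector, of c]]
    have "integral {0..x} f = \<Phi> x *v c" by (simp add: o_def f_def integral_unique)
    then show ?case by (simp add: kop_unit(1)[OF L2_integrable[OF f] elim])
  qed
  then have "AE x in \<mu>. E (I0 f) x = E (\<lambda>x. \<Phi> x *v c) x"
    by (rule L2_bounded_op_cong[OF E_bdd _ P, rotated]) (intro L2_intros f)
  then have "AE x in \<mu>. Ns (\<lambda>x. E f x + cadj (v x) *v c) x = 0"
    using Ns_E[OF f] E_Phi[of c] AE_mem
  proof eventually_elim
    case (elim x)
    have "Ns (\<lambda>x. E f x + cadj (v x) *v c) x = Ns (E f) x + Ns (\<lambda>x. cadj (v x) *v c) x"
      by (intro kop_add kernels L2_integrable E_L2 f v_adj_L2)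
    then show ?case using elim Ns_v[of x c] by simp
  qed
  then have "AE x in \<mu>. E f x + cadj (v x) *v c = 0"
    by (rule Ns_injective[rotated]) (intro L2_on_add E_L2 f v_adj_L2)
  then show ?thesis unfolding f_def by eventually_elim (simp add: add_eq_0_iff2)
qed

lemma colwise_vec:
  fixes F :: "real \<Rightarrow> complex^'q::finite^'m2"
  assumes U: "L2_bounded_op l U" and F: "\<And>j. (\<lambda>t. column j (F t)) \<in> L2"
    and G: "(\<lambda>t. G t *v c) \<in> L2" and eq: "AE x in \<mu>. F x = G x"
  shows "AE x in \<mu>. colwise U F x *v c = U (\<lambda>t. G t *v c) x"
proof -
  have 1: "AE x in \<mu>. U (\<lambda>t. \<Sum>j\<in>UNIV. c $ j *s column j (F t)) x = (\<Sum>j\<in>UNIV. U (\<lambda>t. c $ j *s column j (F t)) x)"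
    by (rule L2_bounded_op_sum[OF U L2_on_cmult[OF F]]) simp
  have 2: "AE x in \<mu>. \<forall>j\<in>UNIV. U (\<lambda>t. c $ j *s column j (F t)) x = c $ j *s U (\<lambda>t. column j (F t)) x"
    by (rule AE_finite_allI) (auto intro: L2_bounded_op_cmult[OF U F])
  have "(\<lambda>t. F t *v c) \<in> L2"
    by (rule L2_on_cong_AE[OF G]) (use eq in \<open>auto elim: eventually_mono\<close>)
  then have 3: "AE x in \<mu>. U (\<lambda>t. F t *v c) x = U (\<lambda>t. G t *v c) x"
    by (rule L2_bounded_op_cong[OF U _ G]) (use eq in \<open>eventually_elim, simp\<close>)
  show ?thesis
    using 1 2 3
  proof eventually_elim
    case (elim x)
    have col: "column j (colwise U F x) = U (\<lambda>t. column j (F t)) x" for j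
      by (simp add: colwise_def column_def vec_eq_iff)
    have "colwise U F x *v c = (\<Sum>j\<in>UNIV. c $ j *s U (\<lambda>t. column j (F t)) x)"
      unfolding matrix_vec_columns[of "colwise U F x"] col ..
    also have "\<dots> = U (\<lambda>t. F t *v c) x"
      unfolding matrix_vec_columns[of "F _"] using elim by simp
    finally show ?case using elim by simp
  qed
qed

text \<open>The inverse of S is E followed by its adjoint, so pairing the integral with a and c
  gives the inner product of E(\<Phi> upr a + lwr a) = \<gamma> a with E D c, which is minus the
  adjoint of v applied to c. Up to sign this is the integral of \<beta>' = v \<gamma>, that is,
  \<beta>(l) - \<beta>(0).\<close>

theorem beta_integral:
  assumes D_eq: "AE x in \<mu>. D x = vector_derivative \<Phi> (at x)"
  shows "\<beta> l = hcat (mat 1) 0 - (LINT t:{0..l}|lebesgue.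
    cadj (colwise (\<lambda>f. Es (E f)) (\<lambda>r. vector_derivative \<Phi> (at r)) t) ** hcat (\<Phi> t) (mat 1))"
proof -
  define G where "G = colwise (\<lambda>f. Es (E f)) (\<lambda>r. vector_derivative \<Phi> (at r))"
  have Fcol: "(\<lambda>t. column j (vector_derivative \<Phi> (at t))) \<in> L2" for j
  proof -
    have "(\<lambda>t. column j (D t)) = (\<lambda>t. D t *v axis j 1)"
      by (simp add: fun_eq_iff vec_eq_iff column_def matrix_vector_mult_def axis_def if_distrib[of "(*) _"] sum.delta cong: if_cong)
    then have "(\<lambda>t. column j (D t)) \<in> L2" using D_L2 by metis
    then show ?thesis by (rule L2_on_cong_AE) (use D_eq in \<open>auto elim: eventually_mono\<close>)
  qed
  have G: "AE t in \<mu>. G t *v c = Es (E (\<lambda>t. D t *v c)) t" for c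
    unfolding G_def by (rule colwise_vec[OF EsE_bounded Fcol D_L2]) (use D_eq in \<open>eventually_elim, simp\<close>)
  have Es_ED: "Es (E (\<lambda>t. D t *v c)) \<in> L2" for c by (intro L2_intros D_L2)
  have Gint: "integrable \<mu> G"
  proof -
    \<comment> \<open>Places a vector as k-th column of a zero matrix, so that G is a finite sum of
      images of its columns under bounded linear maps.\<close>
    define cm :: "'m1 \<Rightarrow> complex^'m2 \<Rightarrow> complex^'m1^'m2" where "cm k w = (\<chi> i j. if j = k then w $ i else 0)" for k w
    have cm: "bounded_linear (cm k)" for k
      by (rule linear_conv_bounded_linear[THEN iffD1])
        (auto simp: cm_def linear_iff vec_eq_iff)
    have "G = (\<lambda>t. \<Sum>k\<in>UNIV. cm k (Es (E (\<lambda>t. column k (vector_derivative \<Phi> (at t)))) t))"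
      by (simp add: fun_eq_iff vec_eq_iff cm_def G_def colwise_def if_distrib if_distribR sum.delta cong: if_cong)
    moreover have "integrable \<mu> (\<lambda>t. cm k (Es (E (\<lambda>t. column k (vector_derivative \<Phi> (at t)))) t))" for k
      by (rule integrable_bounded_linear[OF cm L2_integrable]) (intro L2_intros Fcol)
    ultimately show ?thesis by simp
  qed
  have hc: "continuous_on {0..l} (\<lambda>t. hcat (\<Phi> t) (mat 1 :: complex^'m2^'m2))"
  proof -
    have "linear (\<lambda>A :: complex^'m1^'m2. hcat A (0 :: complex^'m2^'m2))"
      by (auto simp: linear_iff hcat_def vec_eq_iff split: sum.split)
    then have "continuous_on {0..l} (\<lambda>t. hcat (\<Phi> t) (0 :: complex^'m2^'m2))"
      by (intro bounded_linear.continuous_on[OF _ Phi_cont]) (simp add: linear_conv_bounded_linear)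
    then have "continuous_on {0..l} (\<lambda>t. hcat (\<Phi> t) (0 :: complex^'m2^'m2) + hcat 0 (mat 1))"
      by (intro continuous_intros)
    moreover have "hcat (\<Phi> t) (0 :: complex^'m2^'m2) + hcat 0 (mat 1) = hcat (\<Phi> t) (mat 1)" for t
      by (auto simp: hcat_def vec_eq_iff split: sum.split)
    ultimately show ?thesis by simp
  qed
  have int: "integrable \<mu> (\<lambda>t. cadj (G t) ** hcat (\<Phi> t) (mat 1))"
    by (rule bilinear_integrable[OF bounded_bilinear.flip[OF bounded_bilinear_matrix_matrix] hc])
      (rule integrable_bounded_linear[OF bounded_linear_cadj Gint])
  define I where "I = (\<integral>t. cadj (G t) ** hcat (\<Phi> t) (mat 1) \<partial>\<mu>)"
  have "I *v a = \<beta> 0 *v a - \<beta> l *v a" for a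
  proof (rule vec_eq_inner)
    fix c
    define p where "p t = \<Phi> t *v upr a + lwr a" for t
    have P: "(\<lambda>x. \<Phi> x *v upr a) \<in> L2"
      by (intro L2_on_continuous Phi_vec_cont)
    have cL: "(\<lambda>x. lwr a) \<in> L2" by (intro L2_on_continuous continuous_intros)
    have p: "p \<in> L2" unfolding p_def by (intro L2_on_add P cL)
    have Ep: "AE x in \<mu>. E p x = \<gamma> x *v a"
      using L2_bounded_op_add[OF E_bdd P cL] E_Phi[of "upr a"] E_const[of "lwr a"]
    proof eventually_elim
      case (elim x)
      have "\<gamma> x *v vjoin (upr a) 0 + \<gamma> x *v vjoin 0 (lwr a) = \<gamma> x *v a"
        by (simp add: matrix_vector_right_distrib[symmetric] vjoin_add)
      then show ?case using elim by (simp add: p_def[abs_def])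
    qed
    have "I *v a = (\<integral>t. (cadj (G t) ** hcat (\<Phi> t) (mat 1)) *v a \<partial>\<mu>)"
      unfolding I_def by (rule integral_bounded_linear[OF bounded_bilinear.bounded_linear_left[OF bounded_bilinear_matrix_vector] int, symmetric])
    also have "\<dots> = (\<integral>t. cadj (G t) *v p t \<partial>\<mu>)"
      by (simp add: matrix_vector_mul_assoc[symmetric] hcat_vec p_def)
    also have "\<dots> \<bullet> c = (\<integral>t. (cadj (G t) *v p t) \<bullet> c \<partial>\<mu>)"
    proof (rule integral_inner_left[symmetric])
      have "integrable \<mu> (\<lambda>t. (cadj (G t) ** hcat (\<Phi> t) (mat 1)) *v a)"
        by (rule integrable_bounded_linear[OF bounded_bilinear.bounded_linear_left[OF bounded_bilinear_matrix_vector] int])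
      then show "integrable \<mu> (\<lambda>t. cadj (G t) *v p t)"
        by (simp add: matrix_vector_mul_assoc[symmetric] hcat_vec p_def)
    qed
    also have "\<dots> = ip p (\<lambda>t. G t *v c)"
      unfolding ip_def using inner_matrix_cadj[of "cadj (G _)"] by simp
    also have "\<dots> = ip p (Es (E (\<lambda>t. D t *v c)))"
      by (rule ip_cong[symmetric]) (use G[of c] p Es_ED in \<open>auto elim: eventually_mono\<close>)
    also have "\<dots> = ip (E p) (E (\<lambda>t. D t *v c))" by (rule E_adjoint[symmetric]) (intro p L2_intros D_L2)+
    also have "\<dots> = ip (\<lambda>t. \<gamma> t *v a) (\<lambda>t. - (cadj (v t) *v c))"
      by (rule ip_cong[OF Ep E_D]) (intro L2_intros p D_L2)+
    also have "\<dots> = - (\<integral>t. c \<bullet> (v t *v (\<gamma> t *v a)) \<partial>\<mu>)"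
    proof -
      have "(\<gamma> t *v a) \<bullet> (cadj (v t) *v c) = c \<bullet> (v t *v (\<gamma> t *v a))" for t
        using inner_matrix_cadj[of "v t" "\<gamma> t *v a" c] by (simp add: inner_commute)
      then show ?thesis by (simp add: ip_def)
    qed
    also have "(\<integral>t. c \<bullet> (v t *v (\<gamma> t *v a)) \<partial>\<mu>) = integral {0..l} (\<lambda>t. c \<bullet> (v t *v (\<gamma> t *v a)))"
    proof -
      have "integrable \<mu> (\<lambda>t. (\<gamma> t *v a) \<bullet> (cadj (v t) *v c))"
        by (intro L2_on_inner_integrable v_adj_L2 L2_on_continuous gamma_vec_cont)
      then have "integrable \<mu> (\<lambda>t. c \<bullet> (v t *v (\<gamma> t *v a)))"
        using inner_matrix_cadj[of "v _" "\<gamma> _ *v a" c] by (simp add: inner_commute)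
      from lint_eq_integral(1)[OF this, of l] show ?thesis
        by (simp add: set_lebesgue_integral_def integral_restrict_space)
    qed
    also have "\<dots> = c \<bullet> (\<beta> l *v a) - c \<bullet> (\<beta> 0 *v a)"
      by (rule integral_unique[OF beta_difference]) (use l_pos in simp)
    finally show "(I *v a) \<bullet> c = (\<beta> 0 *v a - \<beta> l *v a) \<bullet> c"
      by (simp add: inner_diff_left inner_diff_right inner_commute)
  qed
  then have "\<beta> l = \<beta> 0 - I"
    by (intro matrix_eq_vectorI) (simp add: matrix_vector_mult_diff_rdistrib)
  moreover have "I = (LINT t:{0..l}|lebesgue. cadj (G t) ** hcat (\<Phi> t) (mat 1))"
    by (simp add: I_def set_lebesgue_integral_def integral_restrict_space)
  ultimately show ?thesis by (simp add: beta_0 G_def)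
qed

end

context dirac_similarity
begin

theorem beta_formula:
  assumes L: "l \<le> L"
  shows "\<exists>Q. L2_inverse l (S_sub L \<Phi> l) Q \<and>
     \<beta> l = hcat (mat 1) 0 - (LINT t:{0..l}|lebesgue.
       cadj (colwise Q (\<lambda>r. vector_derivative \<Phi> (at r)) t) ** hcat (\<Phi> t) (mat 1))"
proof -
  obtain \<kappa> where \<kappa>: "borel_kernel \<kappa>" "\<And>f. f \<in> L2 \<Longrightarrow> AE x in \<mu>. E f x = f x + kop \<kappa> f x"
    by (rule kernel_representative) blast
  obtain D C where D: "D \<in> borel_measurable borel" "\<And>x. norm (D x) \<le> C"
    "AE x in \<mu>. D x = vector_derivative \<Phi> (at x)" "has_ae_deriv 0 l \<Phi> D"
    by (rule derivative_representative) blast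
  interpret dirac_kernels M v u \<Phi> l k R \<kappa> D C
    by unfold_locales (use \<kappa> D Phi_0 in auto)
  show ?thesis using S_sub_inverse[OF D(3) L] beta_integral[OF D(3)] by blast
qed

end

context dirac_system
begin

theorem beta_recovery:
  assumes Phi: "is_Phi1 \<gamma> \<Phi>" and x: "0 \<le> x" "x \<le> L"
  shows "\<exists>Q. L2_inverse x (S_sub L \<Phi> x) Q \<and>
     \<beta> x = hcat (mat 1) 0 - (LINT t:{0..x}|lebesgue.
       cadj (colwise Q (\<lambda>r. vector_derivative \<Phi> (at r)) t) ** hcat (\<Phi> t) (mat 1))"
proof (cases "x = 0")
  case False
  then have "0 < x" using x by simp
  then obtain k R where "dirac_similarity M v u \<Phi> x k R" using similarity_exists[OF Phi] by blast
  then interpret dirac_similarity M v u \<Phi> x k R .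
  show ?thesis by (rule beta_formula[OF x(2)])
next
  case True
  \<comment> \<open>On a single point everything holds almost everywhere and all L2 norms are 0, so
    any two operators are inverse to each other.\<close>
  have ae: "AE t in lebesgue. t \<noteq> (0 :: real)" by (rule AE_completion[OF AE_lborel_singleton])
  have n: "AE t in lebesgue_on {0..0 :: real}. P t" for P
    by (subst AE_restrict_space_iff, simp, rule eventually_mono[OF ae], auto)
  have L2: "f \<in> L2_on {0..0}" for f :: "real \<Rightarrow> complex^'m2"
  proof (rule L2_on_cong_AE[of "\<lambda>_. 0"])
    show "(\<lambda>_. 0) \<in> L2_on {0..0 :: real}" by (intro L2_on_continuous continuous_intros)
  qed (use n in auto)
  have 0: "L2_norm_on {0..0} f = 0" for f :: "real \<Rightarrow> complex^'m2"
    unfolding L2_norm_on_def by (subst integral_eq_zero_AE) (use n in auto)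
  have "L2_inverse 0 T U" for T U :: "'m2 oper"
    unfolding L2_inverse_def L2_bounded_op_def by (intro conjI ballI allI n L2 exI[of _ 0]) (simp_all add: 0[simplified])
  moreover have "(LINT t:{0..0}|lebesgue. h t) = 0" for h :: "real \<Rightarrow> complex^('m1 + 'm2)^'m1"
    unfolding set_lebesgue_integral_def by (rule integral_eq_zero_AE) (use ae in \<open>eventually_elim, simp add: indicator_def\<close>)
  ultimately show ?thesis unfolding True by (auto simp: beta_0)
qed

end

section \<open>Recovery of \<open>\<gamma>\<close> and \<open>v\<close>\<close>

text \<open>Holds for any set S, so ordinary, within-interval and one-sided derivatives are treated
  together.\<close>

lemma has_vector_derivative_iff_quotient:
  "(f has_vector_derivative D) (at x within S) \<longleftrightarrow> ((\<lambda>y. (f y - f x) /\<^sub>R (y - x)) \<longlongrightarrow> D) (at x within S)"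
proof -
  have *: "((\<lambda>y. norm (f y - f x - (y - x) *\<^sub>R D) / norm (y - x)) \<longlongrightarrow> 0) (at x within S) \<longleftrightarrow>
     ((\<lambda>y. norm ((f y - f x) /\<^sub>R (y - x) - D)) \<longlongrightarrow> 0) (at x within S)"
  proof (rule filterlim_cong[OF refl refl])
    show "\<forall>\<^sub>F y in at x within S. norm (f y - f x - (y - x) *\<^sub>R D) / norm (y - x) = norm ((f y - f x) /\<^sub>R (y - x) - D)"
      unfolding eventually_at_filter
    proof (intro always_eventually allI impI)
      fix y assume "y \<noteq> x"
      then have "(f y - f x) /\<^sub>R (y - x) - D = (f y - f x - (y - x) *\<^sub>R D) /\<^sub>R (y - x)"
        by (simp add: scaleR_diff_right)
      then show "norm (f y - f x - (y - x) *\<^sub>R D) / norm (y - x) = norm ((f y - f x) /\<^sub>R (y - x) - D)"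
        by (simp add: divide_inverse mult.commute)
    qed
  qed
  then show ?thesis
    unfolding has_vector_derivative_def has_derivative_iff_norm
    unfolding * by (simp only: bounded_linear_scaleR_left tendsto_norm_zero_iff LIM_zero_iff simp_thms)
qed

lemma lip_vector_derivative_le:
  assumes lip: "\<And>y z. y \<in> {a..b} \<Longrightarrow> z \<in> {a..b} \<Longrightarrow> norm (f z - f y) \<le> L * \<bar>z - y\<bar>"
    and d: "(f has_vector_derivative D) (at x within S)" and x: "x \<in> {a..b}"
    and S: "at x within S \<noteq> bot" "\<forall>\<^sub>F y in at x within S. y \<in> {a..b}"
  shows "norm D \<le> L"
proof (rule tendsto_upperbound[OF tendsto_norm _ S(1)])
  show "((\<lambda>y. (f y - f x) /\<^sub>R (y - x)) \<longlongrightarrow> D) (at x within S)"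
    using d by (simp add: has_vector_derivative_iff_quotient)
  have "\<forall>\<^sub>F y in at x within S. y \<noteq> x" by (simp add: eventually_at_filter)
  with S(2) show "\<forall>\<^sub>F y in at x within S. norm ((f y - f x) /\<^sub>R (y - x)) \<le> L"
  proof eventually_elim
    case (elim y)
    then have "0 < \<bar>y - x\<bar>" by simp
    then show ?case using lip[OF x, of y] elim unfolding norm_scaleR by (simp add: field_simps)
  qed
qed

lemma has_ae_deriv_boundedly_diff:
  assumes f: "has_ae_deriv 0 l f f'" and l: "0 < l" shows "boundedly_diff l f"
  unfolding boundedly_diff_def
proof (intro conjI)
  show "abs_cont_on 0 l f" by (rule lip_on_abs_cont[OF has_ae_deriv_lip[OF f]])
  obtain L where L: "\<And>x y. x \<in> {0..l} \<Longrightarrow> y \<in> {0..l} \<Longrightarrow> norm (f y - f x) \<le> L * \<bar>y - x\<bar>"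
    using has_ae_deriv_lip[OF f] by (rule lip_onE) blast
  have "AE x in Leb l. \<exists>D. (f has_vector_derivative D) (at x within {0..l}) \<and> norm D \<le> L"
    using AE_mem has_ae_derivD[OF f]
  proof eventually_elim
    case (elim x)
    have "at x within {0..l} \<noteq> bot" using elim l by (simp add: at_within_Icc_at trivial_limit_within)
    moreover have "\<forall>\<^sub>F y in at x within {0..l}. y \<in> {0..l}" by (simp add: eventually_at_filter)
    ultimately show ?case using lip_vector_derivative_le[OF L elim(2) elim(1)] elim by blast
  qed
  then show "\<exists>C. AE x in Leb l. \<exists>D. (f has_vector_derivative D) (at x within {0..l}) \<and> norm D \<le> C" by blast
qed

text \<open>The bound is given for one-sided derivatives only, but where f is differentiable the
  right derivative is the derivative. A finite break set is harmless for the fundamental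
  theorem.\<close>

lemma piecewise_diff_lip:
  fixes f :: "real \<Rightarrow> 'a::euclidean_space"
  assumes "piecewise_diff l f" shows "lip_on 0 l f"
proof -
  obtain F C where c: "continuous_on {0..l} f" and F: "finite F"
    "\<And>x. x \<in> {0..l} - F \<Longrightarrow> f differentiable (at x within {0..l})"
    and C: "\<And>x. x \<in> {0..<l} \<Longrightarrow> \<exists>D. (f has_vector_derivative D) (at_right x) \<and> norm D \<le> C"
    using assms unfolding piecewise_diff_def by blast
  define f' where "f' x = vector_derivative f (at x)" for x
  have d: "(f has_vector_derivative f' x) (at x) \<and> norm (f' x) \<le> C" if x: "x \<in> {0<..<l} - F" for x
  proof -
    have "at x within {0..l} = at x" using x by (intro at_within_interior) (simp add: interior_atLeastAtMost_real)
    then have 1: "(f has_vector_derivative f' x) (at x)"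
      using F(2)[of x] x unfolding f'_def by (simp add: vector_derivative_works)
    obtain D where D: "(f has_vector_derivative D) (at_right x)" "norm D \<le> C" using C[of x] x by auto
    have "f' x = D"
      using 1 D(1) unfolding has_vector_derivative_iff_quotient
      by (intro tendsto_unique[of "at_right x"]) (auto intro: tendsto_mono[OF at_le])
    then show ?thesis using 1 D by simp
  qed
  have "norm (f z - f y) \<le> max C 0 * \<bar>z - y\<bar>" if "y \<in> {0..l}" "z \<in> {0..l}" "y \<le> z" for y z
  proof -
    have "(f' has_integral f z - f y) {y..z}"
      by (rule fundamental_theorem_of_calculus_interior_strong[OF F(1) that(3)])
        (use that d in \<open>auto intro: continuous_on_subset[OF c]\<close>)
    from has_integral_bound_real[of "max C 0" "F \<union> {y, z}", OF _ _ this]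
    show ?thesis using d that F(1) by (force simp: le_max_iff_disj)
  qed
  then show ?thesis unfolding lip_on_def
    by (intro exI[of _ "max C 0"] ballI) (metis abs_minus_commute linear norm_minus_commute)
qed

lemma piecewise_diff_has_ae_deriv:
  fixes f :: "real \<Rightarrow> 'a::euclidean_space"
  assumes f: "piecewise_diff l f" shows "has_ae_deriv 0 l f (\<lambda>x. vector_derivative f (at x within {0..l}))"
  unfolding has_ae_deriv_def
proof
  show "lip_on 0 l f" by (rule piecewise_diff_lip[OF f])
  obtain F where F: "finite F" "\<And>x. x \<in> {0..l} - F \<Longrightarrow> f differentiable (at x within {0..l})"
    using f unfolding piecewise_diff_def by blast
  have "AE x in lebesgue. x \<notin> F"
    using F(1) by (intro AE_not_in) (simp add: negligible_iff_null_sets[symmetric] negligible_finite)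
  then have "AE x in Leb l. x \<in> {0..l} - F"
    by (subst AE_restrict_space_iff) auto
  then show "AE x in Leb l. (f has_vector_derivative vector_derivative f (at x within {0..l})) (at x within {0..l})"
    by eventually_elim (use F(2) in \<open>simp add: vector_derivative_works\<close>)
qed

context dirac_system
begin

lemma beta_deriv: "has_ae_deriv 0 l \<beta> (\<lambda>x. v x ** \<gamma> x)"
  and gamma_deriv: "has_ae_deriv 0 l \<gamma> (\<lambda>x. - (cadj (v x) ** \<beta> x))"
proof -
  note d = has_ae_deriv_bounded_linear[OF bounded_bilinear.bounded_linear_right[OF bounded_bilinear_matrix_matrix] u_deriv[of l 0]]
  have "hcat (mat 1) 0 ** ((cscale (\<i> * 0) jmat + jmat ** Vmat (v x)) ** u x 0) = v x ** \<gamma> x" for x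
    by (rule matrix_eq_vectorI) (simp only: coefficient_vec matrix_vector_mul_assoc[symmetric], simp add: hcat_vec gamma_of_vec)
  then show "has_ae_deriv 0 l \<beta> (\<lambda>x. v x ** \<gamma> x)"
    using d[of "hcat (mat 1) 0"] by (simp add: beta_of_def[abs_def])
  have "hcat 0 (mat 1) ** ((cscale (\<i> * 0) jmat + jmat ** Vmat (v x)) ** u x 0) = - (cadj (v x) ** \<beta> x)" for x
    by (rule matrix_eq_vectorI)
      (simp only: coefficient_vec minus_matrix_vec matrix_vector_mul_assoc[symmetric], simp add: hcat_vec beta_of_vec)
  then show "has_ae_deriv 0 l \<gamma> (\<lambda>x. - (cadj (v x) ** \<beta> x))"
    using d[of "hcat 0 (mat 1)"] by (simp add: gamma_of_def[abs_def])
qed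

lemma cadj_hcat_vec: "cadj (hcat A B) *v y = vjoin (cadj A *v y) (cadj B *v y)"
proof (rule vec_eq_inner)
  fix d
  have i: "(cadj A *v y) \<bullet> w = y \<bullet> (A *v w)" for A :: "complex^'a^'c" and w
    using inner_matrix_cadj[of "cadj A" y w] by simp
  have j: "(cadj B *v y) \<bullet> w = y \<bullet> (B *v w)" for B :: "complex^'b^'c" and w
    using inner_matrix_cadj[of "cadj B" y w] by simp
  have "(cadj (hcat A B) *v y) \<bullet> d = y \<bullet> (hcat A B *v d)"
    using inner_matrix_cadj[of "cadj (hcat A B)" y d] by simp
  then show "(cadj (hcat A B) *v y) \<bullet> d = vjoin (cadj A *v y) (cadj B *v y) \<bullet> d"
    by (simp add: hcat_vec inner_blocks i j inner_add_right)
qed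

text \<open>At the real parameter 0 the matrix u is unitary, and \<beta> and \<gamma> are its two
  block rows.\<close>

lemma block_orthogonality:
  assumes "0 \<le> x"
  shows "\<beta> x ** cadj (\<gamma> x) = 0" "\<gamma> x ** cadj (\<gamma> x) = mat 1" "\<gamma> x ** cadj (\<beta> x) = 0"
    "cadj (\<beta> x) ** \<beta> x + cadj (\<gamma> x) ** \<gamma> x = mat 1"
proof -
  have uu: "u x 0 *v (cadj (u x 0) *v w) = w" "cadj (u x 0) *v (u x 0 *v w) = w" for w
    using u_inverse(1,2)[OF assms, of 0] by (simp_all add: matrix_vector_mul_assoc)
  have b: "cadj (\<beta> x) *v w = cadj (u x 0) *v vjoin w 0" for w
    by (simp add: beta_of_def cadj_mult cadj_hcat_vec flip: matrix_vector_mul_assoc)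
  have g: "cadj (\<gamma> x) *v w = cadj (u x 0) *v vjoin 0 w" for w
    by (simp add: gamma_of_def cadj_mult cadj_hcat_vec flip: matrix_vector_mul_assoc)
  show "\<beta> x ** cadj (\<gamma> x) = 0" "\<gamma> x ** cadj (\<gamma> x) = mat 1" "\<gamma> x ** cadj (\<beta> x) = 0"
    by (rule matrix_eq_vectorI, simp add: g b uu beta_of_vec gamma_of_vec flip: matrix_vector_mul_assoc)+
  show "cadj (\<beta> x) ** \<beta> x + cadj (\<gamma> x) ** \<gamma> x = mat 1"
    by (rule matrix_eq_vectorI)
      (simp add: g b uu beta_of_vec gamma_of_vec matrix_vector_mult_add_rdistrib matrix_vector_right_distrib[symmetric] vjoin_add
        flip: matrix_vector_mul_assoc)
qed

lemma matrix_decompose: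
  assumes "0 \<le> x"
  shows "A = (A ** cadj (\<beta> x)) ** \<beta> x + (A ** cadj (\<gamma> x)) ** \<gamma> x"
proof -
  have "A = A ** (cadj (\<beta> x) ** \<beta> x + cadj (\<gamma> x) ** \<gamma> x)" by (simp add: block_orthogonality(4)[OF assms])
  then show ?thesis by (simp add: matrix_add_ldistrib matrix_mul_assoc)
qed

text \<open>Here the diagonal part of \<open>\<gamma>' \<gamma>\<^sup>*\<close> vanishes, so the difference is of second order.\<close>

lemma gamma_gamma_le:
  "\<exists>C\<ge>0. \<forall>x\<in>{0..l}. \<forall>y\<in>{0..l}. norm (\<gamma> y ** cadj (\<gamma> x) - mat 1) \<le> C * \<bar>y - x\<bar>\<^sup>2"
proof -
  obtain L where L: "L \<ge> 0" "\<And>x y. x \<in> {0..l} \<Longrightarrow> y \<in> {0..l} \<Longrightarrow> norm (\<gamma> y - \<gamma> x) \<le> L * \<bar>y - x\<bar>"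
    using has_ae_deriv_lip[OF gamma_deriv[of l]] by (rule lip_onE) blast
  obtain B where B: "B \<ge> 0" "\<And>x. x \<in> {0..l} \<Longrightarrow> norm (\<beta> x) \<le> B"
    using has_ae_deriv_lip[OF beta_deriv[of l]] by (rule lip_on_bounded) blast
  define V where "V = real CARD('m2) * (real CARD('m1) * M)"
  have V: "norm (cadj (v t)) \<le> V" if "0 \<le> t" for t
    unfolding V_def by (rule norm_matrix_entry_le(2)[OF norm_v_adj_vec[OF that]])
  have "0 \<le> V" using M_pos by (simp add: V_def)
  define C where "C = V * (B * L)"
  have C0: "0 \<le> C" unfolding C_def using \<open>0 \<le> V\<close> B L by simp
  have "norm (\<gamma> y ** cadj (\<gamma> x) - mat 1) \<le> C * \<bar>y - x\<bar>\<^sup>2" if x: "x \<in> {0..l}" and y: "y \<in> {0..l}" for x y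
  proof -
    define a b where "a = min x y" and "b = max x y"
    have ab: "0 \<le> a" "b \<le> l" "x \<in> {a..b}" "y \<in> {a..b}" using x y by (auto simp: a_def b_def)
    define h where "h t = \<gamma> t ** cadj (\<gamma> x)" for t
    have "has_ae_deriv 0 l h (\<lambda>t. - (cadj (v t) ** \<beta> t) ** cadj (\<gamma> x))"
      unfolding h_def
      by (rule has_ae_deriv_bounded_linear[OF bounded_bilinear.bounded_linear_left[OF bounded_bilinear_matrix_matrix] gamma_deriv])
    then have d: "has_ae_deriv a b h (\<lambda>t. - (cadj (v t) ** \<beta> t) ** cadj (\<gamma> x))"
      by (rule has_ae_deriv_subset[OF _ ab(1,2)])
    have "norm (- (cadj (v t) ** \<beta> t) ** cadj (\<gamma> x)) \<le> C * \<bar>y - x\<bar>" if t: "t \<in> {a..b}" for t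
    proof -
      have tl: "t \<in> {0..l}" using t ab by auto
      \<comment> \<open>Since \<beta>(t) annihilates the adjoint of \<gamma>(t), the latter can be
        subtracted; this produces the second factor of order y - x.\<close>
      have 1: "- (cadj (v t) ** \<beta> t) ** cadj (\<gamma> x) = cadj (v t) ** (\<beta> t ** cadj (\<gamma> t - \<gamma> x))"
        using block_orthogonality(1)[of t] tl
        by (simp add: cadj_diff matrix_mul_assoc[symmetric] bounded_bilinear.diff_right[OF bounded_bilinear_matrix_matrix]
          bounded_bilinear.minus_left[OF bounded_bilinear_matrix_matrix] bounded_bilinear.minus_right[OF bounded_bilinear_matrix_matrix])
      have tx: "\<bar>t - x\<bar> \<le> \<bar>y - x\<bar>" using t by (auto simp: a_def b_def)
      have "norm (\<gamma> t - \<gamma> x) \<le> L * \<bar>y - x\<bar>"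
        using L(2)[OF x tl] mult_left_mono[OF tx L(1)] by linarith
      then have bg: "norm (\<beta> t ** cadj (\<gamma> t - \<gamma> x)) \<le> B * (L * \<bar>y - x\<bar>)"
        using B(1) B(2)[OF tl] by (intro order_trans[OF norm_matrix_matrix_le] mult_mono) auto
      have "norm (cadj (v t) ** (\<beta> t ** cadj (\<gamma> t - \<gamma> x))) \<le> V * (B * (L * \<bar>y - x\<bar>))"
        using V[of t] tl \<open>0 \<le> V\<close> by (intro order_trans[OF norm_matrix_matrix_le mult_mono[OF _ bg]]) auto
      then show ?thesis unfolding 1 by (simp add: C_def mult_ac)
    qed
    then have "AE t in lebesgue_on {a..b}. norm (- (cadj (v t) ** \<beta> t) ** cadj (\<gamma> x)) \<le> C * \<bar>y - x\<bar>"
      by (intro AE_I2) simp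
    from has_ae_deriv_norm_le[OF d this _ ab(3,4)]
    have "norm (h y - h x) \<le> C * \<bar>y - x\<bar> * \<bar>y - x\<bar>" using C0 by simp
    then show ?thesis using block_orthogonality(2)[of x] x by (simp add: h_def power2_eq_square mult_ac)
  qed
  then show ?thesis using C0 by blast
qed

text \<open>Decompose the increment of \<gamma> along the rows of \<beta>(x) and \<gamma>(x). The
  component along \<gamma>(x) is of second order; orthogonality at y turns the one along \<beta>(x)
  into an increment of \<beta>. So \<gamma> inherits differentiability from \<beta> at each point
  and in each one-sided sense.\<close>

lemma gamma_within_deriv:
  assumes x: "x \<in> {0..l}" and S: "\<forall>\<^sub>F y in at x within S. y \<in> {0..l}"
    and B: "(\<beta> has_vector_derivative B) (at x within S)"
  shows "(\<gamma> has_vector_derivative - ((\<gamma> x ** cadj B) ** \<beta> x)) (at x within S)"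
proof -
  obtain L where L: "L \<ge> 0" "\<And>x y. x \<in> {0..l} \<Longrightarrow> y \<in> {0..l} \<Longrightarrow> norm (\<gamma> y - \<gamma> x) \<le> L * \<bar>y - x\<bar>"
    using has_ae_deriv_lip[OF gamma_deriv[of l]] by (rule lip_onE) blast
  obtain C where C: "\<And>x y. x \<in> {0..l} \<Longrightarrow> y \<in> {0..l} \<Longrightarrow> norm (\<gamma> y ** cadj (\<gamma> x) - mat 1) \<le> C * \<bar>y - x\<bar>\<^sup>2"
    using gamma_gamma_le[of l] by blast
  have id: "((\<lambda>y. \<bar>y - x\<bar>) \<longlongrightarrow> 0) (at x within S)"
  proof -
    have "((\<lambda>y. \<bar>y - x\<bar>) \<longlongrightarrow> \<bar>x - x\<bar>) (at x within S)" by (intro tendsto_intros)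
    then show ?thesis by simp
  qed
  have ne: "\<forall>\<^sub>F y in at x within S. y \<noteq> x" by (simp add: eventually_at_filter)
  have "((\<lambda>y. \<gamma> y - \<gamma> x) \<longlongrightarrow> 0) (at x within S)"
  proof (rule Lim_null_comparison)
    show "\<forall>\<^sub>F y in at x within S. norm (\<gamma> y - \<gamma> x) \<le> L * \<bar>y - x\<bar>"
      using S by eventually_elim (rule L(2)[OF x])
    show "((\<lambda>y. L * \<bar>y - x\<bar>) \<longlongrightarrow> 0) (at x within S)" by (rule tendsto_mult_right_zero[OF id])
  qed
  then have g: "(\<gamma> \<longlongrightarrow> \<gamma> x) (at x within S)" by (simp add: LIM_zero_iff)
  define q where "q y = (\<beta> y - \<beta> x) /\<^sub>R (y - x)" for y
  define r where "r y = (\<gamma> y ** cadj (\<gamma> x) - mat 1) /\<^sub>R (y - x)" for y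
  have q: "(q \<longlongrightarrow> B) (at x within S)" using B by (simp add: has_vector_derivative_iff_quotient q_def[abs_def])
  have r: "(r \<longlongrightarrow> 0) (at x within S)"
  proof (rule Lim_null_comparison)
    show "\<forall>\<^sub>F y in at x within S. norm (r y) \<le> C * \<bar>y - x\<bar>"
      using S ne
    proof eventually_elim
      case (elim y)
      then show ?case using C[OF x elim(1)] unfolding r_def norm_scaleR by (simp add: field_simps power2_eq_square)
    qed
    show "((\<lambda>y. C * \<bar>y - x\<bar>) \<longlongrightarrow> 0) (at x within S)" by (rule tendsto_mult_right_zero[OF id])
  qed
  note bb = bounded_bilinear_matrix_matrix
  have eq: "\<forall>\<^sub>F y in at x within S. - ((\<gamma> y ** cadj (q y)) ** \<beta> x) + r y ** \<gamma> x = (\<gamma> y - \<gamma> x) /\<^sub>R (y - x)"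
    using S
  proof eventually_elim
    case (elim y)
    have "\<gamma> y ** cadj (\<beta> x) = - (\<gamma> y ** cadj (\<beta> y - \<beta> x))"
      using block_orthogonality(3)[of y] elim by (simp add: cadj_diff bounded_bilinear.diff_right[OF bb])
    then have "\<gamma> y - \<gamma> x = - ((\<gamma> y ** cadj (\<beta> y - \<beta> x)) ** \<beta> x) + (\<gamma> y ** cadj (\<gamma> x) - mat 1) ** \<gamma> x"
      using matrix_decompose[of x "\<gamma> y"] x
      by (simp add: bounded_bilinear.diff_left[OF bb] bounded_bilinear.minus_left[OF bb])
    then show ?case
      by (simp only: q_def r_def linear_scale[OF linear_cadj] bounded_bilinear.scaleR_left[OF bb] bounded_bilinear.scaleR_right[OF bb]
        scaleR_right_distrib scaleR_minus_right)
  qed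
  have "((\<lambda>y. - ((\<gamma> y ** cadj (q y)) ** \<beta> x) + r y ** \<gamma> x) \<longlongrightarrow> - ((\<gamma> x ** cadj B) ** \<beta> x) + 0 ** \<gamma> x) (at x within S)"
    by (intro tendsto_add tendsto_minus bounded_bilinear.tendsto[OF bb] g q r tendsto_const bounded_linear.tendsto[OF bounded_linear_cadj])
  from Lim_transform_eventually[OF this eq] show ?thesis
    by (simp add: has_vector_derivative_iff_quotient bounded_bilinear.zero_left[OF bb])
qed

theorem complement_exists:
  assumes l: "0 < l"
  shows "boundedly_diff l \<gamma> \<and> piecewise_diff_rel l \<beta> \<gamma> \<and> complements l \<beta> \<gamma>"
proof (intro conjI)
  show "boundedly_diff l \<gamma>" by (rule has_ae_deriv_boundedly_diff[OF gamma_deriv l])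
  show "complements l \<beta> \<gamma>"
    by (auto simp: complements_def block_orthogonality gamma_0 pos_definite_def Re_quad_form)
  obtain L where L: "\<And>x y. x \<in> {0..l} \<Longrightarrow> y \<in> {0..l} \<Longrightarrow> norm (\<gamma> y - \<gamma> x) \<le> L * \<bar>y - x\<bar>"
    using has_ae_deriv_lip[OF gamma_deriv[of l]] by (rule lip_onE) blast
  \<comment> \<open>No extra break points arise, and the Lipschitz constant of \<gamma> bounds its
    one-sided derivatives.\<close>
  show "piecewise_diff_rel l \<beta> \<gamma>"
    unfolding piecewise_diff_rel_def
  proof (intro conjI exI[of _ "{}"] exI[of _ L] ballI impI)
    fix x assume x: "x \<in> {0..l} - {}" and "\<beta> differentiable at x within {0..l}"
    then obtain B where "(\<beta> has_vector_derivative B) (at x within {0..l})" by (auto simp: vector_derivative_works)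
    from gamma_within_deriv[OF _ _ this, of l] x
    show "\<gamma> differentiable at x within {0..l}"
      by (auto simp: eventually_at_filter intro: differentiableI_vector)
  next
    fix x assume x: "x \<in> {0..<l}" and "\<exists>D. (\<beta> has_vector_derivative D) (at_right x)"
    then obtain B where B: "(\<beta> has_vector_derivative B) (at_right x)" by blast
    have S: "\<forall>\<^sub>F y in at_right x. y \<in> {0..l}"
      using x by (auto simp: eventually_at_right_field intro: exI[of _ l])
    have x': "x \<in> {0..l}" using x by simp
    from gamma_within_deriv[OF x' S B] lip_vector_derivative_le[OF L _ x' _ S]
    show "\<exists>D. (\<gamma> has_vector_derivative D) (at_right x) \<and> norm D \<le> L" by auto
  next
    fix x assume x: "x \<in> {0<..l}" and "\<exists>D. (\<beta> has_vector_derivative D) (at_left x)"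
    then obtain B where B: "(\<beta> has_vector_derivative B) (at_left x)" by blast
    have S: "\<forall>\<^sub>F y in at_left x. y \<in> {0..l}"
      using x by (auto simp: eventually_at_left_field intro: exI[of _ 0])
    have x': "x \<in> {0..l}" using x by simp
    from gamma_within_deriv[OF x' S B] lip_vector_derivative_le[OF L _ x' _ S]
    show "\<exists>D. (\<gamma> has_vector_derivative D) (at_left x) \<and> norm D \<le> L" by auto
  qed (simp_all add: gamma_cont)
qed

theorem v_formula:
  "AE x in Leb l. v x = vector_derivative \<beta> (at x) ** cadj (\<gamma> x)"
proof -
  have "AE x in lebesgue. x \<noteq> 0 \<and> x \<noteq> l"
    using AE_completion[OF AE_lborel_singleton[of 0]] AE_completion[OF AE_lborel_singleton[of l]]
    by eventually_elim simp
  then have "AE x in Leb l. x \<in> {0<..<l}"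
    by (subst AE_restrict_space_iff) (auto elim: eventually_mono)
  then show ?thesis using has_ae_derivD[OF beta_deriv]
  proof eventually_elim
    case (elim x)
    then have "at x within {0..l} = at x" by (intro at_within_interior) (simp add: interior_atLeastAtMost_real)
    then have "vector_derivative \<beta> (at x) = v x ** \<gamma> x" using elim(2) by (simp add: vector_derivative_at)
    then show ?case using block_orthogonality(2)[of x] elim(1) by (simp add: matrix_mul_assoc[symmetric])
  qed
qed

end

lemma matrix_inverse_exists:
  fixes A :: "complex^'n::finite^'n"
  assumes "\<And>h. cadj A *v h = 0 \<Longrightarrow> h = 0"
  obtains B where "A ** B = mat 1" "B ** A = mat 1"
proof -
  have "inj ((*v) (cadj A))"
    using assms by (intro injI) (metis eq_iff_diff_eq_0 matrix_vector_mult_diff_distrib)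
  then obtain B where "B ** cadj A = mat 1"
    using matrix_left_invertible_injective by blast
  then have "A ** cadj B = mat 1" using cadj_mult[of B "cadj A"] by simp
  then show ?thesis using that matrix_left_right_inverse by blast
qed

text \<open>The identity \<kappa>(y) - \<kappa>(x) = - \<kappa>(y) (\<rho>(y) - \<rho>(x))
  \<kappa>(x) reduces differentiability of the inverse to its continuity.\<close>

lemma has_vector_derivative_matrix_inverse:
  fixes \<rho> \<kappa> :: "real \<Rightarrow> complex^'n::finite^'n"
  assumes inv: "\<And>y. y \<in> S \<Longrightarrow> \<kappa> y ** \<rho> y = mat 1" "\<And>y. y \<in> S \<Longrightarrow> \<rho> y ** \<kappa> y = mat 1"
    and x: "x \<in> S" and \<kappa>: "(\<kappa> \<longlongrightarrow> \<kappa> x) (at x within S)" and \<rho>: "(\<rho> has_vector_derivative r) (at x within S)"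
  shows "(\<kappa> has_vector_derivative - ((\<kappa> x ** r) ** \<kappa> x)) (at x within S)"
proof -
  note bb = bounded_bilinear_matrix_matrix
  have eq: "\<forall>\<^sub>F y in at x within S. - ((\<kappa> y ** ((\<rho> y - \<rho> x) /\<^sub>R (y - x))) ** \<kappa> x) = (\<kappa> y - \<kappa> x) /\<^sub>R (y - x)"
    unfolding eventually_at_filter
  proof (intro always_eventually allI impI)
    fix y assume "y \<in> S"
    then have "\<kappa> y - \<kappa> x = - ((\<kappa> y ** (\<rho> y - \<rho> x)) ** \<kappa> x)"
      using inv[of y] inv[OF x]
      by (simp add: bounded_bilinear.diff_right[OF bb] bounded_bilinear.diff_left[OF bb] flip: matrix_mul_assoc)
    then show "- ((\<kappa> y ** ((\<rho> y - \<rho> x) /\<^sub>R (y - x))) ** \<kappa> x) = (\<kappa> y - \<kappa> x) /\<^sub>R (y - x)"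
      by (simp add: bounded_bilinear.scaleR_left[OF bb] bounded_bilinear.scaleR_right[OF bb])
  qed
  have "((\<lambda>y. - ((\<kappa> y ** ((\<rho> y - \<rho> x) /\<^sub>R (y - x))) ** \<kappa> x)) \<longlongrightarrow> - ((\<kappa> x ** r) ** \<kappa> x)) (at x within S)"
    by (intro tendsto_minus bounded_bilinear.tendsto[OF bb] \<kappa> tendsto_const \<rho>[unfolded has_vector_derivative_iff_quotient])
  from Lim_transform_eventually[OF this eq] show ?thesis
    by (simp add: has_vector_derivative_iff_quotient)
qed

text \<open>By compactness |\<rho>(x) h| has a positive minimum over the interval times the unit
  sphere, which bounds the inverses uniformly; the difference identity for inverses does the
  rest.\<close>

lemma lip_on_matrix_inverse:
  fixes \<rho> \<kappa> :: "real \<Rightarrow> complex^'n::finite^'n"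
  assumes inv: "\<And>y. y \<in> {a..b} \<Longrightarrow> \<kappa> y ** \<rho> y = mat 1" "\<And>y. y \<in> {a..b} \<Longrightarrow> \<rho> y ** \<kappa> y = mat 1"
    and \<rho>: "lip_on a b \<rho>"
  shows "lip_on a b \<kappa>"
proof (cases "a \<le> b")
  case False then show ?thesis by (simp add: lip_on_def)
next
  case True
  note bb = bounded_bilinear_matrix_matrix
  define Q where "Q = {a..b} \<times> sphere (0 :: complex^'n) 1"
  have Q: "compact Q" unfolding Q_def by (intro compact_Times) auto
  have "continuous_on Q (\<lambda>p. norm (\<rho> (fst p) *v snd p))"
  proof (intro continuous_on_norm continuous_on_matrix_vector)
    show "continuous_on Q (\<lambda>p. \<rho> (fst p))"
      by (rule continuous_on_compose2[OF lip_on_continuous[OF \<rho>]]) (auto simp: Q_def intro!: continuous_intros)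
  qed (intro continuous_intros)
  moreover have "Q \<noteq> {}"
  proof -
    have "norm (axis undefined 1 :: complex^'n) = 1" by (simp add: norm_axis_1)
    then show ?thesis using True by (auto simp: Q_def)
  qed
  ultimately obtain p where p: "p \<in> Q" "\<And>q. q \<in> Q \<Longrightarrow> norm (\<rho> (fst p) *v snd p) \<le> norm (\<rho> (fst q) *v snd q)"
    using continuous_attains_inf[OF Q] by blast
  define c where "c = norm (\<rho> (fst p) *v snd p)"
  have "0 < c"
  proof -
    have "\<rho> (fst p) *v snd p \<noteq> 0"
    proof
      assume "\<rho> (fst p) *v snd p = 0"
      then have "\<kappa> (fst p) *v (\<rho> (fst p) *v snd p) = 0" by simp
      then have "snd p = 0" using inv(1)[of "fst p"] p(1) by (auto simp: matrix_vector_mul_assoc Q_def)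
      then show False using p(1) by (auto simp: Q_def)
    qed
    then show ?thesis by (simp add: c_def)
  qed
  have c: "c * norm h \<le> norm (\<rho> x *v h)" if "x \<in> {a..b}" for x h
  proof (cases "h = 0")
    case False
    then have "(x, h /\<^sub>R norm h) \<in> Q" using that by (simp add: Q_def)
    from p(2)[OF this] have "c \<le> norm (\<rho> x *v h) / norm h"
      unfolding c_def using False by (simp add: matrix_vector_mult_scaleR_right divide_inverse mult.commute)
    then show ?thesis using False by (simp add: pos_le_divide_eq)
  qed simp
  define B where "B = real CARD('n) * (real CARD('n) * (1 / c))"
  have B: "norm (\<kappa> x) \<le> B" if "x \<in> {a..b}" for x
    unfolding B_def
  proof (rule norm_matrix_entry_le(2))
    fix h
    show "norm (\<kappa> x *v h) \<le> 1 / c * norm h"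
      using c[OF that, of "\<kappa> x *v h"] inv(2)[OF that] \<open>0 < c\<close> by (simp add: matrix_vector_mul_assoc field_simps)
  qed
  have "0 \<le> B" using \<open>0 < c\<close> by (simp add: B_def)
  obtain L where L: "L \<ge> 0" "\<And>x y. x \<in> {a..b} \<Longrightarrow> y \<in> {a..b} \<Longrightarrow> norm (\<rho> y - \<rho> x) \<le> L * \<bar>y - x\<bar>"
    using \<rho> by (rule lip_onE) blast
  have "norm (\<kappa> y - \<kappa> x) \<le> (B * L * B) * \<bar>y - x\<bar>" if x: "x \<in> {a..b}" and y: "y \<in> {a..b}" for x y
  proof -
    have "\<kappa> y - \<kappa> x = - ((\<kappa> y ** (\<rho> y - \<rho> x)) ** \<kappa> x)"
      using inv[OF y] inv[OF x]
      by (simp add: bounded_bilinear.diff_right[OF bb] bounded_bilinear.diff_left[OF bb] flip: matrix_mul_assoc)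
    then have "norm (\<kappa> y - \<kappa> x) = norm ((\<kappa> y ** (\<rho> y - \<rho> x)) ** \<kappa> x)" by simp
    also have "\<dots> \<le> (norm (\<kappa> y) * norm (\<rho> y - \<rho> x)) * norm (\<kappa> x)"
      by (intro order_trans[OF norm_matrix_matrix_le] mult_right_mono norm_matrix_matrix_le norm_ge_zero)
    also have "\<dots> \<le> (B * (L * \<bar>y - x\<bar>)) * B"
      using B L x y \<open>0 \<le> B\<close> by (intro mult_mono) auto
    finally show ?thesis by (simp add: mult_ac)
  qed
  then show ?thesis unfolding lip_on_def by blast
qed

lemma AE_bounded_matrix_product:
  fixes f :: "'a \<Rightarrow> complex^'q::finite^'p::finite" and g :: "'a \<Rightarrow> complex^'r::finite^'q"
  assumes "\<exists>C. AE x in N. norm (f x) \<le> C" "\<exists>C. AE x in N. norm (g x) \<le> C"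
  shows "\<exists>C. AE x in N. norm (f x ** g x) \<le> C"
proof -
  obtain B C where f: "AE x in N. norm (f x) \<le> B" and g: "AE x in N. norm (g x) \<le> C" using assms by blast
  have "AE x in N. norm (f x ** g x) \<le> B * C"
    using f g
  proof eventually_elim
    case (elim x)
    then show ?case using order_trans[OF norm_ge_zero elim(1)]
      by (intro order_trans[OF norm_matrix_matrix_le] mult_mono) auto
  qed
  then show ?thesis by blast
qed

text \<open>Both admissible regularity classes for g enter only through \<open>g_deriv\<close>, so
  they are handled at once.\<close>

locale complement_function = dirac_system M v u
  for M v and u :: "real \<Rightarrow> complex \<Rightarrow> complex^('m1::finite + 'm2::finite)^('m1 + 'm2)" +
  fixes l :: real and g :: "real \<Rightarrow> complex^('m1 + 'm2)^'m2"
  assumes l_pos: "0 < l" and g_deriv: "has_ae_deriv 0 l g (\<lambda>x. vector_derivative g (at x within {0..l}))"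
    and compl: "complements l \<beta> g"
begin

definition \<rho> :: "real \<Rightarrow> complex^'m2^'m2" where "\<rho> x = g x ** cadj (\<gamma> x)"

definition \<kappa>0 :: "real \<Rightarrow> complex^'m2^'m2" where "\<kappa>0 x = matrix_inv (\<rho> x)"

abbreviation "g' x \<equiv> vector_derivative g (at x within {0..l})"

text \<open>Expanding g in the orthonormal rows of \<beta> and \<gamma> leaves only the
  \<gamma>-part, with coefficient \<rho>.\<close>

lemma g_eq:
  assumes x: "x \<in> {0..l}" shows "g x = \<rho> x ** \<gamma> x" "g x ** cadj (\<beta> x) = 0" "g x ** cadj (g x) = \<rho> x ** cadj (\<rho> x)"
proof -
  have "\<beta> x ** cadj (g x) = 0" using compl x by (simp add: complements_def)
  then show 1: "g x ** cadj (\<beta> x) = 0" using cadj_mult[of "\<beta> x" "cadj (g x)"] by simp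
  show 2: "g x = \<rho> x ** \<gamma> x"
    using matrix_decompose[of x "g x"] x 1 by (simp add: \<rho>_def)
  have "\<rho> x ** cadj (\<rho> x) = \<rho> x ** (\<gamma> x ** cadj (\<gamma> x)) ** cadj (\<rho> x)" using block_orthogonality(2)[of x] x by simp
  then show "g x ** cadj (g x) = \<rho> x ** cadj (\<rho> x)" by (simp add: 2 cadj_mult matrix_mul_assoc)
qed

lemma \<kappa>0_inverse:
  assumes x: "x \<in> {0..l}" shows "\<kappa>0 x ** \<rho> x = mat 1" "\<rho> x ** \<kappa>0 x = mat 1"
proof -
  have "pos_definite (g x ** cadj (g x))" using compl x by (simp add: complements_def)
  then have pd: "pos_definite (\<rho> x ** cadj (\<rho> x))" using g_eq(3)[OF x] by simp
  have inj: "h = 0" if "cadj (\<rho> x) *v h = 0" for h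
  proof (rule ccontr)
    assume "h \<noteq> 0"
    then have "0 < (\<rho> x ** cadj (\<rho> x) *v h) \<bullet> h" using pd by (simp add: pos_definite_def Re_quad_form)
    then show False using that by (simp flip: matrix_vector_mul_assoc)
  qed
  obtain B where B: "\<rho> x ** B = mat 1" "B ** \<rho> x = mat 1" by (rule matrix_inverse_exists[OF inj]) blast+
  have "\<kappa>0 x = B" unfolding \<kappa>0_def by (rule matrix_inv_unique[OF B])
  then show "\<kappa>0 x ** \<rho> x = mat 1" "\<rho> x ** \<kappa>0 x = mat 1" using B by simp_all
qed

text \<open>Inserting g = \<rho> \<gamma> cancels the adjoint of \<rho>, so the coefficient in the
  equation for \<kappa> becomes \<rho>' times the inverse of \<rho>, as for the inverse function
  itself.\<close>

lemma adj_inverse: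
  assumes x: "x \<in> {0..l}"
  shows "matrix_inv (g x ** cadj (g x)) = cadj (\<kappa>0 x) ** \<kappa>0 x"
    "cadj (g x) ** matrix_inv (g x ** cadj (g x)) = cadj (\<gamma> x) ** \<kappa>0 x"
proof -
  note i = \<kappa>0_inverse[OF x]
  have ci: "cadj (\<rho> x) ** cadj (\<kappa>0 x) = mat 1" "cadj (\<kappa>0 x) ** cadj (\<rho> x) = mat 1"
    using arg_cong[OF i(1), of cadj] arg_cong[OF i(2), of cadj] by (simp_all only: cadj_mult cadj_mat1)
  have cancel: "P ** (Q ** A) = A" if "P ** Q = mat 1" for P Q A :: "complex^'m2^'m2"
    using that by (simp add: matrix_mul_assoc)
  show 1: "matrix_inv (g x ** cadj (g x)) = cadj (\<kappa>0 x) ** \<kappa>0 x"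
    unfolding g_eq(3)[OF x]
    by (rule matrix_inv_unique) (simp_all only: matrix_mul_assoc[symmetric] cancel[OF ci(1)] cancel[OF i(1)] i ci)
  show "cadj (g x) ** matrix_inv (g x ** cadj (g x)) = cadj (\<gamma> x) ** \<kappa>0 x"
    unfolding 1 unfolding g_eq(1)[OF x] cadj_mult
    by (simp only: matrix_mul_assoc[symmetric] cancel[OF ci(1)])
qed

text \<open>The term from differentiating \<gamma> vanishes: \<gamma>' factors through \<beta>, and
  g is orthogonal to \<beta>.\<close>

lemma \<rho>_deriv: "has_ae_deriv 0 l \<rho> (\<lambda>x. g' x ** cadj (\<gamma> x))"
proof (rule has_ae_deriv_cong)
  show "has_ae_deriv 0 l \<rho> (\<lambda>x. g x ** cadj (- (cadj (v x) ** \<beta> x)) + g' x ** cadj (\<gamma> x))"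
    unfolding \<rho>_def[abs_def]
    by (intro has_ae_deriv_bilinear[OF bounded_bilinear_matrix_matrix] g_deriv has_ae_deriv_bounded_linear[OF bounded_linear_cadj] gamma_deriv)
  show "AE x in Leb l. g x ** cadj (- (cadj (v x) ** \<beta> x)) + g' x ** cadj (\<gamma> x) = g' x ** cadj (\<gamma> x)"
    using AE_mem
  proof eventually_elim
    case (elim x)
    have "g x ** cadj (cadj (v x) ** \<beta> x) = (g x ** cadj (\<beta> x)) ** v x"
      by (simp add: cadj_mult matrix_mul_assoc)
    then show ?case using g_eq(2)[OF elim]
      by (simp add: cadj_uminus bounded_bilinear.minus_right[OF bounded_bilinear_matrix_matrix]
        bounded_bilinear.zero_left[OF bounded_bilinear_matrix_matrix])
  qed
qed

lemma \<kappa>0_lip: "lip_on 0 l \<kappa>0"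
  by (rule lip_on_matrix_inverse[OF \<kappa>0_inverse has_ae_deriv_lip[OF \<rho>_deriv]])

lemma rhs_eq:
  assumes "x \<in> {0..l}"
  shows "\<kappa> ** g' x ** cadj (g x) ** matrix_inv (g x ** cadj (g x)) = ((\<kappa> ** g' x) ** cadj (\<gamma> x)) ** \<kappa>0 x"
  using adj_inverse(2)[OF assms] by (simp flip: matrix_mul_assoc)

lemma \<kappa>0_solution: "kappa_solution l g \<kappa>0"
  unfolding kappa_solution_def
proof (intro conjI)
  have 0: "0 \<in> {0..l}" using l_pos by simp
  have "\<rho> 0 = mat 1"
    using compl block_orthogonality(2)[of 0] by (simp add: \<rho>_def complements_def gamma_0)
  then show "\<kappa>0 0 = mat 1" using \<kappa>0_inverse[OF 0] by simp
  show "abs_cont_on 0 l \<kappa>0" by (rule lip_on_abs_cont[OF \<kappa>0_lip])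
  show "AE x in Leb l. (\<kappa>0 has_vector_derivative
     - (\<kappa>0 x ** g' x ** cadj (g x) ** matrix_inv (g x ** cadj (g x)))) (at x within {0..l})"
    using AE_mem has_ae_derivD[OF \<rho>_deriv]
  proof eventually_elim
    case (elim x)
    have "(\<kappa>0 \<longlongrightarrow> \<kappa>0 x) (at x within {0..l})"
      using lip_on_continuous[OF \<kappa>0_lip] elim(1) by (simp add: continuous_on)
    from has_vector_derivative_matrix_inverse[OF \<kappa>0_inverse elim(1) this elim(2)]
    show ?case unfolding rhs_eq[OF elim(1)] by (simp add: matrix_mul_assoc)
  qed
qed

text \<open>The product \<kappa> \<rho> has zero derivative and starts at the identity, so \<kappa>
  inverts \<rho> and \<kappa> g = \<kappa> \<rho> \<gamma> = \<gamma>. As \<kappa> is only assumed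
  absolutely continuous, its derivative is shown beforehand to be bounded, by bounding every factor
  of the equation.\<close>

lemma kappa_unique:
  assumes \<kappa>: "kappa_solution l g \<kappa>" and x: "x \<in> {0..l}"
  shows "\<gamma> x = \<kappa> x ** g x"
proof -
  define d where "d x = - (\<kappa> x ** g' x ** cadj (g x) ** matrix_inv (g x ** cadj (g x)))" for x
  have ac: "abs_cont_on 0 l \<kappa>" and \<kappa>0: "\<kappa> 0 = mat 1"
    and ae: "AE x in Leb l. (\<kappa> has_vector_derivative d x) (at x within {0..l})"
    using \<kappa> by (auto simp: kappa_solution_def d_def)
  have bd: "\<exists>C. AE x in Leb l. norm (f x) \<le> C" if c: "continuous_on {0..l} f"
    for f :: "real \<Rightarrow> complex^'a::finite^'b::finite"
  proof -
    obtain C where "\<And>x. x \<in> {0..l} \<Longrightarrow> norm (f x) \<le> C" using continuous_on_Icc_bounded[OF c] by blast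
    then show ?thesis by (intro exI[of _ C] AE_I2) auto
  qed
  have bg: "\<exists>C. AE x in Leb l. norm (g' x) \<le> C"
  proof -
    obtain L where L: "\<And>x y. x \<in> {0..l} \<Longrightarrow> y \<in> {0..l} \<Longrightarrow> norm (g y - g x) \<le> L * \<bar>y - x\<bar>"
      using has_ae_deriv_lip[OF g_deriv] by (rule lip_onE) blast
    have "AE x in Leb l. norm (g' x) \<le> L"
      using has_ae_derivD[OF g_deriv] AE_mem
    proof eventually_elim
      case (elim x)
      have "at x within {0..l} \<noteq> bot" using elim l_pos by (simp add: at_within_Icc_at trivial_limit_within)
      moreover have "\<forall>\<^sub>F y in at x within {0..l}. y \<in> {0..l}" by (simp add: eventually_at_filter)
      ultimately show ?case using lip_vector_derivative_le[OF L elim] by blast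
    qed
    then show ?thesis by blast
  qed
  have "\<exists>C. AE x in Leb l. norm (((\<kappa> x ** g' x) ** cadj (\<gamma> x)) ** \<kappa>0 x) \<le> C"
    by (intro AE_bounded_matrix_product bg bd abs_cont_on_continuous[OF ac]
      continuous_on_cadj gamma_cont lip_on_continuous[OF \<kappa>0_lip])
  then obtain C where "AE x in Leb l. norm (((\<kappa> x ** g' x) ** cadj (\<gamma> x)) ** \<kappa>0 x) \<le> C" by blast
  then have "AE x in Leb l. norm (d x) \<le> C"
    using AE_mem by eventually_elim (simp add: d_def rhs_eq)
  then have "\<exists>C. AE x in Leb l. norm (d x) \<le> C" by blast
  then obtain C where C: "AE x in Leb l. norm (d x) \<le> C" by blast
  have "has_ae_deriv 0 l \<kappa> d"
    by (rule abs_cont_bounded_has_ae_deriv[OF ac, of d C]) (use ae C in \<open>eventually_elim, simp\<close>)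
  from has_ae_deriv_bilinear[OF bounded_bilinear_matrix_matrix this \<rho>_deriv]
  have "has_ae_deriv 0 l (\<lambda>x. \<kappa> x ** \<rho> x) (\<lambda>x. \<kappa> x ** (g' x ** cadj (\<gamma> x)) + d x ** \<rho> x)" .
  moreover have "AE x in Leb l. \<kappa> x ** (g' x ** cadj (\<gamma> x)) + d x ** \<rho> x = 0"
    using AE_mem
  proof eventually_elim
    case (elim x)
    have "d x ** \<rho> x = - (\<kappa> x ** (g' x ** cadj (\<gamma> x)))"
      unfolding d_def rhs_eq[OF elim]
      using \<kappa>0_inverse(1)[OF elim] by (simp add: bounded_bilinear.minus_left[OF bounded_bilinear_matrix_matrix] flip: matrix_mul_assoc)
    then show ?case by simp
  qed
  ultimately have "\<kappa> x ** \<rho> x = \<kappa> 0 ** \<rho> 0" using x by (rule has_ae_deriv_0)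
  also have "\<dots> = mat 1"
    using compl block_orthogonality(2)[of 0] \<kappa>0 by (simp add: \<rho>_def complements_def gamma_0)
  finally have "\<kappa> x ** \<rho> x = mat 1" .
  then show ?thesis unfolding g_eq(1)[OF x] by (simp add: matrix_mul_assoc)
qed

end

theorem theorem4p1:
  fixes M :: real
    and v :: "real \<Rightarrow> complex^'m2^'m1"
    and u :: "real \<Rightarrow> complex \<Rightarrow> complex^('m1::finite + 'm2::finite)^('m1::finite + 'm2::finite)"
    and \<phi> :: "complex \<Rightarrow> complex^'m1^'m2"
    and \<Phi>1 :: "real \<Rightarrow> complex^'m1^'m2"
  defines "\<beta> \<equiv> beta_of u" and "\<gamma> \<equiv> gamma_of u"
  assumes "M > 0"
    and "v \<in> borel_measurable (lebesgue_on {0..})"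
    and "\<And>x. 0 \<le> x \<Longrightarrow> onorm ((*v) (v x)) \<le> M"
    and "fundamental_solution v u"
    and "weyl_function M u \<phi>"
    and "is_Phi1 \<gamma> \<Phi>1"
  shows
    "(\<forall>z. Im z > M \<longrightarrow>
        \<phi> z = cscale (2 * \<i> * z) (LINT x:{0..}|lebesgue. cscale (exp (2 * \<i> * x * z)) (\<Phi>1 x)))
     \<and> (\<forall>\<eta>>M. (\<lambda>x. exp (- 2 * \<eta> * x) *\<^sub>R \<Phi>1 x) \<in> L2_on {0..})
     \<and> (\<forall>l>0.
        (\<forall>\<eta>>M. \<exists>G.
           (\<forall>i k. lim_in_mean {0..2 * l}
              (\<lambda>a x. LINT \<xi>:{- a..a}|lebesgue.
                 exp (- \<i> * x * \<xi>) * \<phi> (Complex \<xi> \<eta>) $ i $ k / (2 * \<i> * Complex \<xi> \<eta>))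
              (\<lambda>x. G x $ i $ k)) \<and>
           (AE x in lebesgue_on {0..2 * l}. \<Phi>1 (x / 2) = (exp (x * \<eta>) / pi) *\<^sub>R G x))
      \<and> (\<forall>x\<in>{0..l}. \<exists>R. L2_inverse x (S_sub l \<Phi>1 x) R \<and>
           \<beta> x = hcat (mat 1) 0 - (LINT t:{0..x}|lebesgue.
             cadj (colwise R (\<lambda>r. vector_derivative \<Phi>1 (at r)) t) ** hcat (\<Phi>1 t) (mat 1)))
      \<and> \<gamma> 0 = hcat 0 (mat 1)
      \<and> (\<exists>g. boundedly_diff l g \<and> piecewise_diff_rel l \<beta> g \<and> complements l \<beta> g)
      \<and> (\<forall>g. (boundedly_diff l g \<or> piecewise_diff l g) \<and> complements l \<beta> g \<longrightarrow>
           (\<exists>\<kappa>. kappa_solution l g \<kappa>) \<and>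
           (\<forall>\<kappa>. kappa_solution l g \<kappa> \<longrightarrow> (\<forall>x\<in>{0..l}. \<gamma> x = \<kappa> x ** g x)))
      \<and> (AE x in lebesgue_on {0..l}. v x = vector_derivative \<beta> (at x) ** cadj (\<gamma> x)))"
proof -
  interpret dirac_system M v u by unfold_locales (fact assms)+
  note Phi = \<open>is_Phi1 \<gamma> \<Phi>1\<close>[unfolded \<gamma>_def]
  have kappa: "(\<exists>\<kappa>. kappa_solution l g \<kappa>) \<and> (\<forall>\<kappa>. kappa_solution l g \<kappa> \<longrightarrow> (\<forall>x\<in>{0..l}. \<gamma> x = \<kappa> x ** g x))"
    if "0 < l" "boundedly_diff l g \<or> piecewise_diff l g" "complements l \<beta> g" for l g
  proof -
    have "has_ae_deriv 0 l g (\<lambda>x. vector_derivative g (at x within {0..l}))"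
      using that(2) boundedly_diff_has_ae_deriv piecewise_diff_has_ae_deriv by blast
    then interpret complement_function M v u l g
      using that by unfold_locales (simp_all add: \<beta>_def)
    show ?thesis unfolding \<gamma>_def using \<kappa>0_solution kappa_unique by blast
  qed
  show ?thesis
  proof (intro conjI allI impI ballI)
    show "\<phi> z = cscale (2 * \<i> * z) (LINT x:{0..}|lebesgue. cscale (exp (2 * \<i> * x * z)) (\<Phi>1 x))" if "Im z > M" for z
      by (rule Weyl_representation[OF Phi \<open>weyl_function M u \<phi>\<close> that])
    show "(\<lambda>x. exp (- 2 * \<eta> * x) *\<^sub>R \<Phi>1 x) \<in> L2_on {0..}" if "M < \<eta>" for \<eta>
      using Phi_L2[OF Phi, of \<eta>] that by simp
  next
    fix l :: real assume l: "0 < l"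
    show "\<exists>G. (\<forall>i k. lim_in_mean {0..2 * l}
              (\<lambda>a x. LINT \<xi>:{- a..a}|lebesgue.
                 exp (- \<i> * x * \<xi>) * \<phi> (Complex \<xi> \<eta>) $ i $ k / (2 * \<i> * Complex \<xi> \<eta>))
              (\<lambda>x. G x $ i $ k)) \<and>
           (AE x in lebesgue_on {0..2 * l}. \<Phi>1 (x / 2) = (exp (x * \<eta>) / pi) *\<^sub>R G x)" if "M < \<eta>" for \<eta>
      by (rule Phi_fourier_inversion[OF Phi \<open>weyl_function M u \<phi>\<close> that l])
    show "\<exists>R. L2_inverse x (S_sub l \<Phi>1 x) R \<and>
           \<beta> x = hcat (mat 1) 0 - (LINT t:{0..x}|lebesgue.
             cadj (colwise R (\<lambda>r. vector_derivative \<Phi>1 (at r)) t) ** hcat (\<Phi>1 t) (mat 1))" if "x \<in> {0..l}" for x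
      unfolding \<beta>_def by (rule beta_recovery[OF Phi]) (use that in auto)
    show "\<gamma> 0 = hcat 0 (mat 1)" unfolding \<gamma>_def by (rule gamma_0)
    show "\<exists>g. boundedly_diff l g \<and> piecewise_diff_rel l \<beta> g \<and> complements l \<beta> g"
      unfolding \<beta>_def using complement_exists[OF l] by blast
    show "\<exists>\<kappa>. kappa_solution l g \<kappa>" if "(boundedly_diff l g \<or> piecewise_diff l g) \<and> complements l \<beta> g" for g
      using kappa[OF l] that by blast
    show "\<gamma> x = \<kappa> x ** g x" if "(boundedly_diff l g \<or> piecewise_diff l g) \<and> complements l \<beta> g"
      "kappa_solution l g \<kappa>" "x \<in> {0..l}" for g \<kappa> x
      using kappa[OF l] that by blast
    show "AE x in lebesgue_on {0..l}. v x = vector_derivative \<beta> (at x) ** cadj (\<gamma> x)"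
      unfolding \<beta>_def \<gamma>_def by (rule v_formula)
  qed
qed

end
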